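(* Let $F:\mathbb{R}^n\to\mathbb{R}^n$ be smooth (in particular $F\in C^2(\mathbb{R}^n;\mathbb{R}^n)$), let $U^0\in\mathbb{R}^n$ be a constant state, and let $U^1:\mathbb{R}\to\mathbb{R}^n$ be an arbitrary function of bounded variation with compact support. Assume that $\nabla F(U)$ is diagonalizable with real eigenvalues for every $U$, that each eigenvalue has constant multiplicity, and that each corresponding characteristic field is either genuinely nonlinear ($\nabla\lambda_j\cdot \mathbf{r}_j\equiv 1$) or linearly degenerate ($\nabla\lambda_j\cdot \mathbf{r}_j\equiv 0$). Let $U^{\varepsilon}(t,x)$ be the entropy solution of $$\partial_tU+\partial_xF(U)=0,\qquad U|_{t=0}=U^0+\varepsilon U^1(x),$$ given by the standard Riemann semigroup, i.e. $U^\varepsilon(t,\cdot)=S_t(U^0+\varepsilon U^1)$. Let $$U^{\varepsilon}_w(t,x)=U^0+\varepsilon\sum_{j=1}^n\sigma^{(j)}(\varepsilon t,\,x-\lambda_j(U^0)t)\,\mathbf{r}_j(U^0),$$ where $\sigma^{(j)}(\tau,y)$ is the entropy solution of $\partial_\tau\sigma^{(j)}+\frac12\partial_y(\sigma^{(j)})^2=0$ if the $j$-th field is genuinely nonlinear, and the solution of $\partial_\tau\sigma^{(j)}=0$ if the $j$-th field is linearly degenerate, in both cases with initial data $\sigma^{(j)}(0,y)=\mathbf{l}_j(U^0)\cdot U^1(y)$. Then there exist $\varepsilon_0>0$ and $C>0$, with $C$ independent of $\varepsilon$ and $t$, such that for all $t>0$ and all $\varepsilon\in(0,\varepsilon_0]$,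 $$\|U^{\varepsilon}(t,\cdot)-U^{\varepsilon}_w(t,\cdot)\|_{L^1}\le C\,\varepsilon^2 .$$
   Context: Eigenstructure: $\lambda_1(U)\le\dots\le\lambda_n(U)$ are the eigenvalues of $\nabla F(U)$ counted with multiplicity; constant multiplicity means that for each pair $j,k$ either $\lambda_j\equiv\lambda_k$ or $\lambda_j(U)\neq\lambda_k(U)$ for all $U$. The (smooth) left and right eigenvectors $\mathbf{l}_j(U)$, $\mathbf{r}_k(U)$ satisfy $\mathbf{l}_j\nabla F=\lambda_j\mathbf{l}_j$, $\nabla F\,\mathbf{r}_k=\lambda_k\mathbf{r}_k$, $\mathbf{l}_j\cdot\mathbf{r}_k=\delta_{jk}$. Standard Riemann semigroup (SRS): a map $S:\mathcal{D}\times[0,\infty)\to\mathcal{D}$ on a closed domain $\mathcal{D}$ of functions $\mathbb{R}\to\mathbb{R}^n$ (with difference from $U^0$ in $L^1$) containing all $\bar U$ with $\bar U-U^0\in L^1$ and total variation less than some $\delta_0>0$, such that: (i) $S_0\bar U=\bar U$ and $S_tS_s\bar U=S_{t+s}\bar U$; (ii) $\|S_t\bar U-S_s\bar V\|_{L^1}\le L_1\|\bar U-\bar V\|_{L^1}+L_2|t-s|$ for some constants $L_1,L_2$; (iii) for every piecewise constant $\bar U\in\mathcal{D}$ there is $\delta>0$ such that for $t\in[0,\delta]$, $S_t\bar U$ coincides with the solution of $\partial_tU+\partial_xF(U)=0$ obtained by piecing together the standard entropy solutions of the Riemann problems at the jumps of $\bar U$. For $\varepsilon$ small, $U^0+\varepsilon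 U^1\in\mathcal{D}$. *)

theory Defs
  imports "HOL-Analysis.Analysis"
begin

section \<open>Smooth functions and functions of bounded variation\<close>

primrec C_k :: "nat \<Rightarrow> ('a::real_normed_vector \<Rightarrow> 'b::real_normed_vector) \<Rightarrow> bool" where
  "C_k 0 f \<longleftrightarrow> continuous_on UNIV f"
| "C_k (Suc k) f \<longleftrightarrow> (\<forall>x. f differentiable (at x)) \<and>
     (\<forall>v. C_k k (\<lambda>x. frechet_derivative f (at x) v))"

definition smooth :: "('a::real_normed_vector \<Rightarrow> 'b::real_normed_vector) \<Rightarrow> bool" where
  "smooth f \<longleftrightarrow> (\<forall>k. C_k k f)"

definition total_variation :: "(real \<Rightarrow> 'a::real_normed_vector) \<Rightarrow> ennreal" where
  "total_variation f =
     (SUP p\<in>{p::nat \<Rightarrow> real. mono p}. SUP N. \<Sum>i<N. ennreal (norm (f (p (Suc i)) - f (p i))))"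

definition bounded_variation :: "(real \<Rightarrow> 'a::real_normed_vector) \<Rightarrow> bool" where
  "bounded_variation f \<longleftrightarrow> total_variation f < \<infinity>"

definition L1_dist :: "(real \<Rightarrow> 'a::euclidean_space) \<Rightarrow> (real \<Rightarrow> 'a) \<Rightarrow> real" where
  "L1_dist u v = (LINT x|lborel. norm (u x - v x))"


section \<open>Eigenstructure and characteristic fields\<close>

text \<open>
  The fields are numbered by \<open>j \<in> {1..CARD('n)}\<close> (natural numbers, so that the eigenvalues can be
  listed in increasing order); values at other indices are irrelevant.
\<close>

definition real_diagonalizable :: "real^'n^'n \<Rightarrow> bool" where
  "real_diagonalizable A \<longleftrightarrow>
     (\<exists>P D :: real^'n^'n. invertible P \<and> (\<forall>i j. i \<noteq> j \<longrightarrow> D $ i $ j = 0) \<and> A = P ** D ** matrix_inv P)"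

text \<open>Multiplicities are those of the roots of the characteristic polynomial.\<close>

definition ordered_eigenvalues :: "real^'n^'n \<Rightarrow> (nat \<Rightarrow> real) \<Rightarrow> bool" where
  "ordered_eigenvalues A \<mu> \<longleftrightarrow>
     mono_on {1..CARD('n)} \<mu> \<and>
     (\<forall>z. det (mat z - A) = (\<Prod>j = 1..CARD('n). (z - \<mu> j)))"

definition constant_multiplicity :: "(nat \<Rightarrow> real^'n \<Rightarrow> real) \<Rightarrow> bool" where
  "constant_multiplicity lam \<longleftrightarrow>
     (\<forall>j\<in>{1..CARD('n)}. \<forall>k\<in>{1..CARD('n)}.
        (\<forall>U. lam j U = lam k U) \<or> (\<forall>U. lam j U \<noteq> lam k U))"

definition smooth_eigenvectors ::
    "(real^'n \<Rightarrow> real^'n) \<Rightarrow> (nat \<Rightarrow> real^'n \<Rightarrow> real) \<Rightarrow>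
     (nat \<Rightarrow> real^'n \<Rightarrow> real^'n) \<Rightarrow> (nat \<Rightarrow> real^'n \<Rightarrow> real^'n) \<Rightarrow> bool" where
  "smooth_eigenvectors F lam l r \<longleftrightarrow>
     (\<forall>j\<in>{1..CARD('n)}. smooth (l j) \<and> smooth (r j) \<and>
        (\<forall>U. l j U v* jacobian F (at U) = lam j U *\<^sub>R l j U) \<and>
        (\<forall>U. jacobian F (at U) *v r j U = lam j U *\<^sub>R r j U)) \<and>
     (\<forall>j\<in>{1..CARD('n)}. \<forall>k\<in>{1..CARD('n)}. \<forall>U. l j U \<bullet> r k U = (if j = k then 1 else 0))"

definition genuinely_nonlinear :: "(real^'n \<Rightarrow> real) \<Rightarrow> (real^'n \<Rightarrow> real^'n) \<Rightarrow> bool" where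
  "genuinely_nonlinear \<mu> \<rho> \<longleftrightarrow>
     (\<forall>U. \<mu> differentiable (at U) \<and> frechet_derivative \<mu> (at U) (\<rho> U) = 1)"

definition linearly_degenerate :: "(real^'n \<Rightarrow> real) \<Rightarrow> (real^'n \<Rightarrow> real^'n) \<Rightarrow> bool" where
  "linearly_degenerate \<mu> \<rho> \<longleftrightarrow>
     (\<forall>U. \<mu> differentiable (at U) \<and> frechet_derivative \<mu> (at U) (\<rho> U) = 0)"


section \<open>The Riemann problem\<close>

definition rankine_hugoniot ::
    "(real^'n \<Rightarrow> real^'n) \<Rightarrow> real^'n \<Rightarrow> real^'n \<Rightarrow> real \<Rightarrow> bool" where
  "rankine_hugoniot F ul ur s \<longleftrightarrow> F ur - F ul = s *\<^sub>R (ur - ul)"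

text \<open>
  With the normalization \<open>\<nabla>\<lambda>\<^sub>j \<cdot> r\<^sub>j \<equiv> 1\<close>, an integral curve of \<open>r\<^sub>j\<close> can be parametrized by
  \<open>\<lambda>\<^sub>j\<close>, i.e. by the self-similar variable \<open>\<xi> = x/t\<close> of the centred rarefaction wave.
\<close>

definition rarefaction ::
    "(nat \<Rightarrow> real^'n \<Rightarrow> real) \<Rightarrow> (nat \<Rightarrow> real^'n \<Rightarrow> real^'n) \<Rightarrow> nat \<Rightarrow>
     real^'n \<Rightarrow> real^'n \<Rightarrow> (real \<Rightarrow> real^'n) \<Rightarrow> bool" where
  "rarefaction lam r j ul ur g \<longleftrightarrow>
     lam j ul \<le> lam j ur \<and> g (lam j ul) = ul \<and> g (lam j ur) = ur \<and>
     (\<forall>\<xi>\<in>{lam j ul..lam j ur}.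
        (g has_vector_derivative r j (g \<xi>)) (at \<xi> within {lam j ul..lam j ur}))"

definition lax_shock ::
    "(real^'n \<Rightarrow> real^'n) \<Rightarrow> (nat \<Rightarrow> real^'n \<Rightarrow> real) \<Rightarrow> nat \<Rightarrow>
     real^'n \<Rightarrow> real^'n \<Rightarrow> real \<Rightarrow> bool" where
  "lax_shock F lam j ul ur s \<longleftrightarrow>
     rankine_hugoniot F ul ur s \<and> lam j ur < s \<and> s < lam j ul \<and>
     (1 < j \<longrightarrow> lam (j - 1) ul < s) \<and> (j < CARD('n) \<longrightarrow> s < lam (j + 1) ur)"

definition contact_discontinuity ::
    "(real^'n \<Rightarrow> real^'n) \<Rightarrow> (nat \<Rightarrow> real^'n \<Rightarrow> real) \<Rightarrow> nat \<Rightarrow>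
     real^'n \<Rightarrow> real^'n \<Rightarrow> real \<Rightarrow> bool" where
  "contact_discontinuity F lam j ul ur s \<longleftrightarrow>
     rankine_hugoniot F ul ur s \<and> lam j ul = s \<and> lam j ur = s"

text \<open>
  The profile \<open>w\<close> (a function of \<open>\<xi> = x/t\<close>) contains a \<open>j\<close>-wave from \<open>ul\<close> to \<open>ur\<close> occupying
  \<open>a \<le> \<xi> \<le> b\<close>. The trivial wave \<open>ul = ur\<close> is included, as a rarefaction or contact of strength 0.
  Profiles matter only up to null sets, so their values at jumps are left free.
\<close>

definition elementary_wave ::
    "(real^'n \<Rightarrow> real^'n) \<Rightarrow> (nat \<Rightarrow> real^'n \<Rightarrow> real) \<Rightarrow> (nat \<Rightarrow> real^'n \<Rightarrow> real^'n) \<Rightarrow> nat \<Rightarrow>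
     real^'n \<Rightarrow> real^'n \<Rightarrow> real \<Rightarrow> real \<Rightarrow> (real \<Rightarrow> real^'n) \<Rightarrow> bool" where
  "elementary_wave F lam r j ul ur a b w \<longleftrightarrow>
     (genuinely_nonlinear (lam j) (r j) \<and> a = lam j ul \<and> b = lam j ur \<and>
        (\<exists>g. rarefaction lam r j ul ur g \<and> (\<forall>\<xi>\<in>{a<..<b}. w \<xi> = g \<xi>))) \<or>
     (genuinely_nonlinear (lam j) (r j) \<and> a = b \<and> lax_shock F lam j ul ur a) \<or>
     (linearly_degenerate (lam j) (r j) \<and> a = b \<and> contact_discontinuity F lam j ul ur a)"

text \<open>
  For a repeated eigenvalue of multiplicity \<open>p\<close> (a linearly degenerate field), the single contact
  discontinuity of that family appears as \<open>p\<close> successive contacts with one and the same speed.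
\<close>

definition lax_riemann_solution ::
    "(real^'n \<Rightarrow> real^'n) \<Rightarrow> (nat \<Rightarrow> real^'n \<Rightarrow> real) \<Rightarrow> (nat \<Rightarrow> real^'n \<Rightarrow> real^'n) \<Rightarrow>
     real^'n \<Rightarrow> real^'n \<Rightarrow> (real \<Rightarrow> real^'n) \<Rightarrow> bool" where
  "lax_riemann_solution F lam r ul ur w \<longleftrightarrow>
     (\<exists>\<omega> a b. \<omega> 0 = ul \<and> \<omega> (CARD('n)) = ur \<and>
        (\<forall>j\<in>{1..CARD('n)}. elementary_wave F lam r j (\<omega> (j - 1)) (\<omega> j) (a j) (b j) w) \<and>
        (\<forall>j\<in>{1..<CARD('n)}. b j \<le> a (j + 1)) \<and>
        (\<forall>\<xi><a 1. w \<xi> = ul) \<and>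
        (\<forall>j\<in>{1..<CARD('n)}. \<forall>\<xi>\<in>{b j<..<a (j + 1)}. w \<xi> = \<omega> j) \<and>
        (\<forall>\<xi>>b (CARD('n)). w \<xi> = ur))"

text \<open>
  The standard solution for a small jump is the Lax solution all of whose states are close to the
  two data; a system may have further, large-amplitude, Lax solutions with the same data. A family
  \<open>R ul ur\<close> of profiles makes the standard selection if it is continuous on the diagonal.
\<close>

definition small_jump_continuous :: "(real^'n \<Rightarrow> real^'n \<Rightarrow> real \<Rightarrow> real^'n) \<Rightarrow> bool" where
  "small_jump_continuous R \<longleftrightarrow>
     (\<forall>U. \<forall>e>0. \<exists>d>0. \<forall>ul\<in>ball U d. \<forall>ur\<in>ball U d. \<forall>\<xi>. dist (R ul ur \<xi>) U < e)"


section \<open>Standard Riemann semigroup\<close>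

text \<open>
  \<open>v\<close> takes the values \<open>u 0, \<dots>, u N\<close>, with jumps at \<open>p 1 < \<dots> < p N\<close>. Jumps may be trivial
  (\<open>u (i - 1) = u i\<close>), so constant functions are covered although \<open>N \<ge> 1\<close>.
\<close>

definition piecewise_constant ::
    "nat \<Rightarrow> (nat \<Rightarrow> real) \<Rightarrow> (nat \<Rightarrow> 'a) \<Rightarrow> (real \<Rightarrow> 'a) \<Rightarrow> bool" where
  "piecewise_constant N p u v \<longleftrightarrow>
     1 \<le> N \<and> strict_mono_on {1..N} p \<and>
     (\<forall>x<p 1. v x = u 0) \<and>
     (\<forall>i\<in>{1..<N}. \<forall>x\<in>{p i<..<p (i + 1)}. v x = u i) \<and>
     (\<forall>x>p N. v x = u N)"

text \<open>
  Functions are understood up to equality almost everywhere; in particular a domain closed in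
  \<open>U0 + L\<^sup>1\<close> is automatically stable under changes on null sets. In the last clause, the solution
  around each jump \<open>p i\<close>, up to the midpoints between it and the neighbouring jumps, is the
  self-similar solution of the Riemann problem centred at \<open>p i\<close>; at \<open>t = 0\<close> the requirement is
  the identity \<open>S 0 v = v\<close>.
\<close>

definition standard_riemann_semigroup ::
    "(real^'n \<Rightarrow> real^'n) \<Rightarrow> (nat \<Rightarrow> real^'n \<Rightarrow> real) \<Rightarrow> (nat \<Rightarrow> real^'n \<Rightarrow> real^'n) \<Rightarrow> real^'n \<Rightarrow>
     (real \<Rightarrow> real^'n) set \<Rightarrow> (real \<Rightarrow> (real \<Rightarrow> real^'n) \<Rightarrow> (real \<Rightarrow> real^'n)) \<Rightarrow> bool" where
  "standard_riemann_semigroup F lam r U0 \<D> S \<longleftrightarrow>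
     (\<forall>v\<in>\<D>. integrable lborel (\<lambda>x. v x - U0)) \<and>
     (\<forall>v. integrable lborel (\<lambda>x. v x - U0) \<and> (\<forall>e>0. \<exists>w\<in>\<D>. L1_dist w v < e) \<longrightarrow> v \<in> \<D>) \<and>
     (\<exists>\<delta>\<^sub>0>0. \<forall>v. integrable lborel (\<lambda>x. v x - U0) \<and> total_variation v < ennreal \<delta>\<^sub>0 \<longrightarrow> v \<in> \<D>) \<and>
     (\<forall>v\<in>\<D>. \<forall>t\<ge>0. S t v \<in> \<D>) \<and>
     (\<forall>v\<in>\<D>. AE x in lborel. S 0 v x = v x) \<and>
     (\<forall>v\<in>\<D>. \<forall>s\<ge>0. \<forall>t\<ge>0. AE x in lborel. S t (S s v) x = S (t + s) v x) \<and>
     (\<exists>L\<^sub>1 L\<^sub>2. \<forall>v\<in>\<D>. \<forall>w\<in>\<D>. \<forall>s\<ge>0. \<forall>t\<ge>0.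
        L1_dist (S t v) (S s w) \<le> L\<^sub>1 * L1_dist v w + L\<^sub>2 * \<bar>t - s\<bar>) \<and>
     (\<exists>R. small_jump_continuous R \<and>
        (\<forall>v\<in>\<D>. \<forall>N p u. piecewise_constant N p u v \<longrightarrow>
           (\<forall>i\<in>{1..N}. lax_riemann_solution F lam r (u (i - 1)) (u i) (R (u (i - 1)) (u i))) \<and>
           (\<exists>\<delta>>0. \<forall>t\<in>{0<..\<delta>}. AE x in lborel.
              \<forall>i\<in>{1..N}. (\<forall>k\<in>{1..N}. \<bar>x - p i\<bar> \<le> \<bar>x - p k\<bar>) \<longrightarrow>
                 S t v x = R (u (i - 1)) (u i) ((x - p i) / t))))"


section \<open>Scalar conservation laws and the approximate solution\<close>

text \<open>
  Solutions of \<open>\<partial>\<^sub>\<tau>\<sigma> + \<partial>\<^sub>yf(\<sigma>) = 0\<close> on \<open>[0,\<infinity>) \<times> \<real>\<close> are sought in \<open>L\<^sup>\<infinity> \<inter> C([0,\<infinity>); L\<^sup>1\<^sub>l\<^sub>o\<^sub>c)\<close>, so that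
  \<open>\<sigma>(\<tau>,\<cdot>)\<close> is well defined (almost everywhere) for each single \<open>\<tau>\<close>.
\<close>

definition solution_class :: "(real \<Rightarrow> real) \<Rightarrow> (real \<Rightarrow> real \<Rightarrow> real) \<Rightarrow> bool" where
  "solution_class s0 \<sigma> \<longleftrightarrow>
     (\<lambda>(\<tau>, y). \<sigma> \<tau> y) \<in> borel_measurable (restrict_space borel ({0..} \<times> UNIV)) \<and>
     (\<exists>M. \<forall>\<tau>\<ge>0. AE y in lborel. \<bar>\<sigma> \<tau> y\<bar> \<le> M) \<and>
     (\<forall>\<tau>\<ge>0. \<forall>b. ((\<lambda>s. LINT y:{-b..b}|lborel. \<bar>\<sigma> s y - \<sigma> \<tau> y\<bar>) \<longlongrightarrow> 0) (at \<tau> within {0..})) \<and>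
     (AE y in lborel. \<sigma> 0 y = s0 y)"

definition test_function :: "(real \<times> real \<Rightarrow> real) \<Rightarrow> bool" where
  "test_function \<phi> \<longleftrightarrow> smooth \<phi> \<and>
     (\<exists>K. compact K \<and> K \<subseteq> {0<..} \<times> UNIV \<and> (\<forall>z. z \<notin> K \<longrightarrow> \<phi> z = 0))"

definition weak_solution ::
    "(real \<Rightarrow> real) \<Rightarrow> (real \<Rightarrow> real) \<Rightarrow> (real \<Rightarrow> real \<Rightarrow> real) \<Rightarrow> bool" where
  "weak_solution f s0 \<sigma> \<longleftrightarrow> solution_class s0 \<sigma> \<and>
     (\<forall>\<phi>. test_function \<phi> \<longrightarrow>
        (LINT z:{0<..} \<times> UNIV|lborel.
           \<sigma> (fst z) (snd z) * frechet_derivative \<phi> (at z) (1, 0) +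
           f (\<sigma> (fst z) (snd z)) * frechet_derivative \<phi> (at z) (0, 1)) = 0)"

text \<open>Kruzhkov's entropy condition.\<close>

definition entropy_solution ::
    "(real \<Rightarrow> real) \<Rightarrow> (real \<Rightarrow> real) \<Rightarrow> (real \<Rightarrow> real \<Rightarrow> real) \<Rightarrow> bool" where
  "entropy_solution f s0 \<sigma> \<longleftrightarrow> solution_class s0 \<sigma> \<and>
     (\<forall>\<phi> k. test_function \<phi> \<and> (\<forall>z. 0 \<le> \<phi> z) \<longrightarrow>
        (LINT z:{0<..} \<times> UNIV|lborel.
           \<bar>\<sigma> (fst z) (snd z) - k\<bar> * frechet_derivative \<phi> (at z) (1, 0) +
           sgn (\<sigma> (fst z) (snd z) - k) * (f (\<sigma> (fst z) (snd z)) - f k) *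
             frechet_derivative \<phi> (at z) (0, 1)) \<ge> 0)"

definition approx_solution ::
    "real^'n \<Rightarrow> (nat \<Rightarrow> real^'n \<Rightarrow> real) \<Rightarrow> (nat \<Rightarrow> real^'n \<Rightarrow> real^'n) \<Rightarrow>
     (nat \<Rightarrow> real \<Rightarrow> real \<Rightarrow> real) \<Rightarrow> real \<Rightarrow> real \<Rightarrow> real \<Rightarrow> real^'n" where
  "approx_solution U0 lam r \<sigma> \<epsilon> t x =
     U0 + \<epsilon> *\<^sub>R (\<Sum>j = 1..CARD('n). \<sigma> j (\<epsilon> * t) (x - lam j U0 * t) *\<^sub>R r j U0)"

end

theory Submission
 imports Defs
begin

text \<open>
  The solution is compared with \<open>w(t,x) = W(\<epsilon> v\<^sub>1(\<epsilon>t, x - \<lambda>\<^sub>1t), \<dots>, \<epsilon> v\<^sub>n(\<epsilon>t, x - \<lambda>\<^sub>nt))\<close>, where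
  \<open>W(s\<^sub>1, \<dots>, s\<^sub>n)\<close> follows the flows of \<open>r\<^sub>1, \<dots>, r\<^sub>n\<close> from \<open>U\<^sup>0\<close> for the times \<open>s\<^sub>j\<close>, and \<open>v\<^sub>j\<close> is a
  step function approximating \<open>\<sigma>\<^sub>j\<close> whose jumps move with the exact Rankine-Hugoniot speeds of Burgers'
  equation (they stay fixed for a linearly degenerate field) and whose upward jumps are at most \<open>\<kappa>\<close>.
  That \<open>v\<^sub>j\<close> is close to \<open>\<sigma>\<^sub>j\<close> in \<open>L\<^sup>1\<close> follows from Kruzhkov's inequality tested with cutoffs that
  move along the jumps of \<open>v\<^sub>j\<close>.

  For \<open>S\<close> it suffices to bound the local error of \<open>w\<close>. A front with jump \<open>[w]\<close> and speed \<open>s\<close> costs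
  \<open>O(|[F(w)] - s[w]|)\<close> per unit time, plus \<open>O(|[w]|\<^sup>2)\<close> if it is an upward jump. Up to a time \<open>T\<^sub>0\<close>
  independent of \<open>\<epsilon>\<close> this is \<open>O(\<epsilon>\<^sup>2)\<close>. After \<open>T\<^sub>0\<close> the families occupy disjoint intervals: then contact
  discontinuities are exact, upward jumps cost \<open>O(\<epsilon>\<^sup>2\<kappa>)\<close>, and a shock costs \<open>O((\<epsilon>|[v\<^sub>j]|)\<^sup>3)\<close>. The last
  contribution, integrated over all times, is \<open>O(\<epsilon>\<^sup>2)\<close>, since \<open>\<integral> v\<^sub>j\<^sup>2\<close> is dissipated at a rate
  proportional to \<open>\<epsilon> |[v\<^sub>j]|\<^sup>3\<close>. Finally \<open>\<kappa>\<close> tends to \<open>0\<close>.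
\<close>

section \<open>Smooth cutoff functions\<close>

text \<open>The bound is uniform in time because every contribution that grows with \<open>t\<close>
  carries a factor \<open>kap\<close>, and \<open>eps\<close> and \<open>t\<close> are fixed while
  \<open>kap\<close> tends to 0. The Rankine-Hugoniot speed of Burgers' equation serves two
  purposes: downward jumps of the step functions produce no Kruzhkov error, and along a curve of
  \<open>r j\<close>, parametrized by \<open>lam j\<close> up to a constant, the mean of the two
  parameters is the system's own jump speed up to second order, which leaves a cubic residual.
  Composed flows are used instead of the linear superposition because they make contacts exact. The
  price is the distance of \<open>w\<close> from the superposition; it is quadratic, hence bounded
  by the integrals of the squares of the step functions, the same quantity whose decay pays for the
  shocks. On the side of \<open>S\<close>, the obstacle is that smallness is known for the values of
  a Riemann profile only, while intermediate states of a Lax solution may be hidden between waves of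
  equal speed. Lax's inequalities exclude this between different eigenvalues, and the contacts of a
  repeated eigenvalue are merged into one jump.\<close>

lemma C_k_const [simp]: "C_k k (%x. c)"
 by (induction k arbitrary: c) auto

lemma C_k_continuous: "C_k k f ==> continuous_on UNIV f"
 by (cases k) (auto intro!: differentiable_imp_continuous_on simp: differentiable_on_def differentiable_at_withinI)

lemma C_k_Suc: "C_k (Suc k) f ==> C_k k f"
 by (induction k arbitrary: f) (auto intro!: C_k_continuous[of "Suc 0"])

lemma C_k_add: "C_k k f ==> C_k k g ==> C_k k (%x. f x + g x)"
proof (induction k arbitrary: f g)
 case (Suc k)
 have "frechet_derivative (%x. f x + g x) (at x) v = frechet_derivative f (at x) v + frechet_derivative g (at x) v" for x v
 proof -
  have "((%x. f x + g x) has_derivative (%v. frechet_derivative f (at x) v + frechet_derivative g (at x) v)) (at x)"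
   using Suc.prems by (intro has_derivative_add) (auto simp: frechet_derivative_works[symmetric])
  from frechet_derivative_at[OF this] show ?thesis by metis
 qed
 then show ?case using Suc by auto
qed (auto intro: continuous_intros)

lemma C_k_bilinear:
 assumes B: "bounded_bilinear B" and "C_k k f" "C_k k g"
 shows "C_k k (%x. B (f x) (g x))"
 using assms(2,3)
proof (induction k arbitrary: f g)
 case 0
 then show ?case using bounded_bilinear.continuous_on[OF B] by auto
next
 case (Suc k)
 have d: "((%x. B (f x) (g x)) has_derivative (%v. B (f x) (frechet_derivative g (at x) v) + B (frechet_derivative f (at x) v) (g x))) (at x)" for x
  using Suc.prems by (intro bounded_bilinear.FDERIV[OF B]) (auto simp: frechet_derivative_works[symmetric])
 have "frechet_derivative (%x. B (f x) (g x)) (at x) v = B (f x) (frechet_derivative g (at x) v) + B (frechet_derivative f (at x) v) (g x)" for x v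
  using frechet_derivative_at[OF d[of x]] by metis
 moreover have "C_k k (%x. B (f x) (frechet_derivative g (at x) v) + B (frechet_derivative f (at x) v) (g x))" for v
 proof -
  have "C_k k f" "C_k k g" "C_k k (%x. frechet_derivative f (at x) v)" "C_k k (%x. frechet_derivative g (at x) v)"
   using C_k_Suc[OF Suc.prems(1)] C_k_Suc[OF Suc.prems(2)] Suc.prems by auto
  then show ?thesis by (intro C_k_add Suc.IH)
 qed
 moreover have "(%x. B (f x) (g x)) differentiable (at x)" for x
  using d[of x] unfolding differentiable_def by blast
 ultimately show ?case by simp
qed

lemmas C_k_mult = C_k_bilinear[OF bounded_bilinear_mult]

lemma C_k_compose_affine:
 fixes f :: "real => real"
 assumes L: "bounded_linear L" and "C_k k f"
 shows "C_k k (%z. f (L z + c))"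
 using assms(2)
proof (induction k arbitrary: f)
 case 0
 have "continuous_on UNIV L" using L by (simp add: linear_continuous_on)
 then show ?case using 0 by (auto intro!: continuous_on_compose2[of UNIV f] continuous_intros)
next
 case (Suc k)
 have d: "((%z. f (L z + c)) has_derivative (%v. frechet_derivative f (at (L z + c)) (L v))) (at z)" for z
 proof -
  have "((%z. L z + c) has_derivative L) (at z)" by (auto intro!: derivative_eq_intros bounded_linear_imp_has_derivative[OF L])
  moreover have "(f has_derivative frechet_derivative f (at (L z + c))) (at (L z + c))"
   using Suc.prems by (auto simp: frechet_derivative_works[symmetric])
  ultimately show ?thesis using diff_chain_at[of "%z. L z + c" L z f] by (simp add: o_def)
 qed
 have lin: "frechet_derivative f (at x) v = v * frechet_derivative f (at x) 1" for x v
 proof -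
  have "linear (frechet_derivative f (at x))" using Suc.prems linear_frechet_derivative by auto
  from linear_scale[OF this, of v 1] show ?thesis by simp
 qed
 have "frechet_derivative (%z. f (L z + c)) (at z) v = L v * frechet_derivative f (at (L z + c)) 1" for z v
  using frechet_derivative_at[OF d[of z]] lin by metis
 moreover have "C_k k (%z. L v * frechet_derivative f (at (L z + c)) 1)" for v
  using Suc.prems by (intro C_k_mult Suc.IH) auto
 moreover have "(%z. f (L z + c)) differentiable (at z)" for z
  using d[of z] unfolding differentiable_def by blast
 ultimately show ?case by simp
qed

lemma C_k_Suc_realI:
 assumes d: "!!x. (f has_real_derivative f' x) (at x)" and "C_k k f'"
 shows "C_k (Suc k) f"
proof -
 have d': "(f has_derivative (%v. f' x * v)) (at x)" for x using d by (simp add: has_field_derivative_def)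
 have "frechet_derivative f (at x) v = f' x * v" for x v
  using frechet_derivative_at[OF d'[of x]] by metis
 moreover have "C_k k (%x. f' x * v)" for v using assms(2) by (intro C_k_mult) auto
 moreover have "f differentiable (at x)" for x
  using d'[of x] unfolding differentiable_def by blast
 ultimately show ?thesis by simp
qed

text \<open>The powers of \<open>1/x\<close> make the family closed under differentiation
  (\<open>flat_deriv\<close>), so that one induction proves all its members smooth.\<close>

definition flat :: "nat => real => real" where
 "flat m x = (if x > 0 then inverse x ^ m * exp (- inverse x) else 0)"

lemma flat_tendsto: "((%x. inverse x ^ m * exp (- inverse x)) \<longlongrightarrow> 0) (at_right (0::real))"
proof -
 have "((%y::real. y ^ m / exp y) \<longlongrightarrow> 0) at_top" by (rule tendsto_power_div_exp_0)
 from filterlim_compose[OF this filterlim_inverse_at_top_right]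
 show ?thesis by (simp add: exp_minus divide_inverse)
qed

lemma flat_deriv: "(flat m has_real_derivative flat (m+2) x - real m * flat (m+1) x) (at x)"
proof (cases x "0::real" rule: linorder_cases)
 case less
 have "((%x. 0::real) has_real_derivative 0) (at x)" by simp
 then have "(flat m has_real_derivative 0) (at x)"
  by (rule has_field_derivative_transform_within_open[of _ _ _ "{..<0}"]) (use less in \<open>auto simp: flat_def\<close>)
 then show ?thesis using less by (simp add: flat_def)
next
 case greater
 have "((%x. inverse x ^ m * exp (- inverse x)) has_real_derivative flat (m+2) x - real m * flat (m+1) x) (at x)"
 proof -
  have "(real m * inverse x ^ (m - Suc 0) * (- (inverse x ^ 2))) * exp (- inverse x) + inverse x ^ m * (exp (- inverse x) * inverse x ^ 2)
   = flat (m+2) x - real m * flat (m+1) x"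
   using greater by (cases m) (simp_all add: flat_def power_add power2_eq_square algebra_simps)
  moreover have "((%x. inverse x ^ m * exp (- inverse x)) has_real_derivative
    (real m * inverse x ^ (m - Suc 0) * (- (inverse x ^ 2))) * exp (- inverse x) + inverse x ^ m * (exp (- inverse x) * inverse x ^ 2)) (at x)"
   using greater by (auto intro!: derivative_eq_intros simp: power2_eq_square)
  ultimately show ?thesis by metis
 qed
 then show ?thesis
  by (rule has_field_derivative_transform_within_open[of _ _ _ "{0<..}"]) (use greater in \<open>auto simp: flat_def\<close>)
next
 case equal
 \<comment> \<open>From the right, the difference quotient at 0 is \<open>flat (Suc m)\<close>
   itself.\<close>
 have "((%y. (flat m y - flat m 0) / (y - 0)) \<longlongrightarrow> 0) (at_right 0)"
 proof (rule Lim_transform_eventually[OF flat_tendsto[of "Suc m"]])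
  show "\<forall>\<^sub>F x in at_right 0. inverse x ^ Suc m * exp (- inverse x) = (flat m x - flat m 0) / (x - 0)"
   by (auto simp: eventually_at_filter flat_def divide_inverse)
 qed
 moreover have "((%y. (flat m y - flat m 0) / (y - 0)) \<longlongrightarrow> 0) (at_left 0)"
 proof (rule Lim_transform_eventually[OF tendsto_const])
  show "\<forall>\<^sub>F x in at_left 0. 0 = (flat m x - flat m 0) / (x - 0)"
   by (auto simp: eventually_at_filter flat_def)
 qed
 ultimately have "(flat m has_real_derivative 0) (at 0)"
  unfolding has_field_derivative_iff by (simp add: filterlim_split_at)
 then show ?thesis using equal by (simp add: flat_def)
qed

lemma C_k_flat: "C_k k (flat m)"
proof (induction k arbitrary: m)
 case 0
 show ?case using DERIV_continuous[OF flat_deriv] by (auto intro: continuous_at_imp_continuous_on)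
next
 case (Suc k)
 have "C_k k (%x. flat (m+2) x + (- real m) * flat (m+1) x)"
  by (intro C_k_add C_k_mult Suc.IH C_k_const)
 then show ?case using flat_deriv by (intro C_k_Suc_realI[where f'="%x. flat (m+2) x - real m * flat (m+1) x"]) auto
qed

text \<open>Positive exactly on the open interval from 1 to 2. As the support stays away from 0,
  \<open>smooth_step\<close> can be an integral from 0: it vanishes wherever the interval
  \<open>{0..x}\<close> degenerates.\<close>

definition bump :: "real => real" where
 "bump x = flat 0 (x - 1) * flat 0 (2 - x)"

lemma C_k_bump: "C_k k bump"
 unfolding bump_def[abs_def]
 using C_k_compose_affine[of "%x. x" k "flat 0" "-1"] C_k_compose_affine[of "%x. -x" k "flat 0" "2"]
 by (intro C_k_mult) (auto simp: C_k_flat bounded_linear_minus)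

lemma bump_nonneg: "bump x >= 0" by (simp add: bump_def flat_def)

lemma bump_pos: "1 < x ==> x < 2 ==> bump x > 0" by (simp add: bump_def flat_def)

lemma bump_zero: "x <= 1 | 2 <= x ==> bump x = 0" by (auto simp: bump_def flat_def)

definition smooth_step :: "real => real" where
 "smooth_step x = integral {0..x} bump / integral {0..2} bump"

definition mollifier :: "real => real" where
 "mollifier x = bump x / integral {0..2} bump"

lemma bump_integrable: "bump integrable_on {a..b}"
 using C_k_continuous[OF C_k_bump[of 0]] by (intro integrable_continuous_interval) (auto intro: continuous_on_subset)

lemma bump_integral_pos: "integral {0..2} bump > 0"
proof -
 have "integral {0..2} bump ~= 0"
 proof
  assume "integral {0..2} bump = 0"
  then have "(bump has_integral 0) (cbox 0 2)" using bump_integrable[of 0 2] by (metis box_real(2) integrable_integral)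
  then have "bump 1.5 = 0"
   by (rule has_integral_0_cbox_imp_0[rotated 2]) (use C_k_continuous[OF C_k_bump[of 0]] in \<open>auto intro: continuous_on_subset bump_nonneg simp: mem_box\<close>)
  then show False using bump_pos[of "1.5"] by simp
 qed
 moreover have "integral {0..2} bump >= 0" by (intro integral_nonneg bump_integrable) (auto simp: bump_nonneg)
 ultimately show ?thesis by simp
qed

lemma smooth_step_deriv: "(smooth_step has_real_derivative mollifier x) (at x)"
proof (cases "x < 1")
 case True
 have z: "smooth_step y = 0" if "y < 1" for y
 proof -
  have "integral {0..y} bump = integral {0..y} (%x. 0)" using that by (intro integral_cong) (auto simp: bump_zero)
  then show ?thesis by (simp add: smooth_step_def)
 qed
 have "((%x. 0::real) has_real_derivative 0) (at x)" by simp
 then have "(smooth_step has_real_derivative 0) (at x)"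
  by (rule has_field_derivative_transform_within_open[of _ _ _ "{..<1}"]) (use True z in auto)
 then show ?thesis using True by (simp add: mollifier_def bump_zero)
next
 case False
 have "((%u. integral {0..u} bump) has_real_derivative bump x) (at x within {0..x+1})"
  using C_k_continuous[OF C_k_bump[of 0]] False by (intro integral_has_real_derivative) (auto intro: continuous_on_subset)
 then have "((%u. integral {0..u} bump) has_real_derivative bump x) (at x)"
  using at_within_interior[of x "{0..x+1}"] False by (auto simp: interior_atLeastAtMost_real)
 from DERIV_cdivide[OF this, of "integral {0..2} bump"] show ?thesis
  unfolding smooth_step_def[abs_def] mollifier_def by simp
qed

lemma C_k_mollifier: "C_k k mollifier"
 unfolding mollifier_def[abs_def] divide_inverse by (intro C_k_mult C_k_bump C_k_const)

lemma C_k_smooth_step: "C_k k smooth_step"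
 using C_k_Suc[OF C_k_Suc_realI[OF smooth_step_deriv C_k_mollifier]] .

lemma mollifier_nonneg: "0 <= mollifier x"
 using bump_integral_pos by (simp add: mollifier_def bump_nonneg)

lemma mollifier_zero: "x <= 1 | 2 <= x ==> mollifier x = 0" by (auto simp: mollifier_def bump_zero)

lemma smooth_step_mono: "x <= y ==> smooth_step x <= smooth_step y"
 by (rule DERIV_nonneg_imp_nondecreasing[of x y]) (use smooth_step_deriv mollifier_nonneg in blast)+

lemma smooth_step_0: "x <= 1 ==> smooth_step x = 0"
proof -
 assume "x <= 1"
 then have "integral {0..x} bump = integral {0..x} (%x. 0)" by (intro integral_cong) (auto simp: bump_zero)
 then show ?thesis by (simp add: smooth_step_def)
qed

lemma smooth_step_1: assumes "2 <= x" shows "smooth_step x = 1"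
proof -
 have "integral {0..2} bump + integral {2..x} bump = integral {0..x} bump"
  by (rule Henstock_Kurzweil_Integration.integral_combine) (use assms bump_integrable in auto)
 moreover have "integral {2..x} bump = integral {2..x} (%x. 0)" by (intro integral_cong) (auto simp: bump_zero)
 ultimately show ?thesis using bump_integral_pos by (simp add: smooth_step_def)
qed

lemma smooth_step_bounds: "0 <= smooth_step x" "smooth_step x <= 1"
 using smooth_step_mono[of "min x 0" x] smooth_step_0[of "min x 0"] smooth_step_mono[of x "max x 2"] smooth_step_1[of "max x 2"] by auto

lemma mollifier_continuous: "continuous_on UNIV mollifier"
 by (rule C_k_continuous[OF C_k_mollifier[of 0]])

lemma mollifier_measurable [measurable]: "mollifier : borel_measurable borel"
 by (rule borel_measurable_continuous_onI[OF mollifier_continuous])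

lemma smooth_step_continuous: "continuous_on UNIV smooth_step"
 by (rule C_k_continuous[OF C_k_smooth_step[of 0]])

lemma smooth_step_measurable [measurable]: "smooth_step : borel_measurable borel"
 by (rule borel_measurable_continuous_onI[OF smooth_step_continuous])

section \<open>Sticky particles\<close>

definition stepv :: "'i set => ('i => real) => ('i => real) => real => real" where
 "stepv I d p y = (SUM i:{i:I. p i <= y}. d i)"

definition stepl :: "'i set => ('i => real) => ('i => real) => real => real" where
 "stepl I d p y = (SUM i:{i:I. p i < y}. d i)"

definition jump :: "'i set => ('i => real) => ('i => real) => real => real" where
 "jump I d p y = (SUM i:{i:I. p i = y}. d i)"

text \<open>The chord slope of \<open>u^2 / 2\<close> between the left and right states at
  \<open>y\<close>, that is, the Rankine-Hugoniot speed of Burgers' equation.\<close>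

definition speed :: "'i set => ('i => real) => ('i => real) => real => real" where
 "speed I d p y = (stepl I d p y + stepv I d p y) / 2"

lemma stepv_eq_stepl_jump:
 assumes "finite I"
 shows "stepv I d p y = stepl I d p y + jump I d p y"
proof -
 have "{i:I. p i <= y} = {i:I. p i < y} \<union> {i:I. p i = y}" by auto
 then show ?thesis
  unfolding stepv_def stepl_def jump_def using assms
  by (simp only: , intro sum.union_disjoint) auto
qed

lemma abs_stepv_le: "finite I ==> abs(stepv I d p y) <= (SUM i:I. abs(d i))"
 unfolding stepv_def by (rule order_trans[OF sum_abs]) (auto intro!: sum_mono2)

lemma abs_stepl_le: "finite I ==> abs(stepl I d p y) <= (SUM i:I. abs(d i))"
 unfolding stepl_def by (rule order_trans[OF sum_abs]) (auto intro!: sum_mono2)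

lemma abs_speed_le:
 assumes "finite I" shows "abs(speed I d p y) <= (SUM i:I. abs(d i))"
 using abs_stepv_le[OF assms, of d p y] abs_stepl_le[OF assms, of d p y] unfolding speed_def by (simp add: abs_le_iff)

lemma speed_cong_order:
 assumes "!!k. k : I ==> q k < q i \<longleftrightarrow> p k < p i" "!!k. k : I ==> q k <= q i \<longleftrightarrow> p k <= p i"
 shows "speed I d q (q i) = speed I d p (p i)"
proof -
 have "{k:I. q k < q i} = {k:I. p k < p i}" "{k:I. q k <= q i} = {k:I. p k <= p i}" using assms by auto
 then show ?thesis unfolding speed_def stepl_def stepv_def by simp
qed

text \<open>Pair the points off from the left: each pair of neighbours contributes at most 0, and at
  most one point is left over. In \<open>sticky_exists\<close> the points are the positions that
  merge in one collision, so upward jumps cannot build up.\<close>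

lemma sum_le_of_consecutive:
 fixes D :: "real => real"
 assumes "finite Y" "0 <= kap" "!!y. y : Y ==> D y <= kap"
  "!!y z. y : Y ==> z : Y ==> y < z ==> Y \<inter> {y<..<z} = {} ==> D y + D z <= 0"
 shows "sum D Y <= kap"
 using assms
proof (induction "card Y" arbitrary: Y rule: less_induct)
 case less
 show ?case
 proof (cases "Y = {}")
  case True then show ?thesis using less.prems by simp
 next
  case False
  define y where "y = Min Y"
  have y: "y : Y" "!!z. z : Y ==> y <= z" using False less.prems(1) by (auto simp: y_def)
  show ?thesis
  proof (cases "Y - {y} = {}")
   case True
   then have "Y = {y}" using y by auto
   then show ?thesis using less.prems(3) by auto
  next
   case ne: False
   define z where "z = Min (Y - {y})"
   have "z : Y - {y}" using ne less.prems(1) unfolding z_def by (intro Min_in) auto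
   moreover have zmin: "!!w. w : Y - {y} ==> z <= w" using less.prems(1) unfolding z_def by (intro Min_le) auto
   ultimately have z: "z : Y" "y < z" using y by force+
   have e: "Y \<inter> {y<..<z} = {}" using zmin by force
   have "D y + D z <= 0" by (rule less.prems(4)[OF y(1) z e])
   have c: "card (Y - {y,z}) < card Y" using y z less.prems(1) by (intro psubset_card_mono) auto
   have "sum D (Y - {y,z}) <= kap"
   proof (rule less.hyps[OF c])
    fix a b assume ab: "a : Y - {y, z}" "b : Y - {y, z}" "a < b" "(Y - {y, z}) \<inter> {a<..<b} = {}"
    have "z <= a" using zmin ab by auto
    then have "Y \<inter> {a<..<b} = {}" using ab z by auto
    then show "D a + D b <= 0" using less.prems(4) ab by auto
   qed (use less.prems in auto)
   moreover have "sum D Y = (D y + D z) + sum D (Y - {y,z})"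
    using sum.subset_diff[of "{y,z}" Y D] y z less.prems(1) by auto
   ultimately show ?thesis using \<open>D y + D z <= 0\<close> by linarith
  qed
 qed
qed

text \<open>
  Particle \<open>i\<close> carries the jump \<open>d i\<close> of the step function; colliding particles stay together, because
  the speed depends on the position only.
\<close>

definition sticky :: "'i set => ('i => real) => real => (real => 'i => real) => bool" where
 "sticky I d kap P \<longleftrightarrow>
   (ALL tau>=0. EX h>0. ALL eta:{0..h}. ALL i:I. P (tau + eta) i = P tau i + eta * speed I d (P tau) (P tau i)) &
   (ALL i:I. ALL tau>=0. ALL tau'>=0. abs(P tau i - P tau' i) <= (SUM i:I. abs(d i)) * abs(tau - tau')) &
   (ALL tau>=0. ALL x. jump I d (P tau) x <= kap)"

text \<open>Particles move freely until the first collision, where the number of distinct positions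
  drops and the motion restarts. No merger creates an upward jump above \<open>kap\<close>, because
  neighbours that collide have jumps of negative sum.\<close>

lemma sticky_exists:
 fixes p :: "'i => real"
 assumes I: "finite I" and k0: "0 <= kap" and J: "!!x. jump I d p x <= kap"
 shows "EX P. P 0 = p & sticky I d kap P"
 using J
proof (induction "card (p ` I)" arbitrary: p rule: less_induct)
 case less
 define M where "M = (SUM i:I. abs(d i))"
 define s where "s i = speed I d p (p i)" for i
 have sM: "abs(s i) <= M" for i unfolding s_def M_def using I by (rule abs_speed_le)
 have seq: "s i = s k" if "p i = p k" for i k using that by (simp add: s_def)
 define q where "q eta i = p i + eta * s i" for eta i
 have qlip: "abs(q eta i - q eta' i) <= M * abs(eta - eta')" for eta eta' i
 proof -
  have "q eta i - q eta' i = s i * (eta - eta')" by (simp add: q_def algebra_simps)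
  then show ?thesis using mult_right_mono[OF sM[of i], of "abs(eta - eta')"] by (simp add: abs_mult)
 qed
 \<comment> \<open>As long as the strict order of the positions persists, neither the speeds nor the
   clusters change.\<close>
 have free: "speed I d (q eta) (q eta i) = s i" "jump I d (q eta) x <= kap"
  if ord: "!!i k. i : I ==> k : I ==> p i < p k ==> q eta i < q eta k" and "i : I" for eta i x
 proof -
  have lt: "q eta i < q eta k \<longleftrightarrow> p i < p k" and le: "q eta i <= q eta k \<longleftrightarrow> p i <= p k" if "i : I" "k : I" for i k
   using ord[OF that] ord[OF that(2,1)] seq[of i k] unfolding q_def by (cases "p i" "p k" rule: linorder_cases; force)+
  show "speed I d (q eta) (q eta i) = s i"
   unfolding s_def using lt le \<open>i : I\<close> by (intro speed_cong_order) auto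
  show "jump I d (q eta) x <= kap"
  proof (cases "EX k:I. q eta k = x")
   case True
   then obtain k where k: "k : I" "q eta k = x" by auto
   have "{i : I. q eta i = x} = {i : I. p i = p k}" using le[OF _ k(1)] le[OF k(1)] k by (metis (no_types, lifting) order.eq_iff)
   then show ?thesis using less.prems[of "p k"] by (simp add: jump_def)
  next
   case False
   then have "{i : I. q eta i = x} = {}" by auto
   then show ?thesis using k0 unfolding jump_def by (simp only: sum.empty)
  qed
 qed
 \<comment> \<open>The pairs on a collision course; \<open>t1\<close> below is the earliest of their
   meeting times.\<close>
 define C where "C = {(i,k). i : I & k : I & p i < p k & s k < s i}"
 have finC: "finite C" using I by (rule_tac finite_subset[of _ "I \<times> I"]) (auto simp: C_def)
 show ?case
 proof (cases "C = {}")
  case True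
  have ord: "q eta i < q eta k" if "i : I" "k : I" "p i < p k" "0 <= eta" for eta i k
  proof -
   have "s i <= s k" using True that unfolding C_def by force
   then have "eta * s i <= eta * s k" using that by (intro mult_left_mono)
   then show ?thesis using that unfolding q_def by linarith
  qed
  have "sticky I d kap q"
   unfolding sticky_def
  proof (intro conjI allI impI ballI)
   fix tau :: real assume t: "0 <= tau"
   have "q (tau + eta) i = q tau i + eta * speed I d (q tau) (q tau i)" if "i : I" for eta i
    using free(1)[of tau i] ord that t by (simp add: q_def algebra_simps)
   then show "EX h>0. ALL eta:{0..h}. ALL i:I. q (tau + eta) i = q tau i + eta * speed I d (q tau) (q tau i)"
    by (intro exI[of _ 1]) auto
   show "jump I d (q tau) x <= kap" for x
   proof (cases "I = {}")
    case True then show ?thesis using k0 by (simp add: jump_def)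
   next
    case False then show ?thesis using free(2)[of tau] ord t by blast
   qed
  qed (use qlip in \<open>auto simp: M_def\<close>)
  then show ?thesis by (intro exI[of _ q]) (auto simp: q_def)
 next
  case False
  define f where "f = (%(i,k). (p k - p i) / (s i - s k))"
  define t1 where "t1 = Min (f ` C)"
  have t1pos: "t1 > 0" unfolding t1_def using finC False by (auto simp: f_def C_def)
  have t1le: "t1 <= (p k - p i) / (s i - s k)" if "(i,k) : C" for i k
  proof -
   have "f (i,k) : f ` C" using that by blast
   then show ?thesis unfolding t1_def using finC by (metis (no_types, lifting) Min_le case_prod_conv f_def finite_imageI)
  qed
  have "t1 : f ` C" unfolding t1_def using finC False by (intro Min_in) auto
  then obtain i0 k0 where c0: "(i0,k0) : C" "t1 = (p k0 - p i0) / (s i0 - s k0)" by (auto simp: f_def)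
  have ord: "q eta i < q eta k" if "i : I" "k : I" "p i < p k" "0 <= eta" "eta < t1" for eta i k
  proof (cases "s i <= s k")
   case True
   then have "eta * s i <= eta * s k" using that by (intro mult_left_mono)
   then show ?thesis using that unfolding q_def by linarith
  next
   case False
   then have "(i,k) : C" using that by (auto simp: C_def)
   then have "eta < (p k - p i) / (s i - s k)" using t1le that by fastforce
   then have "eta * (s i - s k) < p k - p i" using False by (simp add: pos_less_divide_eq)
   then show ?thesis by (simp add: q_def algebra_simps)
  qed
  have ord1: "q t1 i <= q t1 k" if "i : I" "k : I" "p i <= p k" for i k
  proof (cases "p i = p k")
   case True then show ?thesis using seq[OF True] by (simp add: q_def)
  next
   case ne: False
   show ?thesis
   proof (cases "s i <= s k")
    case True
    then have "t1 * s i <= t1 * s k" using t1pos by (intro mult_left_mono) auto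
    then show ?thesis using that unfolding q_def by linarith
   next
    case False
    then have "(i,k) : C" using that ne by (auto simp: C_def)
    then have "t1 <= (p k - p i) / (s i - s k)" using t1le that by fastforce
    then have "t1 * (s i - s k) <= p k - p i" using False by (simp add: pos_le_divide_eq)
    then show ?thesis by (simp add: q_def algebra_simps)
   qed
  qed
  \<comment> \<open>The position after time \<open>t1\<close> as a function of the initial position.
    A colliding pair makes it non-injective, which gives the decrease for the induction.\<close>
  define g where "g y = y + t1 * speed I d p y" for y
  have qg: "q t1 i = g (p i)" for i by (simp add: q_def g_def s_def)
  have card: "card (q t1 ` I) < card (p ` I)"
  proof -
   have "q t1 ` I = g ` (p ` I)" using qg by auto
   moreover have "~ inj_on g (p ` I)"
   proof
    assume inj: "inj_on g (p ` I)"
    have "s i0 - s k0 ~= 0" using c0 by (auto simp: C_def)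
    then have "t1 * (s i0 - s k0) = p k0 - p i0" using c0 by simp
    then have "q t1 i0 = q t1 k0" by (simp add: q_def algebra_simps)
    then have "p i0 = p k0" using inj_onD[OF inj, of "p i0" "p k0"] c0 qg by (auto simp: C_def)
    then show False using c0 by (auto simp: C_def)
   qed
   ultimately show ?thesis using I card_image_le[of "p ` I" g] eq_card_imp_inj_on[of "p ` I" g] by (metis finite_imageI le_neq_implies_less)
  qed
  have J1: "jump I d (q t1) x <= kap" for x
  proof -
   define Y where "Y = {y : p ` I. g y = x}"
   have finY: "finite Y" using I by (auto simp: Y_def)
   have "jump I d (q t1) x = (SUM y:Y. jump I d p y)"
   proof -
    have "(SUM y:Y. SUM i:{i : {i : I. q t1 i = x}. p i = y}. d i) = (SUM i:{i : I. q t1 i = x}. d i)"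
     by (rule sum.group) (use I finY qg in \<open>auto simp: Y_def\<close>)
    moreover have "{i : {i : I. q t1 i = x}. p i = y} = {i : I. p i = y}" if "y : Y" for y
     using that qg by (auto simp: Y_def)
    ultimately show ?thesis by (simp add: jump_def)
   qed
   also have "... <= kap"
   proof (rule sum_le_of_consecutive[OF finY k0])
    show "jump I d p y <= kap" for y by (rule less.prems)
    fix y z assume yz: "y : Y" "z : Y" "y < z" "Y \<inter> {y<..<z} = {}"
    \<comment> \<open>A particle strictly between two others that meet at \<open>x\<close> is
      squeezed into \<open>x\<close> as well.\<close>
    have gap: "w ~: p ` I" if "y < w" "w < z" for w
    proof
     assume "w : p ` I"
     then obtain k i j where k: "k : I" "p k = w" "i : I" "p i = y" "j : I" "p j = z" using yz by (auto simp: Y_def)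
     have "g y <= g w" "g w <= g z" using ord1[of i k] ord1[of k j] k that qg by auto
     then have "w : Y" using yz k by (auto simp: Y_def)
     then show False using that yz by auto
    qed
    have "p i < z \<longleftrightarrow> p i <= y" if "i : I" for i
     using gap[of "p i"] yz(3) that by (meson imageI le_less_trans not_le)
    then have "{i : I. p i < z} = {i : I. p i <= y}" by auto
    then have e: "stepl I d p z = stepv I d p y" by (simp add: stepl_def stepv_def)
    \<comment> \<open>The right state at \<open>y\<close> is the left state at \<open>z\<close>, so
      the speeds differ by half the sum of the two jumps; meeting at a positive time makes that sum
      negative.\<close>
    have "y + t1 * speed I d p y = z + t1 * speed I d p z" using yz by (auto simp: Y_def g_def)
    then have "t1 * (speed I d p z - speed I d p y) < 0" using yz(3) by (simp add: algebra_simps)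
    then have "speed I d p z < speed I d p y" using t1pos by (simp add: mult_less_0_iff)
    then show "jump I d p y + jump I d p z <= 0"
     unfolding speed_def e stepv_eq_stepl_jump[OF I] using e stepv_eq_stepl_jump[OF I, of d p y] by argo
   qed
   finally show ?thesis .
  qed
  obtain P where P: "P 0 = q t1" "sticky I d kap P" using less.hyps[OF card J1] by auto
  define Q where "Q tau = (if tau < t1 then q tau else P (tau - t1))" for tau
  have Plip: "abs(P tau i - P tau' i) <= M * abs(tau - tau')" if "i : I" "0 <= tau" "0 <= tau'" for i tau tau'
   using P(2) that unfolding sticky_def M_def by auto
  have Qlip0: "abs(Q tau i - Q tau' i) <= M * abs(tau - tau')" if "i : I" "tau < t1" "t1 <= tau'" for i tau tau'
  proof -
   have "abs(q tau i - q t1 i) <= M * (t1 - tau)" using qlip[of tau i t1] that by simp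
   moreover have "abs(P 0 i - P (tau' - t1) i) <= M * (tau' - t1)" using Plip[of i 0 "tau' - t1"] that by simp
   ultimately show ?thesis using that P(1) by (simp add: Q_def algebra_simps)
  qed
  have "sticky I d kap Q"
   unfolding sticky_def
  proof (intro conjI allI impI ballI)
   fix tau :: real assume t: "0 <= tau"
   show "EX h>0. ALL eta:{0..h}. ALL i:I. Q (tau + eta) i = Q tau i + eta * speed I d (Q tau) (Q tau i)"
   proof (cases "tau < t1")
    case True
    have "Q (tau + eta) i = Q tau i + eta * speed I d (Q tau) (Q tau i)" if "i : I" "eta <= (t1 - tau) / 2" for eta i
    proof -
     have "tau + eta < t1" using that True by argo
     then show ?thesis using free(1)[of tau i] ord that t True by (simp add: Q_def q_def algebra_simps)
    qed
    then show ?thesis using True by (intro exI[of _ "(t1 - tau) / 2"]) auto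
   next
    case False
    then obtain h where "h > 0" "!!eta i. eta:{0..h} ==> i : I ==> P (tau - t1 + eta) i = P (tau - t1) i + eta * speed I d (P (tau - t1)) (P (tau - t1) i)"
     using P(2) unfolding sticky_def by (meson diff_ge_0_iff_ge linorder_not_less)
    then show ?thesis using False by (intro exI[of _ h]) (auto simp: Q_def algebra_simps)
   qed
   show "jump I d (Q tau) x <= kap" for x
   proof (cases "I = {}")
    case True then show ?thesis using k0 by (simp add: jump_def)
   next
    case False
    then show ?thesis using free(2)[of tau] ord t P(2) by (auto simp: Q_def sticky_def)
   qed
  next
   fix i tau tau' assume "i : I" "0 <= (tau::real)" "0 <= (tau'::real)"
   then show "abs(Q tau i - Q tau' i) <= (SUM i:I. abs(d i)) * abs(tau - tau')"
    using Qlip0[of i tau tau'] Qlip0[of i tau' tau] qlip[of tau i tau'] Plip[of i "tau - t1" "tau' - t1"]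
    unfolding M_def[symmetric]
    by (cases "tau < t1"; cases "tau' < t1") (auto simp: Q_def abs_minus_commute)
  qed
  moreover have "Q 0 = p" using t1pos by (auto simp: Q_def q_def)
  ultimately show ?thesis by blast
 qed
qed

section \<open>Scalar conservation laws and moving fronts\<close>

text \<open>By compactness there is a last time at which \<open>F\<close> does not exceed
  \<open>F a\<close>; the local hypothesis would push it further if it were before
  \<open>b\<close>.\<close>

lemma right_local_nonincreasing:
 fixes F :: "real => real"
 assumes "a <= b" "continuous_on {a..b} F"
  "!!s. a <= s ==> s < b ==> EX k>0. ALL eta:{0<..<k}. F (s + eta) <= F s"
 shows "F b <= F a"
proof -
 define A where "A = {t:{a..b}. F t <= F a}"
 have "closed A" unfolding A_def
  using continuous_closed_preimage[OF assms(2) closed_atLeastAtMost closed_atMost, of "F a"] by (simp add: vimage_def Int_def)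
 then have "compact A" using bounded_closed_interval[of a b] by (metis (no_types, lifting) A_def bounded_subset compact_eq_bounded_closed mem_Collect_eq subsetI)
 moreover have "a : A" using assms by (auto simp: A_def)
 ultimately obtain t where t: "t : A" "!!s. s : A ==> s <= t" using compact_attains_sup[of A] by blast
 show ?thesis
 proof (cases "t < b")
  case True
  then obtain k where k: "k > 0" "!!eta. eta : {0<..<k} ==> F (t + eta) <= F t" using assms(3)[of t] t by (auto simp: A_def)
  define eta where "eta = min (k/2) (b - t)"
  have "eta : {0<..<k}" "t + eta <= b" using k True by (auto simp: eta_def min_def)
  then have "t + eta : A" using k(2)[of eta] t by (auto simp: A_def)
  then show ?thesis using t(2)[of "t + eta"] \<open>eta : {0<..<k}\<close> by auto
 next
  case False then show ?thesis using t by (auto simp: A_def)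
 qed
qed

text \<open>The rate is assumed just after every \<open>t\<close>, but not at \<open>t\<close>
  itself; continuity carries it over. This admits the exceptional times at which fronts of different
  families cross.\<close>

lemma right_punctured_growth:
 fixes E :: "real => real"
 assumes "a <= b" and cont: "continuous_on {a..b} E"
  and loc: "!!t. a <= t ==> t < b ==> EX h>0. ALL s:{t<..<t+h}. s < b --> (EX k>0. ALL eta:{0<..<k}. E (s + eta) <= E s + c * eta)"
 shows "E b <= E a + c * (b - a)"
proof -
 define F where "F t = E t - c * t" for t
 have Fc: "continuous_on {a..b} F" unfolding F_def by (intro continuous_intros cont)
 have "F b <= F a"
 proof (rule right_local_nonincreasing[OF \<open>a <= b\<close> Fc])
  fix t assume t: "a <= t" "t < b"
  obtain h where h: "h > 0" "!!s. s:{t<..<t+h} ==> s < b ==> (EX k>0. ALL eta:{0<..<k}. E (s + eta) <= E s + c * eta)"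
   using loc[OF t] by blast
  define k where "k = min h (b - t)"
  have "F (t + eta) <= F t" if eta: "eta : {0<..<k}" for eta
  proof -
   have *: "F (t + eta) <= F s" if s: "s : {t<..<t+eta}" for s
   proof (rule right_local_nonincreasing[where F=F and a=s and b="t + eta"])
    show "continuous_on {s..t + eta} F" using eta s t by (intro continuous_on_subset[OF Fc]) (auto simp: k_def)
    fix r assume r: "s <= r" "r < t + eta"
    then obtain k' where "k'>0" "ALL eta:{0<..<k'}. E (r + eta) <= E r + c * eta" using h(2)[of r] s eta by (auto simp: k_def)
    then show "EX k>0. ALL eta:{0<..<k}. F (r + eta) <= F r" by (intro exI[of _ k']) (auto simp: F_def algebra_simps)
   qed (use s in auto)
   have "(F \<longlongrightarrow> F t) (at t within {a..b})" using Fc t by (auto simp: continuous_on_def)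
   then have "(F \<longlongrightarrow> F t) (at t within {t..b})" by (rule tendsto_within_subset) (use t in auto)
   then have lim: "(F \<longlongrightarrow> F t) (at_right t)" using t(2) by (simp add: at_within_Icc_at_right)
   have ev: "\<forall>\<^sub>F s in at_right t. F (t + eta) <= F s"
    using * eta unfolding eventually_at_right_field by (intro exI[of _ "t + eta"]) auto
   show ?thesis by (rule tendsto_lowerbound[OF lim ev]) simp
  qed
  then show "EX k>0. ALL eta:{0<..<k}. F (t + eta) <= F t" using h t by (intro exI[of _ k]) (auto simp: k_def)
 qed
 then show ?thesis by (simp add: F_def algebra_simps)
qed

section \<open>Smooth cutoffs and the entropy balance between moving fronts\<close>

definition ramp :: "real => real => real => real" where
 "ramp h c x = smooth_step ((x - c) / h)"

definition dramp :: "real => real => real => real" where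
 "dramp h c x = mollifier ((x - c) / h) / h"

lemma ramp_measurable [measurable]: "ramp h c : borel_measurable borel" "dramp h c : borel_measurable borel"
 unfolding ramp_def[abs_def] dramp_def[abs_def] by measurable

lemma ramp_0: "0 < h ==> x <= c + h ==> ramp h c x = 0"
 unfolding ramp_def by (rule smooth_step_0) (simp add: pos_divide_le_eq)

lemma ramp_1: "0 < h ==> c + 2 * h <= x ==> ramp h c x = 1"
 unfolding ramp_def by (rule smooth_step_1) (simp add: pos_le_divide_eq)

lemma ramp_bounds: "0 <= ramp h c x" "ramp h c x <= 1"
 unfolding ramp_def by (rule smooth_step_bounds)+

lemma ramp_mono: "0 < h ==> x - c <= y - d ==> ramp h c x <= ramp h d y"
 unfolding ramp_def by (intro smooth_step_mono divide_right_mono) auto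

lemma ramp_indicator:
 assumes "0 < h"
 shows "abs(ramp h c x - indicator {c..} x) <= indicator {c..c + 2 * h} x"
proof -
 consider "x < c" | "c + 2 * h < x" | "x : {c..c + 2 * h}" by force
 then show ?thesis
  using ramp_0[OF assms, of x c] ramp_1[OF assms, of c x] ramp_bounds[of h c x] assms by cases (auto simp: indicator_def)
qed

lemma dramp_nonneg: "0 < h ==> 0 <= dramp h c x"
 unfolding dramp_def by (simp add: mollifier_nonneg)

lemma dramp_0: "0 < h ==> x ~: {c + h..c + 2 * h} ==> dramp h c x = 0"
 unfolding dramp_def by (subst mollifier_zero) (auto simp: pos_le_divide_eq pos_divide_le_eq not_le)

lemma ramp_compose_deriv:
 assumes "bounded_linear L" "0 < h"
 shows "((%z. ramp h c (L z)) has_derivative (%w. L w * dramp h c (L z))) (at z)"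
proof -
 have "((%z. (L z - c) / h) has_derivative (%w. L w / h)) (at z)"
  using assms by (auto intro!: derivative_eq_intros bounded_linear_imp_has_derivative)
 from DERIV_compose_FDERIV[OF smooth_step_deriv this] show ?thesis by (simp add: ramp_def dramp_def)
qed

lemma C_k_ramp: "bounded_linear L ==> C_k k (%z. ramp h c (L z))"
 unfolding ramp_def
 using C_k_compose_affine[OF bounded_linear_compose[OF bounded_linear_divide] C_k_smooth_step, of L k h "- c / h"]
 by (simp add: diff_divide_distrib)

lemma dramp_integral:
 assumes h: "0 < h" shows "has_bochner_integral lborel (dramp h c) 1"
proof -
 have "has_bochner_integral lborel (%x. dramp h c x * indicator {c..c + 2*h} x) (ramp h c (c + 2 * h) - ramp h c c)"
 proof (rule has_bochner_integral_FTC_Icc_real)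
  show "DERIV (ramp h c) x :> dramp h c x" for x
   using ramp_compose_deriv[OF bounded_linear_ident h] by (simp add: has_field_derivative_def mult_commute_abs)
  have "continuous_on UNIV (dramp h c)"
   unfolding dramp_def[abs_def] using h
   by (intro continuous_on_divide continuous_on_compose2[OF mollifier_continuous] continuous_intros) auto
  then show "isCont (dramp h c) x" for x by (simp add: continuous_on_eq_continuous_at)
 qed (use h in auto)
 moreover have "dramp h c x * indicator {c..c + 2*h} x = dramp h c x" for x
  by (cases "x : {c + h..c + 2 * h}") (use h in \<open>auto simp: dramp_0\<close>)
 ultimately show ?thesis using h by (simp add: ramp_0 ramp_1)
qed

lemma integrable_bounded_support:
 fixes f :: "'a::euclidean_space => real"
 assumes "f : borel_measurable borel" "bounded A" "A : sets borel" "!!x. x : A ==> abs(f x) <= K" "!!x. x ~: A ==> f x = 0"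
 shows "integrable lborel f"
 by (rule integrableI_bounded_set[where A=A and B=K])
   (use assms emeasure_bounded_finite[OF assms(2)] in \<open>auto simp: less_top\<close>)

lemma integrable_on_interval:
 fixes f :: "real => real"
 assumes "f : borel_measurable borel" "!!x. abs(f x) <= K" "A \<subseteq> {a..b}" "A : sets borel"
 shows "integrable lborel (%x. indicator A x * f x)"
 by (rule integrable_bounded_support[where A=A and K=K])
   (use assms bounded_subset[OF bounded_closed_interval assms(3)] in \<open>auto simp: indicator_def\<close>)

lemma test_function_outside:
 assumes "compact K" "!!z. z ~: K ==> f z = 0" "z ~: K"
 shows "frechet_derivative f (at z) = (%_. 0)"
proof -
 have "((%z. 0) has_derivative (%_. 0)) (at z)" by simp
 then have "(f has_derivative (%_. 0)) (at z)"
  by (rule has_derivative_transform_within_open[where s="- K"])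
    (use assms in \<open>auto simp: compact_imp_closed open_Compl\<close>)
 then show ?thesis by (rule frechet_derivative_at[symmetric])
qed

lemma test_function_measurable:
 assumes "test_function f" shows "(%z. frechet_derivative f (at z) w) : borel_measurable borel"
proof -
 have "C_k (Suc 0) f" using assms unfolding test_function_def smooth_def by blast
 then show ?thesis unfolding C_k.simps by (intro borel_measurable_continuous_onI) blast
qed

lemma test_function_integrable:
 assumes f: "test_function f" and g: "g : borel_measurable borel" "!!z. abs(g z) <= B"
 shows "integrable lborel (%z. g z * frechet_derivative f (at z) w)"
proof -
 obtain K where K: "compact K" "!!z. z ~: K ==> f z = 0" using f unfolding test_function_def by blast
 have "C_k (Suc 0) f" using f unfolding test_function_def smooth_def by blast
 then have "continuous_on K (%z. frechet_derivative f (at z) w)" unfolding C_k.simps by (blast intro: continuous_on_subset)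
 from compact_imp_bounded[OF compact_continuous_image[OF this K(1)]]
 obtain D where D: "!!z. z : K ==> abs(frechet_derivative f (at z) w) <= D" unfolding bounded_iff by force
 show ?thesis
 proof (rule integrable_bounded_support[where A=K and K="B * D"])
  show "(%z. g z * frechet_derivative f (at z) w) : borel_measurable borel"
   by (intro borel_measurable_times g test_function_measurable f)
  have "0 <= B" using g(2)[of undefined] by linarith
  then show "abs(g z * frechet_derivative f (at z) w) <= B * D" if "z : K" for z
   unfolding abs_mult using g(2) D[OF that] by (intro mult_mono) auto
  show "g z * frechet_derivative f (at z) w = 0" if "z ~: K" for z
   using test_function_outside[OF K that] by simp
 qed (use K in \<open>auto intro: compact_imp_bounded borel_compact\<close>)
qed

text \<open>The bound holds at every point, not only almost everywhere, and at negative times too;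
  \<open>truncate\<close> produces such representatives of solutions.\<close>

locale scalar_field =
 fixes v :: "real => real => real" and M :: real
 assumes meas [measurable]: "(%z. v (fst z) (snd z)) : borel_measurable borel"
  and bound: "!!t y. abs(v t y) <= M"
  and cont: "!!t b. 0 <= t ==> ((%s. LINT y:{-b..b}|lborel. abs(v s y - v t y)) \<longlongrightarrow> 0) (at t within {0..})"
begin

lemma M_nonneg: "0 <= M" using bound[of 0 0] by linarith

lemma meas_slice [measurable]: "v t : borel_measurable borel"
proof -
 have [measurable]: "(%z. v (fst z) (snd z)) : borel_measurable (borel \<Otimes>\<^sub>M borel)" using meas by (simp add: borel_prod)
 have "(%y. v (fst (t, y)) (snd (t, y))) : borel_measurable borel" by measurable
 then show ?thesis by simp
qed

lemma slice_diff_integrable: "integrable lborel (%y. indicator {-b..b} y * abs(v r y - v t y))"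
 using bound abs_triangle_ineq4[THEN order_trans, OF add_mono[OF bound bound]] by (intro integrable_on_interval) auto

end

text \<open>
 The entropies \<open>E i\<close>, with fluxes \<open>Q i\<close>, are used between the fronts \<open>i\<close> and \<open>i + 1\<close>; smoothing these
 regions at scale \<open>h\<close> gives admissible test functions.
\<close>

locale smoothed_fronts = scalar_field +
 fixes E Q :: "nat => real => real" and q s e :: "nat => real" and N :: nat and K a b h :: real
 assumes EQ_measurable [measurable]: "!!i. E i : borel_measurable borel" "!!i. Q i : borel_measurable borel"
  and EQ_bounded: "!!i x. i <= N ==> abs x <= M ==> abs(E i x) <= K" "!!i x. i <= N ==> abs x <= M ==> abs(Q i x) <= K"
  and entropy: "!!f i. i <= N ==> test_function f ==> (!!z. 0 <= f z) ==>
    0 <= (LINT z|lborel. E i (v (fst z) (snd z)) * frechet_derivative f (at z) (1, 0) +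
       Q i (v (fst z) (snd z)) * frechet_derivative f (at z) (0, 1))"
  and left: "!!x. abs x <= M ==> Q 0 x - s 0 * E 0 x <= 0"
  and right: "!!x. abs x <= M ==> 0 <= Q N x - s (Suc N) * E N x"
  and front: "!!k x. k < N ==> abs x <= M ==>
    (Q (Suc k) x - s (Suc k) * E (Suc k) x) - (Q k x - s (Suc k) * E k x) <= e k"
  and e_nonneg: "!!k. k < N ==> 0 <= e k"
  and ord: "!!k t. k <= N ==> a <= t ==> t <= b + 2 * h ==> q k + s k * t <= q (Suc k) + s (Suc k) * t"
  and ab: "0 <= a" "a <= b" and h: "0 < h"
begin

lemma K_nonneg: "0 <= K" using EQ_bounded(1)[of 0 0] M_nonneg by auto

definition pos where "pos k t = q k + s k * t"
definition X where "X k t y = ramp h (q k) (y - s k * t)"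
definition m where "m k t y = dramp h (q k) (y - s k * t)"
definition al where "al t = ramp h a t - ramp h b t"
definition dal where "dal t = dramp h a t - dramp h b t"
definition T where "T i z = al (fst z) * (X i (fst z) (snd z) - X (Suc i) (fst z) (snd z))"
definition H where "H t = (LINT y|lborel. (SUM i<=N. indicator {pos i t..<pos (Suc i) t} y * E i (v t y)))"

lemma pos_mono: "k <= N ==> a <= t ==> t <= b + 2 * h ==> pos k t <= pos (Suc k) t"
 using ord unfolding pos_def by auto

lemma al_bounds: "0 <= al t" "al t <= 1"
 using ramp_mono[OF h, of t b t a] ramp_bounds[of h a t] ramp_bounds[of h b t] ab unfolding al_def by auto

lemma al_zero: "t ~: {a + h..b + 2 * h} ==> al t = 0" "t ~: {a + h..b + 2 * h} ==> dal t = 0"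
 using ramp_0[OF h, of t a] ramp_0[OF h, of t b] ramp_1[OF h, of a t] ramp_1[OF h, of b t]
  dramp_0[OF h, of t a] dramp_0[OF h, of t b] ab h unfolding al_def dal_def by (auto simp: not_le)

lemma X_mono:
 assumes "k <= N" "a <= t" "t <= b + 2 * h" shows "X (Suc k) t y <= X k t y"
 unfolding X_def using ord[OF assms] by (intro ramp_mono h) simp

lemma T_test_function:
 assumes i: "i <= N" shows "test_function (T i)"
 unfolding test_function_def
proof (intro conjI exI allI impI)
 define Y where "Y = abs(q i) + abs(q (Suc i)) + (abs(s i) + abs(s (Suc i))) * (b + 2 * h) + 2 * h"
 have diff: "C_k k (%x. f x - g x)" if "C_k k f" "C_k k g" for k and f g :: "real \<times> real => real"
  using C_k_add[OF that(1) C_k_mult[OF C_k_const[of k "-1"] that(2)]] by simp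
 show "smooth (T i)"
  unfolding smooth_def T_def[abs_def] al_def X_def
  by (intro allI C_k_mult diff C_k_ramp bounded_linear_fst bounded_linear_sub bounded_linear_snd
    bounded_linear_compose[OF bounded_linear_mult_right])
 show "compact ({a + h..b + 2 * h} \<times> {-Y..Y})" by (intro compact_Times) auto
 show "{a + h..b + 2 * h} \<times> {-Y..Y} \<subseteq> {0<..} \<times> UNIV" using ab h by auto
 fix z assume z: "z ~: {a + h..b + 2 * h} \<times> {-Y..Y}"
 show "T i z = 0"
 proof (cases "fst z : {a + h..b + 2 * h}")
  case True
  have "abs(s k * fst z) <= abs(s k) * (b + 2 * h)" for k using True ab h by (auto simp: abs_mult intro!: mult_left_mono)
  note sb = this[of i] this[of "Suc i"]
  consider "snd z < -Y" | "Y < snd z" using z True by (force simp: mem_Times_iff)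
  then have "X i (fst z) (snd z) = X (Suc i) (fst z) (snd z)"
  proof cases
   case 1
   have "0 <= (abs(s i) + abs(s (Suc i))) * (b + 2 * h)" using ab h by simp
   then show ?thesis unfolding X_def using 1 sb h unfolding Y_def
    by (subst ramp_0, simp, simp add: distrib_right, subst ramp_0) (auto simp: distrib_right)
  next
   case 2
   then show ?thesis unfolding X_def using sb h unfolding Y_def
    by (subst ramp_1, simp, simp add: distrib_right, subst ramp_1) (auto simp: distrib_right)
  qed
  then show ?thesis by (simp add: T_def)
 qed (simp add: T_def al_zero)
qed

lemma T_nonneg:
 assumes "i <= N" shows "0 <= T i z"
proof (cases "fst z : {a + h..b + 2 * h}")
 case True
 then show ?thesis unfolding T_def using assms al_bounds h X_mono[of i "fst z" "snd z"] by (intro mult_nonneg_nonneg) auto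
qed (simp add: T_def al_zero)

lemma T_derivative:
 shows "frechet_derivative (T i) (at z) w = al (fst z) * ((snd w - s i * fst w) * m i (fst z) (snd z)
  - (snd w - s (Suc i) * fst w) * m (Suc i) (fst z) (snd z)) + fst w * dal (fst z) * (X i (fst z) (snd z) - X (Suc i) (fst z) (snd z))"
proof -
 have bl: "bounded_linear (%z::real \<times> real. snd z - s j * fst z)" for j
  by (intro bounded_linear_sub bounded_linear_snd bounded_linear_compose[OF bounded_linear_mult_right] bounded_linear_fst)
 note d = has_derivative_mult[OF
  has_derivative_diff[OF ramp_compose_deriv[OF bounded_linear_fst h, of a] ramp_compose_deriv[OF bounded_linear_fst h, of b]]
  has_derivative_diff[OF ramp_compose_deriv[OF bl[of i] h, of "q i"] ramp_compose_deriv[OF bl[of "Suc i"] h, of "q (Suc i)"]], of z]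
 have e: "T i = (%z. (ramp h a (fst z) - ramp h b (fst z)) * (ramp h (q i) (snd z - s i * fst z) - ramp h (q (Suc i)) (snd z - s (Suc i) * fst z)))"
  by (simp add: T_def X_def al_def fun_eq_iff)
 show ?thesis
  unfolding e frechet_derivative_at[OF d, symmetric] by (simp add: m_def X_def al_def dal_def algebra_simps)
qed

definition J where "J i z = E i (v (fst z) (snd z)) * frechet_derivative (T i) (at z) (1, 0) +
       Q i (v (fst z) (snd z)) * frechet_derivative (T i) (at z) (0, 1)"

text \<open>Summation by parts over the regions: the derivative of the cutoff at an inner front
  occurs in both adjacent regions with opposite signs, so that only the difference of
  \<open>Q - s * E\<close> across the front remains, which \<open>front\<close> bounds. At the two
  outer fronts \<open>left\<close> and \<open>right\<close> give the favourable sign.\<close>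

lemma J_sum_le:
 "(SUM i<=N. J i (t, y)) <= dal t * (SUM i<=N. (X i t y - X (Suc i) t y) * E i (v t y)) + al t * (SUM k<N. m (Suc k) t y * e k)"
proof -
 define A where "A i = Q i (v t y) - s i * E i (v t y)" for i
 define B where "B i = Q i (v t y) - s (Suc i) * E i (v t y)" for i
 have m0: "0 <= m k t y" for k unfolding m_def by (rule dramp_nonneg[OF h])
 have "(SUM i<=N. J i (t, y)) = (SUM i<=N. dal t * ((X i t y - X (Suc i) t y) * E i (v t y)) + al t * (m i t y * A i - m (Suc i) t y * B i))"
  unfolding J_def T_derivative A_def B_def by (intro sum.cong refl) (simp add: algebra_simps)
 also have "... = dal t * (SUM i<=N. (X i t y - X (Suc i) t y) * E i (v t y)) + al t * ((SUM i<=N. m i t y * A i) - (SUM i<=N. m (Suc i) t y * B i))"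
  by (simp add: sum.distrib sum_distrib_left[symmetric] sum_subtractf)
 also have "(SUM i<=N. m i t y * A i) - (SUM i<=N. m (Suc i) t y * B i)
   = m 0 t y * A 0 - m (Suc N) t y * B N + (SUM k<N. m (Suc k) t y * (A (Suc k) - B k))"
  using sum.atMost_shift[of "%i. m i t y * A i" N]
  by (simp add: lessThan_Suc_atMost[symmetric] right_diff_distrib sum_subtractf)
 also have "... <= (SUM k<N. m (Suc k) t y * e k)"
 proof -
  have "m 0 t y * A 0 <= 0" "0 <= m (Suc N) t y * B N"
   using m0 left[OF bound] right[OF bound] by (auto simp: A_def B_def mult_nonneg_nonpos)
  moreover have "(SUM k<N. m (Suc k) t y * (A (Suc k) - B k)) <= (SUM k<N. m (Suc k) t y * e k)"
   using front[OF _ bound] by (intro sum_mono mult_left_mono m0) (auto simp: A_def B_def)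
  ultimately show ?thesis by linarith
 qed
 finally show ?thesis using al_bounds[of t] by (simp add: mult_left_mono)
qed

lemma region_integrable: "integrable lborel (%y. indicator {pos i t..<pos (Suc i) t} y * E i (v t y))" if "i <= N"
 by (rule integrable_on_interval[OF _ EQ_bounded(1)[OF that bound], where a="pos i t" and b="pos (Suc i) t"]) auto

text \<open>The time derivative of the cutoff has mass 1 near \<open>a\<close> and mass -1 near
  \<open>b\<close> (\<open>dramp_integral\<close>), so the summed entropy inequality compares two
  averages of \<open>H\<close>.\<close>

lemma smoothed_growth:
 assumes H: "!!r. r : {a..a + 2 * h} ==> abs(H r - H a) <= k" "!!r. r : {b..b + 2 * h} ==> abs(H r - H b) <= k"
 shows "H b <= H a + (SUM k<N. e k) * (b - a) + 2 * k + h * (2 * (SUM k<N. e k) + 8 * real (Suc N) * K)"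
proof -
 define c where "c = (SUM k<N. e k)"
 \<comment> \<open>The cost of replacing smoothed regions by sharp ones: each of the
   \<open>Suc N\<close> regions has two ends, and at each end the cutoff differs from the indicator
   on an interval of length \<open>2 * h\<close> only.\<close>
 define D where "D = 4 * h * real (Suc N) * K"
 define S where "S z = (SUM i<=N. J i z)" for z
 define I where "I c y = (indicator {c..c + 2 * h} y :: real)" for c y
 define g where "g t = (H a + k + D) * dramp h a t - (H b - k - D) * dramp h b t + c * indicator {a..b + 2 * h} t" for t
 have c0: "0 <= c" unfolding c_def by (intro sum_nonneg e_nonneg) auto
 have Ji: "integrable lborel (J i)" if "i <= N" for i
  unfolding J_def[abs_def] using that
  by (intro Bochner_Integration.integrable_add test_function_integrable[where B=K] T_test_function EQ_bounded bound) auto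
 have Si: "integrable (lborel \<Otimes>\<^sub>M lborel) S"
  unfolding S_def[abs_def] lborel_prod by (intro Bochner_Integration.integrable_sum Ji) auto
 have gi: "has_bochner_integral lborel g ((H a + k + D) * 1 - (H b - k - D) * 1 + c * (b + 2 * h - a))"
  unfolding g_def[abs_def] using dramp_integral[OF h] ab h
  by (intro has_bochner_integral_add has_bochner_integral_diff has_bochner_integral_mult_right)
    (auto simp: has_bochner_integral_iff)
 have "0 <= (SUM i<=N. LINT z|lborel. J i z)"
  unfolding J_def by (intro sum_nonneg entropy T_test_function T_nonneg) auto
 also have "... = (LINT z|lborel. S z)"
  unfolding S_def using Ji by (intro Bochner_Integration.integral_sum[symmetric]) auto
 also have "... = (LINT t|lborel. LINT y|lborel. S (t, y))"
  using lborel_pair.integral_fst'[OF Si] by (simp add: lborel_prod)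
 also have "... <= (LINT t|lborel. g t)"
 proof (rule integral_mono_AE)
  show "integrable lborel (%t. LINT y|lborel. S (t, y))" by (rule lborel_pair.integrable_fst'[OF Si])
  show "integrable lborel g" using gi by (rule integrable.intros)
  show "AE t in lborel. (LINT y|lborel. S (t, y)) <= g t"
   using lborel_pair.AE_integrable_fst'[OF Si]
  proof eventually_elim
   case (elim t)
   show ?case
   proof (cases "t : {a..b + 2 * h}")
    case True
    define R where "R y = dal t * (SUM i<=N. indicator {pos i t..<pos (Suc i) t} y * E i (v t y))
     + (dramp h a t + dramp h b t) * (SUM i<=N. (I (pos i t) y + I (pos (Suc i) t) y) * K) + al t * (SUM k<N. m (Suc k) t y * e k)" for y
    have mi: "has_bochner_integral lborel (m k t) 1" for k
    proof -
     have "m k t = dramp h (pos k t)" by (auto simp: m_def dramp_def pos_def algebra_simps)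
     then show ?thesis using dramp_integral[OF h] by simp
    qed
    have Ii: "has_bochner_integral lborel (I c) (2 * h)" for c
     unfolding I_def[abs_def] using h by (simp add: has_bochner_integral_iff)
    have "has_bochner_integral lborel R (dal t * H t + (dramp h a t + dramp h b t) * (SUM i<=N. (2 * h + 2 * h) * K) + al t * (SUM k<N. 1 * e k))"
     unfolding R_def[abs_def] H_def using mi Ii
     by (intro has_bochner_integral_add has_bochner_integral_mult_right has_bochner_integral_sum has_bochner_integral_mult_left has_bochner_integral_integrable
       Bochner_Integration.integrable_sum region_integrable) auto
    then have Ri: "has_bochner_integral lborel R (dal t * H t + (dramp h a t + dramp h b t) * D + al t * c)"
     by (simp add: D_def c_def algebra_simps)
    have SR: "S (t, y) <= R y" for y
    proof -
     have d: "abs(dal t) <= dramp h a t + dramp h b t" unfolding dal_def using dramp_nonneg[OF h, of a t] dramp_nonneg[OF h, of b t] by linarith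
     have "abs((SUM i<=N. (X i t y - X (Suc i) t y) * E i (v t y)) - (SUM i<=N. indicator {pos i t..<pos (Suc i) t} y * E i (v t y)))
       <= (SUM i<=N. (I (pos i t) y + I (pos (Suc i) t) y) * K)"
      unfolding sum_subtractf[symmetric] left_diff_distrib[symmetric]
     proof (rule order_trans[OF sum_abs], intro sum_mono, unfold abs_mult, intro mult_mono EQ_bounded bound)
      fix i assume i: "i : {..N}"
      have XI: "abs(X k t y - indicator {pos k t..} y) <= I (pos k t) y" for k
       using ramp_indicator[OF h, of "q k" "y - s k * t"] by (auto simp: X_def I_def pos_def indicator_def algebra_simps split: if_splits)
      have "indicator {pos i t..<pos (Suc i) t} y = (indicator {pos i t..} y - indicator {pos (Suc i) t..} y :: real)"
       using pos_mono[of i t] i True by (auto simp: indicator_def)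
      then show "abs(X i t y - X (Suc i) t y - indicator {pos i t..<pos (Suc i) t} y) <= I (pos i t) y + I (pos (Suc i) t) y"
       using XI[of i] XI[of "Suc i"] by linarith
     qed (auto simp: I_def)
     then have "abs(dal t * ((SUM i<=N. (X i t y - X (Suc i) t y) * E i (v t y)) - (SUM i<=N. indicator {pos i t..<pos (Suc i) t} y * E i (v t y))))
       <= (dramp h a t + dramp h b t) * (SUM i<=N. (I (pos i t) y + I (pos (Suc i) t) y) * K)"
      unfolding abs_mult using d by (intro mult_mono) auto
     then show ?thesis using J_sum_le[of t y] unfolding S_def R_def right_diff_distrib by linarith
    qed
    have "(LINT y|lborel. S (t, y)) <= (LINT y|lborel. R y)"
     using elim SR integrable.intros[OF Ri] by (intro integral_mono) auto
    also have "... = dal t * H t + (dramp h a t + dramp h b t) * D + al t * c" using Ri by (rule has_bochner_integral_integral_eq)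
    also have "... <= g t"
    proof -
     have "dramp h a t * H t <= dramp h a t * (H a + k)" if "t : {a..a + 2 * h}"
      using H(1)[OF that] by (intro mult_left_mono dramp_nonneg h) linarith
     moreover have "dramp h b t * (H b - k) <= dramp h b t * H t" if "t : {b..b + 2 * h}"
      using H(2)[OF that] by (intro mult_left_mono dramp_nonneg h) linarith
     moreover have "dramp h d t = 0" if "t ~: {d..d + 2 * h}" for d
      using that h by (intro dramp_0) auto
     ultimately have "dramp h a t * H t <= dramp h a t * (H a + k)" "dramp h b t * (H b - k) <= dramp h b t * H t"
      by (metis mult_zero_left order_refl)+
     moreover have "al t * c <= c" using al_bounds[of t] c0 by (simp add: mult_left_le_one_le)
     ultimately show ?thesis using True by (simp add: g_def dal_def algebra_simps)
    qed
    finally show ?thesis .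
   next
    case False
    then have "dramp h a t = 0" "dramp h b t = 0" "al t = 0" "dal t = 0" using ab h by (auto intro!: dramp_0 al_zero)
    then show ?thesis using False by (simp add: S_def J_def T_derivative g_def)
   qed
  qed
 qed
 also have "... = (H a + k + D) * 1 - (H b - k - D) * 1 + c * (b + 2 * h - a)" using gi by (rule has_bochner_integral_integral_eq)
 finally show ?thesis by (simp add: c_def[symmetric] D_def algebra_simps)
qed

end

text \<open>The sharp form of \<open>smoothed_growth\<close>, obtained as \<open>h\<close> tends to
  0. Continuity of \<open>H\<close> removes the averaging, and \<open>b < d\<close> leaves room for
  the cutoff at \<open>b\<close>, which reaches up to time \<open>b + 2 * h\<close>.\<close>

lemma (in scalar_field) front_growth:
 fixes E Q :: "nat => real => real" and q s :: "nat => real" and N :: nat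
 defines "H \<equiv> %t. LINT y|lborel. (SUM i<=N. indicator {q i + s i * t..<q (Suc i) + s (Suc i) * t} y * E i (v t y))"
 assumes EQ_measurable: "!!i. E i : borel_measurable borel" "!!i. Q i : borel_measurable borel"
  and EQ_bounded: "!!i x. i <= N ==> abs x <= M ==> abs(E i x) <= K" "!!i x. i <= N ==> abs x <= M ==> abs(Q i x) <= K"
  and entropy: "!!f i. i <= N ==> test_function f ==> (!!z. 0 <= f z) ==>
    0 <= (LINT z|lborel. E i (v (fst z) (snd z)) * frechet_derivative f (at z) (1, 0) +
       Q i (v (fst z) (snd z)) * frechet_derivative f (at z) (0, 1))"
  and left: "!!x. abs x <= M ==> Q 0 x - s 0 * E 0 x <= 0"
  and right: "!!x. abs x <= M ==> 0 <= Q N x - s (Suc N) * E N x"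
  and front: "!!k x. k < N ==> abs x <= M ==>
    (Q (Suc k) x - s (Suc k) * E (Suc k) x) - (Q k x - s (Suc k) * E k x) <= e k"
  and e_nonneg: "!!k. k < N ==> 0 <= e k"
  and ord: "!!k t. k <= N ==> a <= t ==> t <= d ==> q k + s k * t <= q (Suc k) + s (Suc k) * t"
  and Hc: "continuous_on {a..d} H" and ab: "0 <= a" "a <= b" "b < d"
 shows "H b <= H a + (SUM k<N. e k) * (b - a)"
proof (rule field_le_epsilon)
 fix k :: real assume k: "0 < k"
 have ev: "\<forall>\<^sub>F h in at_right 0. ALL r:{t..t + 2 * h}. abs(H r - H t) <= k / 4" if t: "t : {a..<d}" for t
 proof -
  obtain w where w: "w > 0" "!!r. r : {a..d} ==> dist r t < w ==> dist (H r) (H t) < k / 4"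
   using Hc[unfolded continuous_on_iff, rule_format, of t "k / 4"] t k by auto
  have "ALL r:{t..t + 2 * h}. abs(H r - H t) <= k / 4" if "0 < h" "h < min w (d - t) / 2" for h
  proof
   fix r assume r: "r : {t..t + 2 * h}"
   have "2 * h < w" "2 * h < d - t" using that by auto
   then show "abs(H r - H t) <= k / 4" using w(2)[of r] r t by (auto simp: dist_real_def)
  qed
  then show ?thesis unfolding eventually_at_right_field using w t by (intro exI[of _ "min w (d - t) / 2"]) auto
 qed
 define c where "c = 2 * (SUM k<N. e k) + 8 * real (Suc N) * K"
 have "((%h. h * c) \<longlongrightarrow> 0 * c) (at_right 0)" by (intro tendsto_intros)
 then have "\<forall>\<^sub>F h in at_right 0. h * c < k / 2" by (rule order_tendstoD) (use k in auto)
 moreover have "\<forall>\<^sub>F h in at_right 0. b + 2 * h < d"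
  unfolding eventually_at_right_field using ab by (intro exI[of _ "(d - b) / 2"]) auto
 moreover have "\<forall>\<^sub>F h in at_right (0::real). 0 < h" by (rule eventually_at_right_less)
 moreover have "\<forall>\<^sub>F h in at_right 0. ALL r:{a..a + 2 * h}. abs(H r - H a) <= k / 4"
  "\<forall>\<^sub>F h in at_right 0. ALL r:{b..b + 2 * h}. abs(H r - H b) <= k / 4"
  by (rule ev; use ab in auto)+
 ultimately have "\<forall>\<^sub>F h in at_right (0::real). H b <= H a + (SUM k<N. e k) * (b - a) + k"
 proof eventually_elim
  case (elim h)
  interpret smoothed_fronts v M E Q q s e N K a b h
   using EQ_measurable EQ_bounded entropy left right front e_nonneg ord ab elim by unfold_locales auto
  have "H b <= H a + (SUM k<N. e k) * (b - a) + 2 * (k / 4) + h * c"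
   unfolding c_def using smoothed_growth[of "k / 4", unfolded H_def pos_def] elim unfolding assms(1) by auto
  then show ?case using elim by simp
 qed
 then show "H b <= H a + (SUM k<N. e k) * (b - a) + k" by simp
qed

section \<open>Entropy solutions of Burgers' equation against tracked step functions\<close>

definition burgers_flux :: "real => real => real" where
 "burgers_flux v k = sgn (v - k) * (v^2/2 - k\<^sup>2/2)"

lemma burgers_flux_eq: "burgers_flux v k = abs(v - k) * ((v + k) / 2)"
 by (cases v k rule: linorder_cases) (auto simp: burgers_flux_def power2_eq_square field_simps)

text \<open>There is a contribution only if \<open>v\<close> lies between the two states. It is then
  nonpositive for a downward jump, and equal to \<open>(b - v) * (v - a)\<close> for an upward one,
  which is largest at the midpoint.\<close>

lemma burgers_front:
 assumes "s = (a + b) / 2"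
 shows "(burgers_flux v b - s * abs(v - b)) - (burgers_flux v a - s * abs(v - a)) <= (max 0 (b - a))\<^sup>2 / 4"
proof -
 have e: "(burgers_flux v b - s * abs(v - b)) - (burgers_flux v a - s * abs(v - a)) = (abs(v - b) * (v - a) - abs(v - a) * (v - b)) / 2"
  unfolding burgers_flux_eq assms by (simp add: field_simps)
 consider "v <= a" "v <= b" | "a <= v" "b <= v" | "a <= v" "v <= b" | "b <= v" "v <= a" by linarith
 then show ?thesis
 proof cases
  case 3
  have "(b - v) * (v - a) <= (b - a)\<^sup>2 / 4"
   using zero_le_power2[of "(b - v) - (v - a)"] by (simp add: power2_eq_square algebra_simps)
  then show ?thesis using 3 unfolding e by (simp add: abs_if max_def algebra_simps)
 next
  case 4
  have "(v - b) * (v - a) <= 0" using 4 by (simp add: mult_nonneg_nonpos)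
  then show ?thesis using 4 zero_le_power2[of "max 0 (b - a)"] unfolding e by (simp add: abs_if algebra_simps split: if_splits)
 next
  case 1
  then have "abs(v - b) * (v - a) - abs(v - a) * (v - b) = 0" by (simp add: abs_if algebra_simps)
  then show ?thesis unfolding e by simp
 next
  case 2
  then have "abs(v - b) * (v - a) - abs(v - a) * (v - b) = 0" by (simp add: abs_if algebra_simps)
  then show ?thesis unfolding e by simp
 qed
qed

lemma real_set_enumeration:
 fixes Q :: "real set" assumes "finite Q"
 obtains p :: "nat => real" where "strict_mono_on {1..card Q} p" "p ` {1..card Q} = Q"
proof
 define p where "p k = sorted_list_of_set Q ! (k - 1)" for k
 have len: "length (sorted_list_of_set Q) = card Q" using assms by simp
 show "strict_mono_on {1..card Q} p"
  unfolding p_def by (rule strict_mono_onI) (auto intro!: sorted_wrt_nth_less[OF strict_sorted_list_of_set] simp: len)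
 have "p ` {1..card Q} = set (sorted_list_of_set Q)"
  unfolding set_conv_nth len p_def by (force simp: image_iff intro!: bexI[of _ "Suc _"])
 then show "p ` {1..card Q} = Q" using assms by simp
qed

lemma stepv_as_sum: "finite I ==> stepv I d p y = (SUM i:I. d i * indicator {p i..} y)"
 unfolding stepv_def by (simp only: sum.inter_filter, intro sum.cong) (auto simp: indicator_def)

lemma stepv_measurable [measurable]: "finite I ==> stepv I d p : borel_measurable borel"
proof -
 assume "finite I"
 then have "stepv I d p = (%y. SUM i:I. d i * indicator {p i..} y)" using stepv_as_sum by blast
 then show ?thesis by simp
qed

lemma has_bochner_integral_indicator_diff:
 "has_bochner_integral lborel (%y. abs(indicator {a..} y - indicator {b..} y)) (abs(a - b))" for a b :: real
proof -
 have "(%y. abs(indicator {a..} y - indicator {b..} y)) = (indicator {min a b..<max a b} :: real => real)"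
  by (auto simp: indicator_def fun_eq_iff)
 then show ?thesis by (simp add: has_bochner_integral_iff max_def min_def)
qed

lemma stepv_diff:
 assumes "finite I"
 shows "integrable lborel (%y. abs(stepv I d p y - stepv I d q y))"
  "(LINT y|lborel. abs(stepv I d p y - stepv I d q y)) <= (SUM i:I. abs(d i) * abs(p i - q i))"
proof -
 define g where "g y = (SUM i:I. abs(d i) * abs(indicator {p i..} y - indicator {q i..} y))" for y :: real
 have g: "has_bochner_integral lborel g (SUM i:I. abs(d i) * abs(p i - q i))"
  unfolding g_def[abs_def] by (intro has_bochner_integral_sum has_bochner_integral_mult_right has_bochner_integral_indicator_diff)
 have le: "abs(stepv I d p y - stepv I d q y) <= g y" for y
  unfolding stepv_as_sum[OF assms] g_def sum_subtractf[symmetric] abs_mult[symmetric]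
  by (rule order_trans[OF sum_abs]) (simp add: right_diff_distrib)
 have gi: "integrable lborel g" using g by (rule integrable.intros)
 show i: "integrable lborel (%y. abs(stepv I d p y - stepv I d q y))"
  by (rule Bochner_Integration.integrable_bound[OF gi]) (use assms le in \<open>auto intro: AE_I2 order_trans[OF le abs_ge_self]\<close>)
 have "(LINT y|lborel. abs(stepv I d p y - stepv I d q y)) <= (LINT y|lborel. g y)"
  by (intro integral_mono i gi le)
 then show "(LINT y|lborel. abs(stepv I d p y - stepv I d q y)) <= (SUM i:I. abs(d i) * abs(p i - q i))"
  using g by (simp add: has_bochner_integral_integral_eq)
qed

text \<open>Moving all jumps to the point 0 gives the zero function, since the jumps cancel;
  \<open>stepv_diff\<close> compares with it.\<close>

lemma stepv_integrable:
 assumes "finite I" "sum d I = 0" shows "integrable lborel (stepv I d p)"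
proof -
 have "stepv I d (%_. 0) y = 0" for y
 proof -
  have "{i:I. (0::real) <= y} = I | {i:I. (0::real) <= y} = {}" by auto
  then show ?thesis unfolding stepv_def using assms(2) by (elim disjE) (simp_all only: sum.empty)
 qed
 then have "integrable lborel (%y. abs(stepv I d p y))" using stepv_diff(1)[OF assms(1), of d p "%_. 0"] by simp
 moreover have "stepv I d p : borel_measurable lborel" using stepv_measurable[OF assms(1)] by simp
 ultimately show ?thesis by (rule integrable_abs_cancel)
qed

lemma sum_abs_jump_le:
 assumes "finite I" "finite Q"
 shows "(SUM y:Q. abs(jump I d p y)) <= (SUM i:I. abs(d i))"
proof -
 have "(SUM y:Q. abs(jump I d p y)) <= (SUM y:Q. SUM i:{i:I. p i = y}. abs(d i))"
  unfolding jump_def by (intro sum_mono sum_abs)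
 also have "... = (SUM y:Q. SUM i:{i:{i:I. p i : Q}. p i = y}. abs(d i))"
  by (intro sum.cong) auto
 also have "... = (SUM i:{i:I. p i : Q}. abs(d i))"
  using assms by (intro sum.group) auto
 also have "... <= (SUM i:I. abs(d i))" using assms by (intro sum_mono2) auto
 finally show ?thesis .
qed

lemma linear_fronts_stay_ordered:
 fixes p s :: "nat => real"
 assumes "!!k. k <= N ==> p k < p (Suc k)"
 obtains h where "h > 0" "!!k eta. k <= N ==> eta : {0..h} ==> p k + s k * eta < p (Suc k) + s (Suc k) * eta"
proof -
 have "\<forall>\<^sub>F eta in at_right 0. ALL k:{..N}. p k + s k * eta < p (Suc k) + s (Suc k) * eta"
 proof (intro eventually_ball_finite ballI)
  fix k assume "k : {..N}"
  then have "0 < (p (Suc k) + s (Suc k) * 0) - (p k + s k * 0)" using assms by simp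
  moreover have "((%eta. (p (Suc k) + s (Suc k) * eta) - (p k + s k * eta)) \<longlongrightarrow> (p (Suc k) + s (Suc k) * 0) - (p k + s k * 0)) (at_right 0)"
   by (intro tendsto_intros)
  ultimately have "\<forall>\<^sub>F eta in at_right 0. 0 < (p (Suc k) + s (Suc k) * eta) - (p k + s k * eta)"
   by (rule order_tendstoD(1)[rotated])
  then show "\<forall>\<^sub>F eta in at_right 0. p k + s k * eta < p (Suc k) + s (Suc k) * eta" by eventually_elim simp
 qed simp
 then obtain b where b: "b > 0" "!!eta. 0 < eta ==> eta < b ==> ALL k:{..N}. p k + s k * eta < p (Suc k) + s (Suc k) * eta"
  unfolding eventually_at_right_field by auto
 show thesis
 proof (rule that[of "b/2"])
  fix k eta assume "k <= N" "eta : {0..b/2}"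
  then show "p k + s k * eta < p (Suc k) + s (Suc k) * eta"
   using assms[of k] b(2)[of eta] b(1) by (cases "eta = 0") auto
 qed (use b in auto)
qed

text \<open>The distance is measured on the windows \<open>{- bet tau..<bet tau}\<close>, which
  shrink at speed \<open>M\<close>. This bounds all characteristic and front speeds, so nothing
  enters through the ends. The conditions on \<open>B\<close> keep every particle inside the window
  up to time \<open>T\<close>, so that the step function vanishes at both ends.\<close>

locale kruzhkov_tracking = scalar_field +
 fixes I :: "'i set" and d :: "'i => real" and kap :: real and P :: "real => 'i => real" and T B :: real
 assumes ent: "!!f k. test_function f ==> (!!z. 0 <= f z) ==>
    0 <= (LINT z|lborel. abs(v (fst z) (snd z) - k) * frechet_derivative f (at z) (1, 0) +
       burgers_flux (v (fst z) (snd z)) k * frechet_derivative f (at z) (0, 1))"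
  and I: "finite I" and st: "sticky I d kap P" and sum0: "(SUM i:I. d i) = 0"
  and MV: "(SUM i:I. abs(d i)) <= M" and T0: "0 <= T" and k0: "0 <= kap"
  and B: "!!i. i : I ==> abs(P 0 i) + 2 * M * T < B" and B0: "2 * M * T < B"
begin

definition w :: "real => real => real" where "w tau y = stepv I d (P tau) y"
definition bet :: "real => real" where "bet tau = B - M * tau"
definition E :: "real => real" where "E tau = (LINT y|lborel. indicator {- bet tau..<bet tau} y * abs(v tau y - w tau y))"
definition V where "V = (SUM i:I. abs(d i))"

lemma w_measurable [measurable]: "w tau : borel_measurable borel" unfolding w_def[abs_def] using I by measurable

lemma w_le: "abs(w tau y) <= M" unfolding w_def using abs_stepv_le[OF I, of d "P tau" y] MV by linarith

lemma vw_le: "abs(v tau y - w tau y) <= 2 * M" using bound[of tau y] w_le[of tau y] by linarith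

lemma P_bound: "i : I ==> 0 <= tau ==> abs(P tau i) <= abs(P 0 i) + M * tau"
proof -
 assume a: "i : I" "0 <= tau"
 have "abs(P tau i - P 0 i) <= V * abs(tau - 0)" using st a unfolding sticky_def V_def by blast
 moreover have "V * abs(tau - 0) <= M * tau" using MV a by (auto simp: V_def intro!: mult_right_mono)
 ultimately show ?thesis by linarith
qed

lemma E_integrable: "integrable lborel (%y. indicator {- bet tau..<bet tau} y * abs(v tau y - w tau y))"
 using vw_le by (intro integrable_on_interval[where K="2 * M" and a="- bet tau" and b="bet tau"]) auto

lemma E_diff:
 assumes "r : {0..T}" "t : {0..T}"
 shows "abs(E r - E t) <= (LINT y:{-B..B}|lborel. abs(v r y - v t y)) + (V * M + 2 * M * (2 * M)) * abs(r - t)"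
proof -
 have bet: "0 <= bet q" "bet q <= B" if "q : {0..T}" for q
 proof -
  have "0 <= M * q" "M * q <= M * T" using that M_nonneg by (auto intro: mult_left_mono)
  then show "0 <= bet q" "bet q <= B" using B0 M_nonneg T0 unfolding bet_def by (auto simp: mult_nonneg_nonneg)
 qed
 define h where "h q y = indicator {- bet q..<bet q} y * abs(v q y - w q y)" for q y
 define D where "D y = abs(indicator {- bet r..} y - indicator {- bet t..} y :: real) + abs(indicator {bet r..} y - indicator {bet t..} y)" for y :: real
 have bd: "abs((-bet r) - (- bet t)) = M * abs(r - t)" "abs(bet r - bet t) = M * abs(r - t)"
 proof -
  have "bet r - bet t = - (M * (r - t))" by (simp add: bet_def algebra_simps)
  then show "abs(bet r - bet t) = M * abs(r - t)" using M_nonneg by (simp add: abs_mult)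
  then show "abs((-bet r) - (- bet t)) = M * abs(r - t)" by linarith
 qed
 have Di: "has_bochner_integral lborel D (M * abs(r - t) + M * abs(r - t))"
  unfolding D_def using has_bochner_integral_indicator_diff[of "- bet r" "- bet t"] has_bochner_integral_indicator_diff[of "bet r" "bet t"]
  unfolding bd by (rule has_bochner_integral_add)
 have pw: "abs(h r y - h t y) <= indicator {-B..B} y * abs(v r y - v t y) + abs(w r y - w t y) + D y * (2 * M)" for y
 proof -
  have ind: "indicator {- bet q..<bet q} y = (indicator {- bet q..} y - indicator {bet q..} y :: real)" if "q : {0..T}" for q
   using bet[OF that] by (auto simp: indicator_def)
  have D0: "0 <= D y" by (simp add: D_def)
  have Dle: "abs(indicator {- bet r..<bet r} y - indicator {- bet t..<bet t} y :: real) <= D y"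
   unfolding ind[OF assms(1)] ind[OF assms(2)] D_def by linarith
  have "h r y - h t y = indicator {- bet r..<bet r} y * (abs(v r y - w r y) - abs(v t y - w t y)) + (indicator {- bet r..<bet r} y - indicator {- bet t..<bet t} y) * abs(v t y - w t y)"
   by (simp add: h_def algebra_simps)
  moreover have "abs(indicator {- bet r..<bet r} y * (abs(v r y - w r y) - abs(v t y - w t y))) <= indicator {-B..B} y * abs(v r y - v t y) + abs(w r y - w t y)"
  proof (cases "y : {- bet r..<bet r}")
   case True
   then have "y : {-B..B}" using bet[OF assms(1)] by auto
   then show ?thesis using True by (simp add: indicator_def)
  qed (auto simp: indicator_def)
  moreover have "abs((indicator {- bet r..<bet r} y - indicator {- bet t..<bet t} y) * abs(v t y - w t y)) <= D y * (2 * M)"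
   unfolding abs_mult using Dle D0 bound[of t y] w_le[of t y] by (intro mult_mono) auto
  ultimately show ?thesis by linarith
 qed
 note i1 = slice_diff_integrable[of B r t]
 note i2 = stepv_diff(1)[OF I, of d "P r" "P t", folded w_def]
 have i3: "integrable lborel D" using Di by (rule integrable.intros)
 note ih = E_integrable[folded h_def]
 have "abs(E r - E t) = abs(LINT y|lborel. h r y - h t y)" unfolding E_def h_def[symmetric] using ih by simp
 also have "... <= (LINT y|lborel. abs(h r y - h t y))" by (rule integral_abs_bound)
 also have "... <= (LINT y|lborel. indicator {-B..B} y * abs(v r y - v t y) + abs(w r y - w t y) + D y * (2 * M))"
  using i1 i2 i3 ih pw by (intro integral_mono) auto
 also have "... = (LINT y:{-B..B}|lborel. abs(v r y - v t y)) + (LINT y|lborel. abs(w r y - w t y)) + (LINT y|lborel. D y) * (2 * M)"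
  using i1 i2 i3 by (simp add: set_lebesgue_integral_def)
 also have "(LINT y|lborel. D y) = 2 * M * abs(r - t)" using Di by (simp add: has_bochner_integral_integral_eq)
 also have "(LINT y|lborel. abs(w r y - w t y)) <= V * M * abs(r - t)"
 proof -
  have "(SUM i:I. abs(d i) * abs(P r i - P t i)) <= (SUM i:I. abs(d i) * (M * abs(r - t)))"
  proof (intro sum_mono mult_left_mono)
   fix i assume "i : I"
   then have "abs(P r i - P t i) <= V * abs(r - t)" using st assms unfolding sticky_def V_def by auto
   also have "... <= M * abs(r - t)" using MV by (auto simp: V_def intro: mult_right_mono)
   finally show "abs(P r i - P t i) <= M * abs(r - t)" .
  qed simp
  also have "... = V * M * abs(r - t)" by (simp add: V_def sum_distrib_right mult.assoc)
  finally show ?thesis using stepv_diff(2)[OF I, of d "P r" "P t", folded w_def] by linarith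
 qed
 finally show ?thesis by (simp add: algebra_simps)
qed

lemma E_continuous: "continuous_on {0..T} E"
 unfolding continuous_on_def
proof
 fix t assume t: "t : {0..T}"
 define g where "g r = (LINT y:{-B..B}|lborel. abs(v r y - v t y)) + (V * M + 2 * M * (2 * M)) * abs(r - t)" for r
 have "(g \<longlongrightarrow> 0 + (V * M + 2 * M * (2 * M)) * abs(t - t)) (at t within {0..})"
  unfolding g_def using t by (intro tendsto_intros cont) auto
 then have "(g \<longlongrightarrow> 0) (at t within {0..})" by simp
 then have g0: "(g \<longlongrightarrow> 0) (at t within {0..T})" by (rule tendsto_within_subset) auto
 have "((%r. E r - E t) \<longlongrightarrow> 0) (at t within {0..T})"
  by (rule Lim_null_comparison[OF _ g0]) (use E_diff t in \<open>auto simp: eventually_at_filter g_def\<close>)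
 then show "(E \<longlongrightarrow> E t) (at t within {0..T})" by (simp add: LIM_zero_iff)
qed

text \<open>\<open>front_growth\<close> with the particles as inner fronts, the ends of the window
  as outer fronts, and Kruzhkov entropies centred at the values of the step function in between.
  Only upward jumps cost anything, each at most a quarter of its square, hence at most
  \<open>kap * V / 4\<close> in total.\<close>

lemma E_local:
 assumes t: "0 <= t" "t < T"
 shows "EX k>0. ALL eta:{0<..<k}. E (t + eta) <= E t + (kap * V / 4) * eta"
proof -
 from st t(1) have "EX h>0. ALL eta:{0..h}. ALL i:I. P (t + eta) i = P t i + eta * speed I d (P t) (P t i)"
  unfolding sticky_def by simp
 then obtain h where "h > 0" and h_all: "ALL eta:{0..h}. ALL i:I. P (t + eta) i = P t i + eta * speed I d (P t) (P t i)"
  by auto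
 then have h: "h > 0" "!!eta i. eta : {0..h} ==> i : I ==> P (t + eta) i = P t i + eta * speed I d (P t) (P t i)"
  by auto
 define Q where "Q = P t ` I"
 have finQ: "finite Q" using I by (simp add: Q_def)
 define N where "N = card Q"
 obtain q where q: "strict_mono_on {1..N} q" "q ` {1..N} = Q" using real_set_enumeration[OF finQ] unfolding N_def by blast
 define p where "p k = (if k = 0 then - bet t else if k = Suc N then bet t else q k)" for k
 define u where "u k = (if k = 0 then 0 else stepv I d (P t) (q k))" for k
 define s where "s k = (if k = 0 then M else if k = Suc N then - M else speed I d (P t) (q k))" for k
 have MT: "M * t <= M * T" using t M_nonneg by (auto intro: mult_left_mono)
 have Qb: "- bet t < x & x < bet t" if "x : Q" for x
 proof -
  obtain i where i: "i : I" "x = P t i" using \<open>x : Q\<close> unfolding Q_def by auto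
  then show ?thesis using P_bound[OF i(1) t(1)] B[OF i(1)] MT unfolding bet_def by (auto simp: abs_le_iff)
 qed
 have betpos: "0 < bet t" unfolding bet_def using B0 MT mult_nonneg_nonneg[OF M_nonneg T0] by linarith
 have pord: "p k < p (Suc k)" if "k <= N" for k
 proof -
  have "q m : Q" if "m : {1..N}" for m using q(2) that by blast
  moreover have "q k < q (Suc k)" if "k : {1..<N}" using strict_mono_onD[OF q(1)] that by auto
  ultimately show ?thesis using that Qb betpos unfolding p_def by (cases "k = 0"; cases "k = N") auto
 qed
 obtain h' where h': "h' > 0" "!!k eta. k <= N ==> eta : {0..h'} ==> p k + s k * eta < p (Suc k) + s (Suc k) * eta"
  using linear_fronts_stay_ordered[of N p s] pord by blast
 define h2 where "h2 = min h h'"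
 have h2: "h2 > 0" "h2 <= h" "h2 <= h'" using h h' by (auto simp: h2_def)
 have stepl_q: "stepl I d (P t) (q k) = u (k - 1)" if k: "k : {1..N}" for k
 proof (cases "k = 1")
  case True
  have e: "{i : I. P t i < q k} = {}"
  proof -
   have "q k <= P t i" if "i : I" for i
   proof -
    have "P t i : q ` {1..N}" using that q(2) by (simp add: Q_def)
    then obtain m where "m : {1..N}" "P t i = q m" by auto
    then show ?thesis using strict_mono_on_leD[OF q(1), of k m] True k by auto
   qed
   then show ?thesis by (auto simp: not_less)
  qed
  show ?thesis using True unfolding stepl_def e by (simp add: u_def)
 next
  case False
  have "P t i < q k \<longleftrightarrow> P t i <= q (k - 1)" if "i : I" for i
  proof -
   have "P t i : q ` {1..N}" using that q(2) by (simp add: Q_def)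
   then obtain m where m: "m : {1..N}" "P t i = q m" by auto
   have k1: "k - 1 : {1..N}" using k False unfolding atLeastAtMost_iff by arith
   have "q m < q k \<longleftrightarrow> m < k" "q m <= q (k - 1) \<longleftrightarrow> m <= k - 1"
    using strict_mono_on_less[OF q(1), of m k] strict_mono_on_less_eq[OF q(1), of m "k - 1", OF m(1) k1] m k by auto
   then show ?thesis unfolding m(2) using k by auto
  qed
  then have "{i : I. P t i < q k} = {i : I. P t i <= q (k - 1)}" by auto
  then show ?thesis using False k by (simp add: stepl_def stepv_def u_def)
 qed
 have uN: "u N = 0"
 proof (cases "N = 0")
  case False
  have "P t i <= q N" if "i : I" for i
  proof -
   have "P t i : q ` {1..N}" using that q(2) by (simp add: Q_def)
   then obtain m where "m : {1..N}" "P t i = q m" by auto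
   then show ?thesis using strict_mono_on_leD[OF q(1), of m N] False by auto
  qed
  then have "{i : I. P t i <= q N} = I" by auto
  then show ?thesis using False sum0 by (simp add: u_def stepv_def)
 qed (simp add: u_def)
 \<comment> \<open>The lines through the fronts at time \<open>t\<close> with their current speeds,
   written with the offset at time 0 that \<open>front_growth\<close> expects.\<close>
 define pos where "pos k tau = (p k - s k * t) + s k * tau" for k tau
 have pos_mono: "pos k tau <= pos (Suc k) tau" if "k <= N" "t <= tau" "tau <= t + h2" for k tau
  using h'(2)[of k "tau - t"] that h2 unfolding pos_def by (simp add: algebra_simps)
 have pos_mono': "pos i tau <= pos j tau" if "i <= j" "j <= Suc N" "t <= tau" "tau <= t + h2" for i j tau
  using that by (induction j rule: dec_induct) (auto intro: order_trans pos_mono)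
 have wu: "w tau y = u i" if tau: "t <= tau" "tau <= t + h2" and i: "i <= N" and y: "y : {pos i tau..<pos (Suc i) tau}" for tau i y
 proof -
  have "P tau k <= y \<longleftrightarrow> i ~= 0 & P t k <= q i" if k: "k : I" for k
  proof -
   have "P t k : q ` {1..N}" using k q(2) by (simp add: Q_def)
   then obtain m where m: "m : {1..N}" "P t k = q m" by auto
   have "P tau k = P t k + (tau - t) * speed I d (P t) (P t k)" using h(2)[of "tau - t" k] k tau h2 by auto
   also have "... = pos m tau" using m by (auto simp: pos_def p_def s_def algebra_simps)
   finally have e: "P tau k = pos m tau" .
   show ?thesis
   proof (cases "m <= i")
    case True
    then have "pos m tau <= pos i tau" using tau i by (intro pos_mono') auto
    moreover have "q m <= q i" using strict_mono_on_leD[OF q(1), of m i] True m i by auto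
    ultimately show ?thesis using y e m True by auto
   next
    case False
    then have "pos (Suc i) tau <= pos m tau" using tau m by (intro pos_mono') auto
    moreover have "q i < q m" if "i ~= 0" using strict_mono_onD[OF q(1), of i m] False m i that by auto
    ultimately show ?thesis using y e m by auto
   qed
  qed
  then have "{k : I. P tau k <= y} = (if i = 0 then {} else {k : I. P t k <= q i})" by auto
  then show ?thesis by (simp add: w_def u_def stepv_def)
 qed
 have HE: "(LINT y|lborel. (SUM i<=N. indicator {pos i tau..<pos (Suc i) tau} y * abs(v tau y - u i))) = E tau" if tau: "t <= tau" "tau <= t + h2" for tau
  unfolding E_def
 proof (rule Bochner_Integration.integral_cong[OF refl])
  fix y
  have "(SUM i<=N. indicator {pos i tau..<pos (Suc i) tau} y * abs(v tau y - u i)) = (SUM i<=N. indicator {pos i tau..<pos (Suc i) tau} y) * abs(v tau y - w tau y)"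
   unfolding sum_distrib_right by (intro sum.cong refl) (use wu[OF tau] in \<open>auto simp: indicator_def\<close>)
  also have "(SUM i<=j. indicator {pos i tau..<pos (Suc i) tau} y) = (indicator {pos 0 tau..<pos (Suc j) tau} y :: real)" if "j <= N" for j
   using that
  proof (induction j)
   case (Suc j)
   have "pos 0 tau <= pos (Suc j) tau" "pos (Suc j) tau <= pos (Suc (Suc j)) tau" using tau Suc.prems by (auto intro!: pos_mono')
   then show ?case using Suc by (auto simp: indicator_def)
  qed simp
  finally show "(SUM i<=N. indicator {pos i tau..<pos (Suc i) tau} y * abs(v tau y - u i)) = indicator {- bet tau..<bet tau} y * abs(v tau y - w tau y)"
   by (simp add: pos_def p_def s_def bet_def algebra_simps)
 qed
 define e where "e k = (max 0 (u (Suc k) - u k))\<^sup>2 / 4" for k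
 have c: "(SUM k<N. e k) <= kap * V / 4"
 proof -
  have "e k <= kap * abs(jump I d (P t) (q (Suc k))) / 4" if "k < N" for k
  proof -
   have "u (Suc k) = u k + jump I d (P t) (q (Suc k))"
    using stepl_q[of "Suc k"] that stepv_eq_stepl_jump[OF I, of d "P t" "q (Suc k)"] by (simp add: u_def)
   moreover have "jump I d (P t) (q (Suc k)) <= kap" using st t by (auto simp: sticky_def)
   ultimately have "(max 0 (u (Suc k) - u k)) * (max 0 (u (Suc k) - u k)) <= kap * abs(jump I d (P t) (q (Suc k)))"
    using k0 by (intro mult_mono) auto
   then show ?thesis by (simp add: e_def power2_eq_square)
  qed
  then have "(SUM k<N. e k) <= (SUM k<N. kap * abs(jump I d (P t) (q (Suc k))) / 4)" by (intro sum_mono) auto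
  also have "... = kap / 4 * (SUM k<N. abs(jump I d (P t) (q (Suc k))))" by (simp add: sum_distrib_left)
  also have "(SUM k<N. abs(jump I d (P t) (q (Suc k)))) = (SUM k:{1..N}. abs(jump I d (P t) (q k)))"
   using sum.atLeast1_atMost_eq[of "%k. abs(jump I d (P t) (q k))" N] by simp
  also have "... = (SUM x:Q. abs(jump I d (P t) x))"
   using sum.reindex[OF strict_mono_on_imp_inj_on[OF q(1)], of "%x. abs(jump I d (P t) x)"] q(2) by simp
  also have "... <= V" unfolding V_def by (rule sum_abs_jump_le[OF I finQ])
  finally show ?thesis using k0 by (simp add: mult_left_mono)
 qed
 define U where "U = (SUM i<=N. abs(u i))"
 define b where "b = min T (t + h2)"
 have U: "abs(u i) <= U" if "i <= N" for i unfolding U_def using that by (intro member_le_sum) auto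
 have "E (t + eta) <= E t + (kap * V / 4) * eta" if eta: "eta : {0<..<b - t}" for eta
 proof -
  have le: "t <= t + eta" "t + eta <= t + h2" "t <= t + h2" using eta h2 by (auto simp: b_def)
  have "(LINT y|lborel. (SUM i<=N. indicator {(p i - s i * t) + s i * (t + eta)..<(p (Suc i) - s (Suc i) * t) + s (Suc i) * (t + eta)} y * abs(v (t + eta) y - u i)))
    <= (LINT y|lborel. (SUM i<=N. indicator {(p i - s i * t) + s i * t..<(p (Suc i) - s (Suc i) * t) + s (Suc i) * t} y * abs(v t y - u i)))
     + (SUM k<N. e k) * (t + eta - t)"
  proof (rule front_growth[where Q="%i x. burgers_flux x (u i)" and K="(M + U) + (M + U) * (M + U)" and d=b])
   show "abs(abs(x - u i)) <= (M + U) + (M + U) * (M + U)" "abs(burgers_flux x (u i)) <= (M + U) + (M + U) * (M + U)"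
    if i: "i <= N" and x: "abs x <= M" for i x
   proof -
    have MU: "abs(x - u i) <= M + U" "abs((x + u i) / 2) <= M + U" using U[OF i] x by auto
    note sq = zero_le_square[of "M + U"]
    then show "abs(abs(x - u i)) <= (M + U) + (M + U) * (M + U)" unfolding abs_idempotent using MU sq by linarith
    have "abs(burgers_flux x (u i)) <= (M + U) * (M + U)"
     unfolding burgers_flux_eq abs_mult abs_idempotent using MU by (intro mult_mono) auto
    then show "abs(burgers_flux x (u i)) <= (M + U) + (M + U) * (M + U)" using MU by linarith
   qed
   have us: "u 0 = 0" "s 0 = M" "s (Suc N) = - M" by (simp_all add: u_def s_def)
   \<comment> \<open>Where the step function vanishes, the flux is \<open>abs x * (x / 2)\<close>,
     and an end moving inward at speed \<open>M\<close> outruns it.\<close>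
   have "x / 2 - M <= 0" "0 <= x / 2 + M" if "abs x <= M" for x using that M_nonneg by auto
   then show "burgers_flux x (u 0) - s 0 * abs(x - u 0) <= 0" "0 <= burgers_flux x (u N) - s (Suc N) * abs(x - u N)"
    if "abs x <= M" for x
    using that mult_nonneg_nonpos[of "abs x" "x / 2 - M"] mult_nonneg_nonneg[of "abs x" "x / 2 + M"]
    by (auto simp: uN us burgers_flux_eq algebra_simps)
   show "burgers_flux x (u (Suc k)) - s (Suc k) * abs(x - u (Suc k)) - (burgers_flux x (u k) - s (Suc k) * abs(x - u k)) <= e k"
    if "k < N" for k x
    unfolding e_def using stepl_q[of "Suc k"] that by (intro burgers_front) (simp add: s_def speed_def u_def)
   show "p k - s k * t + s k * tau <= p (Suc k) - s (Suc k) * t + s (Suc k) * tau" if "k <= N" "t <= tau" "tau <= b" for k tau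
    using pos_mono[of k tau] that by (simp add: pos_def b_def)
   show "continuous_on {t..b} (%tau. LINT y|lborel. (SUM i<=N. indicator {p i - s i * t + s i * tau..<p (Suc i) - s (Suc i) * t + s (Suc i) * tau} y * abs(v tau y - u i)))"
    unfolding pos_def[symmetric]
    using continuous_on_subset[OF E_continuous, of "{t..b}"] t HE by (subst continuous_on_cong[OF refl, where g=E]) (auto simp: b_def)
  qed (use ent t eta in \<open>auto simp: e_def burgers_flux_eq\<close>)
  then have "E (t + eta) <= E t + (SUM k<N. e k) * (t + eta - t)"
   unfolding pos_def[symmetric] HE[OF le(1,2)] HE[OF order_refl le(3)] .
  also have "(SUM k<N. e k) * (t + eta - t) <= (kap * V / 4) * eta" using c eta by (auto intro: mult_right_mono)
  finally show ?thesis by simp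
 qed
 then show ?thesis using h2 t by (intro exI[of _ "b - t"]) (auto simp: b_def)
qed

lemma E_growth: "E T <= E 0 + (kap * V / 4) * T"
proof -
 have "E T - (kap * V / 4) * T <= E 0 - (kap * V / 4) * 0"
 proof (rule right_local_nonincreasing[of 0 T "%t. E t - (kap * V / 4) * t", OF T0])
  show "continuous_on {0..T} (%t. E t - kap * V / 4 * t)" by (intro continuous_intros E_continuous)
  fix t assume "0 <= t" "t < T"
  then obtain k where "k > 0" "ALL eta:{0<..<k}. E (t + eta) <= E t + (kap * V / 4) * eta" using E_local by blast
  then show "EX k>0. ALL eta:{0<..<k}. E (t + eta) - kap * V / 4 * (t + eta) <= E t - kap * V / 4 * t"
   unfolding distrib_left by (intro exI[of _ k]) force
 qed
 then show ?thesis by simp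
qed

end

section \<open>Bounded representatives of solutions, and windows that exhaust the line\<close>

definition truncate :: "real => (real => real => real) => real => real => real" where
 "truncate M \<sigma> t y = (if 0 <= t then max (- M) (min M (\<sigma> t y)) else 0)"

locale truncated_solution = scalar_field +
 fixes \<sigma> :: "real => real => real"
 assumes AE_eq: "!!t. 0 <= t ==> AE y in lborel. v t y = \<sigma> t y"
  and slice_measurable: "!!t. 0 <= t ==> \<sigma> t : borel_measurable borel"
  and weak_form: "!!f e q. test_function f ==> e : borel_measurable borel ==> q : borel_measurable borel ==>
   (LINT z:{0<..} \<times> UNIV|lborel. e (\<sigma> (fst z) (snd z)) * frechet_derivative f (at z) (1, 0) + q (\<sigma> (fst z) (snd z)) * frechet_derivative f (at z) (0, 1))
   = (LINT z|lborel. e (v (fst z) (snd z)) * frechet_derivative f (at z) (1, 0) + q (v (fst z) (snd z)) * frechet_derivative f (at z) (0, 1))"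

lemma solution_class_truncate:
 assumes sc: "solution_class s0 \<sigma>"
 shows "EX M0. ALL M>=M0. truncated_solution (truncate M \<sigma>) M \<sigma>"
proof -
 obtain M1 where M1: "!!t. 0 <= t ==> AE y in lborel. abs(\<sigma> t y) <= M1"
  using sc unfolding solution_class_def by blast
 define M0 where "M0 = max M1 0"
 define g where "g z = indicator ({0..} \<times> UNIV) z *\<^sub>R \<sigma> (fst z) (snd z)" for z :: "real \<times> real"
 have gm [measurable]: "g : borel_measurable borel"
 proof -
  have cl: "closed ({0..} \<times> UNIV :: (real \<times> real) set)" by (intro closed_Times) auto
  have "(%(t, y). \<sigma> t y) : borel_measurable (restrict_space borel ({0..} \<times> UNIV))"
   using sc unfolding solution_class_def by blast
  then have "(%z. indicator ({0..} \<times> UNIV) z *\<^sub>R (case z of (t, y) => \<sigma> t y)) : borel_measurable borel"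
   using cl by (subst (asm) borel_measurable_restrict_space_iff) auto
  then show ?thesis unfolding g_def by (simp add: case_prod_beta)
 qed
 have [measurable]: "g : borel_measurable (borel \<Otimes>\<^sub>M borel)" using gm by (simp add: borel_prod)
 have gs: "g (t, y) = (if 0 <= t then \<sigma> t y else 0)" for t y by (simp add: g_def indicator_def)
 have tr: "truncate M \<sigma> t y = max (- M) (min M (g (t, y)))" if "M0 <= M" for M t y
  using that by (simp add: truncate_def gs M0_def)
 have sm: "\<sigma> t : borel_measurable borel" if "0 <= t" for t
 proof -
  have "(%y. g (t, y)) : borel_measurable borel" by measurable
  then show ?thesis using that by (simp add: gs)
 qed
 have ae: "AE y in lborel. truncate M \<sigma> t y = \<sigma> t y" if "M0 <= M" "0 <= t" for M t
  using M1[OF that(2)] by eventually_elim (use that in \<open>auto simp: truncate_def M0_def abs_le_iff\<close>)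
 have "AE z in lborel \<Otimes>\<^sub>M lborel. abs(g z) <= M0"
 proof (rule lborel_pair.AE_pair_measure)
  have [measurable]: "g : borel_measurable (lborel \<Otimes>\<^sub>M lborel)" using gm by (simp add: lborel_prod)
  show "{z : space (lborel \<Otimes>\<^sub>M lborel). abs(g z) <= M0} : sets (lborel \<Otimes>\<^sub>M lborel)" by measurable
  show "AE t in lborel. AE y in lborel. abs(g (t, y)) <= M0"
  proof (rule AE_I2)
   fix t :: real
   show "AE y in lborel. abs(g (t, y)) <= M0"
    by (cases "0 <= t") (use M1[of t] in \<open>auto simp: gs M0_def elim: eventually_mono\<close>)
  qed
 qed
 then have ae2: "AE z in lborel. abs(g z) <= M0" unfolding lborel_prod .
 show ?thesis
 proof (intro exI[of _ M0] allI impI)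
  fix M assume M: "M0 <= M"
  have tm: "(%z. truncate M \<sigma> (fst z) (snd z)) : borel_measurable borel" unfolding tr[OF M] prod.collapse by measurable
  have tms: "truncate M \<sigma> t : borel_measurable borel" for t unfolding tr[OF M, abs_def] by measurable
  show "truncated_solution (truncate M \<sigma>) M \<sigma>"
  proof
   show "abs(truncate M \<sigma> t y) <= M" for t y using M by (auto simp: truncate_def M0_def)
   show "((%s. LINT y:{-b..b}|lborel. abs(truncate M \<sigma> s y - truncate M \<sigma> t y)) \<longlongrightarrow> 0) (at t within {0..})" if t: "0 <= t" for t b
   proof (rule Lim_transform_eventually)
    show "((%s. LINT y:{-b..b}|lborel. abs(\<sigma> s y - \<sigma> t y)) \<longlongrightarrow> 0) (at t within {0..})"
     using sc t unfolding solution_class_def by blast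
    show "\<forall>\<^sub>F s in at t within {0..}. (LINT y:{-b..b}|lborel. abs(\<sigma> s y - \<sigma> t y)) = (LINT y:{-b..b}|lborel. abs(truncate M \<sigma> s y - truncate M \<sigma> t y))"
     unfolding eventually_at_filter set_lebesgue_integral_def
    proof (rule always_eventually, intro allI impI, rule integral_cong_AE)
     fix s assume "s : {0::real..}"
     then show "AE y in lborel. indicator {-b..b} y *\<^sub>R (abs(\<sigma> s y - \<sigma> t y)) = indicator {-b..b} y *\<^sub>R (abs(truncate M \<sigma> s y - truncate M \<sigma> t y))"
      using ae[OF M t] ae[OF M, of s] by (auto elim: eventually_elim2)
    qed (use sm[OF t] sm tms in auto)
   qed
  fix f and e q :: "real => real" assume f: "test_function f" and [measurable]: "e : borel_measurable borel" "q : borel_measurable borel"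
  note [measurable] = test_function_measurable[OF f] tm
  define H where "H s z = e s * frechet_derivative f (at z) (1, 0) + q s * frechet_derivative f (at z) (0, 1)" for s z
  have op: "({0<..} \<times> UNIV :: (real \<times> real) set) : sets borel" by (intro borel_open open_Times) auto
  have "(LINT z:{0<..} \<times> UNIV|lborel. H (\<sigma> (fst z) (snd z)) z) = (LINT z:{0<..} \<times> UNIV|lborel. H (g z) z)"
   unfolding set_lebesgue_integral_def by (intro Bochner_Integration.integral_cong) (auto simp: gs indicator_def)
  also have "... = (LINT z|lborel. H (truncate M \<sigma> (fst z) (snd z)) z)"
   unfolding set_lebesgue_integral_def
  proof (rule integral_cong_AE)
   obtain K where K: "compact K" "!!z. z ~: K ==> f z = 0" "K \<subseteq> {0<..} \<times> UNIV" using f unfolding test_function_def by blast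
   show "AE z in lborel. indicator ({0<..} \<times> UNIV) z *\<^sub>R H (g z) z = H (truncate M \<sigma> (fst z) (snd z)) z"
    using ae2
   proof eventually_elim
    case (elim z)
    show ?case
    proof (cases "0 < fst z")
     case True
     then show ?thesis using elim M by (cases z) (auto simp: tr[OF M] abs_le_iff)
    next
     case False
     then have "z ~: K" using K(3) by auto
     from test_function_outside[OF K(1,2) this] show ?thesis using False by (simp add: H_def indicator_def mem_Times_iff)
    qed
   qed
  qed (use op in \<open>simp_all add: H_def\<close>)
  finally show "(LINT z:{0<..} \<times> UNIV|lborel. e (\<sigma> (fst z) (snd z)) * frechet_derivative f (at z) (1, 0) + q (\<sigma> (fst z) (snd z)) * frechet_derivative f (at z) (0, 1))
   = (LINT z|lborel. e (truncate M \<sigma> (fst z) (snd z)) * frechet_derivative f (at z) (1, 0) + q (truncate M \<sigma> (fst z) (snd z)) * frechet_derivative f (at z) (0, 1))"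
   unfolding H_def .
  qed (use tm ae[OF M] sm in auto)
 qed
qed

lemma integrable_of_exhaustion:
 fixes f :: "real => real"
 assumes f: "f : borel_measurable borel" and lim: "filterlim c at_top sequentially" and c: "incseq c"
  and h: "!!n. integrable lborel (%y. indicator {- c n..<c n} y * abs(f y))" "!!n. (LINT y|lborel. indicator {- c n..<c n} y * abs(f y)) <= B"
 shows "integrable lborel f" "(LINT y|lborel. abs(f y)) <= B"
proof -
 define h where "h n y = indicator {- c n..<c n} y * abs(f y)" for n :: nat and y
 have inc: "incseq (%n. h n y)" for y
  using incseqD[OF c] by (intro monoI) (force simp: h_def indicator_def)
 have ih: "incseq (%n. LINT y|lborel. h n y)"
  using h inc by (intro monoI integral_mono) (auto simp: h_def[symmetric] dest: incseqD)
 obtain L where L: "(%n. LINT y|lborel. h n y) \<longlonglongrightarrow> L"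
  using incseq_convergent[OF ih, of B] h(2) unfolding h_def by blast
 have lim': "(%n. h n y) \<longlonglongrightarrow> abs(f y)" for y
 proof (rule tendsto_eventually)
  have "\<forall>\<^sub>F n in sequentially. abs y < c n" using lim by (simp add: filterlim_at_top_dense)
  then show "\<forall>\<^sub>F n in sequentially. h n y = abs(f y)" by eventually_elim (auto simp: h_def indicator_def)
 qed
 note mc = h(1)[folded h_def] AE_I2[OF inc] AE_I2[OF lim'] L
 have "integrable lborel (%y. abs(f y))" by (rule integrable_monotone_convergence[OF mc]) (use f in auto)
 then show "integrable lborel f" by (rule integrable_abs_cancel) (use f in simp)
 have "(LINT y|lborel. abs(f y)) = L" by (rule integral_monotone_convergence[OF mc]) (use f in auto)
 also have "L <= B" by (rule LIMSEQ_le_const2[OF L]) (use h(2) in \<open>auto simp: h_def\<close>)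
 finally show "(LINT y|lborel. abs(f y)) <= B" .
qed

text \<open>\<open>kruzhkov_tracking\<close> is applied on windows whose half-width at time
  \<open>T\<close> is \<open>c n\<close>; letting \<open>n\<close> grow yields both the
  integrability at time \<open>T\<close> and the bound on the whole line.\<close>

lemma entropy_solution_tracking:
 assumes es: "entropy_solution (%s. s^2 / 2) s0 \<sigma>" and s0: "integrable lborel s0"
  and I: "finite I" and st: "sticky I d kap P" and sum0: "(SUM i:I. d i) = 0" and k0: "0 <= kap" and T: "0 <= T"
 shows "integrable lborel (%y. \<sigma> T y - stepv I d (P T) y)"
  "(LINT y|lborel. abs(\<sigma> T y - stepv I d (P T) y)) <= (LINT y|lborel. abs(s0 y - stepv I d (P 0) y)) + kap * (SUM i:I. abs(d i)) / 4 * T"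
proof -
 have sc: "solution_class s0 \<sigma>" using es by (simp add: entropy_solution_def)
 then have s0': "AE y in lborel. \<sigma> 0 y = s0 y" by (simp add: solution_class_def)
 define V where "V = (SUM i:I. abs(d i))"
 obtain M where VM: "V <= M" and ts: "truncated_solution (truncate M \<sigma>) M \<sigma>"
  using solution_class_truncate[OF sc] by (meson linorder_linear max.cobounded1 max.cobounded2)
 let ?v = "truncate M \<sigma>"
 interpret truncated_solution ?v M \<sigma> by fact
 have wm [measurable]: "stepv I d (P t) : borel_measurable borel" for t by (rule stepv_measurable[OF I])
 \<comment> \<open>Adding \<open>M * T\<close> gives the half-width at time 0, which exceeds
   \<open>abs(P 0 i) + 2 * M * T\<close> for every particle.\<close>
 define c where "c n = (SUM i:I. abs(P 0 i)) + 2 * M * T + 1 + real n - M * T" for n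
 let ?D = "LINT y|lborel. abs(s0 y - stepv I d (P 0) y)"
 have tracking: "integrable lborel (%y. indicator {- c n..<c n} y * abs(?v T y - stepv I d (P T) y)) &
  (LINT y|lborel. indicator {- c n..<c n} y * abs(?v T y - stepv I d (P T) y)) <= ?D + kap * V / 4 * T" for n
 proof -
  interpret kt: kruzhkov_tracking ?v M I d kap P T "c n + M * T"
  proof
   show "abs(P 0 i) + 2 * M * T < c n + M * T" if "i : I" for i
    using member_le_sum[OF that, of "%i. abs(P 0 i)"] I by (simp add: c_def)
   have "0 <= (SUM i:I. abs(P 0 i))" by (intro sum_nonneg) auto
   then show "2 * M * T < c n + M * T" unfolding c_def using of_nat_0_le_iff[of n] by linarith
   fix f k assume f: "test_function f" "!!z. 0 <= f z"
   have "(%s. burgers_flux s k) : borel_measurable borel" unfolding burgers_flux_eq by measurable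
   then show "0 <= (LINT z|lborel. abs(?v (fst z) (snd z) - k) * frechet_derivative f (at z) (1, 0) +
       burgers_flux (?v (fst z) (snd z)) k * frechet_derivative f (at z) (0, 1))"
    using weak_form[OF f(1), of "%s. abs(s - k)" "%s. burgers_flux s k"] es[unfolded entropy_solution_def, THEN conjunct2, rule_format, of f k] f
    by (simp add: burgers_flux_def)
  qed (use I st sum0 T k0 VM in \<open>auto simp: V_def\<close>)
  have hE: "(LINT y|lborel. indicator {- c n..<c n} y * abs(?v T y - stepv I d (P T) y)) = kt.E T"
   by (simp add: kt.E_def kt.bet_def kt.w_def)
  also have "... <= kt.E 0 + (kap * V / 4) * T" using kt.E_growth by (simp add: kt.V_def V_def)
  also have "kt.E 0 <= ?D"
   unfolding kt.E_def
  proof (rule integral_mono_AE)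
   show "integrable lborel (%y. abs(s0 y - stepv I d (P 0) y))" using s0 stepv_integrable[OF I sum0] by auto
   show "AE y in lborel. indicator {- kt.bet 0..<kt.bet 0} y * abs(?v 0 y - kt.w 0 y) <= abs(s0 y - stepv I d (P 0) y)"
    using AE_eq[OF order_refl] s0' by eventually_elim (simp add: indicator_def kt.w_def)
  qed (rule kt.E_integrable)
  finally show ?thesis using kt.E_integrable[of T] by (simp add: kt.bet_def kt.w_def)
 qed
 have "filterlim c at_top sequentially"
  unfolding c_def using filterlim_tendsto_add_at_top[OF tendsto_const filterlim_real_sequentially, of "(SUM i:I. abs(P 0 i)) + 2 * M * T + 1 - M * T"]
  by (simp add: algebra_simps)
 note ex = integrable_of_exhaustion[OF _ this _ tracking[THEN conjunct1] tracking[THEN conjunct2]]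
 have i: "integrable lborel (%y. ?v T y - stepv I d (P T) y)" "(LINT y|lborel. abs(?v T y - stepv I d (P T) y)) <= ?D + kap * V / 4 * T"
  by (rule ex; auto simp: c_def intro: incseq_SucI)+
 have ae: "AE y in lborel. ?v T y - stepv I d (P T) y = \<sigma> T y - stepv I d (P T) y"
  using AE_eq[OF T] by eventually_elim simp
 have m: "(%y. \<sigma> T y - stepv I d (P T) y) : borel_measurable lborel" using slice_measurable[OF T] by simp
 show "integrable lborel (%y. \<sigma> T y - stepv I d (P T) y)"
  by (rule integrable_cong_AE_imp[OF i(1) m]) (use ae in \<open>auto elim: eventually_mono\<close>)
 have "(LINT y|lborel. abs(\<sigma> T y - stepv I d (P T) y)) = (LINT y|lborel. abs(?v T y - stepv I d (P T) y))"
  by (rule integral_cong_AE) (use m ae in \<open>auto elim: eventually_mono\<close>)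
 then show "(LINT y|lborel. abs(\<sigma> T y - stepv I d (P T) y)) <= ?D + kap * (SUM i:I. abs(d i)) / 4 * T"
  using i(2) by (simp add: V_def)
qed

text \<open>Adding the bound \<open>M\<close> makes both functions densities of finite measures on
  \<open>{- real n..<real n}\<close>. These measures agree on rays, hence coincide, and densities
  are unique almost everywhere.\<close>

lemma AE_eq_of_interval_integrals:
 fixes f g :: "real => real"
 assumes meas: "f : borel_measurable borel" "g : borel_measurable borel" and bd: "!!x. abs(f x) <= M" "!!x. abs(g x) <= M"
  and eq: "!!p q. p < q ==> (LINT x|lborel. indicator {p..<q} x * f x) = (LINT x|lborel. indicator {p..<q} x * g x)"
 shows "AE x in lborel. f x = g x"
proof -
 have "AE x in lborel. x : {- real n..<real n} --> f x = g x" for n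
 proof -
  define D where "D h x = ennreal (indicator {- real n..<real n} x * (M + h x))" for h :: "real => real" and x
  have Dm: "D h : borel_measurable borel" if "h : borel_measurable borel" for h unfolding D_def using that by measurable
  have em: "emeasure (density lborel (D h)) {x<..} = ennreal (M * (LINT y|lborel. indicator {max x (- real n)..<real n} y) + (LINT y|lborel. indicator {max x (- real n)..<real n} y * h y))"
   if h: "h : borel_measurable borel" "!!x. abs(h x) <= M" for h x
  proof -
   let ?I = "%y. indicator {max x (- real n)..<real n} y :: real"
   have ih: "integrable lborel (%y. ?I y * h y)"
    by (rule integrable_on_interval[OF h(1) h(2), where a="max x (- real n)" and b="real n"]) auto
   have iI: "integrable lborel ?I"
    using integrable_on_interval[of "%_. 1" 1 "{max x (- real n)..<real n}" "max x (- real n)" "real n"] by (simp add: subset_eq)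
   have nn: "0 <= M + h y" for y using h(2)[of y] by linarith
   have "emeasure (density lborel (D h)) {x<..} = (\<integral>\<^sup>+ y. D h y * indicator {x<..} y \<partial>lborel)"
    using Dm[OF h(1)] by (subst emeasure_density) auto
   also have "... = (\<integral>\<^sup>+ y. ennreal (M * ?I y + ?I y * h y) \<partial>lborel)"
    by (rule nn_integral_cong_AE, rule eventually_mono[OF AE_lborel_singleton[of x]])
      (auto simp: D_def indicator_def)
   also have "... = ennreal (LINT y|lborel. M * ?I y + ?I y * h y)"
    using ih iI nn by (intro nn_integral_eq_integral Bochner_Integration.integrable_add) (auto simp: indicator_def)
   also have "(LINT y|lborel. M * ?I y + ?I y * h y) = M * (LINT y|lborel. ?I y) + (LINT y|lborel. ?I y * h y)"
    using ih iI by simp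
   finally show ?thesis .
  qed
  have "density lborel (D f) = density lborel (D g)"
  proof (rule measure_eqI_lessThan)
   show "emeasure (density lborel (D f)) {x<..} < \<infinity>" for x using em[OF meas(1) bd(1), of x] by simp
   show "emeasure (density lborel (D f)) {x<..} = emeasure (density lborel (D g)) {x<..}" for x
    unfolding em[OF meas(1) bd(1)] em[OF meas(2) bd(2)]
    using eq[of "max x (- real n)" "real n"] by (cases "max x (- real n) < real n") auto
  qed auto
  then have "AE x in lborel. D f x = D g x"
   using Dm meas by (intro sigma_finite_measure.density_unique[OF sigma_finite_lborel]) auto
  then show ?thesis
  proof eventually_elim
   case (elim x)
   have "0 <= M + f x" "0 <= M + g x" using bd(1)[of x] bd(2)[of x] by linarith+
   then show ?case using elim by (auto simp: D_def indicator_def)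
  qed
 qed
 then have "AE x in lborel. ALL n::nat. x : {- real n..<real n} --> f x = g x" by (subst AE_all_countable) auto
 then show ?thesis
 proof eventually_elim
  case (elim x)
  obtain n where "abs x < real n" using reals_Archimedean2 by blast
  then show ?case using elim by (auto dest!: spec[of _ n])
 qed
qed

text \<open>With two fronts at rest and zero flux, \<open>front_growth\<close> for the linear
  entropies \<open>x\<close> and \<open>- x\<close> shows that the integral over an interval neither
  grows nor decreases.\<close>

lemma stationary_weak_solution:
 assumes ws: "weak_solution (%s. 0) s0 \<sigma>" and T: "0 <= T"
 shows "AE y in lborel. \<sigma> T y = s0 y" "\<sigma> T : borel_measurable borel"
proof -
 have sc: "solution_class s0 \<sigma>" using ws by (simp add: weak_solution_def)
 obtain M where ts: "truncated_solution (truncate M \<sigma>) M \<sigma>"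
  using solution_class_truncate[OF sc] by blast
 define v where "v = truncate M \<sigma>"
 interpret truncated_solution v M \<sigma> using ts by (simp add: v_def)
 show "\<sigma> T : borel_measurable borel" by (rule slice_measurable[OF T])
 have ii: "integrable lborel (%y. indicator {p..<q} y * v t y)" for p q t
  by (rule integrable_on_interval[OF _ bound, where a=p and b=q]) auto
 have mono: "c * (LINT y|lborel. indicator {p..<q} y * v T y) <= c * (LINT y|lborel. indicator {p..<q} y * v 0 y)"
  if pq: "p < q" and c: "abs c = 1" for p q c
 proof -
  define H where "H t = (LINT y|lborel. indicator {p..<q} y * (c * v t y))" for t
  have stat: "(LINT z|lborel. c * v (fst z) (snd z) * frechet_derivative f (at z) (1, 0)) = 0" if "test_function f" for f
  proof -
   have "(LINT z|lborel. v (fst z) (snd z) * frechet_derivative f (at z) (1, 0)) = 0"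
    using weak_form[OF that, of "%x. x" "%_. 0"] ws that unfolding weak_solution_def by simp
   then show ?thesis by (simp add: mult.assoc)
  qed
  have Hd: "abs(H r - H t) <= (LINT y:{- (abs p + abs q)..abs p + abs q}|lborel. abs(v r y - v t y))" for r t
  proof -
   have "abs(H r - H t) = abs(LINT y|lborel. c * (indicator {p..<q} y * v r y) - c * (indicator {p..<q} y * v t y))"
    unfolding H_def using ii[of p q] by (simp add: mult.left_commute)
   also have "... <= (LINT y|lborel. abs(c * (indicator {p..<q} y * v r y) - c * (indicator {p..<q} y * v t y)))" by (rule integral_abs_bound)
   also have "... <= (LINT y|lborel. indicator {- (abs p + abs q)..abs p + abs q} y * abs(v r y - v t y))"
   proof (rule integral_mono)
    show "integrable lborel (%y. abs(c * (indicator {p..<q} y * v r y) - c * (indicator {p..<q} y * v t y)))" using ii[of p q] by auto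
    show "abs(c * (indicator {p..<q} y * v r y) - c * (indicator {p..<q} y * v t y)) <= indicator {- (abs p + abs q)..abs p + abs q} y * abs(v r y - v t y)" for y
     using c by (auto simp: right_diff_distrib[symmetric] abs_mult indicator_def)
   qed (rule slice_diff_integrable)
   finally show ?thesis by (simp add: set_lebesgue_integral_def)
  qed
  have Hc: "continuous_on {0..T + 1} H"
   unfolding continuous_on_def
  proof
   fix t assume t: "t : {0..T + 1}"
   have "((%r. H r - H t) \<longlongrightarrow> 0) (at t within {0..T + 1})"
    by (rule Lim_null_comparison[OF always_eventually tendsto_within_subset[OF cont[of t "abs p + abs q"]]]) (use Hd t in auto)
   then show "(H \<longlongrightarrow> H t) (at t within {0..T + 1})" by (simp add: LIM_zero_iff)
  qed
  have "H T <= H 0 + (SUM k<0. (%_. 0) k) * (T - 0)"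
   using front_growth[where N=0 and E="%_ x. c * x" and Q="%_ _. 0" and s="%_. 0" and q="%i. if i = 0 then p else q"
     and K=M and d="T + 1" and a=0 and b=T and e="%_. 0"] Hc T pq c M_nonneg stat
   by (simp add: H_def[symmetric] H_def[abs_def, symmetric] abs_mult)
  then show ?thesis unfolding H_def by (simp add: mult.left_commute)
 qed
 have "AE y in lborel. v T y = v 0 y"
 proof (rule AE_eq_of_interval_integrals)
  show "(LINT x|lborel. indicator {p..<q} x * v T x) = (LINT x|lborel. indicator {p..<q} x * v 0 x)" if "p < q" for p q
   using mono[OF that, of 1] mono[OF that, of "-1"] by simp
 qed (use bound in auto)
 moreover have "AE y in lborel. \<sigma> 0 y = s0 y" using sc by (simp add: solution_class_def)
 ultimately show "AE y in lborel. \<sigma> T y = s0 y" using AE_eq[OF T] AE_eq[OF order_refl] by eventually_elim simp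
qed

section \<open>Flows of smooth vector fields\<close>

text \<open>\<open>C_k\<close> yields continuity of each directional derivative separately; bounding
  the finitely many basis directions on the compact ball controls the operator norm.\<close>

lemma C1_lipschitz:
 fixes f :: "'a::euclidean_space => 'b::real_normed_vector"
 assumes "C_k (Suc 0) f"
 shows "EX L>=0. ALL x:cball U d. ALL y:cball U d. norm (f x - f y) <= L * norm (x - y)"
proof -
 have fd: "(f has_derivative frechet_derivative f (at x)) (at x)" for x
  using assms by (auto simp: frechet_derivative_works[symmetric])
 have lin: "linear (frechet_derivative f (at x))" for x
  using fd has_derivative_linear by blast
 have bd: "EX B>=0. ALL x:cball U d. norm (frechet_derivative f (at x) b) <= B" for b
 proof -
  have "continuous_on (cball U d) (%x. frechet_derivative f (at x) b)"
   using assms by (auto intro: continuous_on_subset)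
  then have "compact ((%x. frechet_derivative f (at x) b) ` cball U d)" by (intro compact_continuous_image) auto
  then have "bounded ((%x. frechet_derivative f (at x) b) ` cball U d)" by (rule compact_imp_bounded)
  then obtain B where "ALL x:cball U d. norm (frechet_derivative f (at x) b) <= B" unfolding bounded_iff by auto
  then show ?thesis by (intro exI[of _ "max B 0"]) (auto simp: max.coboundedI1)
 qed
 then obtain B where B: "!!b. B b >= 0" "!!b x. x : cball U d ==> norm (frechet_derivative f (at x) b) <= B b" by metis
 define L where "L = (SUM b:Basis. B b)"
 have L0: "0 <= L" unfolding L_def using B by (intro sum_nonneg) auto
 have on: "onorm (frechet_derivative f (at x)) <= L" if x: "x : cball U d" for x
 proof (rule onorm_bound[OF L0])
  fix v :: 'a
  have "frechet_derivative f (at x) v = frechet_derivative f (at x) (SUM b:Basis. (v \<bullet> b) *\<^sub>R b)" by (simp add: euclidean_representation)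
  also have "... = (SUM b:Basis. (v \<bullet> b) *\<^sub>R frechet_derivative f (at x) b)"
   by (simp add: linear_sum[OF lin] linear_cmul[OF lin])
  also have "norm ... <= (SUM b:Basis. norm v * B b)"
  proof (rule order_trans[OF norm_sum], intro sum_mono)
   fix b :: 'a assume "b : Basis"
   then have "abs(v \<bullet> b) <= norm v" by (rule Basis_le_norm)
   then show "norm ((v \<bullet> b) *\<^sub>R frechet_derivative f (at x) b) <= norm v * B b"
    using B(2)[OF x, of b] by (auto intro!: mult_mono)
  qed
  finally show "norm (frechet_derivative f (at x) v) <= L * norm v" by (simp add: L_def sum_distrib_left mult.commute)
 qed
 have "norm (f x - f y) <= L * norm (x - y)" if "x : cball U d" "y : cball U d" for x y
  by (rule differentiable_bound[of "cball U d" f "%x. frechet_derivative f (at x)" L])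
    (use fd on that in \<open>auto intro: has_derivative_at_withinI convex_cball\<close>)
 then show ?thesis using L0 by blast
qed

lemma vector_derivative_bound:
 fixes g :: "real => 'a::real_normed_vector"
 assumes "convex S" "!!x. x : S ==> (g has_vector_derivative g' x) (at x within S)"
  "!!x. x : S ==> norm (g' x) <= B" "x : S" "y : S"
 shows "norm (g x - g y) <= B * abs(x - y)"
proof -
 have "norm (g x - g y) <= B * norm (x - y)"
 proof (rule differentiable_bound[OF assms(1)])
  fix x assume x: "x : S"
  show "(g has_derivative (%h. h *\<^sub>R g' x)) (at x within S)" using assms(2)[OF x] by (simp add: has_vector_derivative_def)
  show "onorm (%h. h *\<^sub>R g' x) <= B"
   using mult_right_mono[OF assms(3)[OF x] abs_ge_zero] by (intro onorm_le) (simp add: mult.commute)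
 qed (use assms in auto)
 then show ?thesis by simp
qed

text \<open>Picard iteration. The curves live on the whole real line with time clamped to
  \<open>{-h..h}\<close>, so that the fixed point argument runs in the complete space of bounded
  continuous functions. The contraction factor \<open>1 / 4\<close> also yields Lipschitz dependence
  on the initial point.\<close>

lemma picard_global:
 fixes rho :: "'a::euclidean_space => 'a"
 assumes L: "0 <= L" "!!x y. norm (rho x - rho y) <= L * norm (x - y)" and h: "0 < h" "L * (2 * h) <= 1 / 4"
 shows "EX phi. (ALL u. phi 0 u = u) &
   (ALL u. ALL s:{-h..h}. ((%s. phi s u) has_vector_derivative rho (phi s u)) (at s within {-h..h})) &
   (ALL u v. ALL s:{-h..h}. norm (phi s u - phi s v) <= 2 * norm (u - v))"
proof -
 have contrho: "continuous_on UNIV rho"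
  by (rule lipschitz_on_continuous_on[of L]) (auto simp: lipschitz_on_def dist_norm L)
 define cl where "cl s = max (-h) (min h s)" for s :: real
 have clc: "continuous_on UNIV cl" unfolding cl_def by (intro continuous_intros)
 have clh: "cl s : {-h..h}" for s using h by (auto simp: cl_def)
 have cl_id: "cl s = s" if "s : {-h..h}" for s using that by (auto simp: cl_def)
 \<comment> \<open>The integral from 0 to \<open>s\<close>, for either sign of
   \<open>s\<close>.\<close>
 define I where "I g s = integral {-h..s} (%x. rho (g x)) - integral {-h..0} (%x. rho (g x))" for g :: "real => 'a" and s
 have gi: "(%x. rho (g x)) integrable_on {a..b}" if "continuous_on UNIV g" for g :: "real => 'a" and a b
  by (intro integrable_continuous_interval continuous_on_compose2[OF contrho] continuous_on_subset[OF that]) auto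
 have Ider: "((%s. I g s) has_vector_derivative rho (g s)) (at s within {-h..h})" if g: "continuous_on UNIV g" and s: "s : {-h..h}" for g s
 proof -
  have "continuous_on {-h..h} (%x. rho (g x))"
   by (intro continuous_on_compose2[OF contrho] continuous_on_subset[OF g]) auto
  then have "((%s. integral {-h..s} (%x. rho (g x))) has_vector_derivative rho (g s)) (at s within {-h..h})"
   using s by (rule integral_has_vector_derivative)
  then show ?thesis unfolding I_def using has_vector_derivative_diff[OF _ has_vector_derivative_const] by fastforce
 qed
 have Icont: "continuous_on {-h..h} (I g)" if "continuous_on UNIV g" for g
  using Ider[OF that] by (meson has_vector_derivative_continuous continuous_on_eq_continuous_within)
 have I0: "I g 0 = 0" for g by (simp add: I_def)
 have Idiff: "norm (I g s - I k s) <= 1 / 4 * D" if g: "continuous_on UNIV g" "continuous_on UNIV k" and s: "s : {-h..h}"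
   and D: "!!x. norm (g x - k x) <= D" for g k s D
 proof -
  have D0: "0 <= D" using D[of 0] norm_ge_zero order_trans by blast
  have "norm ((I g s - I k s) - (I g 0 - I k 0)) <= (L * D) * abs(s - 0)"
  proof (rule vector_derivative_bound[of "{-h..h}" _ "%x. rho (g x) - rho (k x)"])
   fix x assume x: "x : {-h..h}"
   show "((%s. I g s - I k s) has_vector_derivative rho (g x) - rho (k x)) (at x within {-h..h})"
    by (intro has_vector_derivative_diff Ider g x)
   show "norm (rho (g x) - rho (k x)) <= L * D" using L(2)[of "g x" "k x"] mult_left_mono[OF D[of x] L(1)] by linarith
  qed (use s h in auto)
  also have "... <= (L * D) * h" using s L D0 by (intro mult_left_mono) auto
  also have "... = (L * h) * D" by simp
  also have "... <= 1 / 4 * D" using h D0 mult_nonneg_nonneg[OF L(1), of h] by (intro mult_right_mono) auto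
  finally show ?thesis by (simp add: I0)
 qed
 define Top where "Top u g = Bcontfun (%s. u + I (apply_bcontfun g) (cl s))" for u and g :: "real \<Rightarrow>\<^sub>C 'a"
 have gc: "continuous_on UNIV (apply_bcontfun g)" for g :: "real \<Rightarrow>\<^sub>C 'a"
  using apply_bcontfun[of g] by (simp add: bcontfun_def)
 have inb: "(%s. u + I (apply_bcontfun g) (cl s)) : bcontfun" for u and g :: "real \<Rightarrow>\<^sub>C 'a"
 proof -
  have "continuous_on UNIV (%s. u + I (apply_bcontfun g) (cl s))"
   using clh by (intro continuous_intros continuous_on_compose2[OF Icont[OF gc] clc]) auto
  moreover have "bounded (range (%s. u + I (apply_bcontfun g) (cl s)))"
  proof -
   have "compact ((%s. u + I (apply_bcontfun g) s) ` {-h..h})"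
    by (intro compact_continuous_image continuous_intros Icont[OF gc]) auto
   moreover have "range (%s. u + I (apply_bcontfun g) (cl s)) \<subseteq> (%s. u + I (apply_bcontfun g) s) ` {-h..h}" using clh by auto
   ultimately show ?thesis using bounded_subset compact_imp_bounded by blast
  qed
  ultimately show ?thesis by (simp add: bcontfun_def)
 qed
 have app: "apply_bcontfun (Top u g) s = u + I (apply_bcontfun g) (cl s)" for u g s
  unfolding Top_def using Bcontfun_inverse[OF inb] by simp
 have dD: "norm (apply_bcontfun f x - apply_bcontfun g x) <= dist f g" for f g :: "real \<Rightarrow>\<^sub>C 'a" and x
  using dist_bounded[of f x g] by (simp add: dist_norm)
 have contr: "dist (Top u f) (Top u g) <= 1 / 4 * dist f g" for u f g
 proof (rule dist_bound)
  fix s show "dist (apply_bcontfun (Top u f) s) (apply_bcontfun (Top u g) s) <= 1 / 4 * dist f g"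
   unfolding app dist_norm[where 'a='a] using Idiff[OF gc[of f] gc[of g] clh[of s] dD] by simp
 qed
 have "EX! g. Top u g = g" for u by (rule banach_fix_type[of "1/4"]) (use contr in auto)
 then obtain G where G: "!!u. Top u (G u) = G u" by metis
 define phi where "phi s u = apply_bcontfun (G u) s" for s u
 have phi: "phi s u = u + I (apply_bcontfun (G u)) (cl s)" for s u
  unfolding phi_def using app[of u "G u" s] G by simp
 have phiG: "apply_bcontfun (G u) = (%s. phi s u)" for u by (simp add: phi_def)
 show ?thesis
 proof (intro exI[of _ phi] conjI allI ballI)
  fix u show "phi 0 u = u" using phi[of 0 u] cl_id[of 0] h I0 by simp
 next
  fix u s assume s: "s : {-h..h}"
  have "((%s. u + I (apply_bcontfun (G u)) s) has_vector_derivative 0 + rho (apply_bcontfun (G u) s)) (at s within {-h..h})"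
   by (intro has_vector_derivative_add has_vector_derivative_const Ider gc s)
  then have "((%s. u + I (apply_bcontfun (G u)) s) has_vector_derivative rho (phi s u)) (at s within {-h..h})"
   by (simp add: phiG)
  then show "((%s. phi s u) has_vector_derivative rho (phi s u)) (at s within {-h..h})"
   by (rule has_vector_derivative_transform[rotated 2]) (use s phi cl_id in auto)
 next
  fix u v s assume s: "s : {-h..h}"
  have "dist (G u) (G v) <= norm (u - v) + 1 / 4 * dist (G u) (G v)"
  proof (rule dist_bound)
   fix s
   have "dist (apply_bcontfun (G u) s) (apply_bcontfun (G v) s) = norm ((u - v) + (I (apply_bcontfun (G u)) (cl s) - I (apply_bcontfun (G v)) (cl s)))"
    using phi[of s u] phi[of s v] by (simp add: phiG dist_norm algebra_simps)
   also have "... <= norm (u - v) + 1 / 4 * dist (G u) (G v)"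
    by (rule order_trans[OF norm_triangle_ineq]) (intro add_left_mono Idiff gc clh dD)
   finally show "dist (apply_bcontfun (G u) s) (apply_bcontfun (G v) s) <= norm (u - v) + 1 / 4 * dist (G u) (G v)" .
  qed
  then have "dist (G u) (G v) <= 2 * norm (u - v)" using norm_ge_zero[of "u - v"] by linarith
  then show "norm (phi s u - phi s v) <= 2 * norm (u - v)" using dD[of "G u" s "G v"] unfolding phi_def by linarith
 qed
qed

text \<open>Composing the field with the projection onto the ball makes it globally Lipschitz and
  bounded; for short times the curves stay in the ball and are thus integral curves of the original
  field. The second-order estimate splits the increment into a change of time from \<open>a\<close>
  to \<open>a'\<close> at the initial point \<open>u'\<close> and a change of the initial point from
  \<open>u\<close> to \<open>u'\<close> at time \<open>a\<close>.\<close>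

lemma local_flow:
 fixes rho :: "'a::euclidean_space => 'a"
 assumes d: "0 < d" and L: "0 <= L" "!!x y. x : cball U0 d ==> y : cball U0 d ==> norm (rho x - rho y) <= L * norm (x - y)"
 shows "EX phi h C. 0 < h & 0 <= C & (ALL u. phi 0 u = u) &
  (ALL u:cball U0 h. ALL s:{-h..h}. phi s u : cball U0 d & ((%s. phi s u) has_vector_derivative rho (phi s u)) (at s within {-h..h})) &
  (ALL u:cball U0 h. ALL u':cball U0 h. ALL a:{-h..h}. ALL a':{-h..h}.
    norm (phi a' u' - phi a u - (u' - u) - (a' - a) *\<^sub>R rho U0) <= C * (abs a + abs a' + norm (u - U0) + norm (u' - U0)) * (abs(a' - a) + norm (u' - u)))"
proof -
 define pp where "pp = closest_point (cball U0 d)"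
 have ppin: "pp x : cball U0 d" for x unfolding pp_def using d by (intro closest_point_in_set) auto
 have ppid: "pp x = x" if "x : cball U0 d" for x unfolding pp_def using that closest_point_self by blast
 have pplip: "norm (pp x - pp y) <= norm (x - y)" for x y
  unfolding pp_def dist_norm[symmetric] using d by (intro closest_point_lipschitz) auto
 define rho' where "rho' x = rho (pp x)" for x
 have L': "norm (rho' x - rho' y) <= L * norm (x - y)" for x y
  unfolding rho'_def using order_trans[OF L(2)[OF ppin ppin] mult_left_mono[OF pplip L(1)]] .
 define B where "B = norm (rho U0) + L * d"
 have B0: "0 <= B" using L d by (simp add: B_def)
 have B: "norm (rho' x) <= B" for x
 proof -
  have "norm (rho' x - rho' U0) <= L * norm (pp x - pp U0)" unfolding rho'_def by (rule L(2)[OF ppin ppin])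
  also have "... <= L * d" using ppin[of x] ppid[of U0] d L by (intro mult_left_mono) (auto simp: dist_norm norm_minus_commute)
  finally have "norm (rho' x - rho' U0) <= L * d" .
  moreover have "rho' U0 = rho U0" using ppid[of U0] d by (simp add: rho'_def)
  ultimately show ?thesis unfolding B_def using norm_triangle_sub[of "rho' x" "rho' U0"] by simp
 qed
 define h where "h = min (1 / (8 * (L + 1))) (d / (2 * (B + 1)))"
 have h0: "0 < h" using L d B0 by (simp add: h_def)
 have hL: "L * (2 * h) <= 1 / 4"
 proof -
  have "h <= 1 / (8 * (L + 1))" by (simp add: h_def)
  then have "h * (8 * (L + 1)) <= 1" using L by (simp add: pos_le_divide_eq)
  then show ?thesis using h0 by (simp add: algebra_simps)
 qed
 have hB: "(B + 1) * h <= d / 2"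
 proof -
  have "h <= d / (2 * (B + 1))" by (simp add: h_def)
  then have "h * (2 * (B + 1)) <= d" using B0 by (simp add: pos_le_divide_eq)
  then show ?thesis by (simp add: algebra_simps)
 qed
 obtain phi where phi: "!!u. phi 0 u = u"
   "!!u s. s:{-h..h} ==> ((%s. phi s u) has_vector_derivative rho' (phi s u)) (at s within {-h..h})"
   "!!u v s. s:{-h..h} ==> norm (phi s u - phi s v) <= 2 * norm (u - v)"
  using picard_global[OF L(1) L' h0 hL] by blast
 have time: "norm (phi a u - phi b u) <= B * abs(a - b)" if "a : {-h..h}" "b : {-h..h}" for a b u
  by (rule vector_derivative_bound[of "{-h..h}" _ "%s. rho' (phi s u)"]) (use that phi(2) B in auto)
 have near: "norm (phi a u - U0) <= norm (u - U0) + B * abs a" if "a : {-h..h}" for a u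
 proof -
  have "norm (phi a u - u) <= B * abs a" using time[of a 0 u] that h0 phi(1)[of u] by simp
  moreover have "norm (phi a u - U0) <= norm (phi a u - u) + norm (u - U0)" using norm_triangle_ineq[of "phi a u - u" "u - U0"] by simp
  ultimately show ?thesis by linarith
 qed
 have inball: "phi a u : cball U0 d" if "u : cball U0 h" "a : {-h..h}" for a u
 proof -
  have "B * abs a <= B * h" using that B0 by (intro mult_left_mono) auto
  then have "norm (phi a u - U0) <= (B + 1) * h" using near[OF that(2), of u] that(1) by (simp add: dist_norm norm_minus_commute algebra_simps)
  then show ?thesis using hB d by (simp add: dist_norm norm_minus_commute)
 qed
 define C where "C = L * (B + 3)"
 have C0: "0 <= C" using L B0 by (simp add: C_def)
 have rho0: "rho' U0 = rho U0" using ppid[of U0] d by (simp add: rho'_def)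
 have est: "norm (phi a' u' - phi a u - (u' - u) - (a' - a) *\<^sub>R rho U0) <= C * (abs a + abs a' + norm (u - U0) + norm (u' - U0)) * (abs(a' - a) + norm (u' - u))"
  if a: "a : {-h..h}" "a' : {-h..h}" for a a' u u'
 proof -
  define E where "E = abs a + abs a' + norm (u - U0) + norm (u' - U0)"
  have E0: "0 <= E" by (simp add: E_def)
  define J where "J = closed_segment a a'"
  have J: "J \<subseteq> {-h..h}" unfolding J_def using a by (auto simp: closed_segment_eq_real_ivl split: if_splits)
  have Jb: "abs s <= abs a + abs a'" if "s : J" for s using that by (auto simp: J_def closed_segment_eq_real_ivl split: if_splits)
  have "norm ((phi a' u' - a' *\<^sub>R rho U0) - (phi a u' - a *\<^sub>R rho U0)) <= (L * ((B + 1) * E)) * abs(a' - a)"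
  proof (rule vector_derivative_bound[of J "%s. phi s u' - s *\<^sub>R rho U0" "%s. rho' (phi s u') - rho U0"])
   fix s assume s: "s : J"
   have "((%s. s *\<^sub>R rho U0) has_vector_derivative 1 *\<^sub>R rho U0) (at s within J)"
    by (auto intro!: derivative_eq_intros simp: has_vector_derivative_def)
   then have "((%s. s *\<^sub>R rho U0) has_vector_derivative rho U0) (at s within J)" by simp
   moreover have "((%s. phi s u') has_vector_derivative rho' (phi s u')) (at s within J)"
    using phi(2)[of s u'] J s by (meson has_vector_derivative_within_subset subsetD)
   ultimately show "((%s. phi s u' - s *\<^sub>R rho U0) has_vector_derivative rho' (phi s u') - rho U0) (at s within J)"
    by (intro has_vector_derivative_diff)
   have "norm (phi s u' - U0) <= norm (u' - U0) + B * abs s" using near[of s u'] J s by auto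
   also have "... <= E + B * E"
   proof -
    have "norm (u' - U0) <= E" "abs s <= E" using Jb[OF s] norm_ge_zero[of "u - U0"] norm_ge_zero[of "u' - U0"] unfolding E_def by linarith+
    then show ?thesis using B0 by (intro add_mono mult_left_mono) auto
   qed
   finally have "norm (phi s u' - U0) <= (B + 1) * E" by (simp add: algebra_simps)
   then show "norm (rho' (phi s u') - rho U0) <= L * ((B + 1) * E)"
    using L'[of "phi s u'" U0] mult_left_mono[OF _ L(1)] unfolding rho0 by (meson order_trans)
  qed (auto simp: J_def)
  moreover have "norm ((phi a u' - phi a u) - (phi 0 u' - phi 0 u)) <= (L * (2 * norm (u' - u))) * abs(a - 0)"
  proof (rule vector_derivative_bound[of "{-h..h}" "%s. phi s u' - phi s u" "%s. rho' (phi s u') - rho' (phi s u)"])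
   fix s assume s: "s : {-h..h}"
   show "((%s. phi s u' - phi s u) has_vector_derivative rho' (phi s u') - rho' (phi s u)) (at s within {-h..h})"
    by (intro has_vector_derivative_diff phi(2) s)
   show "norm (rho' (phi s u') - rho' (phi s u)) <= L * (2 * norm (u' - u))"
    by (rule order_trans[OF L' mult_left_mono[OF phi(3)[OF s] L(1)]])
  qed (use a h0 in auto)
  moreover have "(L * (2 * norm (u' - u))) * abs(a - 0) <= (L * (2 * norm (u' - u))) * E"
   using L by (intro mult_left_mono) (auto simp: E_def)
  moreover have "phi a' u' - phi a u - (u' - u) - (a' - a) *\<^sub>R rho U0 = ((phi a' u' - a' *\<^sub>R rho U0) - (phi a u' - a *\<^sub>R rho U0)) + ((phi a u' - phi a u) - (phi 0 u' - phi 0 u))"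
   by (simp add: phi(1) algebra_simps)
  ultimately have "norm (phi a' u' - phi a u - (u' - u) - (a' - a) *\<^sub>R rho U0) <= (L * ((B + 1) * E)) * abs(a' - a) + (L * (2 * norm (u' - u))) * E"
   by (smt (verit) norm_triangle_ineq)
  also have "... <= C * E * (abs(a' - a) + norm (u' - u))"
  proof -
   have "(L * ((B + 1) * E)) * abs(a' - a) <= C * E * abs(a' - a)"
    unfolding C_def mult.assoc[symmetric] using L E0 by (intro mult_right_mono mult_left_mono) auto
   moreover have "(L * (2 * norm (u' - u))) * E = L * 2 * E * norm (u' - u)" by simp
   moreover have "L * 2 * E * norm (u' - u) <= C * E * norm (u' - u)"
    unfolding C_def using L E0 B0 by (intro mult_right_mono mult_left_mono) auto
   ultimately show ?thesis unfolding distrib_left by linarith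
  qed
  finally show ?thesis by (simp add: E_def)
 qed
 have der: "((%s. phi s u) has_vector_derivative rho (phi s u)) (at s within {-h..h})" if "u : cball U0 h" "s : {-h..h}" for u s
  using phi(2)[OF that(2), of u] ppid[OF inball[OF that]] by (simp add: rho'_def)
 show ?thesis
  by (intro exI[of _ phi] exI[of _ h] exI[of _ C] conjI allI ballI) (use h0 C0 phi(1) inball der est in auto)
qed

text \<open>The second difference is symmetric in \<open>v\<close> and \<open>w\<close>, whence
  \<open>symmetric_second_derivative\<close>. The mean value inequality is applied in the direction
  \<open>v\<close> only, so differentiability of one directional derivative at the single point
  \<open>x\<close> suffices.\<close>

lemma second_difference:
 fixes F :: "'a::real_normed_vector => 'b::real_normed_vector"
 assumes d1: "!!x. F differentiable (at x)"
  and d2: "((%x. frechet_derivative F (at x) v) has_derivative D) (at x)"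
  and e: "0 < eps"
 shows "EX dl>0. ALL s. 0 < s --> s < dl -->
  norm (F (x + s *\<^sub>R v + s *\<^sub>R w) - F (x + s *\<^sub>R v) - F (x + s *\<^sub>R w) + F x - s\<^sup>2 *\<^sub>R D w) <= eps * s^2"
proof -
 define f where "f x = frechet_derivative F (at x) v" for x
 define B where "B = 2 * (norm v + norm w) + 1"
 have B: "0 < B" by (simp add: B_def add_nonneg_pos)
 have linD: "linear D" using d2 has_derivative_linear by blast
 obtain dl where dl: "dl > 0" "!!y. norm (y - x) < dl ==> norm (f y - f x - D (y - x)) <= (eps / B) * norm (y - x)"
  using d2 e B unfolding f_def has_derivative_at_alt by (metis divide_pos_pos)
 have "norm (F (x + s *\<^sub>R v + s *\<^sub>R w) - F (x + s *\<^sub>R v) - F (x + s *\<^sub>R w) + F x - s\<^sup>2 *\<^sub>R D w) <= eps * s^2"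
  if s: "0 < s" "s < dl / B" for s
 proof -
  have sB: "s * B < dl" using s B by (simp add: pos_less_divide_eq)
  define g where "g t = F (x + t *\<^sub>R v + s *\<^sub>R w) - F (x + t *\<^sub>R v) - (t * s) *\<^sub>R D w" for t
  have Fd: "((%t. F (y + t *\<^sub>R v)) has_vector_derivative f (y + t *\<^sub>R v)) (at t within S)" for y t S
  proof -
   have "((%t. y + t *\<^sub>R v) has_derivative (%h. h *\<^sub>R v)) (at t within S)" by (auto intro!: derivative_eq_intros)
   moreover have "(F has_derivative frechet_derivative F (at (y + t *\<^sub>R v))) (at (y + t *\<^sub>R v))" using d1 by (simp add: frechet_derivative_works[symmetric])
   ultimately have "((%t. F (y + t *\<^sub>R v)) has_derivative (%h. frechet_derivative F (at (y + t *\<^sub>R v)) (h *\<^sub>R v))) (at t within S)"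
    using has_derivative_compose[of "%t. y + t *\<^sub>R v"] by blast
   then show ?thesis unfolding has_vector_derivative_def f_def
    using linear_cmul[OF linear_frechet_derivative[OF d1[of "y + t *\<^sub>R v"]]] by simp
  qed
  have gd: "(g has_vector_derivative f (x + s *\<^sub>R w + t *\<^sub>R v) - f (x + t *\<^sub>R v) - s *\<^sub>R D w) (at t within {0..s})" for t
  proof -
   have "((%t. (t * s) *\<^sub>R D w) has_vector_derivative s *\<^sub>R D w) (at t within {0..s})"
    by (auto intro!: derivative_eq_intros simp: has_vector_derivative_def)
   from has_vector_derivative_diff[OF has_vector_derivative_diff[OF Fd[of "x + s *\<^sub>R w" t] Fd[of x t]] this]
   show ?thesis unfolding g_def by (simp add: algebra_simps)
  qed
  have "norm (g s - g 0) <= (eps * s) * abs(s - 0)"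
  proof (rule vector_derivative_bound[of "{0..s}", OF _ gd])
   fix t assume t: "t : {0..s}"
   have near: "norm (s *\<^sub>R w + t *\<^sub>R v) <= s * (norm w + norm v)" "norm (t *\<^sub>R v) <= s * norm v"
    using t s norm_triangle_ineq[of "s *\<^sub>R w" "t *\<^sub>R v"] mult_right_mono[of t s "norm v"] by (auto simp: distrib_left)
   have lt: "norm (s *\<^sub>R w + t *\<^sub>R v) < dl" "norm (t *\<^sub>R v) < dl"
   proof -
    have "s * (norm w + norm v) <= s * B" "s * norm v <= s * B" using s by (auto simp: B_def intro!: mult_left_mono)
    then show "norm (s *\<^sub>R w + t *\<^sub>R v) < dl" "norm (t *\<^sub>R v) < dl" using near sB by linarith+
   qed
   have 1: "norm (f (x + s *\<^sub>R w + t *\<^sub>R v) - f x - D (s *\<^sub>R w + t *\<^sub>R v)) <= (eps / B) * norm (s *\<^sub>R w + t *\<^sub>R v)"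
    using dl(2)[of "x + s *\<^sub>R w + t *\<^sub>R v"] lt(1) by (simp add: add.assoc)
   have 2: "norm (f (x + t *\<^sub>R v) - f x - D (t *\<^sub>R v)) <= (eps / B) * norm (t *\<^sub>R v)"
    using dl(2)[of "x + t *\<^sub>R v"] lt(2) by simp
   have "f (x + s *\<^sub>R w + t *\<^sub>R v) - f (x + t *\<^sub>R v) - s *\<^sub>R D w = (f (x + s *\<^sub>R w + t *\<^sub>R v) - f x - D (s *\<^sub>R w + t *\<^sub>R v)) - (f (x + t *\<^sub>R v) - f x - D (t *\<^sub>R v))"
    by (simp add: linear_add[OF linD] linear_cmul[OF linD])
   then have "norm (f (x + s *\<^sub>R w + t *\<^sub>R v) - f (x + t *\<^sub>R v) - s *\<^sub>R D w) <= (eps / B) * norm (s *\<^sub>R w + t *\<^sub>R v) + (eps / B) * norm (t *\<^sub>R v)"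
    using 1 2 norm_triangle_ineq4 by (smt (verit))
   also have "... <= (eps / B) * (s * (norm w + norm v)) + (eps / B) * (s * norm v)"
    using near e B by (intro add_mono mult_left_mono) auto
   also have "... = (eps / B) * (s * (norm w + 2 * norm v))" by (simp add: algebra_simps)
   also have "... <= (eps / B) * (s * B)" using s e B by (intro mult_left_mono) (auto simp: B_def)
   finally show "norm (f (x + s *\<^sub>R w + t *\<^sub>R v) - f (x + t *\<^sub>R v) - s *\<^sub>R D w) <= eps * s" using B by simp
  qed (use s in auto)
  then show ?thesis using s by (simp add: g_def power2_eq_square algebra_simps)
 qed
 then show ?thesis using dl(1) B by (intro exI[of _ "dl / B"]) auto
qed

lemma symmetric_second_derivative:
 fixes F :: "'a::real_normed_vector => 'b::real_normed_vector"
 assumes d1: "!!x. F differentiable (at x)"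
  and dv: "((%x. frechet_derivative F (at x) v) has_derivative Dv) (at x)"
  and dw: "((%x. frechet_derivative F (at x) w) has_derivative Dw) (at x)"
 shows "Dv w = Dw v"
proof -
 have "norm (Dv w - Dw v) <= 0"
 proof (rule field_le_epsilon)
  fix eps :: real assume e: "0 < eps"
  obtain d1' where d1': "d1' > 0" "!!s. 0 < s ==> s < d1' ==> norm (F (x + s *\<^sub>R v + s *\<^sub>R w) - F (x + s *\<^sub>R v) - F (x + s *\<^sub>R w) + F x - s\<^sup>2 *\<^sub>R Dv w) <= eps / 2 * s^2"
   using second_difference[OF d1 dv, of "eps / 2" w] e by auto
  obtain d2' where d2': "d2' > 0" "!!s. 0 < s ==> s < d2' ==> norm (F (x + s *\<^sub>R w + s *\<^sub>R v) - F (x + s *\<^sub>R w) - F (x + s *\<^sub>R v) + F x - s\<^sup>2 *\<^sub>R Dw v) <= eps / 2 * s^2"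
   using second_difference[OF d1 dw, of "eps / 2" v] e by auto
  define s where "s = min d1' d2' / 2"
  have s: "0 < s" "s < d1'" "s < d2'" using d1'(1) d2'(1) by (auto simp: s_def)
  define h where "h = F (x + s *\<^sub>R v + s *\<^sub>R w) - F (x + s *\<^sub>R v) - F (x + s *\<^sub>R w) + F x"
  have "norm (h - s\<^sup>2 *\<^sub>R Dv w) <= eps / 2 * s^2" using d1'(2)[of s] s by (simp add: h_def)
  moreover have "norm (h - s\<^sup>2 *\<^sub>R Dw v) <= eps / 2 * s^2" using d2'(2)[of s] s by (simp add: h_def algebra_simps)
  moreover have "s\<^sup>2 *\<^sub>R (Dv w - Dw v) = (h - s\<^sup>2 *\<^sub>R Dw v) - (h - s\<^sup>2 *\<^sub>R Dv w)" by (simp add: algebra_simps)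
  ultimately have "norm (s^2 *\<^sub>R (Dv w - Dw v)) <= eps / 2 * s^2 + eps / 2 * s^2"
   by (smt (verit) norm_triangle_ineq4)
  then have "s\<^sup>2 * norm (Dv w - Dw v) <= s\<^sup>2 * eps" by (simp add: mult.commute)
  then show "norm (Dv w - Dw v) <= 0 + eps" using s by simp
 qed
 then show ?thesis by simp
qed

section \<open>Hyperbolic systems\<close>

lemma smooth_C_k: "smooth f ==> C_k k f" by (simp add: smooth_def)

lemma smooth_differentiable: "smooth f ==> f differentiable (at x)"
 using smooth_C_k[of f "Suc 0"] by simp

lemma smooth_frechet_derivative: "smooth f ==> smooth (%x. frechet_derivative f (at x) v)"
 unfolding smooth_def by (metis C_k.simps(2))

lemma smooth_has_derivative: "smooth f ==> (f has_derivative frechet_derivative f (at x)) (at x)"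
 using smooth_differentiable frechet_derivative_works by blast

locale hyperbolic_system =
 fixes F :: "real^'n => real^'n" and lam :: "nat => real^'n => real" and l r :: "nat => real^'n => real^'n" and U0 :: "real^'n"
 assumes smF: "smooth F"
  and ord_ev: "!!U. ordered_eigenvalues (jacobian F (at U)) (%j. lam j U)"
  and const_mult: "constant_multiplicity lam"
  and evec: "smooth_eigenvectors F lam l r"
  and fields: "!!j. j : {1..CARD('n)} ==> genuinely_nonlinear (lam j) (r j) | linearly_degenerate (lam j) (r j)"
begin

definition A :: "real^'n => real^'n => real^'n" where "A U = frechet_derivative F (at U)"

lemma F_deriv: "(F has_derivative A U) (at U)"
 unfolding A_def by (rule smooth_has_derivative[OF smF])

lemma A_linear: "linear (A U)" using F_deriv has_derivative_linear by blast

lemma A_jacobian: "A U v = jacobian F (at U) *v v"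
 using smooth_differentiable[OF smF] unfolding A_def jacobian_def by (simp add: matrix_works linear_frechet_derivative)

lemma A_r: "j : {1..CARD('n)} ==> A U (r j U) = lam j U *\<^sub>R r j U"
 using evec unfolding A_jacobian smooth_eigenvectors_def by blast

lemma l_A: "j : {1..CARD('n)} ==> l j U \<bullet> A U v = lam j U * (l j U \<bullet> v)"
proof -
 assume j: "j : {1..CARD('n)}"
 have "l j U \<bullet> A U v = (l j U v* jacobian F (at U)) \<bullet> v" by (simp add: A_jacobian dot_lmul_matrix)
 also have "l j U v* jacobian F (at U) = lam j U *\<^sub>R l j U" using evec j unfolding smooth_eigenvectors_def by blast
 finally show ?thesis by simp
qed

lemma l_r: "j : {1..CARD('n)} ==> k : {1..CARD('n)} ==> l j U \<bullet> r k U = (if j = k then 1 else 0)"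
 using evec unfolding smooth_eigenvectors_def by blast

lemma smooth_r: "j : {1..CARD('n)} ==> smooth (r j)"
 using evec unfolding smooth_eigenvectors_def by blast

lemma lam_mono: "1 <= i ==> i <= j ==> j <= CARD('n) ==> lam i U <= lam j U"
 using ord_ev[of U] unfolding ordered_eigenvalues_def mono_on_def by auto

lemma lam_eq_everywhere: "i : {1..CARD('n)} ==> j : {1..CARD('n)} ==> lam i U = lam j U ==> lam i V = lam j V"
 using const_mult unfolding constant_multiplicity_def by blast

lemma lam_differentiable: "j : {1..CARD('n)} ==> lam j differentiable (at U)"
 using fields[of j] unfolding genuinely_nonlinear_def linearly_degenerate_def by auto

lemma lam_has_derivative: "j : {1..CARD('n)} ==> (lam j has_derivative frechet_derivative (lam j) (at U)) (at U)"
 using lam_differentiable frechet_derivative_works by blast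

lemma not_GNL_LD: "genuinely_nonlinear (lam j) (r j) ==> ~ linearly_degenerate (lam j) (r j)"
 unfolding genuinely_nonlinear_def linearly_degenerate_def by (metis zero_neq_one)

text \<open>Biorthogonality makes the vectors \<open>r j U\<close> independent, and their number is
  the dimension.\<close>

lemma r_expansion: "v = (SUM j:{1..CARD('n)}. (l j U \<bullet> v) *\<^sub>R r j U)"
proof -
 define B where "B = (%j. r j U) ` {1..CARD('n)}"
 have lsum: "l k U \<bullet> (SUM j:{1..CARD('n)}. c j *\<^sub>R r j U) = c k" if "k : {1..CARD('n)}" for c k
 proof -
  have "l k U \<bullet> (SUM j:{1..CARD('n)}. c j *\<^sub>R r j U) = (SUM j:{1..CARD('n)}. if k = j then c j else 0)"
   unfolding inner_sum_right by (intro sum.cong refl) (simp add: l_r[OF that])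
  then show ?thesis using that by simp
 qed
 have inj: "inj_on (%j. r j U) {1..CARD('n)}"
  by (rule inj_onI) (metis l_r zero_neq_one)
 have ind: "independent B"
  unfolding B_def
 proof (subst independent_explicit_finite_subsets, intro allI impI)
  fix S u assume S: "S \<subseteq> (%j. r j U) ` {1..CARD('n)}" "finite S" "(SUM v:S. u v *\<^sub>R v) = 0"
  show "ALL v:S. u v = 0"
  proof
   fix v assume v: "v : S"
   then obtain k where k: "k : {1..CARD('n)}" "v = r k U" using S by auto
   have "(SUM x:S. u x *\<^sub>R x) = (SUM x:(%j. r j U) ` {1..CARD('n)}. (if x : S then u x else 0) *\<^sub>R x)"
    using S by (intro sum.mono_neutral_cong_left) auto
   also have "... = (SUM j:{1..CARD('n)}. (if r j U : S then u (r j U) else 0) *\<^sub>R r j U)"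
    by (rule sum.reindex_cong[OF inj]) auto
   finally have "l k U \<bullet> (SUM j:{1..CARD('n)}. (if r j U : S then u (r j U) else 0) *\<^sub>R r j U) = 0" using S by simp
   then show "u v = 0" unfolding lsum[OF k(1)] using v k by simp
  qed
 qed
 have "UNIV \<subseteq> span B"
 proof (rule card_ge_dim_independent[OF _ ind])
  have "card B = CARD('n)" using card_image[OF inj] unfolding B_def by simp
  then show "dim (UNIV :: (real^'n) set) <= card B" by (simp add: dim_UNIV)
 qed auto
 then have "v : span B" by auto
 moreover have "finite B" by (simp add: B_def)
 ultimately obtain u where "v = (SUM x:B. u x *\<^sub>R x)" using span_finite[of B] by auto
 also have "... = (SUM j:{1..CARD('n)}. u (r j U) *\<^sub>R r j U)"
  unfolding B_def by (rule sum.reindex_cong[OF inj]) auto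
 finally have v: "v = (SUM j:{1..CARD('n)}. u (r j U) *\<^sub>R r j U)" .
 have "l k U \<bullet> v = u (r k U)" if "k : {1..CARD('n)}" for k using lsum[OF that, of "%j. u (r j U)"] v by simp
 then have "(SUM j:{1..CARD('n)}. (l j U \<bullet> v) *\<^sub>R r j U) = (SUM j:{1..CARD('n)}. u (r j U) *\<^sub>R r j U)"
  by (intro sum.cong) auto
 also have "... = v" by (rule v[symmetric])
 finally show ?thesis by (rule sym)
qed

text \<open>Boillat: along an eigenspace of dimension at least two the eigenvalue is constant. Differentiating
 \<open>A r\<^sub>j = \<lambda> r\<^sub>j\<close> along \<open>r\<^sub>k\<close> and antisymmetrizing removes the second derivative of \<open>F\<close>.\<close>

lemma GNL_simple:
 assumes j: "j : {1..CARD('n)}" and k: "k : {1..CARD('n)}" and ne: "j ~= k" and gnl: "genuinely_nonlinear (lam j) (r j)"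
 shows "lam j U ~= lam k U"
proof
 assume "lam j U = lam k U"
 then have eq: "lam k = lam j" using lam_eq_everywhere[OF j k] by (auto simp: fun_eq_iff)
 define Dr where "Dr i = frechet_derivative (r i) (at U)" for i
 define Dl where "Dl = frechet_derivative (lam j) (at U)"
 define D2 where "D2 v = frechet_derivative (%x. frechet_derivative F (at x) v) (at U)" for v
 have D2: "((%x. frechet_derivative F (at x) v) has_derivative D2 v) (at U)" for v
  unfolding D2_def by (rule smooth_has_derivative[OF smooth_frechet_derivative[OF smF]])
 \<comment> \<open>\<open>C_k\<close> differentiates \<open>A x v\<close> for fixed
   \<open>v\<close>; the expansion in the basis lets \<open>v\<close> depend on \<open>x\<close>, as
   in \<open>A x (r i x)\<close>.\<close>
 have Arep: "A x v = (SUM b:Basis. (v \<bullet> b) *\<^sub>R A x b)" for x v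
 proof -
  have "A x v = A x (SUM b:Basis. (v \<bullet> b) *\<^sub>R b)" by (simp add: euclidean_representation)
  then show ?thesis by (simp only: linear_sum[OF A_linear] linear_cmul[OF A_linear])
 qed
 have D2rep: "D2 v w = (SUM b:Basis. (v \<bullet> b) *\<^sub>R D2 b w)" for v w
 proof -
  have "((%x. SUM b:Basis. (v \<bullet> b) *\<^sub>R A x b) has_derivative (%w. SUM b:Basis. (v \<bullet> b) *\<^sub>R D2 b w)) (at U)"
   unfolding A_def by (intro has_derivative_sum has_derivative_scaleR_right D2)
  moreover have "(%x. SUM b:Basis. (v \<bullet> b) *\<^sub>R A x b) = (%x. A x v)" by (rule ext) (rule Arep[symmetric])
  ultimately have "((%x. A x v) has_derivative (%w. SUM b:Basis. (v \<bullet> b) *\<^sub>R D2 b w)) (at U)" by (simp only:)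
  from has_derivative_unique[OF D2[of v] this[unfolded A_def]] show ?thesis by (rule fun_cong)
 qed
 have key: "A U (Dr i w) + D2 (r i U) w = Dl w *\<^sub>R r i U + lam j U *\<^sub>R Dr i w" if i: "i : {j,k}" for i w
 proof -
  have in1: "i : {1..CARD('n)}" using i j k by auto
  have rd: "(r i has_derivative Dr i) (at U)" unfolding Dr_def by (rule smooth_has_derivative[OF smooth_r[OF in1]])
  have "((%x. SUM b:Basis. (r i x \<bullet> b) *\<^sub>R A x b) has_derivative (%w. SUM b:Basis. (r i U \<bullet> b) *\<^sub>R D2 b w + (Dr i w \<bullet> b) *\<^sub>R A U b)) (at U)"
   unfolding A_def by (intro has_derivative_sum has_derivative_scaleR D2 has_derivative_inner_left rd)
  moreover have "((%x. lam j x *\<^sub>R r i x) has_derivative (%w. lam j U *\<^sub>R Dr i w + Dl w *\<^sub>R r i U)) (at U)"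
   unfolding Dl_def by (intro has_derivative_scaleR rd lam_has_derivative j)
  moreover have "(SUM b:Basis. (r i x \<bullet> b) *\<^sub>R A x b) = lam j x *\<^sub>R r i x" for x
   using Arep[of x "r i x"] A_r[OF in1, of x] i eq by auto
  ultimately have "(%w. SUM b:Basis. (r i U \<bullet> b) *\<^sub>R D2 b w + (Dr i w \<bullet> b) *\<^sub>R A U b) = (%w. lam j U *\<^sub>R Dr i w + Dl w *\<^sub>R r i U)"
   using has_derivative_unique by auto
  then have "(SUM b:Basis. (r i U \<bullet> b) *\<^sub>R D2 b w + (Dr i w \<bullet> b) *\<^sub>R A U b) = lam j U *\<^sub>R Dr i w + Dl w *\<^sub>R r i U" by metis
  then show ?thesis using D2rep[of "r i U" w] Arep[of U "Dr i w"] by (simp add: sum.distrib add.commute)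
 qed
 have sym: "D2 (r j U) (r k U) = D2 (r k U) (r j U)"
  by (rule symmetric_second_derivative[OF smooth_differentiable[OF smF] D2 D2])
 define X where "X = Dr j (r k U) - Dr k (r j U)"
 have "A U X = Dl (r k U) *\<^sub>R r j U - Dl (r j U) *\<^sub>R r k U + lam j U *\<^sub>R X"
 proof -
  have "A U X = (A U (Dr j (r k U)) + D2 (r j U) (r k U)) - (A U (Dr k (r j U)) + D2 (r k U) (r j U))"
   unfolding X_def sym by (simp add: linear_diff[OF A_linear])
  also have "... = (Dl (r k U) *\<^sub>R r j U + lam j U *\<^sub>R Dr j (r k U)) - (Dl (r j U) *\<^sub>R r k U + lam j U *\<^sub>R Dr k (r j U))"
   using key[of j "r k U"] key[of k "r j U"] by simp
  finally show ?thesis unfolding X_def by (simp add: algebra_simps)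
 qed
 \<comment> \<open>Projecting with \<open>l k\<close> removes \<open>X\<close>, because
   \<open>j\<close> and \<open>k\<close> share the eigenvalue, and leaves the derivative of the
   eigenvalue along \<open>r j\<close>.\<close>
 then have "l k U \<bullet> A U X = l k U \<bullet> (Dl (r k U) *\<^sub>R r j U - Dl (r j U) *\<^sub>R r k U + lam j U *\<^sub>R X)" by simp
 then have "Dl (r j U) = 0"
  unfolding l_A[OF k] using l_r[OF k j] l_r[OF k k] ne eq by (simp add: inner_diff_right inner_add_right)
 then show False using gnl unfolding genuinely_nonlinear_def Dl_def by auto
qed

text \<open>The factor 4 leaves room for wave and front speeds that deviate from the eigenvalues at
  \<open>U0\<close> by \<open>gam\<close> or \<open>2 * gam\<close>.\<close>

lemma lam_gap: "EX gam>0. ALL i:{1..CARD('n)}. ALL j:{1..CARD('n)}. lam i U0 ~= lam j U0 --> 4 * gam <= abs(lam i U0 - lam j U0)"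
proof -
 define S where "S = (%(i,j). abs(lam i U0 - lam j U0)) ` {(i,j). i : {1..CARD('n)} & j : {1..CARD('n)} & lam i U0 ~= lam j U0}"
 have "finite {(i,j). i : {1..CARD('n)} & j : {1..CARD('n)} & lam i U0 ~= lam j U0}"
  by (rule finite_subset[of _ "{1..CARD('n)} \<times> {1..CARD('n)}"]) auto
 then have fin: "finite (insert 1 S)" by (simp add: S_def)
 have pos: "0 < Min (insert 1 S)" using fin by (subst Min_gr_iff) (auto simp: S_def)
 have "4 * (Min (insert 1 S) / 4) <= abs(lam i U0 - lam j U0)" if "i : {1..CARD('n)}" "j : {1..CARD('n)}" "lam i U0 ~= lam j U0" for i j
 proof -
  have "abs(lam i U0 - lam j U0) : insert 1 S" using that by (force simp: S_def)
  then show ?thesis using Min_le[OF fin] by simp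
 qed
 then show ?thesis using pos by (intro exI[of _ "Min (insert 1 S) / 4"]) auto
qed

section \<open>Estimates near \<open>U0\<close> and the normal form of small Lax solutions\<close>

lemma F_quadratic:
 "EX C>=0. ALL u:cball U0 1. ALL v:cball U0 1. norm (F u - F v - A U0 (u - v)) <= C * (norm (u - U0) + norm (v - U0)) * norm (u - v)"
proof -
 have "EX L>=0. ALL x:cball U0 1. ALL y:cball U0 1. norm (A x b - A y b) <= L * norm (x - y)" for b
  unfolding A_def by (rule C1_lipschitz[OF smooth_C_k[OF smooth_frechet_derivative[OF smF]]])
 then obtain L where L: "!!b. 0 <= L b" "!!b x y. x : cball U0 1 ==> y : cball U0 1 ==> norm (A x b - A y b) <= L b * norm (x - y)" by metis
 define C where "C = (SUM b:Basis. L b)"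
 have C0: "0 <= C" using L by (auto simp: C_def intro: sum_nonneg)
 have on: "norm (A x v - A U0 v) <= C * norm (x - U0) * norm v" if x: "x : cball U0 1" for x v
 proof -
  have rep: "A y v = (SUM b:Basis. (v \<bullet> b) *\<^sub>R A y b)" for y
  proof -
   have "A y v = A y (SUM b:Basis. (v \<bullet> b) *\<^sub>R b)" by (simp add: euclidean_representation)
   then show ?thesis by (simp only: linear_sum[OF A_linear] linear_cmul[OF A_linear])
  qed
  have "A x v - A U0 v = (SUM b:Basis. (v \<bullet> b) *\<^sub>R (A x b - A U0 b))"
   unfolding rep[of x] rep[of U0] by (simp add: sum_subtractf scaleR_diff_right)
  also have "norm ... <= (SUM b:Basis. norm v * (L b * norm (x - U0)))"
  proof (rule order_trans[OF norm_sum], intro sum_mono)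
   fix b :: "real^'n" assume "b : Basis"
   then have "abs(v \<bullet> b) <= norm v" by (rule Basis_le_norm)
   then show "norm ((v \<bullet> b) *\<^sub>R (A x b - A U0 b)) <= norm v * (L b * norm (x - U0))"
    using L(2)[OF x, of U0 b] by (auto intro!: mult_mono)
  qed
  finally show ?thesis by (simp add: C_def sum_distrib_right sum_distrib_left mult_ac)
 qed
 have "norm (F u - F v - A U0 (u - v)) <= C * (norm (u - U0) + norm (v - U0)) * norm (u - v)"
  if uv: "u : cball U0 1" "v : cball U0 1" for u v
 proof -
  define rho where "rho = max (norm (u - U0)) (norm (v - U0))"
  have rho: "rho <= 1" "0 <= rho" "rho <= norm (u - U0) + norm (v - U0)" using uv by (auto simp: rho_def dist_norm norm_minus_commute le_max_iff_disj)
  have "norm ((F u - A U0 u) - (F v - A U0 v)) <= (C * rho) * norm (u - v)"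
  proof (rule differentiable_bound[of "cball U0 rho" "%x. F x - A U0 x" "%x h. A x h - A U0 h"])
   fix x assume x: "x : cball U0 rho"
   have "(A U0 has_derivative A U0) (at x within cball U0 rho)"
    by (rule bounded_linear_imp_has_derivative) (simp add: A_linear linear_conv_bounded_linear[symmetric])
   then show "((%x. F x - A U0 x) has_derivative (%h. A x h - A U0 h)) (at x within cball U0 rho)"
    by (intro has_derivative_diff has_derivative_at_withinI[OF F_deriv])
   show "onorm (%h. A x h - A U0 h) <= C * rho"
   proof (rule onorm_le)
    fix h :: "real^'n"
    have "C * norm (x - U0) * norm h <= C * rho * norm h"
     using x C0 by (intro mult_right_mono mult_left_mono) (auto simp: dist_norm norm_minus_commute)
    then show "norm (A x h - A U0 h) <= C * rho * norm h" using on[of x h] x rho by auto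
   qed
  qed (auto simp: rho_def dist_norm norm_minus_commute)
  also have "(C * rho) * norm (u - v) <= C * (norm (u - U0) + norm (v - U0)) * norm (u - v)"
   using rho C0 by (intro mult_right_mono mult_left_mono) auto
  finally show ?thesis by (simp add: linear_diff[OF A_linear] algebra_simps)
 qed
 then show ?thesis using C0 by blast
qed

lemma small_ball:
 assumes "0 < eta"
 shows "EX e>0. e <= 1 & (ALL u:cball U0 e. (ALL j:{1..CARD('n)}. abs(lam j u - lam j U0) <= eta & norm (r j u - r j U0) <= eta)
   & (ALL v:cball U0 e. norm (F u - F v - A U0 (u - v)) <= eta * norm (u - v)))"
proof -
 obtain C where C0: "C >= 0" and C1: "ALL u:cball U0 1. ALL v:cball U0 1. norm (F u - F v - A U0 (u - v)) <= C * (norm (u - U0) + norm (v - U0)) * norm (u - v)"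
  using F_quadratic by (elim exE conjE)
 note C = C0 C1[rule_format]
 have "\<forall>\<^sub>F u in nhds U0. ALL j:{1..CARD('n)}. dist (lam j u) (lam j U0) < eta & dist (r j u) (r j U0) < eta"
 proof (intro eventually_ball_finite ballI eventually_conj)
  fix j assume j: "j : {1..CARD('n)}"
  have "isCont (lam j) U0" using lam_differentiable[OF j] by (rule differentiable_imp_continuous_within)
  then show "\<forall>\<^sub>F u in nhds U0. dist (lam j u) (lam j U0) < eta"
   using assms unfolding isCont_def tendsto_at_iff_tendsto_nhds by (rule tendstoD)
  have "isCont (r j) U0" using smooth_differentiable[OF smooth_r[OF j]] by (rule differentiable_imp_continuous_within)
  then show "\<forall>\<^sub>F u in nhds U0. dist (r j u) (r j U0) < eta"
   using assms unfolding isCont_def tendsto_at_iff_tendsto_nhds by (rule tendstoD)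
 qed simp
 then obtain d where d: "d > 0" "!!u. dist u U0 < d ==> ALL j:{1..CARD('n)}. dist (lam j u) (lam j U0) < eta & dist (r j u) (r j U0) < eta"
  unfolding eventually_nhds_metric by blast
 define e where "e = min (min 1 (d/2)) (eta / (2 * C + 1))"
 have e: "0 < e" "e <= 1" "e <= d/2" "e <= eta / (2 * C + 1)"
 proof -
  show "0 < e" using d(1) C(1) assms by (simp add: e_def)
  show "e <= 1" "e <= d/2" "e <= eta / (2 * C + 1)" unfolding e_def by (meson min.cobounded1 min.cobounded2 order_trans)+
 qed
 have ec: "C * (2 * e) <= eta"
 proof -
  have "e * (2 * C + 1) <= eta" using e(4) C(1) by (simp add: pos_le_divide_eq)
  then show ?thesis using e(1) by (simp add: algebra_simps)
 qed
 show ?thesis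
 proof (intro exI[of _ e] conjI ballI)
  fix u j assume u: "u : cball U0 e" and j: "j : {1..CARD('n)}"
  have "dist u U0 < d" using u e d(1) by (simp add: dist_commute)
  then show "abs(lam j u - lam j U0) <= eta" "norm (r j u - r j U0) <= eta" using d(2)[of u] j by (auto simp: dist_norm dist_real_def intro: less_imp_le)
 next
  fix u v assume uv: "u : cball U0 e" "v : cball U0 e"
  have "norm (u - U0) + norm (v - U0) <= 2 * e" using uv by (auto simp: dist_norm norm_minus_commute)
  then have "C * (norm (u - U0) + norm (v - U0)) <= eta" using mult_left_mono[OF _ C(1)] ec by fastforce
  then have "C * (norm (u - U0) + norm (v - U0)) * norm (u - v) <= eta * norm (u - v)" by (intro mult_right_mono) auto
  then show "norm (F u - F v - A U0 (u - v)) <= eta * norm (u - v)" using C(2)[of u v] uv e by auto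
 qed (use e in auto)
qed

text \<open>What survives of \<open>elementary_wave\<close> once the contacts of a repeated
  eigenvalue are merged: for a jump, only the Rankine-Hugoniot relation and a speed close to
  \<open>lam j U0\<close>.\<close>

definition simple_wave :: "real => nat => real^'n => real^'n => real => real => (real => real^'n) => bool" where
 "simple_wave gam j u v a b w \<longleftrightarrow>
   (a = b & F v - F u = a *\<^sub>R (v - u) & abs(a - lam j U0) <= gam) |
   (genuinely_nonlinear (lam j) (r j) & a = lam j u & b = lam j v &
    (EX g. rarefaction lam r j u v g & (ALL xi:{a<..<b}. w xi = g xi)))"

definition shock :: "nat => real^'n => real^'n => real => real => bool" where
 "shock j u v a b \<longleftrightarrow> a = b & genuinely_nonlinear (lam j) (r j) & lax_shock F lam j u v a"

lemma elementary_wave_cases: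
 assumes "elementary_wave F lam r j u v a b w"
 shows "shock j u v a b | (a = lam j u & b = lam j v)"
 using assms unfolding elementary_wave_def shock_def contact_discontinuity_def by auto

lemma lam_distinct_everywhere: "i : {1..CARD('n)} ==> j : {1..CARD('n)} ==> i <= j ==> lam i U ~= lam j U ==> lam i V < lam j V"
 using lam_eq_everywhere[of i j V U] lam_mono[of i j V] by (auto simp: less_le)

text \<open>Only the values of \<open>w\<close> are known to be near \<open>U0\<close>, and
  \<open>w\<close> shows an intermediate state only where it occupies an interval. A state between
  different eigenvalues could be hidden only in a run of shocks of one speed, but then the Lax
  inequalities at the two ends of the run would bring two different eigenvalues within
  \<open>2 * gam\<close> of each other. States inside the group of a repeated eigenvalue escape this
  control, so each such group is replaced by a single jump.\<close>

lemma resolve_lax_solution: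
 assumes gap: "!!i j. i:{1..CARD('n)} ==> j:{1..CARD('n)} ==> lam i U0 ~= lam j U0 ==> 4 * gam <= abs(lam i U0 - lam j U0)"
  and gam: "0 < gam" and near: "!!u j. u : cball U0 e ==> j : {1..CARD('n)} ==> abs(lam j u - lam j U0) <= gam"
  and ul: "ul : cball U0 e" and ur: "ur : cball U0 e" and w: "!!xi. w xi : cball U0 e"
  and lax: "lax_riemann_solution F lam r ul ur w"
 shows "EX om a b. om 0 = ul & om (CARD('n)) = ur & (ALL j<=CARD('n). om j : cball U0 e) &
    (ALL j:{1..CARD('n)}. simple_wave gam j (om (j - 1)) (om j) (a j) (b j) w) &
    (ALL j:{1..<CARD('n)}. b j <= a (j + 1)) &
    (ALL xi<a 1. w xi = ul) &
    (ALL j:{1..<CARD('n)}. ALL xi:{b j<..<a (j + 1)}. w xi = om j) &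
    (ALL xi>b (CARD('n)). w xi = ur) &
    (ALL i:{1..CARD('n)}. ALL j:{1..CARD('n)}. i < j --> lam i U0 = lam j U0 --> om j = om (j - 1))"
proof -
 let ?n = "CARD('n)"
 obtain om a b where sol: "om 0 = ul" "om ?n = ur"
    "!!j. j:{1..?n} ==> elementary_wave F lam r j (om (j - 1)) (om j) (a j) (b j) w"
    "!!j. j:{1..<?n} ==> b j <= a (j + 1)"
    "!!xi. xi<a 1 ==> w xi = ul"
    "!!j xi. j:{1..<?n} ==> xi:{b j<..<a (j + 1)} ==> w xi = om j"
    "!!xi. xi>b ?n ==> w xi = ur"
  using lax unfolding lax_riemann_solution_def by blast
 have n1: "1 <= ?n" by (simp add: Suc_leI)
 \<comment> \<open>\<open>bd k\<close> marks the states that separate different eigenvalues, the two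
   data included.\<close>
 define bd where "bd k \<longleftrightarrow> k = 0 | k = ?n | (1 <= k & k < ?n & lam k U0 < lam (k + 1) U0)" for k
 define sh where "sh j \<longleftrightarrow> shock j (om (j - 1)) (om j) (a j) (b j)" for j
 have nsh: "a j = lam j (om (j - 1)) & b j = lam j (om j)" if "j : {1..?n}" "~ sh j" for j
  using elementary_wave_cases[OF sol(3)[OF that(1)]] that(2) by (auto simp: sh_def)
 have shd: "a j = b j" "lam j (om j) < a j" "a j < lam j (om (j - 1))" "1 < j ==> lam (j - 1) (om (j - 1)) < a j" "j < ?n ==> a j < lam (j + 1) (om j)"
  "genuinely_nonlinear (lam j) (r j)" "F (om j) - F (om (j - 1)) = a j *\<^sub>R (om j - om (j - 1))"
  if "sh j" for j using that unfolding sh_def shock_def lax_shock_def rankine_hugoniot_def by auto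
 have shbd: "bd j" "bd (j - 1)" if "sh j" "j : {1..?n}" for j
 proof -
  show "bd j"
  proof (cases "j = ?n")
   case False
   then have "lam j (om j) < lam (j + 1) (om j)" using shd(2)[OF that(1)] shd(5)[OF that(1)] that(2) by auto
   then have "lam j U0 < lam (j + 1) U0" using lam_distinct_everywhere[of j "j + 1"] that(2) False by force
   then show ?thesis using that(2) False by (auto simp: bd_def)
  qed (simp add: bd_def)
  show "bd (j - 1)"
  proof (cases "j = 1")
   case False
   then have "lam (j - 1) (om (j - 1)) < lam j (om (j - 1))" using shd(3)[OF that(1)] shd(4)[OF that(1)] that(2) by auto
   then have "lam (j - 1) U0 < lam j U0" using lam_distinct_everywhere[of "j - 1" j] that(2) False by force
   then show ?thesis using that(2) False by (auto simp: bd_def)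
  qed (simp add: bd_def)
 qed
 have visible: "om k : cball U0 e" if "k : {1..<?n}" "b k < a (k + 1)" for k
  using sol(6)[OF that(1), of "(b k + a (k + 1)) / 2"] w[of "(b k + a (k + 1)) / 2"] that(2) by auto
 \<comment> \<open>Every other combination contradicts a strict inequality at the common state
   \<open>om k\<close>, given either by the Lax conditions or by the order of the
   eigenvalues.\<close>
 have hidden: "sh k & sh (k + 1)" if k: "k : {1..<?n}" "bd k" "b k = a (k + 1)" for k
 proof -
  have lt: "lam k (om k) < lam (k + 1) (om k)"
   using k lam_distinct_everywhere[of k "k + 1" U0 "om k"] by (auto simp: bd_def)
  show ?thesis
  proof (cases "sh k"; cases "sh (k + 1)")
   assume "sh k" "~ sh (k + 1)"
   then show ?thesis using shd(1,5)[of k] nsh[of "k + 1"] k by auto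
  next
   assume "~ sh k" "sh (k + 1)"
   then show ?thesis using shd(1,4)[of "k + 1"] nsh[of k] k by auto
  next
   assume "~ sh k" "~ sh (k + 1)"
   then show ?thesis using nsh[of "k + 1"] nsh[of k] k lt by auto
  qed auto
 qed
 have bdnear: "om k : cball U0 e" if "k <= ?n" "bd k" for k
  using that
 proof (induction k rule: less_induct)
  case (less k)
  show ?case
  proof (cases "k = 0 | k = ?n | b k < a (k + 1)")
   case True
   then show ?thesis using sol ul ur visible[of k] less.prems by (cases "k = 0"; cases "k = ?n") auto
  next
   case False
   then have k: "k : {1..<?n}" "b k = a (k + 1)" using less.prems sol(4)[of k] by auto
   have shk: "sh k" using hidden[OF k(1) less.prems(2) k(2)] by simp
   have "om (k - 1) : cball U0 e" using less.IH[of "k - 1"] shbd(2)[OF shk] k(1) by auto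
   then have up: "a k < lam k U0 + gam" using shd(3)[OF shk] near[of "om (k - 1)" k] k(1) by auto
   \<comment> \<open>The end of the run of equal speeds that starts at \<open>k\<close>: the first
     later state that is visible or is the right datum.\<close>
   define m where "m = (LEAST m. k < m & (m = ?n | b m < a (m + 1)))"
   have ex: "k < ?n & (?n = ?n | b ?n < a (?n + 1))" using k(1) by auto
   have m: "k < m" "m = ?n | b m < a (m + 1)" using LeastI[of "%m. k < m & (m = ?n | b m < a (m + 1))", OF ex] unfolding m_def by auto
   have mn: "m <= ?n" unfolding m_def by (rule Least_le[of "%m. k < m & (m = ?n | b m < a (m + 1))", OF ex])
   have below: "b i = a (i + 1)" if "k <= i" "i < m" for i
   proof (cases "i = k")
    case False
    then have "~ (i = ?n | b i < a (i + 1))" using that not_less_Least[of i "%m. k < m & (m = ?n | b m < a (m + 1))"] unfolding m_def by auto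
    then show ?thesis using sol(4)[of i] that k(1) mn by auto
   qed (use k in simp)
   have chain: "sh i & a i = a k" if "k <= i" "i <= m" for i
    using that
   proof (induction i rule: dec_induct)
    case (step i)
    then have i: "sh i" "a i = a k" "i : {1..<?n}" using mn k(1) by auto
    have "sh (i + 1)" using hidden[OF i(3)] shbd(1)[OF i(1)] i(3) below[of i] step by auto
    moreover have "a (i + 1) = a k" using below[of i] shd(1)[OF i(1)] i(2) step by auto
    ultimately show ?case by simp
   qed (use shk in simp)
   have shm: "sh m" "a m = a k" using chain[of m] m by auto
   have "om m : cball U0 e"
   proof (cases "m = ?n")
    case True then show ?thesis using sol ur by simp
   next
    case False then show ?thesis using visible[of m] m mn k(1) by auto
   qed
   then have dn: "lam m U0 - gam < a k" using shd(2)[OF shm(1)] shm(2) near[of "om m" m] mn m k(1) by auto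
   have "lam k U0 < lam (k + 1) U0" using less.prems k by (auto simp: bd_def)
   also have "... <= lam m U0" using lam_mono[of "k + 1" m U0] m mn by auto
   finally have lt: "lam k U0 < lam m U0" .
   then have "4 * gam <= lam m U0 - lam k U0" using gap[of k m] k(1) m mn by auto
   then show ?thesis using up dn gam by linarith
  qed
 qed
 \<comment> \<open>For a wave \<open>j\<close> this is the last index of its eigenvalue
   group.\<close>
 define top where "top j = (LEAST k. j <= k & bd k)" for j
 have bdn: "bd ?n" by (simp add: bd_def)
 have top: "j <= top j" "bd (top j)" "top j <= ?n" "!!k. j <= k ==> k < top j ==> ~ bd k" if "j <= ?n" for j
 proof -
  have ex: "j <= ?n & bd ?n" using that bdn by simp
  show "j <= top j" "bd (top j)" using LeastI[of "%k. j <= k & bd k", OF ex] unfolding top_def by auto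
  show "top j <= ?n" unfolding top_def by (rule Least_le[of "%k. j <= k & bd k", OF ex])
  show "~ bd k" if "j <= k" "k < top j" for k
   using not_less_Least[of k "%k. j <= k & bd k"] that unfolding top_def by auto
 qed
 have top_bd: "top j = j" if "bd j" "j <= ?n" for j using top(1)[OF that(2)] top(4)[OF that(2), of j] that(1) by force
 have top_nbd: "top (j - 1) = top j" if "~ bd (j - 1)" "j : {1..?n}" for j
 proof (rule antisym)
  have "j - 1 <= ?n" "j <= ?n" using that by auto
  note t1 = top[OF this(1)] and t2 = top[OF this(2)]
  have "top (j - 1) ~= j - 1" using t1(2) that(1) by metis
  then have "j <= top (j - 1)" using t1(1) by linarith
  then show "top j <= top (j - 1)" unfolding top_def[of j] using t1(2) by (intro Least_le) auto
  show "top (j - 1) <= top j" unfolding top_def[of "j - 1"] using t2(1,2) by (intro Least_le) auto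
 qed
 \<comment> \<open>The whole jump of a group is attributed to its first index; the later indices
   become trivial waves.\<close>
 define om' where "om' j = om (top j)" for j
 have samelam: "lam i U0 = lam j U0" if "j : {1..?n}" "j <= i" "i <= top j" for i j
  using that(2,3)
 proof (induction i rule: dec_induct)
  case (step i)
  have tn: "top j <= ?n" using top(3)[of j] that(1) by auto
  have "~ bd i" using top(4)[of j i] that(1) step by auto
  then have "~ lam i U0 < lam (i + 1) U0" using step that(1) tn by (auto simp: bd_def)
  then have "lam (Suc i) U0 = lam i U0" using lam_mono[of i "Suc i" U0] step that(1) tn by auto
  then show ?case using step by auto
 qed simp
 \<comment> \<open>In a group of at least two, all fields are linearly degenerate by
   \<open>GNL_simple\<close>. Their contacts share one speed, so the Rankine-Hugoniot relations add
   up.\<close>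
 have group: "ALL i. j <= i & i <= top j --> a i = b i & a i = a j & F (om i) - F (om (j - 1)) = a j *\<^sub>R (om i - om (j - 1))"
  and groupa: "a j = lam j (om (j - 1))" if j: "j : {1..?n}" "j < top j" for j
 proof -
  have tn: "top j <= ?n" using top(3)[of j] j by auto
  have contact: "contact_discontinuity F lam i (om (i - 1)) (om i) (a i) & a i = b i" if i: "j <= i" "i <= top j" for i
  proof -
   have i1: "i : {1..?n}" using i j tn by auto
   have "~ genuinely_nonlinear (lam i) (r i)"
   proof
    assume g: "genuinely_nonlinear (lam i) (r i)"
    obtain k where "k : {j, top j}" "k ~= i" using j(2) by (metis insertCI less_irrefl)
    then have "k : {1..?n}" "lam i U0 = lam k U0" using samelam[OF j(1) i] samelam[OF j(1), of k] j tn by auto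
    then show False using GNL_simple[OF i1 _ _ g, of k U0] \<open>k ~= i\<close> by auto
   qed
   then show ?thesis using sol(3)[OF i1] unfolding elementary_wave_def by auto
  qed
  show "a j = lam j (om (j - 1))" using contact[of j] j by (auto simp: contact_discontinuity_def)
  have "a i = b i & a i = a j & F (om i) - F (om (j - 1)) = a j *\<^sub>R (om i - om (j - 1))" if "j <= i" "i <= top j" for i
   using that
  proof (induction i rule: dec_induct)
   case base
   then show ?case using contact[of j] j by (auto simp: contact_discontinuity_def rankine_hugoniot_def)
  next
   case (step i)
   then have IH: "a i = a j" "F (om i) - F (om (j - 1)) = a j *\<^sub>R (om i - om (j - 1))" by auto
   have c1: "a (Suc i) = b (Suc i)" "lam (Suc i) (om i) = a (Suc i)" "F (om (Suc i)) - F (om i) = a (Suc i) *\<^sub>R (om (Suc i) - om i)"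
    using contact[of "Suc i"] step by (auto simp: contact_discontinuity_def rankine_hugoniot_def)
   have c2: "lam i (om i) = a i" using contact[of i] step by (auto simp: contact_discontinuity_def)
   have si: "j <= i" "i <= top j" "j <= Suc i" "Suc i <= top j" using step.hyps step.prems by auto
   have "lam i U0 = lam (Suc i) U0" unfolding samelam[OF j(1) si(1,2)] samelam[OF j(1) si(3,4)] ..
   moreover have "i : {1..?n}" "Suc i : {1..?n}" using si j(1) tn by auto
   ultimately have "lam i (om i) = lam (Suc i) (om i)" using lam_eq_everywhere by blast
   then have aS: "a (Suc i) = a j" using c1 c2 IH by simp
   have "F (om (Suc i)) - F (om (j - 1)) = (F (om (Suc i)) - F (om i)) + (F (om i) - F (om (j - 1)))" by simp
   also have "... = a j *\<^sub>R (om (Suc i) - om (j - 1))" unfolding IH c1(3) aS by (simp add: scaleR_diff_right)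
   finally show ?case using c1 aS by simp
  qed
  then show "ALL i. j <= i & i <= top j --> a i = b i & a i = a j & F (om i) - F (om (j - 1)) = a j *\<^sub>R (om i - om (j - 1))" by blast
 qed
 have in': "om' j : cball U0 e" if "j <= ?n" for j unfolding om'_def using bdnear top[OF that] by auto
 have sw: "simple_wave gam j (om' (j - 1)) (om' j) (a j) (b j) w" if j: "j : {1..?n}" for j
 proof (cases "bd (j - 1)")
  case True
  then have u: "om' (j - 1) = om (j - 1)" using top_bd[of "j - 1"] j by (auto simp: om'_def)
  have un: "om (j - 1) : cball U0 e" using in'[of "j - 1"] u j by auto
  show ?thesis
  proof (cases "j < top j")
   case jt: True
   have "F (om' j) - F (om (j - 1)) = a j *\<^sub>R (om' j - om (j - 1))" using group[OF j jt] jt unfolding om'_def by auto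
   moreover have "a j = b j" using group[OF j jt] jt by auto
   moreover have "abs(a j - lam j U0) <= gam" unfolding groupa[OF j jt] using near[OF un j] .
   ultimately show ?thesis unfolding simple_wave_def u by auto
  next
   case False
   then have v: "om' j = om j" using top(1)[of j] j by (auto simp: om'_def)
   then have vn: "om j : cball U0 e" using in'[of j] j by auto
   show ?thesis
   proof (cases "sh j")
    case True
    have "abs(a j - lam j U0) <= gam" using shd(2,3)[OF True] near[OF un j] near[OF vn j] by auto
    then show ?thesis using shd[OF True] unfolding simple_wave_def u v by auto
   next
    case False
    then have ab: "a j = lam j (om (j - 1))" "b j = lam j (om j)" using nsh[OF j] by auto
    have "abs(a j - lam j U0) <= gam" unfolding ab using near[OF un j] .
    then show ?thesis using sol(3)[OF j] False unfolding elementary_wave_def simple_wave_def u v sh_def shock_def contact_discontinuity_def rankine_hugoniot_def by auto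
   qed
  qed
 next
  case False
  then have same: "om' (j - 1) = om' j" using top_nbd[OF False j] by (simp add: om'_def)
  have j1: "j - 1 : {1..?n}" "j - 1 < top (j - 1)" using False j top(1)[of j] top_nbd[OF False j] by (auto simp: bd_def)
  define k where "k = (LEAST k. top k = top j)"
  have kt: "top k = top j" unfolding k_def by (rule LeastI[of "%k. top k = top j" j]) simp
  have kj: "k <= j - 1" unfolding k_def using top_nbd[OF False j] by (intro Least_le) simp
  have k0: "k ~= 0"
  proof
   assume "k = 0"
   then have "top k = 0" using top_bd[of 0] by (simp add: bd_def)
   then show False using kt top(1)[of j] j by auto
  qed
  have kin: "k : {1..?n}" "k < top k" using k0 kj j kt top(1)[of j] by auto
  have bdk: "bd (k - 1)"
  proof (rule ccontr)
   assume "~ bd (k - 1)"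
   then have "top (k - 1) = top j" using top_nbd[of k] kin kt by simp
   then have "k <= k - 1" unfolding k_def by (intro Least_le)
   then show False using k0 by simp
  qed
  have un: "om (k - 1) : cball U0 e" using bdnear[OF _ bdk] kin by auto
  have jk: "k <= j" "j <= top k" using kj kt top(1)[of j] j by auto
  have "a j = b j" "a j = a k" using spec[OF group[OF kin], of j] jk by auto
  moreover have "abs(a k - lam j U0) <= gam"
   using groupa[OF kin] near[OF un kin(1)] samelam[OF kin(1) jk] by simp
  ultimately show ?thesis unfolding simple_wave_def same by simp
 qed
 have mid: "w xi = om' j" if j: "j : {1..<?n}" and xi: "xi:{b j<..<a (j + 1)}" for j xi
 proof (cases "bd j")
  case True
  then show ?thesis using sol(6)[OF j xi] top_bd[of j] j by (simp add: om'_def)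
 next
  case False
  have "top j ~= j" using False top(2)[of j] j by auto
  then have "j < top j" "Suc j <= top j" using top(1)[of j] j by auto
  then have "b j = a j" "a (j + 1) = a j" using spec[OF group[of j], of j] spec[OF group[of j], of "j + 1"] j by auto
  then show ?thesis using xi by simp
 qed
 have "om' j = om' (j - 1)" if "i : {1..?n}" "j : {1..?n}" "i < j" "lam i U0 = lam j U0" for i j
 proof -
  have "1 <= i" "i <= j - 1" "j - 1 <= ?n" "1 <= j - 1" "j - 1 <= j" "j <= ?n" using that(1-3) unfolding atLeastAtMost_iff by arith+
  then have "lam i U0 <= lam (j - 1) U0" "lam (j - 1) U0 <= lam j U0" by (auto intro: lam_mono)
  then have "lam (j - 1) U0 = lam j U0" using that(4) by simp
  then have "~ bd (j - 1)" using that by (auto simp: bd_def)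
  then show ?thesis using top_nbd that by (simp add: om'_def)
 qed
 moreover have "om' 0 = ul" "om' ?n = ur" using top_bd[of 0] top_bd[of ?n] sol by (auto simp: om'_def bd_def)
 ultimately show ?thesis using in' sw sol(4,5,7) mid
  by (intro exI[of _ om'] exI[of _ a] exI[of _ b] conjI ballI allI impI) auto
qed

end

section \<open>The error of a single wave as a solution of the Riemann problem\<close>

text \<open>An L1 bound, in the self-similar variable, for the difference between \<open>w\<close>
  and a single jump of speed \<open>s\<close>. The dominating \<open>G\<close> avoids any claim
  about the measurability of \<open>w\<close>, and \<open>Z\<close> accounts for the free values at
  jumps.\<close>

abbreviation profile_error ::
  "(real => 'a::real_normed_vector) => 'a => 'a => real => real => bool" where
 "profile_error w ul ur s e \<equiv> EX G Z. integrable lborel G & (ALL xi. 0 <= G xi) & finite Z &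
   (ALL xi. xi ~: Z --> norm (w xi - (if xi < s then ul else ur)) <= G xi) & (LINT xi|lborel. G xi) <= e"

text \<open>The error that may remain when the Rankine-Hugoniot residual vanishes, because
  \<open>s\<close> lies inside a rarefaction fan of family \<open>j\<close>. Degenerate fields have
  no fans, and \<open>riemann_error\<close> shows that a jump \<open>u\<close> which clearly
  decreases along \<open>r j\<close> has none around \<open>s\<close>.\<close>

abbreviation rarefaction_term ::
  "(nat => real^'n => real) => (nat => real^'n => real^'n) => (nat => real^'n => real^'n) =>
   real^'n => real => real => nat => real^'n => real" where
 "rarefaction_term lam l r U0 k C j u \<equiv>
   if linearly_degenerate (lam j) (r j) | l j U0 \<bullet> u <= - k * norm u then 0 else C * (norm u)\<^sup>2"

text \<open>The property of \<open>R\<close> in the last clause of \<open>standard_riemann_semigroup\<close>.\<close>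

abbreviation riemann_exact ::
  "(real^'n => real^'n) => (nat => real^'n => real) => (nat => real^'n => real^'n) =>
   (real => real^'n) set => (real => (real => real^'n) => (real => real^'n)) =>
   (real^'n => real^'n => real => real^'n) => bool" where
 "riemann_exact F lam r \<D> S R \<equiv> ALL v:\<D>. ALL N p u. piecewise_constant N p u v -->
   (ALL i:{1..N}. lax_riemann_solution F lam r (u (i - 1)) (u i) (R (u (i - 1)) (u i))) &
   (EX dl>0. ALL t:{0<..dl}. AE x in lborel.
    ALL i:{1..N}. (ALL k:{1..N}. abs(x - p i) <= abs(x - p k)) --> S t v x = R (u (i - 1)) (u i) ((x - p i) / t))"

text \<open>Diagonal dominance: each wave is seen by the projections of its own eigenvalue group,
  while the other projections are smaller by the factor \<open>th\<close> and can be absorbed. Thus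
  bounds of single waves by their own projections become a bound by the projections of the sum of
  all waves. The set \<open>X\<close> will hold the fans that contain the speed
  \<open>s\<close>.\<close>

lemma group_sum_bound:
 fixes c :: "nat => nat => real" and z mu :: "nat => real" and K th :: real
 assumes J: "finite J" and z: "!!j. j : J ==> 0 <= z j" and K: "0 <= K" and th: "0 <= th" "K * card J * card J * th <= 1 / 2"
  and off: "!!m j. m : J ==> j : J ==> mu m ~= mu j ==> abs(c m j) <= th * z j"
  and own: "!!j. j : J - X ==> z j <= K * (SUM m:{m:J. mu m = mu j}. abs(c m j))"
  and single: "!!i j m. i : J ==> j : J ==> i < j ==> mu i = mu j ==> z j = 0 & c m j = 0"
 shows "sum z (J - X) <= 2 * K * card J * (SUM m:J. abs(SUM j:J. c m j)) + sum z (J \<inter> X)"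
proof -
 define S where "S m = (SUM j:J. c m j)" for m
 define Z where "Z = sum z J"
 have Z0: "0 <= Z" unfolding Z_def using z by (intro sum_nonneg) auto
 have zj: "z j <= K * (SUM m:J. abs(S m)) + K * card J * th * Z" if j: "j : J - X" for j
 proof (cases "EX i:J. i < j & mu i = mu j")
  case True
  then have "z j = 0" using single j by blast
  moreover have "0 <= K * (SUM m:J. abs(S m))" "0 <= K * card J * th * Z" using K th Z0 by (auto intro!: mult_nonneg_nonneg sum_nonneg)
  ultimately show ?thesis by linarith
 next
  case False
  have cm: "abs(c m j) <= abs(S m) + th * Z" if m: "m : J" "mu m = mu j" for m
  proof -
   have "S m = c m j + (SUM i:J - {j}. c m i)" unfolding S_def using J j by (intro sum.remove) auto
   moreover have "abs(SUM i:J - {j}. c m i) <= (SUM i:J - {j}. th * z i)"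
   proof (rule order_trans[OF sum_abs], intro sum_mono)
    fix i assume i: "i : J - {j}"
    show "abs(c m i) <= th * z i"
    proof (cases "mu i = mu j")
     case True
     then have "j < i" using False i by force
     then have "z i = 0 & c m i = 0" using single[of j i m] True i j by auto
     then show ?thesis by simp
    next
     case False
     then show ?thesis using off[OF m(1), of i] m i by auto
    qed
   qed
   moreover have "(SUM i:J - {j}. th * z i) <= th * Z"
    unfolding Z_def sum_distrib_left using J z th by (intro sum_mono2) auto
   ultimately show ?thesis by linarith
  qed
  have "(SUM m:{m:J. mu m = mu j}. abs(c m j)) <= (SUM m:{m:J. mu m = mu j}. abs(S m) + th * Z)" using cm by (intro sum_mono) auto
  also have "... <= (SUM m:J. abs(S m) + th * Z)" using J th Z0 by (intro sum_mono2) auto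
  also have "... = (SUM m:J. abs(S m)) + card J * (th * Z)" by (simp add: sum.distrib)
  finally have "K * (SUM m:{m:J. mu m = mu j}. abs(c m j)) <= K * ((SUM m:J. abs(S m)) + card J * (th * Z))" using K by (rule mult_left_mono)
  then show ?thesis using own[OF j] by (simp add: algebra_simps)
 qed
 have "sum z (J - X) <= (SUM j:J - X. K * (SUM m:J. abs(S m)) + K * card J * th * Z)" using zj by (intro sum_mono) auto
 also have "... <= (SUM j:J. K * (SUM m:J. abs(S m)) + K * card J * th * Z)"
  using J K th Z0 by (intro sum_mono2) (auto intro!: add_nonneg_nonneg mult_nonneg_nonneg sum_nonneg)
 also have "... = K * card J * (SUM m:J. abs(S m)) + (K * card J * card J * th) * Z" by (simp add: algebra_simps)
 also have "(K * card J * card J * th) * Z <= 1 / 2 * Z" using th(2) Z0 by (rule mult_right_mono)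
 also have "Z = sum z (J - X) + sum z (J \<inter> X)"
  unfolding Z_def using sum.Int_Diff[OF J, of z X] by simp
 finally show ?thesis by (simp add: S_def algebra_simps)
qed

lemma absorb_quarter:
 fixes x L Y :: real
 assumes "x * (L / 2) <= Y + 1 / 4 * (L * x)"
 shows "x * L / 4 <= Y"
proof -
 have "x * (L / 2) = 2 * (x * L / 4)" "1 / 4 * (L * x) = x * L / 4" by simp_all
 then show ?thesis using assms by linarith
qed

context hyperbolic_system begin

text \<open>\<open>D\<close> bounds the size of the wave, and \<open>max b s - min a s\<close> is
  the length on which it is misplaced relative to a jump of speed \<open>s\<close>; their product
  has to be recovered from the residual \<open>F v - F u - s *\<^sub>R (v - u)\<close>. For a jump
  the residual is \<open>(a - s) *\<^sub>R (v - u)\<close>. For a fan it is the integral of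
  \<open>(xi - s) *\<^sub>R r j (g xi)\<close>, close to
  \<open>((b - a) * ((a + b) / 2 - s)) *\<^sub>R r j U0\<close>. The leading factor of this can
  vanish for a nontrivial fan only if \<open>s\<close> lies inside it, the case that gets the weaker
  bound \<open>D\<^sup>2\<close>.\<close>

lemma wave_estimate:
 assumes gap: "!!i j. i:{1..CARD('n)} ==> j:{1..CARD('n)} ==> lam i U0 ~= lam j U0 ==> 4 * gam <= abs(lam i U0 - lam j U0)"
  and eta: "0 < eta" "eta <= gam" "eta <= 1"
  and ball: "!!u j. u : cball U0 e ==> j : {1..CARD('n)} ==> norm (r j u - r j U0) <= eta"
   "!!u v. u : cball U0 e ==> v : cball U0 e ==> norm (F u - F v - A U0 (u - v)) <= eta * norm (u - v)"
  and Kl: "1 <= Kl" "!!m. m:{1..CARD('n)} ==> norm (l m U0) <= Kl" and Kr: "1 <= Kr" "!!m. m:{1..CARD('n)} ==> norm (r m U0) <= Kr"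
  and th: "Kl * eta <= th" "Kl * eta <= th * gam" "Kr * CARD('n) * th <= 1 / 2" "Kl * eta <= 1 / 4"
  and K: "4 * (Kr + 1) <= K"
  and j: "j : {1..CARD('n)}" and sw: "simple_wave eta j u v a b w" and u: "u : cball U0 e" and v: "v : cball U0 e" and w: "!!xi. w xi : cball U0 e"
 shows "EX D>=0. a <= b & norm (v - u) <= D & (ALL xi:{a<..<b}. norm (w xi - u) <= D & norm (w xi - v) <= D) & (u = v --> D = 0) &
   (ALL m:{1..CARD('n)}. lam m U0 ~= lam j U0 --> abs(l m U0 \<bullet> (v - u)) <= th * D) &
   D <= K * (SUM m:{m:{1..CARD('n)}. lam m U0 = lam j U0}. abs(l m U0 \<bullet> (v - u))) &
   (ALL s. (ALL m:{1..CARD('n)}. lam m U0 ~= lam j U0 --> abs(l m U0 \<bullet> (F v - F u - s *\<^sub>R (v - u))) <= th * (D * (max b s - min a s))) &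
    (~ (genuinely_nonlinear (lam j) (r j) & a < s & s < b) -->
      D * (max b s - min a s) <= K * (SUM m:{m:{1..CARD('n)}. lam m U0 = lam j U0}. abs(l m U0 \<bullet> (F v - F u - s *\<^sub>R (v - u))))) &
    (genuinely_nonlinear (lam j) (r j) & a < s & s < b -->
      D * (max b s - min a s) <= D\<^sup>2 & (b - a) / 2 <= l j U0 \<bullet> (v - u) & abs(a - lam j U0) <= eta + abs(lam j u - lam j U0) & a = lam j u & b = lam j v))"
proof -
 let ?G = "{m:{1..CARD('n)}. lam m U0 = lam j U0}"
 let ?q = "%s. F v - F u - s *\<^sub>R (v - u)" and ?own = "%x. SUM m:?G. abs(l m U0 \<bullet> x)"
 have gam: "0 < gam" using eta by linarith
 have th0: "0 <= th" using th(1) Kl(1) eta(1) mult_nonneg_nonneg[of Kl eta] by linarith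
 have l_le: "abs(l m U0 \<bullet> x) <= Kl * norm x" if "m : {1..CARD('n)}" for m x
  using Cauchy_Schwarz_ineq2[of "l m U0" x] mult_right_mono[OF Kl(2)[OF that] norm_ge_zero[of x]] by linarith
 have K0: "0 <= K" "2 * Kr <= K" using K Kr by auto
 show ?thesis
  using sw unfolding simple_wave_def
 proof (elim disjE conjE exE)
  assume ab: "a = b" and RH: "F v - F u = a *\<^sub>R (v - u)" and near: "abs(a - lam j U0) <= eta"
  define d where "d = v - u"
  have off: "abs(l m U0 \<bullet> d) <= th * norm d" if m: "m : {1..CARD('n)}" "lam m U0 ~= lam j U0" for m
  proof -
   have "gam <= abs(lam m U0 - a)" using gap[OF m(1) j m(2)] near eta gam by linarith
   then have "gam * abs(l m U0 \<bullet> d) <= abs(lam m U0 - a) * abs(l m U0 \<bullet> d)" by (intro mult_right_mono) auto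
   also have "... = abs(l m U0 \<bullet> (A U0 d - a *\<^sub>R d))"
    by (simp add: inner_diff_right l_A[OF m(1)] abs_mult[symmetric] left_diff_distrib)
   also have "A U0 d - a *\<^sub>R d = - (F v - F u - A U0 (v - u))" using RH by (simp add: d_def)
   also have "abs(l m U0 \<bullet> ...) <= Kl * norm (F v - F u - A U0 (v - u))" using l_le[OF m(1)] by (metis norm_minus_cancel)
   also have "... <= Kl * (eta * norm d)" using ball(2)[OF v u] Kl by (auto simp: d_def intro!: mult_left_mono)
   also have "... <= th * gam * norm d" using mult_right_mono[OF th(2) norm_ge_zero[of d]] by simp
   finally have "gam * abs(l m U0 \<bullet> d) <= gam * (th * norm d)" by (simp add: mult_ac)
   then show ?thesis using gam by simp
  qed
  have own: "norm d <= K * ?own d"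
  proof -
   have "norm d = norm (SUM m:{1..CARD('n)}. (l m U0 \<bullet> d) *\<^sub>R r m U0)" using r_expansion[of d U0] by simp
   also have "... <= (SUM m:{1..CARD('n)}. abs(l m U0 \<bullet> d) * Kr)"
    using Kr by (intro order_trans[OF norm_sum] sum_mono) (auto intro!: mult_left_mono)
   also have "... = (SUM m:?G. abs(l m U0 \<bullet> d) * Kr) + (SUM m:{1..CARD('n)} - ?G. abs(l m U0 \<bullet> d) * Kr)"
    by (rule sum.subset_diff[where A="{1..CARD('n)}" and B="?G", THEN trans[OF _ add.commute]]) auto
   also have "(SUM m:{1..CARD('n)} - ?G. abs(l m U0 \<bullet> d) * Kr) <= (SUM m:{1..CARD('n)}. th * norm d * Kr)"
   proof (rule order_trans[OF sum_mono sum_mono2])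
    show "abs(l m U0 \<bullet> d) * Kr <= th * norm d * Kr" if "m : {1..CARD('n)} - ?G" for m
     using off[of m] that Kr by (auto intro!: mult_right_mono)
   qed (use th0 Kr in auto)
   also have "(SUM m:{1..CARD('n)}. th * norm d * Kr) = (Kr * CARD('n) * th) * norm d" by simp
   also have "... <= 1 / 2 * norm d" by (rule mult_right_mono[OF th(3) norm_ge_zero])
   finally have 1: "norm d <= (SUM m:?G. abs(l m U0 \<bullet> d) * Kr) + 1 / 2 * norm d" by simp
   have "(SUM m:?G. abs(l m U0 \<bullet> d) * Kr) = Kr * ?own d" by (simp add: sum_distrib_left mult.commute)
   with 1 have "norm d <= 2 * Kr * ?own d" by linarith
   also have "... <= K * ?own d" using K0 by (intro mult_right_mono sum_nonneg) auto
   finally show ?thesis .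
  qed
  have q: "?q s = (a - s) *\<^sub>R d" for s using RH by (simp add: d_def scaleR_diff_left)
  have len: "max b s - min a s = abs(a - s)" for s using ab by (auto simp: max_def min_def)
  have 1: "abs(l m U0 \<bullet> ?q s) <= th * (norm d * (max b s - min a s))" if "m : {1..CARD('n)}" "lam m U0 ~= lam j U0" for m s
   unfolding q len inner_scaleR_right abs_mult using mult_left_mono[OF off[OF that] abs_ge_zero[of "a - s"]] by (simp add: mult_ac)
  have 2: "norm d * (max b s - min a s) <= K * ?own (?q s)" for s
  proof -
   have "norm d * abs(a - s) <= (K * ?own d) * abs(a - s)" by (rule mult_right_mono[OF own]) simp
   also have "... = K * (SUM m:?G. abs(l m U0 \<bullet> ((a - s) *\<^sub>R d)))"
    by (simp add: sum_distrib_right sum_distrib_left abs_mult mult_ac)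
   finally show ?thesis unfolding q len .
  qed
  show ?thesis
   by (intro exI[of _ "norm d"] conjI allI impI ballI) (use ab off own 1 2 in \<open>auto simp: d_def\<close>)
 next
  fix g
  assume gnl: "genuinely_nonlinear (lam j) (r j)" and a: "a = lam j u" and b: "b = lam j v"
   and rar: "rarefaction lam r j u v g" and wg: "ALL xi:{a<..<b}. w xi = g xi"
  have ab: "a <= b" and ga: "g a = u" and gb: "g b = v" and gd: "!!xi. xi : {a..b} ==> (g has_vector_derivative r j (g xi)) (at xi within {a..b})"
   using rar unfolding rarefaction_def a b by auto
  define B1 where "B1 = Kr + 1"
  have B1: "1 <= B1" using Kr by (simp add: B1_def)
  \<comment> \<open>Interior points of the curve are values of the profile, hence lie in the
    ball.\<close>
  have gin: "g xi : cball U0 e" if x: "xi : {a..b}" for xi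
  proof -
   consider "xi = a" | "xi = b" | "xi : {a<..<b}" using x by fastforce
   then show ?thesis using ga gb u v w[of xi] wg by cases auto
  qed
  have lamg: "lam j (g xi) = xi" if xi: "xi : {a..b}" for xi
  proof -
   have "norm ((lam j (g xi) - xi) - (lam j (g a) - a)) <= 0 * abs(xi - a)"
   proof (rule vector_derivative_bound[of "{a..b}" "%xi. lam j (g xi) - xi" "%_. 0"])
    fix x assume x: "x : {a..b}"
    have "(g has_derivative (%h. h *\<^sub>R r j (g x))) (at x within {a..b})" using gd[OF x] by (simp add: has_vector_derivative_def)
    then have "((%x. lam j (g x)) has_derivative (%h. frechet_derivative (lam j) (at (g x)) (h *\<^sub>R r j (g x)))) (at x within {a..b})"
     by (rule has_derivative_compose[OF _ lam_has_derivative[OF j]])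
    moreover have "frechet_derivative (lam j) (at (g x)) (h *\<^sub>R r j (g x)) = h *\<^sub>R 1" for h
     using gnl linear_cmul[OF linear_frechet_derivative[OF lam_differentiable[OF j]], of "g x" h "r j (g x)"] unfolding genuinely_nonlinear_def by simp
    ultimately have "((%x. lam j (g x)) has_vector_derivative 1) (at x within {a..b})" unfolding has_vector_derivative_def by simp
    then have "((%xi. lam j (g xi) - xi) has_vector_derivative 1 - 1) (at x within {a..b})"
     by (rule has_vector_derivative_diff) (auto intro: has_vector_derivative_id)
    then show "((%xi. lam j (g xi) - xi) has_vector_derivative 0) (at x within {a..b})" by simp
   qed (use xi ab in auto)
   then show ?thesis using ga a by simp
  qed
  have rn: "norm (r j (g xi)) <= B1" if "xi : {a..b}" for xi
   using norm_triangle_sub[of "r j (g xi)" "r j U0"] ball(1)[OF gin[OF that] j] Kr(2)[OF j] eta by (simp add: B1_def)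
  have lr: "abs(l m U0 \<bullet> r j (g xi) - (if m = j then 1 else 0)) <= Kl * eta" if "xi : {a..b}" "m : {1..CARD('n)}" for xi m
  proof -
   have "l m U0 \<bullet> r j (g xi) - (if m = j then 1 else 0) = l m U0 \<bullet> (r j (g xi) - r j U0)" using l_r[OF that(2) j] by (simp add: inner_diff_right)
   also have "abs(...) <= Kl * norm (r j (g xi) - r j U0)" by (rule l_le[OF that(2)])
   also have "... <= Kl * eta" using ball(1)[OF gin[OF that(1)] j] Kl by (intro mult_left_mono) auto
   finally show ?thesis .
  qed
  have gdiff: "norm (g x - g y) <= B1 * (b - a)" if "x : {a..b}" "y : {a..b}" for x y
  proof -
   have "norm (g x - g y) <= B1 * abs(x - y)"
    by (rule vector_derivative_bound[of "{a..b}", OF _ gd rn]) (use that in auto)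
   also have "... <= B1 * (b - a)" using that B1 by (intro mult_left_mono) auto
   finally show ?thesis .
  qed
  define Q where "Q s xi = F (g xi) - s *\<^sub>R g xi" for s xi
  have Qd: "(Q s has_vector_derivative (xi - s) *\<^sub>R r j (g xi)) (at xi within {a..b})" if xi: "xi : {a..b}" for s xi
  proof -
   have "(g has_derivative (%h. h *\<^sub>R r j (g xi))) (at xi within {a..b})" using gd[OF xi] by (simp add: has_vector_derivative_def)
   then have "((%x. F (g x)) has_derivative (%h. A (g xi) (h *\<^sub>R r j (g xi)))) (at xi within {a..b})"
    by (rule has_derivative_compose[OF _ F_deriv])
   moreover have "A (g xi) (h *\<^sub>R r j (g xi)) = h *\<^sub>R (xi *\<^sub>R r j (g xi))" for h
    by (simp add: linear_cmul[OF A_linear] A_r[OF j] lamg[OF xi])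
   ultimately have "((%x. F (g x)) has_vector_derivative xi *\<^sub>R r j (g xi)) (at xi within {a..b})" unfolding has_vector_derivative_def by simp
   moreover have "((%x. s *\<^sub>R g x) has_vector_derivative s *\<^sub>R r j (g xi)) (at xi within {a..b})"
    by (rule bounded_linear.has_vector_derivative[OF bounded_linear_scaleR_right gd[OF xi]])
   ultimately show ?thesis unfolding Q_def scaleR_diff_left by (rule has_vector_derivative_diff)
  qed
  have q: "?q s = Q s b - Q s a" for s unfolding Q_def ga gb by (simp add: scaleR_diff_right)
  have lQ: "abs(l m U0 \<bullet> ?q s - (if m = j then (b - a) * ((a + b) / 2 - s) else 0)) <= Kl * eta * (max b s - min a s) * (b - a)"
   if m: "m : {1..CARD('n)}" for m s
  proof -
   define dl where "dl = (if m = j then 1 else 0 :: real)"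
   define H where "H xi = l m U0 \<bullet> Q s xi - dl * (xi - s)\<^sup>2 / 2" for xi
   have "norm (H b - H a) <= (Kl * eta * (max b s - min a s)) * abs(b - a)"
   proof (rule vector_derivative_bound[of "{a..b}" H "%xi. l m U0 \<bullet> ((xi - s) *\<^sub>R r j (g xi)) - dl * (xi - s)"])
    fix xi assume xi: "xi : {a..b}"
    have "((%xi. l m U0 \<bullet> Q s xi) has_vector_derivative l m U0 \<bullet> ((xi - s) *\<^sub>R r j (g xi))) (at xi within {a..b})"
     by (rule bounded_linear.has_vector_derivative[OF bounded_linear_inner_right Qd[OF xi]])
    moreover have "((%xi. dl * (xi - s)\<^sup>2 / 2) has_vector_derivative dl * (xi - s)) (at xi within {a..b})"
     unfolding has_real_derivative_iff_has_vector_derivative[symmetric] by (auto intro!: derivative_eq_intros)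
    ultimately show "(H has_vector_derivative l m U0 \<bullet> ((xi - s) *\<^sub>R r j (g xi)) - dl * (xi - s)) (at xi within {a..b})"
     unfolding H_def by (rule has_vector_derivative_diff)
    have "l m U0 \<bullet> ((xi - s) *\<^sub>R r j (g xi)) - dl * (xi - s) = (xi - s) * (l m U0 \<bullet> r j (g xi) - dl)" by (simp add: algebra_simps)
    also have "abs(...) <= (max b s - min a s) * (Kl * eta)"
     unfolding abs_mult using lr[OF xi m] xi by (intro mult_mono) (auto simp: dl_def max_def min_def)
    finally show "norm (l m U0 \<bullet> ((xi - s) *\<^sub>R r j (g xi)) - dl * (xi - s)) <= Kl * eta * (max b s - min a s)" by (simp add: mult_ac)
   qed (use ab in auto)
   moreover have "H b - H a = l m U0 \<bullet> ?q s - (if m = j then (b - a) * ((a + b) / 2 - s) else 0)"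
    unfolding q H_def dl_def by (simp add: inner_diff_right power2_eq_square field_simps)
   ultimately show ?thesis using ab by simp
  qed
  have ld: "abs(l m U0 \<bullet> (v - u) - (if m = j then b - a else 0)) <= Kl * eta * (b - a)" if m: "m : {1..CARD('n)}" for m
  proof -
   define dl where "dl = (if m = j then 1 else 0 :: real)"
   define H where "H xi = l m U0 \<bullet> g xi - dl * xi" for xi
   have "norm (H b - H a) <= (Kl * eta) * abs(b - a)"
   proof (rule vector_derivative_bound[of "{a..b}" H "%xi. l m U0 \<bullet> r j (g xi) - dl"])
    fix xi assume xi: "xi : {a..b}"
    have "((%xi. l m U0 \<bullet> g xi) has_vector_derivative l m U0 \<bullet> r j (g xi)) (at xi within {a..b})"
     by (rule bounded_linear.has_vector_derivative[OF bounded_linear_inner_right gd[OF xi]])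
    moreover have "((%xi. dl * xi) has_vector_derivative dl) (at xi within {a..b})"
     unfolding has_real_derivative_iff_has_vector_derivative[symmetric] by (auto intro!: derivative_eq_intros)
    ultimately show "(H has_vector_derivative l m U0 \<bullet> r j (g xi) - dl) (at xi within {a..b})"
     unfolding H_def by (rule has_vector_derivative_diff)
    show "norm (l m U0 \<bullet> r j (g xi) - dl) <= Kl * eta" using lr[OF xi m] by (simp add: dl_def)
   qed (use ab in auto)
   moreover have "H b - H a = l m U0 \<bullet> (v - u) - (if m = j then b - a else 0)"
    unfolding H_def dl_def ga gb by (simp add: inner_diff_right)
   ultimately show ?thesis using ab by simp
  qed
  define D where "D = B1 * (b - a)"
  have D0: "0 <= D" "b - a <= D" using B1 ab mult_right_mono[OF B1, of "b - a"] by (auto simp: D_def)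
  have len0: "0 <= max b s - min a s" for s using ab by (auto simp: max_def min_def)
  have off: "abs(l m U0 \<bullet> (v - u)) <= th * D" if "m : {1..CARD('n)}" "lam m U0 ~= lam j U0" for m
  proof -
   have "m ~= j" using that by auto
   then have "abs(l m U0 \<bullet> (v - u)) <= Kl * eta * (b - a)" using ld[OF that(1)] by simp
   also have "... <= th * D" using th D0 ab th0 by (intro mult_mono) auto
   finally show ?thesis .
  qed
  have ljd: "(b - a) / 2 <= l j U0 \<bullet> (v - u)"
  proof -
   have "Kl * eta * (b - a) <= 1 / 4 * (b - a)" using th(4) ab by (intro mult_right_mono) auto
   then show ?thesis using ld[OF j] ab by (simp add: abs_le_iff)
  qed
  have jG: "j : ?G" using j by simp
  have own: "D <= K * ?own (v - u)"
  proof -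
   have "2 * B1 <= K" using K Kr by (simp add: B1_def)
   then have "(2 * B1) * ((b - a) / 2) <= K * ((b - a) / 2)" using ab by (intro mult_right_mono) auto
   then have "D <= K * ((b - a) / 2)" by (simp add: D_def)
   also have "... <= K * abs(l j U0 \<bullet> (v - u))" using ljd K0 by (intro mult_left_mono) auto
   also have "... <= K * ?own (v - u)" using jG K0 by (intro mult_left_mono member_le_sum[of j ?G "%m. abs(l m U0 \<bullet> (v - u))"]) auto
   finally show ?thesis .
  qed
  have off2: "abs(l m U0 \<bullet> ?q s) <= th * (D * (max b s - min a s))" if "m : {1..CARD('n)}" "lam m U0 ~= lam j U0" for m s
  proof -
   have "m ~= j" using that by auto
   then have "abs(l m U0 \<bullet> ?q s) <= Kl * eta * (max b s - min a s) * (b - a)" using lQ[OF that(1)] by simp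
   also have "... = (Kl * eta) * ((b - a) * (max b s - min a s))" by simp
   also have "... <= th * (D * (max b s - min a s))" using th D0 ab th0 len0 by (intro mult_mono) auto
   finally show ?thesis .
  qed
  have own2: "D * (max b s - min a s) <= K * ?own (?q s)" if s: "~ (a < s & s < b)" for s
  proof -
   define L where "L = max b s - min a s"
   have half: "L / 2 <= abs((a + b) / 2 - s)"
   proof (cases "s <= a")
    case True
    then have "L = b - s" using ab by (simp add: L_def)
    moreover have "(b - s) / 2 <= (a + b) / 2 - s" using True by (simp add: field_simps)
    ultimately have "L / 2 <= (a + b) / 2 - s" by simp
    then show ?thesis by (rule order_trans[OF _ abs_ge_self])
   next
    case False
    then have "b <= s" using s by auto
    then have "L = s - a" using ab by (simp add: L_def)
    moreover have "(s - a) / 2 <= - ((a + b) / 2 - s)" using \<open>b <= s\<close> by (simp add: field_simps)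
    ultimately have "L / 2 <= - ((a + b) / 2 - s)" by simp
    then show ?thesis by (rule order_trans[OF _ abs_ge_minus_self])
   qed
   have "(b - a) * (L / 2) <= (b - a) * abs((a + b) / 2 - s)" using half ab by (intro mult_left_mono) auto
   also have "... = abs((b - a) * ((a + b) / 2 - s))" using ab by (simp add: abs_mult)
   also have "... <= abs(l j U0 \<bullet> ?q s) + Kl * eta * L * (b - a)"
   proof -
    have gen: "abs y <= abs x + c" if "abs(x - y) <= c" for x y c :: real using that by linarith
    show ?thesis using lQ[OF j, of s] unfolding L_def by (intro gen) simp
   qed
   also have "Kl * eta * L * (b - a) <= 1 / 4 * (L * (b - a))"
    using mult_right_mono[OF th(4), of "L * (b - a)"] len0[of s] ab by (simp add: L_def)
   finally have 0: "(b - a) * (L / 2) <= abs(l j U0 \<bullet> ?q s) + 1 / 4 * (L * (b - a))" by simp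
   have 1: "(b - a) * L / 4 <= abs(l j U0 \<bullet> ?q s)" by (rule absorb_quarter[OF 0])
   \<comment> \<open>Here the factor 4 in \<open>K\<close> is spent: a factor 2 on the distance of
     \<open>s\<close> from the midpoint and a factor 2 on absorbing the deviation of
     \<open>r j\<close> from its value at \<open>U0\<close>; \<open>Kr + 1\<close> bounds
     \<open>r j\<close> along the curve.\<close>
   have "D * L <= K * ((b - a) * L / 4)"
   proof -
    have "0 <= (b - a) * L / 4" using len0[of s] ab by (simp add: L_def)
    then have "4 * (Kr + 1) * ((b - a) * L / 4) <= K * ((b - a) * L / 4)" by (rule mult_right_mono[OF K])
    moreover have "4 * (Kr + 1) * ((b - a) * L / 4) = D * L" by (simp add: D_def B1_def)
    ultimately show ?thesis by metis
   qed
   also have "... <= K * abs(l j U0 \<bullet> ?q s)" using 1 K0 by (intro mult_left_mono) auto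
   also have "... <= K * ?own (?q s)"
    using jG K0 by (intro mult_left_mono member_le_sum[of j ?G "%m. abs(l m U0 \<bullet> ?q s)"]) auto
   finally show ?thesis unfolding L_def .
  qed
  have ex: "D * (max b s - min a s) <= D\<^sup>2" if "a < s" "s < b" for s
  proof -
   have "max b s - min a s = b - a" using that by auto
   then show ?thesis using mult_left_mono[OF D0(2) D0(1)] by (simp add: power2_eq_square)
  qed
  have vu: "norm (v - u) <= D" using gdiff[of b a] ab by (simp add: ga gb D_def)
  have wD: "norm (w xi - u) <= D & norm (w xi - v) <= D" if "xi : {a<..<b}" for xi
   using gdiff[of xi a] gdiff[of xi b] that wg by (auto simp: ga gb D_def)
  have eq: "u = v --> D = 0" using a b by (simp add: D_def)
  show ?thesis
   by (intro exI[of _ D] conjI allI impI ballI) (use D0 ab vu wD eq off own off2 own2 ex ljd gnl eta a b in auto)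
 qed
qed

lemma eigenvector_bounds: "EX Kl>=1. EX Kr>=1. ALL m:{1..CARD('n)}. norm (l m U0) <= Kl & norm (r m U0) <= Kr"
proof -
 define Kl where "Kl = 1 + (SUM m:{1..CARD('n)}. norm (l m U0))"
 define Kr where "Kr = 1 + (SUM m:{1..CARD('n)}. norm (r m U0))"
 have "norm (l m U0) <= Kl" "norm (r m U0) <= Kr" if "m : {1..CARD('n)}" for m
  unfolding Kl_def Kr_def using that member_le_sum[of m "{1..CARD('n)}" "%m. norm (l m U0)"] member_le_sum[of m "{1..CARD('n)}" "%m. norm (r m U0)"] by auto
 moreover have "Kl >= 1" "Kr >= 1" unfolding Kl_def Kr_def by (auto intro: sum_nonneg)
 ultimately show ?thesis by blast
qed

text \<open>Only waves between \<open>xi\<close> and \<open>s\<close> separate the profile from the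
  single jump, and each of them has \<open>xi\<close> in its interval
  \<open>{min (a j) s..max (b j) s}\<close>.\<close>

lemma profile_difference_bound:
 fixes om :: "nat => real^'n" and a b D :: "nat => real" and w :: "real => real^'n"
 assumes N: "1 <= N" and ab: "!!j. j : {1..N} ==> a j <= b j" and ba: "!!j. j : {1..<N} ==> b j <= a (j + 1)"
  and left: "!!xi. xi < a 1 ==> w xi = om 0" and right: "!!xi. b N < xi ==> w xi = om N"
  and mid: "!!j xi. j : {1..<N} ==> xi : {b j<..<a (j + 1)} ==> w xi = om j"
  and D: "!!j. j : {1..N} ==> 0 <= D j" "!!j. j : {1..N} ==> norm (om j - om (j - 1)) <= D j"
   "!!j xi. j : {1..N} ==> xi : {a j<..<b j} ==> norm (w xi - om (j - 1)) <= D j & norm (w xi - om j) <= D j"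
  and xi: "xi ~: insert s (a ` {1..N} \<union> b ` {1..N})"
 shows "norm (w xi - (if xi < s then om 0 else om N)) <= (SUM j:{1..N}. D j * indicator {min (a j) s..max (b j) s} xi)"
proof -
 have amono: "b i <= a j" if "i < j" "i : {1..N}" "j : {1..N}" for i j
 proof -
  have "Suc i <= j" using that by simp
  then show ?thesis using that(3)
  proof (induction j rule: dec_induct)
   case base then show ?case using ba[of i] that by auto
  next
   case (step j) then show ?case using ba[of j] ab[of j] that by fastforce
  qed
 qed
 have bmono: "b i <= b j" if "i <= j" "i : {1..N}" "j : {1..N}" for i j
  using amono[of i j] ab[of j] that by (cases "i = j") force+
 have amono': "a i <= a j" if "i <= j" "i : {1..N}" "j : {1..N}" for i j
  using amono[of i j] ab[of i] that by (cases "i = j") force+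
 \<comment> \<open>The number of waves entirely to the left of \<open>xi\<close>; the next wave
   contains \<open>xi\<close> or lies to its right.\<close>
 define k where "k = card {j:{1..N}. b j < xi}"
 have bset: "{j:{1..N}. b j < xi} = {1..k}"
 proof -
  define S where "S = {j:{1..N}. b j < xi}"
  have fin: "finite S" by (simp add: S_def)
  have down: "i : S" if "j : S" "1 <= i" "i <= j" for i j
   using that bmono[of i j] by (auto simp: S_def intro: le_less_trans)
  show ?thesis
  proof (cases "S = {}")
   case True
   then show ?thesis unfolding k_def S_def[symmetric] by simp
  next
   case False
   have "S = {1..Max S}"
   proof
    show "S \<subseteq> {1..Max S}" using fin by (auto simp: S_def)
    show "{1..Max S} \<subseteq> S" using down Max_in[OF fin False] by auto
   qed
   then have "card S = Max S" by (metis card_atLeastAtMost diff_Suc_1)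
   then show ?thesis using \<open>S = {1..Max S}\<close> unfolding k_def S_def[symmetric] by simp
  qed
 qed
 have kN: "k <= N"
 proof -
  have "k <= card {1..N}" unfolding k_def by (intro card_mono) auto
  then show ?thesis by simp
 qed
 have below: "b j < xi" if "j : {1..k}" for j using that bset by blast
 have above: "xi < b j" if "j : {1..N}" "k < j" for j
 proof -
  have "~ b j < xi"
  proof
   assume "b j < xi"
   then have "j : {1..k}" using bset that by blast
   then show False using that by simp
  qed
  moreover have "xi ~= b j" using xi that by auto
  ultimately show ?thesis by simp
 qed
 have tele: "norm (om j - om i) <= (SUM m:{i<..j}. D m)" if "i <= j" "j <= N" for i j
  using that
 proof (induction j rule: dec_induct)
  case (step j)
  have "norm (om (Suc j) - om i) <= norm (om (Suc j) - om j) + norm (om j - om i)"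
   using norm_triangle_ineq[of "om (Suc j) - om j" "om j - om i"] by simp
  also have "... <= D (Suc j) + (SUM m:{i<..j}. D m)" using D(2)[of "Suc j"] step by auto
  also have "{i<..Suc j} = insert (Suc j) {i<..j}" using step by auto
  then have "D (Suc j) + (SUM m:{i<..j}. D m) = (SUM m:{i<..Suc j}. D m)" by simp
  finally show ?case .
 qed simp
 define I where "I j = (indicator {min (a j) s..max (b j) s} xi :: real)" for j :: nat
 have sub: "(SUM m:M. D m) <= (SUM j:{1..N}. D j * I j)" if "M \<subseteq> {1..N}" "!!m. m : M ==> I m = (1::real)" for M
 proof -
  have "(SUM m:M. D m) = (SUM m:M. D m * I m)" using that by simp
  also have "... <= (SUM j:{1..N}. D j * I j)" using that D(1) by (intro sum_mono2) (auto simp: I_def)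
  finally show ?thesis .
 qed
 have inI: "I m = 1" if "min (a m) s <= xi" "xi <= max (b m) s" for m using that by (simp add: I_def)
 define inwave where "inwave \<longleftrightarrow> k < N & a (k + 1) < xi"
 have wk: "w xi = om k" if "~ inwave"
 proof (cases "k = N")
  case True
  then show ?thesis using right[of xi] below[of N] N by auto
 next
  case False
  then have lt: "xi < a (k + 1)" using that kN xi by (force simp: inwave_def)
  show ?thesis
  proof (cases "k = 0")
   case True then show ?thesis using left[of xi] lt by simp
  next
   case k0: False
   then show ?thesis using mid[of k xi] lt below[of k] kN False by auto
  qed
 qed
 have wi: "norm (w xi - om k) <= D (k + 1) & norm (w xi - om (k + 1)) <= D (k + 1)" if inwave
  using D(3)[of "k + 1" xi] that above[of "k + 1"] by (auto simp: inwave_def)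
 show ?thesis
 proof (cases "xi < s")
  case True
  have I1: "I m = 1" if "m : {1..k}" for m
  proof (rule inI)
   have "a m <= b m" "b m < xi" using ab[of m] below[OF that] that kN by auto
   then show "min (a m) s <= xi" "xi <= max (b m) s" using True by auto
  qed
  show ?thesis
  proof (cases inwave)
   case iw: True
   have "I (k + 1) = 1" using iw True by (intro inI) (auto simp: inwave_def)
   then have II: "I m = 1" if "m : {0<..k + 1}" for m using I1 that by (cases "m = k + 1") auto
   have "norm (w xi - om 0) <= norm (w xi - om k) + norm (om k - om 0)" using norm_triangle_ineq[of "w xi - om k" "om k - om 0"] by simp
   also have "... <= D (k + 1) + (SUM m:{0<..k}. D m)" using wi[OF iw] tele[of 0 k] kN by auto
   also have "{0<..k + 1} = insert (k + 1) {0<..k}" by auto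
   then have "D (k + 1) + (SUM m:{0<..k}. D m) = (SUM m:{0<..k + 1}. D m)" by simp
   also have "... <= (SUM j:{1..N}. D j * I j)" using II iw by (intro sub) (auto simp: inwave_def)
   finally show ?thesis using True by (simp add: I_def)
  next
   case False
   have "norm (w xi - om 0) <= (SUM m:{0<..k}. D m)" unfolding wk[OF False] using tele[of 0 k] kN by auto
   also have "... <= (SUM j:{1..N}. D j * I j)" using I1 kN by (intro sub) auto
   finally show ?thesis using True by (simp add: I_def)
  qed
 next
  case False
  then have s: "s < xi" using xi by auto
  have I1: "I m = 1" if "m : {k<..N}" for m
  proof (rule inI)
   have "xi < b m" using above[of m] that by auto
   then show "min (a m) s <= xi" "xi <= max (b m) s" using s by auto
  qed
  show ?thesis
  proof (cases inwave)
   case iw: True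
   then have kl: "k + 1 <= N" by (simp add: inwave_def)
   have "norm (w xi - om N) <= norm (w xi - om (k + 1)) + norm (om N - om (k + 1))" using norm_triangle_ineq[of "w xi - om (k + 1)" "om (k + 1) - om N"] by (simp add: norm_minus_commute)
   also have "... <= D (k + 1) + (SUM m:{k + 1<..N}. D m)" using wi[OF iw] tele[of "k + 1" N] kl by auto
   also have "{k<..N} = insert (k + 1) {k + 1<..N}" using kl by auto
   then have "D (k + 1) + (SUM m:{k + 1<..N}. D m) = (SUM m:{k<..N}. D m)" by simp
   also have "... <= (SUM j:{1..N}. D j * I j)" using I1 by (intro sub) auto
   finally show ?thesis using False by (simp add: I_def)
  next
   case nw: False
   have "norm (w xi - om N) <= (SUM m:{k<..N}. D m)" unfolding wk[OF nw] using tele[of k N] kN by (simp add: norm_minus_commute)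
   also have "... <= (SUM j:{1..N}. D j * I j)" using I1 by (intro sub) auto
   finally show ?thesis using False by (simp add: I_def)
  qed
 qed
qed

text \<open>The first use of \<open>group_sum_bound\<close> bounds the wave strengths by the jump,
  the second one the products of strength and misplaced length by the residual. As \<open>s\<close>
  is close to \<open>lam j U0\<close>, only a fan of family \<open>j\<close> can contain it. The
  quadratic term then pays for this fan, unless the jump clearly decreases along \<open>r j\<close>;
  but that is incompatible with the increase along the fan, as the other waves have small
  projections.\<close>

lemma riemann_error:
 assumes R: "small_jump_continuous R" and kap0: "0 < kap0"
 shows "EX d>0. EX C>=0. ALL ul:ball U0 d. ALL ur:ball U0 d. lax_riemann_solution F lam r ul ur (R ul ur) -->
  (ALL j:{1..CARD('n)}. ALL s. abs(s - lam j U0) < d -->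
   (profile_error (R ul ur) ul ur s (C * norm (F ur - F ul - s *\<^sub>R (ur - ul)) + rarefaction_term lam l r U0 kap0 C j (ur - ul))))"
proof -
 let ?n = "CARD('n)"
 let ?J = "{1..?n}"
 have n1: "1 <= ?n" by (simp add: Suc_leI)
 obtain gam where gam: "gam > 0" and gap': "ALL i:?J. ALL j:?J. lam i U0 ~= lam j U0 --> 4 * gam <= abs(lam i U0 - lam j U0)"
  using lam_gap by auto
 obtain Kl Kr where Kl: "1 <= Kl" and Kr: "1 <= Kr" and KK: "ALL m:?J. norm (l m U0) <= Kl & norm (r m U0) <= Kr"
  using eigenvector_bounds by auto
 define K where "K = 4 * (Kr + 1)"
 have K: "8 <= K" using Kr by (simp add: K_def)
 define C1 where "C1 = 2 * K * ?n * (?n * Kl)"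
 have C1: "0 <= C1" using K Kl by (simp add: C1_def)
 \<comment> \<open>The first two entries serve the absorptions in \<open>group_sum_bound\<close> and
   \<open>wave_estimate\<close>; the third keeps the other families from producing a decrease of
   \<open>kap0 * norm (ur - ul)\<close>.\<close>
 define th where "th = Min {1 / (2 * (K * ?n * ?n)), 1 / (2 * (Kr * ?n)), kap0 / (C1 + 1), 1}"
 have th: "0 < th" "K * ?n * ?n * th <= 1 / 2" "Kr * ?n * th <= 1 / 2" "C1 * th < kap0"
 proof -
  have p: "0 < K * ?n * ?n" "0 < Kr * ?n" "0 < C1 + 1" using K Kr C1 n1 by auto
  show th0: "0 < th" unfolding th_def using p kap0 by (subst Min_gr_iff) auto
  have "th <= 1 / (2 * (K * ?n * ?n))" "th <= 1 / (2 * (Kr * ?n))" "th <= kap0 / (C1 + 1)" unfolding th_def by (rule Min_le; simp)+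
  then have "th * (2 * (K * ?n * ?n)) <= 1" "th * (2 * (Kr * ?n)) <= 1" "th * (C1 + 1) <= kap0"
   using p by (simp_all only: pos_le_divide_eq mult_pos_pos zero_less_numeral)
  then show "K * ?n * ?n * th <= 1 / 2" "Kr * ?n * th <= 1 / 2" "C1 * th < kap0" using th0 by (simp_all add: algebra_simps)
 qed
 define eta where "eta = min (min gam 1) (min (min (th / Kl) (th * gam / Kl)) (1 / (4 * Kl)))"
 have eta: "0 < eta" "eta <= gam" "eta <= 1" "Kl * eta <= th" "Kl * eta <= th * gam" "Kl * eta <= 1 / 4"
 proof -
  have p: "0 < Kl" using Kl by simp
  show "0 < eta" unfolding eta_def using gam th(1) p by simp
  show "eta <= gam" "eta <= 1" unfolding eta_def by auto
  have "eta <= th / Kl" "eta <= th * gam / Kl" "eta <= 1 / (4 * Kl)" unfolding eta_def by (meson min.cobounded1 min.cobounded2 order_trans)+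
  then have "eta * Kl <= th" "eta * Kl <= th * gam" "eta * (4 * Kl) <= 1"
   using p by (simp_all only: pos_le_divide_eq mult_pos_pos zero_less_numeral)
  then show "Kl * eta <= th" "Kl * eta <= th * gam" "Kl * eta <= 1 / 4" by (simp_all add: mult.commute[of Kl])
 qed
 obtain e where e: "0 < e" "e <= 1" and ball: "ALL u:cball U0 e. (ALL j:?J. abs(lam j u - lam j U0) <= eta & norm (r j u - r j U0) <= eta)
   & (ALL v:cball U0 e. norm (F u - F v - A U0 (u - v)) <= eta * norm (u - v))"
  using small_ball[OF eta(1)] by auto
 obtain d1 where d1: "d1 > 0" and Rb: "ALL ul:ball U0 d1. ALL ur:ball U0 d1. ALL xi. dist (R ul ur xi) U0 < e"
  using R e(1) unfolding small_jump_continuous_def by metis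
 define d where "d = min (min d1 e) gam"
 have d: "0 < d" "d <= d1" "d <= e" "d <= gam" using d1 e gam by (auto simp: d_def)
 \<comment> \<open>The second entry pays for a fan that contains \<open>s\<close>: twice the square
   of its strength, which is at most \<open>C1 * norm (ur - ul)\<close>.\<close>
 define C where "C = max C1 (2 * C1\<^sup>2)"
 have main: "profile_error (R ul ur) ul ur s (C * norm (F ur - F ul - s *\<^sub>R (ur - ul)) + rarefaction_term lam l r U0 kap0 C j0 (ur - ul))"
  if ul: "ul : ball U0 d" and ur: "ur : ball U0 d" and lax: "lax_riemann_solution F lam r ul ur (R ul ur)" and j0: "j0 : ?J" and s: "abs(s - lam j0 U0) < d"
  for ul ur j0 s
 proof -
  define w where "w = R ul ur"
  have wb: "w xi : cball U0 e" for xi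
  proof -
   have "ul : ball U0 d1" "ur : ball U0 d1" using ul ur d by auto
   then show ?thesis using Rb unfolding w_def by (simp add: dist_commute less_imp_le)
  qed
  have ule: "ul : cball U0 e" "ur : cball U0 e" using ul ur d by auto
  have "EX om a b. om 0 = ul & om ?n = ur & (ALL j<=?n. om j : cball U0 e) &
    (ALL j:?J. simple_wave eta j (om (j - 1)) (om j) (a j) (b j) w) &
    (ALL j:{1..<?n}. b j <= a (j + 1)) &
    (ALL xi<a 1. w xi = ul) &
    (ALL j:{1..<?n}. ALL xi:{b j<..<a (j + 1)}. w xi = om j) &
    (ALL xi>b ?n. w xi = ur) &
    (ALL i:?J. ALL j:?J. i < j --> lam i U0 = lam j U0 --> om j = om (j - 1))"
  proof (rule resolve_lax_solution[OF _ eta(1) _ ule wb])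
   show "4 * eta <= abs(lam i U0 - lam j U0)" if "i : ?J" "j : ?J" "lam i U0 ~= lam j U0" for i j
    using gap' that eta(2) by fastforce
   show "abs(lam j u - lam j U0) <= eta" if "u : cball U0 e" "j : ?J" for u j using ball that by blast
   show "lax_riemann_solution F lam r ul ur w" using lax by (simp add: w_def)
  qed
  then obtain om a b where om0: "om 0 = ul" and omn: "om ?n = ur" and omb: "ALL j<=?n. om j : cball U0 e"
    and sw: "ALL j:?J. simple_wave eta j (om (j - 1)) (om j) (a j) (b j) w"
    and ba: "ALL j:{1..<?n}. b j <= a (j + 1)" and wl: "ALL xi<a 1. w xi = ul"
    and wm: "ALL j:{1..<?n}. ALL xi:{b j<..<a (j + 1)}. w xi = om j" and wr: "ALL xi>b ?n. w xi = ur"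
    and grp: "ALL i:?J. ALL j:?J. i < j --> lam i U0 = lam j U0 --> om j = om (j - 1)"
   by (elim exE conjE)
  define dd where "dd j = om j - om (j - 1)" for j
  define q where "q j = F (om j) - F (om (j - 1)) - s *\<^sub>R dd j" for j
  define X where "X = {j:?J. genuinely_nonlinear (lam j) (r j) & a j < s & s < b j}"
  let ?own = "%j x. SUM m:{m:?J. lam m U0 = lam j U0}. abs(l m U0 \<bullet> x)"
  let ?P = "%j D. a j <= b j & norm (dd j) <= D & (ALL xi:{a j<..<b j}. norm (w xi - om (j - 1)) <= D & norm (w xi - om j) <= D) & (om (j - 1) = om j --> D = 0) &
   (ALL m:?J. lam m U0 ~= lam j U0 --> abs(l m U0 \<bullet> dd j) <= th * D) &
   D <= K * ?own j (dd j) &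
   (ALL m:?J. lam m U0 ~= lam j U0 --> abs(l m U0 \<bullet> q j) <= th * (D * (max (b j) s - min (a j) s))) &
    (j ~: X --> D * (max (b j) s - min (a j) s) <= K * ?own j (q j)) &
    (j : X --> D * (max (b j) s - min (a j) s) <= D\<^sup>2 & (b j - a j) / 2 <= l j U0 \<bullet> dd j & abs(a j - lam j U0) <= 2 * eta & abs(b j - lam j U0) <= 2 * eta)"
  have "ALL j:?J. EX D>=0. ?P j D"
  proof
   fix j assume j: "j : ?J"
   have in1: "om (j - 1) : cball U0 e" "om j : cball U0 e" using omb j by auto
   obtain D where D: "D >= 0" "a j <= b j" "norm (dd j) <= D" "ALL xi:{a j<..<b j}. norm (w xi - om (j - 1)) <= D & norm (w xi - om j) <= D" "om (j - 1) = om j --> D = 0"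
     "ALL m:?J. lam m U0 ~= lam j U0 --> abs(l m U0 \<bullet> dd j) <= th * D"
     "D <= K * ?own j (dd j)"
    and Ds: "ALL s. (ALL m:?J. lam m U0 ~= lam j U0 --> abs(l m U0 \<bullet> (F (om j) - F (om (j - 1)) - s *\<^sub>R (om j - om (j - 1)))) <= th * (D * (max (b j) s - min (a j) s))) &
    (~ (genuinely_nonlinear (lam j) (r j) & a j < s & s < b j) -->
      D * (max (b j) s - min (a j) s) <= K * ?own j (F (om j) - F (om (j - 1)) - s *\<^sub>R (om j - om (j - 1)))) &
    (genuinely_nonlinear (lam j) (r j) & a j < s & s < b j -->
      D * (max (b j) s - min (a j) s) <= D\<^sup>2 & (b j - a j) / 2 <= l j U0 \<bullet> (om j - om (j - 1)) & abs(a j - lam j U0) <= eta + abs(lam j (om (j - 1)) - lam j U0) & a j = lam j (om (j - 1)) & b j = lam j (om j))"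
    using wave_estimate[where e=e and gam=gam and eta=eta and Kl=Kl and Kr=Kr and th=th and K=K and w=w, OF gap'[rule_format] eta(1-3) _ _ Kl _ Kr _ eta(4,5) th(3) eta(6) _ j sw[rule_format, OF j] in1 wb]
     ball KK unfolding K_def dd_def by (elim meta_impE) (blast | simp)+
   have near: "abs(lam j (om (j - 1)) - lam j U0) <= eta" "abs(lam j (om j) - lam j U0) <= eta" using ball in1 j by auto
   note Dss = spec[OF Ds, of s, folded dd_def, folded q_def]
   show "EX D>=0. ?P j D"
   proof (intro exI[of _ D] conjI)
    show "j ~: X --> D * (max (b j) s - min (a j) s) <= K * ?own j (q j)"
     using Dss j unfolding X_def by blast
    show "j : X --> D * (max (b j) s - min (a j) s) <= D\<^sup>2 & (b j - a j) / 2 <= l j U0 \<bullet> dd j & abs(a j - lam j U0) <= 2 * eta & abs(b j - lam j U0) <= 2 * eta"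
     using Dss near eta(1) unfolding X_def by auto
   qed (use D Dss in blast)+
  qed
  from bchoice[OF this] obtain D where D': "ALL j:?J. D j >= 0 & ?P j (D j)"
   by auto
  have D: "D j >= 0" "a j <= b j" "norm (dd j) <= D j" "ALL xi:{a j<..<b j}. norm (w xi - om (j - 1)) <= D j & norm (w xi - om j) <= D j" "om (j - 1) = om j ==> D j = 0"
   "ALL m:?J. lam m U0 ~= lam j U0 --> abs(l m U0 \<bullet> dd j) <= th * D j"
   "D j <= K * ?own j (dd j)"
   "ALL m:?J. lam m U0 ~= lam j U0 --> abs(l m U0 \<bullet> q j) <= th * (D j * (max (b j) s - min (a j) s))"
   "j ~: X ==> D j * (max (b j) s - min (a j) s) <= K * ?own j (q j)"
   "j : X ==> D j * (max (b j) s - min (a j) s) <= (D j)\<^sup>2 & (b j - a j) / 2 <= l j U0 \<bullet> dd j & abs(a j - lam j U0) <= 2 * eta & abs(b j - lam j U0) <= 2 * eta"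
   if "j : ?J" for j using bspec[OF D' that] by blast+
  define z where "z j = D j * (max (b j) s - min (a j) s)" for j
  have z0: "0 <= z j" if "j : ?J" for j unfolding z_def using D(1,2)[OF that] by (intro mult_nonneg_nonneg) (auto simp: max_def min_def)
  have single: "D j = 0 & dd j = 0 & q j = 0 & z j = 0" if "i : ?J" "j : ?J" "i < j" "lam i U0 = lam j U0" for i j
  proof -
   have e: "om j = om (j - 1)" using grp that by blast
   then have "D j = 0" using D(5)[OF that(2)] by simp
   then show ?thesis using e by (simp add: dd_def q_def z_def)
  qed
  have dsum: "(SUM j:?J. dd j) = ur - ul"
   using sum_telescope''[of 0 ?n om] om0 omn unfolding dd_def by (simp add: atLeastSucAtMost_greaterThanAtMost)
  have qsum: "(SUM j:?J. q j) = F ur - F ul - s *\<^sub>R (ur - ul)"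
  proof -
   have "(SUM j:?J. q j) = (SUM j:?J. F (om j) - F (om (j - 1))) - s *\<^sub>R (SUM j:?J. dd j)"
    unfolding q_def by (simp add: sum_subtractf scaleR_sum_right)
   also have "(SUM j:?J. F (om j) - F (om (j - 1))) = F ur - F ul"
    using sum_telescope''[of 0 ?n "%j. F (om j)"] om0 omn by (simp add: atLeastSucAtMost_greaterThanAtMost)
   finally show ?thesis by (simp only: dsum)
  qed
  have lsum: "(SUM m:?J. abs(l m U0 \<bullet> x)) <= ?n * Kl * norm x" for x
  proof -
   have "(SUM m:?J. abs(l m U0 \<bullet> x)) <= (SUM m:?J. Kl * norm x)"
   proof (rule sum_mono)
    fix m assume "m : ?J"
    then show "abs(l m U0 \<bullet> x) <= Kl * norm x"
     using Cauchy_Schwarz_ineq2[of "l m U0" x] mult_right_mono[of "norm (l m U0)" Kl "norm x"] KK by fastforce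
   qed
   then show ?thesis by simp
  qed
  have K0: "0 <= K" using K by simp
  have "sum D (?J - {}) <= 2 * K * card ?J * (SUM m:?J. abs(SUM j:?J. l m U0 \<bullet> dd j)) + sum D (?J \<inter> {})"
   by (rule group_sum_bound[where mu="%j. lam j U0" and th=th]) (use D(1,6,7) K0 th single in auto)
  also have "(SUM m:?J. abs(SUM j:?J. l m U0 \<bullet> dd j)) = (SUM m:?J. abs(l m U0 \<bullet> (ur - ul)))"
   unfolding inner_sum_right[symmetric] dsum ..
  finally have "sum D ?J <= 2 * K * ?n * (SUM m:?J. abs(l m U0 \<bullet> (ur - ul)))" by simp
  also have "... <= 2 * K * ?n * (?n * Kl * norm (ur - ul))" using K0 by (intro mult_left_mono lsum) auto
  finally have Dsum: "sum D ?J <= C1 * norm (ur - ul)" by (simp add: C1_def)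
  have "sum z (?J - X) <= 2 * K * card ?J * (SUM m:?J. abs(SUM j:?J. l m U0 \<bullet> q j)) + sum z (?J \<inter> X)"
   by (rule group_sum_bound[where mu="%j. lam j U0" and th=th]) (use D(8,9) K0 th single z0 in \<open>auto simp: z_def[symmetric]\<close>)
  also have "(SUM m:?J. abs(SUM j:?J. l m U0 \<bullet> q j)) = (SUM m:?J. abs(l m U0 \<bullet> (F ur - F ul - s *\<^sub>R (ur - ul))))"
   unfolding inner_sum_right[symmetric] qsum ..
  finally have "sum z (?J - X) <= 2 * K * ?n * (SUM m:?J. abs(l m U0 \<bullet> (F ur - F ul - s *\<^sub>R (ur - ul)))) + sum z (?J \<inter> X)" by simp
  also have "2 * K * ?n * (SUM m:?J. abs(l m U0 \<bullet> (F ur - F ul - s *\<^sub>R (ur - ul)))) <= 2 * K * ?n * (?n * Kl * norm (F ur - F ul - s *\<^sub>R (ur - ul)))"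
   using K0 by (intro mult_left_mono lsum) auto
  finally have zsum: "sum z (?J - X) <= C1 * norm (F ur - F ul - s *\<^sub>R (ur - ul)) + sum z (?J \<inter> X)" by (simp add: C1_def)
  have Xj0: "j = j0" if jX: "j : X" for j
  proof (rule ccontr)
   assume ne: "j ~= j0"
   have j: "j : ?J" "genuinely_nonlinear (lam j) (r j)" "a j < s" "s < b j" using jX by (auto simp: X_def)
   have "lam j U0 ~= lam j0 U0" using GNL_simple[OF j(1) j0 ne j(2)] .
   then have "4 * gam <= abs(lam j U0 - lam j0 U0)" using gap' j(1) j0 by blast
   moreover have "abs(a j - lam j U0) <= 2 * eta" "abs(b j - lam j U0) <= 2 * eta" using D(10)[OF j(1) jX] by auto
   ultimately show False using j(3,4) s d(4) eta(2) by linarith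
  qed
  define G where "G xi = (SUM j:?J. D j * indicator {min (a j) s..max (b j) s} xi)" for xi :: real
  have Gi: "has_bochner_integral lborel G (SUM j:?J. z j)"
   unfolding G_def z_def
  proof (intro has_bochner_integral_sum has_bochner_integral_mult_right)
   fix j assume j: "j : ?J"
   have "min (a j) s <= max (b j) s" using D(2)[OF j] by (auto simp: max_def min_def)
   then show "has_bochner_integral lborel (indicator {min (a j) s..max (b j) s}) (max (b j) s - min (a j) s)"
    by (simp add: has_bochner_integral_iff)
  qed
  have Gpw: "norm (w xi - (if xi < s then ul else ur)) <= G xi" if "xi ~: insert s (a ` ?J \<union> b ` ?J)" for xi
   using profile_difference_bound[of ?n a b w om D xi s] n1 D(1-4) ba wl wm wr that unfolding G_def dd_def om0 omn by auto
  have "(SUM j:?J. z j) = sum z (?J - X) + sum z (?J \<inter> X)" using sum.Int_Diff[of ?J z X] by simp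
  also have "... <= C1 * norm (F ur - F ul - s *\<^sub>R (ur - ul)) + 2 * sum z (?J \<inter> X)" using zsum by linarith
  also have "2 * sum z (?J \<inter> X) <= rarefaction_term lam l r U0 kap0 C j0 (ur - ul)"
  proof (cases "j0 : X")
   case False
   then have "?J \<inter> X = {}" using Xj0 by blast
   then show ?thesis by (simp add: C_def le_max_iff_disj)
  next
   case True
   then have JX: "?J \<inter> X = {j0}" using Xj0 j0 by blast
   have gnl: "genuinely_nonlinear (lam j0) (r j0)" and abj: "a j0 < s" "s < b j0" using True by (auto simp: X_def)
   have Dj: "D j0 <= C1 * norm (ur - ul)"
    using member_le_sum[of j0 ?J D] j0 D(1) Dsum by fastforce
   have "z j0 <= (D j0)\<^sup>2" using D(10)[OF j0 True] by (simp add: z_def)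
   also have "... <= (C1 * norm (ur - ul))\<^sup>2" using Dj D(1)[OF j0] by (intro power_mono) auto
   finally have "2 * z j0 <= 2 * C1\<^sup>2 * (norm (ur - ul))\<^sup>2" by (simp add: power_mult_distrib)
   also have "... <= C * (norm (ur - ul))\<^sup>2" by (intro mult_right_mono) (auto simp: C_def)
   finally have zb: "2 * z j0 <= C * (norm (ur - ul))\<^sup>2" .
   have "~ l j0 U0 \<bullet> (ur - ul) <= - kap0 * norm (ur - ul)"
   proof
    assume neg: "l j0 U0 \<bullet> (ur - ul) <= - kap0 * norm (ur - ul)"
    have "l j0 U0 \<bullet> (ur - ul) = l j0 U0 \<bullet> dd j0 + (SUM j:?J - {j0}. l j0 U0 \<bullet> dd j)"
     unfolding dsum[symmetric] inner_sum_right using j0 by (intro sum.remove) auto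
    moreover have "(b j0 - a j0) / 2 <= l j0 U0 \<bullet> dd j0" using D(10)[OF j0 True] by simp
    moreover have "abs(SUM j:?J - {j0}. l j0 U0 \<bullet> dd j) <= C1 * th * norm (ur - ul)"
    proof -
     have "abs(SUM j:?J - {j0}. l j0 U0 \<bullet> dd j) <= (SUM j:?J - {j0}. th * D j)"
     proof (rule order_trans[OF sum_abs], intro sum_mono)
      fix j assume j: "j : ?J - {j0}"
      then have "lam j0 U0 ~= lam j U0" using GNL_simple[OF j0 _ _ gnl, of j U0] by auto
      then show "abs(l j0 U0 \<bullet> dd j) <= th * D j" using D(6)[of j] j j0 by blast
     qed
     also have "... <= th * sum D ?J" unfolding sum_distrib_left using D(1) th(1) by (intro sum_mono2) auto
     also have "... <= th * (C1 * norm (ur - ul))" using Dsum th(1) by (intro mult_left_mono) auto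
     finally show ?thesis by (simp add: mult_ac)
    qed
    moreover have "C1 * th * norm (ur - ul) <= kap0 * norm (ur - ul)" using th(4) by (intro mult_right_mono) auto
    moreover have "l j0 U0 \<bullet> (ur - ul) <= - (kap0 * norm (ur - ul))" using neg by simp
    ultimately show False using abj by argo
   qed
   then show ?thesis using not_GNL_LD[OF gnl] zb unfolding JX by simp
  qed
  finally have total: "(SUM j:?J. z j) <= C1 * norm (F ur - F ul - s *\<^sub>R (ur - ul)) + rarefaction_term lam l r U0 kap0 C j0 (ur - ul)" by linarith
  have CC: "C1 * norm (F ur - F ul - s *\<^sub>R (ur - ul)) <= C * norm (F ur - F ul - s *\<^sub>R (ur - ul))" by (intro mult_right_mono) (auto simp: C_def)
  show ?thesis
  proof (intro exI[of _ G] exI[of _ "insert s (a ` ?J \<union> b ` ?J)"] conjI allI impI)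
   show "integrable lborel G" using Gi by (rule integrable.intros)
   show "0 <= G xi" for xi unfolding G_def using D(1) by (intro sum_nonneg mult_nonneg_nonneg) auto
   show "finite (insert s (a ` ?J \<union> b ` ?J))" by simp
   show "norm (R ul ur xi - (if xi < s then ul else ur)) <= G xi" if "xi ~: insert s (a ` ?J \<union> b ` ?J)" for xi using Gpw[OF that] by (simp add: w_def)
   show "(LINT xi|lborel. G xi) <= C * norm (F ur - F ul - s *\<^sub>R (ur - ul)) +
      rarefaction_term lam l r U0 kap0 C j0 (ur - ul)"
    using has_bochner_integral_integral_eq[OF Gi] total CC by linarith
  qed
 qed
 have "0 <= C" using C1 by (simp add: C_def le_max_iff_disj)
 then show ?thesis using d(1) main by (intro exI[of _ d] exI[of _ C] conjI ballI impI allI) auto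
qed

end

section \<open>Functions of bounded variation and step functions\<close>

text \<open>\<open>G x\<close> is the variation of \<open>f\<close> on the half-line up to
  \<open>x\<close>. Bounds by the increments of one monotone function are easier to use than the
  total variation: they pass to the components of \<open>f\<close> and telescope.\<close>

lemma bounded_variation_dominated:
 fixes f :: "real => 'a::real_normed_vector"
 assumes "bounded_variation f"
 obtains G V where "mono G" "!!x. 0 <= G x" "!!x. G x <= V" "!!x y. x <= y ==> norm (f y - f x) <= G y - G x"
proof -
 define V where "V = enn2real (total_variation f)"
 define sm where "sm p N = (SUM i<N. norm (f (p (Suc i)) - f (p i)))" for p :: "nat => real" and N
 have smV: "sm p N <= V" if "mono p" for p N
 proof -
  have "ennreal (sm p N) = (SUM i<N. ennreal (norm (f (p (Suc i)) - f (p i))))" unfolding sm_def by simp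
  also have "... <= (SUP N. SUM i<N. ennreal (norm (f (p (Suc i)) - f (p i))))" by (rule SUP_upper) simp
  also have "... <= total_variation f" unfolding total_variation_def using that by (intro SUP_upper) simp
  also have "... = ennreal V" using assms unfolding V_def bounded_variation_def by simp
  finally show ?thesis unfolding V_def by (simp add: ennreal_le_iff)
 qed
 define A where "A x = {sm p N | p N. mono p & p N <= x}" for x
 define G where "G x = Sup (A x)" for x
 have A0: "0 : A x" for x
 proof -
  have "sm (%_. x) 0 = 0" by (simp add: sm_def)
  then show ?thesis unfolding A_def by (auto intro!: exI[of _ "%_. x"] exI[of _ 0] monoI)
 qed
 have AV: "z <= V" if "z : A x" for z x using that smV unfolding A_def by auto
 have bdd: "bdd_above (A x)" for x using AV by (intro bdd_aboveI)
 have inc: "norm (f y - f x) + G x <= G y" if xy: "x <= y" for x y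
 proof -
  have "z <= G y - norm (f y - f x)" if zA: "z : A x" for z
  proof -
   obtain p N where z: "z = sm p N" "mono p" "p N <= x" using zA unfolding A_def by blast
   \<comment> \<open>The partition for \<open>x\<close> is extended by the two points
     \<open>x\<close> and \<open>y\<close>.\<close>
   define q where "q i = (if i <= N then p i else if i = Suc N then x else y)" for i
   have "mono q"
   proof (rule monoI)
    fix i j :: nat assume ij: "i <= j"
    have "p i <= x" if "i <= N" for i using z monoD[OF z(2) that] by simp
    then show "q i <= q j" using ij monoD[OF z(2) ij] xy unfolding q_def by (auto intro: order_trans)
   qed
   moreover have "sm q (Suc (Suc N)) = sm p N + norm (f x - f (p N)) + norm (f y - f x)"
    unfolding sm_def q_def by (simp add: sum.lessThan_Suc)
   moreover have "q (Suc (Suc N)) <= y" unfolding q_def by simp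
   ultimately have "sm p N + norm (f x - f (p N)) + norm (f y - f x) : A y" unfolding A_def by (metis (mono_tags, lifting) mem_Collect_eq)
   then have "sm p N + norm (f x - f (p N)) + norm (f y - f x) <= G y" unfolding G_def using bdd by (rule cSup_upper)
   then show ?thesis using z norm_ge_zero[of "f x - f (p N)"] by linarith
  qed
  then have "G x <= G y - norm (f y - f x)" unfolding G_def[of x] using A0[of x] by (intro cSup_least) auto
  then show ?thesis by simp
 qed
 show thesis
 proof (rule that[of G V])
  show "mono G" by (rule monoI) (use inc norm_ge_zero order_trans in \<open>smt (verit)\<close>)
  show "0 <= G x" for x unfolding G_def using A0 bdd by (rule cSup_upper)
  show "G x <= V" for x unfolding G_def using A0[of x] AV by (intro cSup_least) auto
  show "norm (f y - f x) <= G y - G x" if "x <= y" for x y using inc[OF that] by simp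
 qed
qed

lemma total_variation_le:
 fixes f :: "real => 'a::real_normed_vector"
 assumes G: "!!x. 0 <= G x" "!!x. G x <= V" and f: "!!x y. x <= y ==> norm (f y - f x) <= G y - G x"
 shows "total_variation f <= ennreal V"
 unfolding total_variation_def
proof (rule SUP_least, rule SUP_least)
 fix p :: "nat => real" and N assume "p : {p. mono p}"
 then have p: "mono p" by simp
 have "(SUM i<N. norm (f (p (Suc i)) - f (p i))) <= (SUM i<N. G (p (Suc i)) - G (p i))"
  using p by (intro sum_mono f) (simp add: mono_iff_le_Suc)
 also have "... = G (p N) - G (p 0)" by (rule sum_lessThan_telescope)
 also have "... <= V" using G[of "p N"] G[of "p 0"] by simp
 finally show "(SUM i<N. ennreal (norm (f (p (Suc i)) - f (p i)))) <= ennreal V" by (simp add: ennreal_leI)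
qed

lemma dominated_measurable:
 fixes f :: "real => real"
 assumes G: "mono G" and f: "!!x y. x <= y ==> abs(f y - f x) <= G y - G x"
 shows "f : borel_measurable borel"
proof -
 have "mono (%x. f x + G x)" by (rule monoI) (use f in \<open>smt (verit)\<close>)
 then have "(%x. (f x + G x) - G x) : borel_measurable borel" using G by (intro borel_measurable_diff borel_measurable_mono)
 then show ?thesis by simp
qed

lemma dominated_integrable:
 fixes f :: "real => real"
 assumes G: "mono G" "!!x. 0 <= G x" "!!x. G x <= V" and f: "!!x y. x <= y ==> abs(f y - f x) <= G y - G x"
  and L: "!!y. L <= abs y ==> f y = 0"
 shows "abs(f y) <= V" "integrable lborel f"
proof -
 show b: "abs(f y) <= V" for y
 proof -
  have "f (max (abs L) y) = 0 | f (- abs L) = 0 & - abs L <= y" "f (- max (abs L) (abs y)) = 0" using L by auto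
  moreover have "- max (abs L) (abs y) <= y" by auto
  ultimately show ?thesis using f[of "- max (abs L) (abs y)" y] G(2)[of "- max (abs L) (abs y)"] G(3)[of y] by auto
 qed
 show "integrable lborel f"
 proof (rule Bochner_Integration.integrable_bound[where f="%x. indicator {-abs L..abs L} x * V"])
  show "integrable lborel (%x. indicator {- abs L..abs L} x * V)" by (intro integrable_mult_left integrable_real_indicator) auto
  show "f : borel_measurable lborel" using dominated_measurable[OF G(1) f] by simp
  show "AE x in lborel. norm (f x) <= norm (indicator {- abs L..abs L} x * V)"
  proof (rule AE_I2)
   fix x show "norm (f x) <= norm (indicator {- abs L..abs L} x * V)"
    using b[of x] L[of x] by (cases "x : {-abs L..abs L}") (auto simp: abs_if split: if_splits)
  qed
 qed
qed

lemma sum_shifted_differences: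
 fixes a :: "nat => 'a::ab_group_add"
 shows "(SUM k<n. a (k + m) - a k) = (SUM q<m. a (n + q)) - (SUM q<m. a q)"
proof (induction n)
 case (Suc n)
 have "(SUM q<m. a (Suc n + q)) + a n = (SUM q<Suc m. a (n + q))"
  by (simp only: sum.lessThan_Suc_shift) (simp add: add.commute)
 also have "... = (SUM q<m. a (n + q)) + a (n + m)" by simp
 finally show ?case using Suc by (simp add: algebra_simps)
qed simp

text \<open>Averaging \<open>m\<close> consecutive samples makes every jump of the step function as small as \<open>V / m\<close>.\<close>

lemma step_approximation:
 fixes f G :: "real => real" and K m :: nat and L h V :: real
 assumes G: "mono G" "!!x. 0 <= G x" "!!x. G x <= V" and f: "!!x y. x <= y ==> abs(f y - f x) <= G y - G x"
  and L: "!!y. L <= abs y ==> f y = 0"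
  and m: "0 < m" and h: "0 < h" "real (m + 1) * h <= 1" and L0: "0 <= L" and K: "2 * L + 1 <= real K * h"
 defines "p \<equiv> %k. - L - 1 + (real k + real m) * h"
 defines "d \<equiv> %k. (f (p k) - f (p k - real m * h)) / real m"
 shows "sum d {..<K} = 0" "(SUM k<K. abs(d k)) <= V" "abs(d k) <= V / real m" "integrable lborel (%y. f y - stepv {..<K} d p y)"
  "(LINT y|lborel. abs(f y - stepv {..<K} d p y)) <= real m * h * V"
proof -
 define g where "g k = - L - 1 + (real k) * h" for k
 have pg: "p k = g (k + m)" "p k - real m * h = g k" for k by (auto simp: p_def g_def algebra_simps)
 have dk: "d k = (f (g (k + m)) - f (g k)) / real m" for k unfolding d_def pg(2) unfolding pg(1) ..
 have gmono: "g i <= g j" if "i <= j" for i j using that h by (auto simp: g_def intro!: mult_right_mono)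
 have gle: "i <= j" if "g i <= g j" for i j using that h by (auto simp: g_def)
 \<comment> \<open>Increments over windows of \<open>m\<close> cells overlap \<open>m\<close>-fold,
   hence the factor \<open>m\<close>.\<close>
 have tel: "(SUM k<K. G (g (k + m + s)) - G (g (k + s))) <= real m * V" for s
 proof -
  have "(SUM k<K. G (g (k + m + s)) - G (g (k + s))) = (SUM q<m. G (g (K + q + s))) - (SUM q<m. G (g (q + s)))"
   using sum_shifted_differences[of "%k. G (g (k + s))" m K] by simp
  also have "... <= (SUM q<m. V) - (SUM q<m. 0)" using G by (intro diff_mono sum_mono) auto
  finally show ?thesis by simp
 qed
 have gK: "L <= g i" if "K <= i" for i
 proof -
  have "2 * L + 1 <= real K * h" by (rule K)
  also have "... <= (real i) * h" using that h by (intro mult_right_mono) auto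
  finally show ?thesis by (simp add: g_def)
 qed
 have gm: "g i <= - L" if "i <= m" for i
 proof -
  have "(real i) * h <= real (m + 1) * h" using that h by (intro mult_right_mono) auto
  also have "... <= 1" by (rule h)
  finally show ?thesis by (simp add: g_def)
 qed
 have f0: "f y = 0" if "y <= - L | L <= y" for y using that by (intro L) auto
 \<comment> \<open>After \<open>k\<close> jumps the step function equals the mean of
   \<open>m\<close> consecutive samples of \<open>f\<close>; the first \<open>m\<close> samples lie
   left of the support and drop out.\<close>
 have part: "sum d {..<k} = (SUM q<m. f (g (k + q))) / real m" for k
 proof -
  have "sum d {..<k} = (SUM i<k. f (g (i + m)) - f (g i)) / real m" by (simp add: dk sum_divide_distrib)
  also have "(SUM i<k. f (g (i + m)) - f (g i)) = (SUM q<m. f (g (k + q))) - (SUM q<m. f (g q))" by (rule sum_shifted_differences)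
  also have "(SUM q<m. f (g q)) = 0" using f0 gm by simp
  finally show ?thesis by simp
 qed
 show s0: "sum d {..<K} = 0" unfolding part using f0 gK by simp
 have dG: "abs(d k) <= (G (g (k + m)) - G (g k)) / real m" for k
  unfolding dk using f[OF gmono[of k "k + m"]] by (simp add: divide_right_mono)
 show "abs(d k) <= V / real m"
 proof -
  have "(G (g (k + m)) - G (g k)) / real m <= V / real m" using G(2)[of "g k"] G(3)[of "g (k + m)"] by (intro divide_right_mono) auto
  then show ?thesis using dG[of k] by simp
 qed
 have "(SUM k<K. abs(d k)) <= (SUM k<K. G (g (k + m)) - G (g k)) / real m"
  unfolding sum_divide_distrib by (intro sum_mono dG)
 also have "... <= V" using tel[of 0] m by (simp add: field_simps)
 finally show "(SUM k<K. abs(d k)) <= V" .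
 define c where "c k = G (g (k + m + 1)) - G (g (k + 1))" for k
 have c0: "0 <= c k" for k using monoD[OF G(1) gmono[of "k + 1" "k + m + 1"]] by (simp add: c_def)
 define H where "H y = (SUM k<K. indicator {g (k + m)..<g (k + m + 1)} y * c k)" for y :: real
 have H: "has_bochner_integral lborel H (SUM k<K. h * c k)"
  unfolding H_def
 proof (intro has_bochner_integral_sum has_bochner_integral_mult_left)
  fix k
  have len: "g (k + m + 1) - g (k + m) = h" by (simp add: g_def algebra_simps)
  show "has_bochner_integral lborel (indicator {g (k + m)..<g (k + m + 1)} :: real => real) h"
   using has_bochner_integral_real_indicator[of "{g (k + m)..<g (k + m + 1)}" lborel] gmono[of "k + m" "k + m + 1"] len h
   by (simp add: measure_def emeasure_lborel_Ico)
 qed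
 have bound: "abs(f y - stepv {..<K} d p y) <= H y" for y
 proof -
  have H0: "0 <= H y" unfolding H_def using c0 by (intro sum_nonneg) auto
  consider "y < g m" | "g (K + m) <= y" | k where "k < K" "g (k + m) <= y" "y < g (k + m + 1)"
  proof -
   assume a1: "y < g m ==> thesis" and a2: "g (K + m) <= y ==> thesis"
    and a3: "!!k. k < K ==> g (k + m) <= y ==> y < g (k + m + 1) ==> thesis"
   show thesis
   proof (cases "y < g m | g (K + m) <= y")
    case False
    define k where "k = (LEAST k. y < g (k + m))"
    have ex: "y < g (K + m)" using False by simp
    have k1: "y < g (k + m)" unfolding k_def using ex by (rule LeastI)
    have "k <= K" unfolding k_def using ex by (rule Least_le)
    moreover have "k ~= 0" using k1 False by (cases k) auto
    moreover have "~ y < g (k - 1 + m)" using not_less_Least[of "k - 1" "%k. y < g (k + m)"] \<open>k ~= 0\<close> unfolding k_def by simp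
    ultimately show thesis using a3[of "k - 1"] k1 by simp
   qed (use a1 a2 in auto)
  qed
  then show ?thesis
  proof cases
   case 1
   have "{i : {..<K}. p i <= y} = {}" using 1 gmono[of m] unfolding pg by (auto simp: not_le intro: less_le_trans)
   moreover have "f y = 0" using 1 gm[of m] by (intro f0) auto
   ultimately show ?thesis using H0 unfolding stepv_def by (simp only: sum.empty)
  next
   case 2
   have "{i : {..<K}. p i <= y} = {..<K}" using 2 order_trans[OF gmono[of _ "K + m"] 2] unfolding pg by auto
   moreover have "f y = 0" using 2 gK[of "K + m"] by (intro f0) auto
   ultimately show ?thesis using H0 s0 unfolding stepv_def by (simp only:)
  next
   case 3
   have iff: "p i <= y \<longleftrightarrow> i <= k" for i
   proof
    assume "p i <= y"
    then have "g (i + m) < g (k + m + 1)" using 3 unfolding pg by simp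
    then have "~ k + m + 1 <= i + m" using gmono by (meson not_le)
    then show "i <= k" by simp
   next
    assume "i <= k"
    then show "p i <= y" using 3 gmono[of "i + m" "k + m"] unfolding pg by simp
   qed
   have "{i : {..<K}. p i <= y} = {..<Suc k}" unfolding iff using 3(1) by auto
   then have "stepv {..<K} d p y = (SUM q<m. f (g (Suc k + q))) / real m" using part[of "Suc k"] unfolding stepv_def by simp
   then have "f y - stepv {..<K} d p y = (SUM q<m. f y - f (g (Suc k + q))) / real m"
    using m by (simp add: sum_subtractf field_simps)
   also have "abs(...) <= (SUM q<m. c k) / real m"
   proof -
    have "abs(SUM q<m. f y - f (g (Suc k + q))) <= (SUM q<m. abs(f y - f (g (Suc k + q))))" by (rule sum_abs)
    also have "... <= (SUM q<m. c k)"
    proof (rule sum_mono)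
     fix q assume q: "q : {..<m}"
     have "Suc k + q <= k + m" using q by auto
     then have le: "g (Suc k + q) <= y" using gmono 3 order_trans by blast
     have "abs(f y - f (g (Suc k + q))) <= G y - G (g (Suc k + q))" by (rule f[OF le])
     also have "... <= c k" using monoD[OF G(1), of y "g (k + m + 1)"] 3 monoD[OF G(1) gmono[of "k + 1" "Suc k + q"]] by (simp add: c_def)
     finally show "abs(f y - f (g (Suc k + q))) <= c k" .
    qed
    finally show ?thesis using m by (simp add: field_simps)
   qed
   also have "... = c k" using m by simp
   also have "... = indicator {g (k + m)..<g (k + m + 1)} y * c k" using 3 by simp
   also have "... <= H y" unfolding H_def using 3 c0
    by (intro member_le_sum[of k "{..<K}" "%k. indicator {g (k + m)..<g (k + m + 1)} y * c k"]) auto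
   finally show ?thesis .
  qed
 qed
 have Hi: "integrable lborel H" using H by (rule integrable.intros)
 have meas: "(%y. f y - stepv {..<K} d p y) : borel_measurable lborel"
  using dominated_measurable[OF G(1) f] stepv_measurable by (auto intro!: borel_measurable_diff)
 show int: "integrable lborel (%y. f y - stepv {..<K} d p y)"
  using Hi meas by (rule Bochner_Integration.integrable_bound) (use bound in \<open>auto intro!: AE_I2 intro: order_trans[OF _ abs_ge_self]\<close>)
 have "(LINT y|lborel. abs(f y - stepv {..<K} d p y)) <= (LINT y|lborel. H y)" using int Hi bound by (intro integral_mono) auto
 also have "... = h * (SUM k<K. c k)" using H by (simp add: has_bochner_integral_integral_eq sum_distrib_left)
 also have "... <= h * (real m * V)" unfolding c_def using tel[of 1] h by (intro mult_left_mono) (auto simp: algebra_simps)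
 finally show "(LINT y|lborel. abs(f y - stepv {..<K} d p y)) <= real m * h * V" by (simp add: algebra_simps)
qed

section \<open>Local errors and the semigroup\<close>

lemma L1_dist_nonneg: "0 <= L1_dist u v" unfolding L1_dist_def by simp

lemma L1_dist_commute: "L1_dist u v = L1_dist v u" unfolding L1_dist_def by (simp add: norm_minus_commute)

lemma L1_dist_triangle:
 assumes "integrable lborel (%x. u x - v x)" "integrable lborel (%x. v x - w x)"
 shows "L1_dist u w <= L1_dist u v + L1_dist v w" "integrable lborel (%x. u x - w x)"
proof -
 have "integrable lborel (%x. (u x - v x) + (v x - w x))" using assms by (rule Bochner_Integration.integrable_add)
 then show i: "integrable lborel (%x. u x - w x)" by simp
 have "(LINT x|lborel. norm (u x - w x)) <= (LINT x|lborel. norm (u x - v x) + norm (v x - w x))"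
 proof (rule integral_mono)
  show "norm (u x - w x) <= norm (u x - v x) + norm (v x - w x)" for x using norm_triangle_ineq[of "u x - v x" "v x - w x"] by simp
 qed (use i assms in auto)
 then show "L1_dist u w <= L1_dist u v + L1_dist v w" unfolding L1_dist_def using assms by simp
qed

locale lipschitz_semigroup =
 fixes U0 :: "real^'n" and \<D> :: "(real => real^'n) set" and S :: "real => (real => real^'n) => (real => real^'n)" and L1 L2 :: real
 assumes D_int: "!!v. v : \<D> ==> integrable lborel (%x. v x - U0)"
  and S_in: "!!v t. v : \<D> ==> 0 <= t ==> S t v : \<D>"
  and S_0: "!!v. v : \<D> ==> AE x in lborel. S 0 v x = v x"
  and S_add: "!!v s t. v : \<D> ==> 0 <= s ==> 0 <= t ==> AE x in lborel. S t (S s v) x = S (t + s) v x"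
  and L: "0 <= L1" "0 <= L2"
  and S_lip: "!!v w s t. v : \<D> ==> w : \<D> ==> 0 <= s ==> 0 <= t ==> L1_dist (S t v) (S s w) <= L1 * L1_dist v w + L2 * abs(t - s)"
begin

lemma D_diff: "v : \<D> ==> w : \<D> ==> integrable lborel (%x. v x - w x)"
 using Bochner_Integration.integrable_diff[OF D_int D_int, of v w] by simp

lemma D_measurable: "v : \<D> ==> v : borel_measurable lborel"
proof -
 assume "v : \<D>"
 then have "(%x. v x - U0) : borel_measurable lborel" using D_int by (auto dest: borel_measurable_integrable)
 then have "(%x. (v x - U0) + U0) : borel_measurable lborel" by (intro borel_measurable_add) auto
 then show ?thesis by simp
qed

lemma D_triangle: "u : \<D> ==> v : \<D> ==> w : \<D> ==> L1_dist u w <= L1_dist u v + L1_dist v w"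
 by (intro L1_dist_triangle(1) D_diff)

lemma D_cong:
 assumes "u : \<D>" "v : \<D>" "AE x in lborel. u x = v x" "w : \<D>"
 shows "L1_dist u w = L1_dist v w"
 unfolding L1_dist_def
proof (rule integral_cong_AE)
 show "(%x. norm (u x - w x)) : borel_measurable lborel" "(%x. norm (v x - w x)) : borel_measurable lborel"
  using D_measurable assms by auto
 show "AE x in lborel. norm (u x - w x) = norm (v x - w x)" using assms(3) by eventually_elim simp
qed

text \<open>\<open>S (T - t)\<close> carries \<open>w t\<close> to the final time. From
  \<open>s\<close> to \<open>s + eta\<close> the distance to \<open>V\<close> changes by at most
  \<open>L1\<close> times the local error made at \<open>s\<close>, and
  \<open>right_punctured_growth\<close> adds up these changes. The term in \<open>En\<close> lets
  local errors be paid for by the decrease of a functional; \<open>Kw\<close> provides continuity in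
  time.\<close>

lemma semigroup_error:
 assumes T: "0 <= a" "a <= b" "b <= T" and w: "!!t. t : {a..b} ==> w t : \<D>" and V: "V : \<D>"
  and wlip: "!!s t. s : {a..b} ==> t : {a..b} ==> L1_dist (w s) (w t) <= Kw * abs(s - t)"
  and En: "continuous_on {a..b} En"
  and loc: "!!t. a <= t ==> t < b ==> EX h>0. ALL s:{t<..<t+h}. s < b --> (EX k>0. ALL eta:{0<..<k}. s + eta <= b --> L1_dist (S eta (w s)) (w (s + eta)) <= c * eta - M * (En (s + eta) - En s))"
 shows "L1_dist (S (T - b) (w b)) V <= L1_dist (S (T - a) (w a)) V + L1 * (c * (b - a) + M * (En a - En b))"
proof -
 define psi where "psi t = L1_dist (S (T - t) (w t)) V" for t
 have Sw: "S (T - t) (w t) : \<D>" if "t : {a..b}" for t using S_in[OF w[OF that], of "T - t"] that T by auto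
 have psilip: "psi s <= psi t + (L1 * Kw + L2) * abs(s - t)" if "s : {a..b}" "t : {a..b}" for s t
 proof -
  have "psi s <= L1_dist (S (T - s) (w s)) (S (T - t) (w t)) + psi t"
   unfolding psi_def by (rule D_triangle[OF Sw[OF that(1)] Sw[OF that(2)] V])
  also have "L1_dist (S (T - s) (w s)) (S (T - t) (w t)) <= L1 * L1_dist (w s) (w t) + L2 * abs((T - s) - (T - t))"
   using that T by (intro S_lip w) auto
  also have "L1 * L1_dist (w s) (w t) <= L1 * (Kw * abs(s - t))" by (intro mult_left_mono wlip that L)
  finally show ?thesis by (simp add: algebra_simps abs_minus_commute)
 qed
 have Kw0: "0 <= L1 * Kw + L2" if "a < b"
 proof -
  have "0 <= Kw * abs(a - b)" using wlip[of a b] L1_dist_nonneg[of "w a" "w b"] that by auto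
  then have "0 <= Kw" using that by (simp add: zero_le_mult_iff)
  then show ?thesis using L by simp
 qed
 have psic: "continuous_on {a..b} psi"
 proof (cases "a < b")
  case True
  show ?thesis
  proof (rule lipschitz_on_continuous_on[of "L1 * Kw + L2"], rule lipschitz_onI)
   fix s t assume "s : {a..b}" "t : {a..b}"
   then show "dist (psi s) (psi t) <= (L1 * Kw + L2) * dist s t"
    using psilip[of s t] psilip[of t s] by (simp add: dist_real_def abs_minus_commute abs_le_iff)
  qed (use Kw0[OF True] in simp)
 next
  case False
  then have "a = b" using T by linarith
  then show ?thesis by simp
 qed
 have "psi b + L1 * M * En b <= (psi a + L1 * M * En a) + (L1 * c) * (b - a)"
 proof (rule right_punctured_growth[of a b "%t. psi t + L1 * M * En t", OF T(2)])
  show "continuous_on {a..b} (%t. psi t + L1 * M * En t)" by (intro continuous_intros psic En)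
  fix t assume t: "a <= t" "t < b"
  have "EX h>0. ALL s:{t<..<t+h}. s < b --> (EX k>0. ALL eta:{0<..<k}. s + eta <= b --> L1_dist (S eta (w s)) (w (s + eta)) <= c * eta - M * (En (s + eta) - En s))"
   by (rule loc[OF t])
  then obtain h where h: "h > 0" and hh: "ALL s:{t<..<t+h}. s < b --> (EX k>0. ALL eta:{0<..<k}. s + eta <= b --> L1_dist (S eta (w s)) (w (s + eta)) <= c * eta - M * (En (s + eta) - En s))"
   by (elim exE conjE)
  show "EX h>0. ALL s:{t<..<t + h}. s < b --> (EX k>0. ALL eta:{0<..<k}. psi (s + eta) + L1 * M * En (s + eta) <= psi s + L1 * M * En s + L1 * c * eta)"
  proof (rule exI[of _ h], rule conjI[OF h], intro ballI impI)
   fix s assume s: "s : {t<..<t + h}" "s < b"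
   obtain k where k: "k > 0" and kk: "ALL eta:{0<..<k}. s + eta <= b --> L1_dist (S eta (w s)) (w (s + eta)) <= c * eta - M * (En (s + eta) - En s)"
    using hh s by auto
   have sab: "s : {a..b}" using s t by auto
   show "EX k>0. ALL eta:{0<..<k}. psi (s + eta) + L1 * M * En (s + eta) <= psi s + L1 * M * En s + L1 * c * eta"
   proof (rule exI[of _ "min k (b - s)"], intro conjI ballI)
    show "0 < min k (b - s)" using k s by simp
    fix eta assume eta: "eta : {0<..<min k (b - s)}"
    have e1: "L1_dist (S eta (w s)) (w (s + eta)) <= c * eta - M * (En (s + eta) - En s)" using kk eta by auto
    have sn: "s + eta : {a..b}" using sab eta by auto
    have Tn: "0 <= T - (s + eta)" using sn T by auto
    have d1: "S eta (w s) : \<D>" using S_in[OF w[OF sab]] eta by auto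
    have d2: "S (T - (s + eta)) (S eta (w s)) : \<D>" using S_in[OF d1 Tn] .
    have "AE x in lborel. S (T - (s + eta)) (S eta (w s)) x = S (T - (s + eta) + eta) (w s) x"
     using w[OF sab] eta Tn by (intro S_add) auto
    then have ae: "AE x in lborel. S (T - (s + eta)) (S eta (w s)) x = S (T - s) (w s) x" by (simp add: algebra_simps)
    have "psi (s + eta) <= L1_dist (S (T - (s + eta)) (w (s + eta))) (S (T - (s + eta)) (S eta (w s))) + L1_dist (S (T - (s + eta)) (S eta (w s))) V"
     unfolding psi_def by (rule D_triangle[OF Sw[OF sn] d2 V])
    also have "L1_dist (S (T - (s + eta)) (S eta (w s))) V = psi s"
     unfolding psi_def by (rule D_cong[OF d2 Sw[OF sab] ae V])
    also have "L1_dist (S (T - (s + eta)) (w (s + eta))) (S (T - (s + eta)) (S eta (w s))) <= L1 * L1_dist (w (s + eta)) (S eta (w s))"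
     using S_lip[OF w[OF sn] d1 Tn Tn] by simp
    also have "... <= L1 * (c * eta - M * (En (s + eta) - En s))" using e1 L by (intro mult_left_mono) (auto simp: L1_dist_commute)
    finally show "psi (s + eta) + L1 * M * En (s + eta) <= psi s + L1 * M * En s + L1 * c * eta" by (simp add: algebra_simps)
   qed
  qed
 qed
 then show ?thesis unfolding psi_def by (simp add: algebra_simps)
qed

end

lemma nearest_point:
 fixes x :: real assumes "finite P" "P ~= {}"
 obtains p where "p : P" "ALL q:P. abs(x - p) <= abs(x - q)"
proof -
 have "EX p:P. ALL q:P. abs(x - p) <= abs(x - q)"
  using ex_min_if_finite[of "(%q. abs(x - q)) ` P"] assms by (auto simp: not_less)
 then show thesis using that by blast
qed

lemma step_piecewise_constant:
 fixes v :: "real => 'a"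
 assumes P: "finite P" "P ~= {}" and step: "!!x y. x <= y ==> P \<inter> {x<..y} = {} ==> v x = v y"
  and p: "strict_mono_on {1..card P} p" "p ` {1..card P} = P"
 shows "piecewise_constant (card P) p (%i. if i = 0 then v (p 1 - 1) else v (p i)) v"
 unfolding piecewise_constant_def
proof (intro conjI allI impI ballI)
 show c1: "1 <= card P" using P by (simp add: Suc_leI card_gt_0_iff)
 show "strict_mono_on {1..card P} p" by (rule p)
 have mem: "EX i:{1..card P}. q = p i" if "q : P" for q using p(2) that by blast
 have le: "p i <= p j \<longleftrightarrow> i <= j" if "i : {1..card P}" "j : {1..card P}" for i j using strict_mono_on_less_eq[OF p(1) that] .
 have lt: "p i < p j \<longleftrightarrow> i < j" if "i : {1..card P}" "j : {1..card P}" for i j using strict_mono_on_less[OF p(1) that] .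
 have min: "p 1 <= q" if "q : P" for q using mem[OF that] le[of 1] c1 by auto
 have max: "q <= p (card P)" if "q : P" for q using mem[OF that] le[of _ "card P"] c1 by auto
 show "v x = (if (0::nat) = 0 then v (p 1 - 1) else v (p 0))" if "x < p 1" for x
 proof -
  have "v (min x (p 1 - 1)) = v x" "v (min x (p 1 - 1)) = v (p 1 - 1)"
   by (rule step; use min that in force)+
  then show ?thesis by simp
 qed
 show "v x = (if i = 0 then v (p 1 - 1) else v (p i))" if i: "i : {1..<card P}" and x: "x : {p i<..<p (i + 1)}" for i x
 proof -
  have "v (p i) = v x"
  proof (rule step)
   show "p i <= x" using x by auto
   show "P \<inter> {p i<..x} = {}"
   proof (rule ccontr)
    assume "P \<inter> {p i<..x} ~= {}"
    then obtain q where "q : P" "p i < q" "q <= x" by auto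
    moreover then obtain k where "k : {1..card P}" "q = p k" using mem by blast
    ultimately have "i < k" "k < i + 1" using lt[of i k] lt[of k "i + 1"] i x by auto
    then show False by simp
   qed
  qed
  then show ?thesis using i by auto
 qed
 show "v x = (if card P = 0 then v (p 1 - 1) else v (p (card P)))" if "p (card P) < x" for x
 proof -
  have "v (p (card P)) = v x" by (rule step) (use max that in force)+
  then show ?thesis using c1 by auto
 qed
qed

text \<open>Each point is charged to its nearest jump \<open>p\<close>, and the change of variable
  \<open>x = p + eta * xi\<close> produces the factor \<open>eta\<close>.\<close>

lemma L1_dist_le_cells:
 fixes u w :: "real => real^'n" and G :: "real => real => real"
 assumes P: "finite P" "P ~= {}" and eta: "0 < eta" and meas: "u : borel_measurable lborel" "w : borel_measurable lborel"
  and G: "!!p. p : P ==> integrable lborel (G p)" "!!p xi. p : P ==> 0 <= G p xi"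
  and ae: "AE x in lborel. ALL p:P. (ALL q:P. abs(x - p) <= abs(x - q)) --> norm (u x - w x) <= G p ((x - p) / eta)"
 shows "L1_dist u w <= eta * (SUM p:P. LINT xi|lborel. G p xi)"
proof -
 have scale: "has_bochner_integral lborel (%x. G p ((x - p) / eta)) (eta * (LINT xi|lborel. G p xi))" if "p : P" for p
 proof -
  have e: "(x - p) / eta = - p / eta + (1 / eta) * x" for x by (simp add: diff_divide_distrib)
  have i: "integrable lborel (%x. G p (- p / eta + (1 / eta) * x))"
   using lborel_integrable_real_affine[OF G(1)[OF that], of "1 / eta" "- p / eta"] eta by simp
  have "(LINT xi|lborel. G p xi) = abs(1 / eta) *\<^sub>R (LINT x|lborel. G p (- p / eta + (1 / eta) * x))"
   using eta by (intro lborel_integral_real_affine) auto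
  then have "(LINT x|lborel. G p (- p / eta + (1 / eta) * x)) = eta * (LINT xi|lborel. G p xi)" using eta by simp
  then show ?thesis unfolding e using has_bochner_integral_integrable[OF i] by simp
 qed
 have sum: "has_bochner_integral lborel (%x. SUM p:P. G p ((x - p) / eta)) (SUM p:P. eta * (LINT xi|lborel. G p xi))"
  by (intro has_bochner_integral_sum scale)
 have le: "AE x in lborel. norm (u x - w x) <= (SUM p:P. G p ((x - p) / eta))"
  using ae
 proof eventually_elim
  case (elim x)
  obtain p where p: "p : P" "ALL q:P. abs(x - p) <= abs(x - q)" using nearest_point[OF P] by blast
  have "norm (u x - w x) <= G p ((x - p) / eta)" using elim p by blast
  also have "... <= (SUM p:P. G p ((x - p) / eta))" using p P G(2) by (intro member_le_sum[of p P "%p. G p ((x - p) / eta)"]) auto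
  finally show ?case .
 qed
 have si: "integrable lborel (%x. SUM p:P. G p ((x - p) / eta))" using sum by (rule integrable.intros)
 have "integrable lborel (%x. norm (u x - w x))"
 proof (rule Bochner_Integration.integrable_bound[OF si])
  show "(%x. norm (u x - w x)) : borel_measurable lborel" using meas by auto
  show "AE x in lborel. norm (norm (u x - w x)) <= norm (SUM p:P. G p ((x - p) / eta))" using le by eventually_elim simp
 qed
 then have "L1_dist u w <= (LINT x|lborel. (SUM p:P. G p ((x - p) / eta)))"
  unfolding L1_dist_def using si le by (intro integral_mono_AE)
 also have "... = eta * (SUM p:P. LINT xi|lborel. G p xi)" using sum by (simp add: has_bochner_integral_integral_eq sum_distrib_left)
 finally show ?thesis .
qed

text \<open>The Riemann clause freed from its enumeration of the jumps: \<open>P\<close> is any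
  nonempty finite set between whose points \<open>v\<close> is constant, and \<open>vl\<close> gives
  the left states.\<close>

lemma riemann_clause:
 assumes clause: "riemann_exact F lam r \<D> S R"
  and v: "v : \<D>" and P: "finite P" "P ~= {}" and step: "!!x y. x <= y ==> P \<inter> {x<..y} = {} ==> v x = v y"
  and vl: "!!p. p : P ==> EX x<p. P \<inter> {x<..<p} = {} & v x = vl p"
 shows "ALL p:P. lax_riemann_solution F lam r (vl p) (v p) (R (vl p) (v p))"
  "EX dl>0. ALL t:{0<..dl}. AE x in lborel. ALL p:P. (ALL q:P. abs(x - p) <= abs(x - q)) --> S t v x = R (vl p) (v p) ((x - p) / t)"
proof -
 obtain p where p: "strict_mono_on {1..card P} p" "p ` {1..card P} = P" using real_set_enumeration[OF P(1)] by blast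
 define u where "u i = (if i = 0 then v (p 1 - 1) else v (p i))" for i
 have pc: "piecewise_constant (card P) p u v" unfolding u_def by (rule step_piecewise_constant[OF P step p])
 have le: "p i <= p j \<longleftrightarrow> i <= j" if "i : {1..card P}" "j : {1..card P}" for i j using strict_mono_on_less_eq[OF p(1) that] .
 have lt: "p i < p j \<longleftrightarrow> i < j" if "i : {1..card P}" "j : {1..card P}" for i j using strict_mono_on_less[OF p(1) that] .
 have mem: "EX i:{1..card P}. q = p i" if "q : P" for q using p(2) that by blast
 have right: "u i = v (p i)" if "i : {1..card P}" for i using that by (simp add: u_def)
 have left: "u (i - 1) = vl (p i)" if i: "i : {1..card P}" for i
 proof -
  have pi: "p i : P" using p(2) i by blast
  obtain x where x: "x < p i" "P \<inter> {x<..<p i} = {}" "v x = vl (p i)" using vl[OF pi] by blast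
  show ?thesis
  proof (cases "i = 1")
   case True
   have "q >= p 1" if "q : P" for q using mem[OF that] le[of 1] i True by auto
   then have "v (min x (p 1 - 1)) = v x" "v (min x (p 1 - 1)) = v (p 1 - 1)" using x(1) True
    by (intro step; force)+
   then show ?thesis using True x by (simp add: u_def)
  next
   case False
   then have i1: "i - 1 : {1..card P}" using i by auto
   then have "p (i - 1) : P" using p(2) by blast
   moreover have "p (i - 1) < p i" using lt[OF i1 i] i False by auto
   ultimately have px: "p (i - 1) <= x" using x(2) by (meson disjoint_iff greaterThanLessThan_iff not_le)
   have "v (p (i - 1)) = v x" using px x(1) x(2)
   proof (intro step)
    show "P \<inter> {p (i - 1)<..x} = {}"
    proof (rule ccontr)
     assume "P \<inter> {p (i - 1)<..x} ~= {}"
     then obtain q where q: "q : P" "p (i - 1) < q" "q <= x" by auto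
     then obtain k where "k : {1..card P}" "q = p k" using mem by blast
     then have "i - 1 < k" "k < i" using lt[OF i1, of k] lt[of k i] i q x(1) by auto
     then show False by simp
    qed
   qed
   then show ?thesis using x(3) right[OF i1] by simp
  qed
 qed
 have cl: "(ALL i:{1..card P}. lax_riemann_solution F lam r (u (i - 1)) (u i) (R (u (i - 1)) (u i))) &
      (EX dl>0. ALL t:{0<..dl}. AE x in lborel.
       ALL i:{1..card P}. (ALL k:{1..card P}. abs(x - p i) <= abs(x - p k)) -->
         S t v x = R (u (i - 1)) (u i) ((x - p i) / t))"
  using clause v pc by blast
 show "ALL q:P. lax_riemann_solution F lam r (vl q) (v q) (R (vl q) (v q))"
 proof
  fix q assume "q : P"
  then obtain i where i: "i : {1..card P}" "q = p i" using mem by blast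
  then show "lax_riemann_solution F lam r (vl q) (v q) (R (vl q) (v q))" using conjunct1[OF cl] left[OF i(1)] right[OF i(1)] by metis
 qed
 from conjunct2[OF cl] obtain dl where dl: "dl > 0" and d: "ALL t:{0<..dl}. AE x in lborel.
       ALL i:{1..card P}. (ALL k:{1..card P}. abs(x - p i) <= abs(x - p k)) -->
         S t v x = R (u (i - 1)) (u i) ((x - p i) / t)"
  by (elim exE conjE)
 show "EX dl>0. ALL t:{0<..dl}. AE x in lborel. ALL p:P. (ALL q:P. abs(x - p) <= abs(x - q)) --> S t v x = R (vl p) (v p) ((x - p) / t)"
 proof (intro exI[of _ dl] conjI dl ballI)
  fix t assume t: "t : {0<..dl}"
  show "AE x in lborel. ALL p:P. (ALL q:P. abs(x - p) <= abs(x - q)) --> S t v x = R (vl p) (v p) ((x - p) / t)"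
   using bspec[OF d t]
  proof eventually_elim
   case (elim x)
   show ?case
   proof (intro ballI impI)
    fix q assume q: "q : P" "ALL q':P. abs(x - q) <= abs(x - q')"
    then obtain i where i: "i : {1..card P}" "q = p i" using mem by blast
    have "ALL k:{1..card P}. abs(x - p i) <= abs(x - p k)" using q i p(2) by blast
    then have "S t v x = R (u (i - 1)) (u i) ((x - p i) / t)" using elim i(1) by blast
    then show "S t v x = R (vl q) (v q) ((x - q) / t)" using left[OF i(1)] right[OF i(1)] i(2) by simp
   qed
  qed
 qed
qed

section \<open>The wave map: composed flows of the eigenvector fields\<close>

primrec compose_flows :: "(nat => real => 'a => 'a) => 'a => nat => (nat => real) => 'a" where
 "compose_flows phi u 0 s = u"
| "compose_flows phi u (Suc k) s = phi (Suc k) (s (Suc k)) (compose_flows phi u k s)"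

text \<open>The quadratic remainders of the single flows add up, because the partial composition is
  Lipschitz (\<open>lip\<close>) and stays in the ball on which the next flow is estimated.\<close>

lemma compose_flows_estimate:
 fixes phi :: "nat => real => 'a => 'a::real_normed_vector" and R :: "nat => 'a"
 assumes h: "0 < h" "0 <= C" and k: "k <= n" and zero: "!!j u. j : {1..n} ==> phi j 0 u = u"
  and est: "!!j u u' a a'. j : {1..n} ==> u : cball U0 h ==> u' : cball U0 h ==> a : {-h..h} ==> a' : {-h..h} ==>
    norm (phi j a' u' - phi j a u - (u' - u) - (a' - a) *\<^sub>R R j) <= C * (abs a + abs a' + norm (u - U0) + norm (u' - U0)) * (abs(a' - a) + norm (u' - u))"
 shows "EX rho>0. EX K>=0. rho <= h & (ALL s s'. (SUM j:{1..k}. abs(s j)) <= rho --> (SUM j:{1..k}. abs(s' j)) <= rho -->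
   norm (compose_flows phi U0 k s' - compose_flows phi U0 k s - (SUM j:{1..k}. (s' j - s j) *\<^sub>R R j))
    <= K * ((SUM j:{1..k}. abs(s j)) + (SUM j:{1..k}. abs(s' j))) * (SUM j:{1..k}. abs(s' j - s j)) &
   (ALL i<k. compose_flows phi U0 i s : cball U0 h))"
 using k
proof (induction k)
 case 0
 show ?case by (rule exI[of _ h], rule conjI[OF h(1)], rule exI[of _ 0]) auto
next
 case (Suc k)
 define N where "N s = (SUM j:{1..k}. abs(s j))" for s :: "nat => real"
 define W where "W = compose_flows phi U0 k"
 define Rm where "Rm = (SUM j:{1..k}. norm (R j))"
 obtain rho K where rho: "0 < rho" "0 <= K" "rho <= h" and IH: "!!s s'. N s <= rho ==> N s' <= rho ==>
   norm (W s' - W s - (SUM j:{1..k}. (s' j - s j) *\<^sub>R R j)) <= K * (N s + N s') * N (%j. s' j - s j)"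
   "!!s i. N s <= rho ==> i < k ==> compose_flows phi U0 i s : cball U0 h"
  using Suc.IH[OF Suc_leD[OF Suc.prems]] unfolding N_def[symmetric] W_def[symmetric] by blast
 have N0: "0 <= N s" for s unfolding N_def by (intro sum_nonneg) auto
 define B where "B = Rm + 2 * K * rho + 1"
 have Rm0: "0 <= Rm" unfolding Rm_def by (intro sum_nonneg) auto
 have B1: "1 <= B" using Rm0 rho by (simp add: B_def)
 have lip: "norm (W s' - W s) <= B * N (%j. s' j - s j)" if "N s <= rho" "N s' <= rho" for s s'
 proof -
  have "norm (W s' - W s) <= norm (W s' - W s - (SUM j:{1..k}. (s' j - s j) *\<^sub>R R j)) + norm (SUM j:{1..k}. (s' j - s j) *\<^sub>R R j)"
   using norm_triangle_ineq[of "W s' - W s - (SUM j:{1..k}. (s' j - s j) *\<^sub>R R j)" "SUM j:{1..k}. (s' j - s j) *\<^sub>R R j"] by simp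
  also have "norm (SUM j:{1..k}. (s' j - s j) *\<^sub>R R j) <= (SUM j:{1..k}. abs(s' j - s j) * Rm)"
  proof (intro order_trans[OF norm_sum] sum_mono)
   fix j assume "j : {1..k}"
   then have "norm (R j) <= Rm" unfolding Rm_def by (intro member_le_sum) auto
   then show "norm ((s' j - s j) *\<^sub>R R j) <= abs(s' j - s j) * Rm" by (simp add: mult_left_mono)
  qed
  also have "... = Rm * N (%j. s' j - s j)" by (simp add: N_def sum_distrib_left mult.commute)
  also have "norm (W s' - W s - (SUM j:{1..k}. (s' j - s j) *\<^sub>R R j)) <= K * (N s + N s') * N (%j. s' j - s j)" by (rule IH(1)[OF that])
  also have "... <= K * (rho + rho) * N (%j. s' j - s j)" using that rho N0 by (intro mult_right_mono mult_left_mono add_mono) auto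
  finally have "norm (W s' - W s) <= (Rm + 2 * K * rho) * N (%j. s' j - s j)" by (simp add: algebra_simps)
  also have "... <= B * N (%j. s' j - s j)" using N0 by (intro mult_right_mono) (auto simp: B_def)
  finally show ?thesis .
 qed
 have W0: "compose_flows phi U0 i (%_. 0) = U0" if "i <= n" for i using that by (induction i) (auto simp: zero)
 have WU0: "norm (W s - U0) <= B * N s" if "N s <= rho" for s
  using lip[of "%_. 0" s] that rho W0[of k] Suc.prems by (simp add: N_def W_def)
 define rho' where "rho' = min rho (h / B)"
 define N' where "N' s = (SUM j:{1..Suc k}. abs(s j))" for s :: "nat => real"
 have N': "N' s = N s + abs(s (Suc k))" for s unfolding N'_def N_def by simp
 have sub: "N s <= rho" "abs(s (Suc k)) <= h" "W s : cball U0 h" if "N' s <= rho'" for s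
 proof -
  have a: "N s <= rho" "abs(s (Suc k)) <= h" "N s <= h / B" using that N0[of s] rho unfolding N' rho'_def by auto
  then show "N s <= rho" "abs(s (Suc k)) <= h" by auto
  have "B * N s <= h" using a(3) B1 by (simp add: field_simps)
  then show "W s : cball U0 h" using WU0[OF a(1)] by (simp add: dist_norm norm_minus_commute)
 qed
 have goal: "norm (compose_flows phi U0 (Suc k) s' - compose_flows phi U0 (Suc k) s - (SUM j:{1..Suc k}. (s' j - s j) *\<^sub>R R j))
   <= (C * B * B + K) * (N' s + N' s') * N' (%j. s' j - s j)" if s: "N' s <= rho'" and s': "N' s' <= rho'" for s s'
 proof -
  define a a' where "a = s (Suc k)" and "a' = s' (Suc k)"
  have "norm (compose_flows phi U0 (Suc k) s' - compose_flows phi U0 (Suc k) s - (SUM j:{1..Suc k}. (s' j - s j) *\<^sub>R R j))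
   = norm ((phi (Suc k) a' (W s') - phi (Suc k) a (W s) - (W s' - W s) - (a' - a) *\<^sub>R R (Suc k)) +
     (W s' - W s - (SUM j:{1..k}. (s' j - s j) *\<^sub>R R j)))"
   unfolding W_def a_def a'_def by (simp add: algebra_simps)
  also have "... <= norm (phi (Suc k) a' (W s') - phi (Suc k) a (W s) - (W s' - W s) - (a' - a) *\<^sub>R R (Suc k)) +
     norm (W s' - W s - (SUM j:{1..k}. (s' j - s j) *\<^sub>R R j))" by (rule norm_triangle_ineq)
  also have "norm (phi (Suc k) a' (W s') - phi (Suc k) a (W s) - (W s' - W s) - (a' - a) *\<^sub>R R (Suc k))
    <= C * (abs a + abs a' + norm (W s - U0) + norm (W s' - U0)) * (abs(a' - a) + norm (W s' - W s))"
   using sub[OF s] sub[OF s'] Suc.prems by (intro est) (auto simp: a_def a'_def)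
  also have "... <= C * (B * (N' s + N' s')) * (B * N' (%j. s' j - s j))"
  proof (rule mult_mono)
   have "abs a + abs a' <= B * (abs a + abs a')" using mult_right_mono[OF B1, of "abs a + abs a'"] by simp
   then have "abs a + abs a' + norm (W s - U0) + norm (W s' - U0) <= B * (N' s + N' s')"
    using WU0[OF sub(1)[OF s]] WU0[OF sub(1)[OF s']] unfolding N' a_def a'_def by (simp add: algebra_simps)
   then show "C * (abs a + abs a' + norm (W s - U0) + norm (W s' - U0)) <= C * (B * (N' s + N' s'))"
    using h by (intro mult_left_mono) auto
   have "abs(a' - a) <= B * abs(a' - a)" using mult_right_mono[OF B1, of "abs(a' - a)"] by simp
   then show "abs(a' - a) + norm (W s' - W s) <= B * N' (%j. s' j - s j)"
    using lip[OF sub(1)[OF s] sub(1)[OF s']] unfolding N' a_def a'_def by (simp add: algebra_simps)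
   show "0 <= C * (B * (N' s + N' s'))" using h B1 N0 unfolding N' by (intro mult_nonneg_nonneg add_nonneg_nonneg) auto
  qed auto
  also have "norm (W s' - W s - (SUM j:{1..k}. (s' j - s j) *\<^sub>R R j)) <= K * (N s + N s') * N (%j. s' j - s j)"
   by (rule IH(1)[OF sub(1)[OF s] sub(1)[OF s']])
  also have "... <= K * (N' s + N' s') * N' (%j. s' j - s j)"
   using rho N0 unfolding N' by (intro mult_mono mult_nonneg_nonneg add_mono add_nonneg_nonneg) auto
  finally show ?thesis by (simp add: algebra_simps)
 qed
 have mem: "compose_flows phi U0 i s : cball U0 h" if "N' s <= rho'" "i < Suc k" for s i
  using sub[OF that(1)] IH(2)[of s i] that(2) unfolding W_def by (cases "i = k") auto
 have "0 < rho'" "0 <= C * B * B + K" "rho' <= h" using rho h B1 by (auto simp: rho'_def)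
 then show ?case using goal mem unfolding N'_def by blast
qed

context hyperbolic_system
begin

text \<open>Two special cases are sharper than the quadratic comparison with the linear
  superposition. Along linearly degenerate fields of one eigenvalue \<open>mu\<close>, this
  eigenvalue is constant on the curve, so \<open>F u - mu *\<^sub>R u\<close> is constant too and
  every jump is an exact contact. Along one genuinely nonlinear field the parameter is the
  eigenvalue up to a constant, and the trapezoidal mean of the speeds leaves a residual of third
  order.\<close>

lemma wave_map:
 "EX W rho C. 0 < rho & 0 <= C & W (%_. 0) = U0 &
  (ALL s s'. (SUM j:{1..CARD('n)}. abs(s j)) <= rho --> (SUM j:{1..CARD('n)}. abs(s' j)) <= rho -->
   norm (W s' - W s - (SUM j:{1..CARD('n)}. (s' j - s j) *\<^sub>R r j U0))
    <= C * ((SUM j:{1..CARD('n)}. abs(s j)) + (SUM j:{1..CARD('n)}. abs(s' j))) * (SUM j:{1..CARD('n)}. abs(s' j - s j))) &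
  (ALL mu s. (SUM j:{1..CARD('n)}. abs(s j)) <= rho -->
   (ALL j:{1..CARD('n)}. s j ~= 0 --> linearly_degenerate (lam j) (r j) & lam j U0 = mu) -->
   F (W s) - mu *\<^sub>R W s = F U0 - mu *\<^sub>R U0) &
  (ALL j:{1..CARD('n)}. ALL s s'. genuinely_nonlinear (lam j) (r j) --> (ALL k. k ~= j --> s k = 0 & s' k = 0) --> abs(s j) <= rho --> abs(s' j) <= rho -->
   norm (F (W s') - F (W s) - (lam j U0 + (s j + s' j) / 2) *\<^sub>R (W s' - W s)) <= C * abs(s' j - s j) ^ 3)"
proof -
 let ?n = "CARD('n)"
 have "ALL j:{1..?n}. EX L>=0. ALL x:cball U0 1. ALL y:cball U0 1. norm (r j x - r j y) <= L * norm (x - y)"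
  using C1_lipschitz smooth_C_k[OF smooth_r] by blast
 then obtain L where L: "!!j. j : {1..?n} ==> 0 <= L j"
  "!!j x y. j : {1..?n} ==> x : cball U0 1 ==> y : cball U0 1 ==> norm (r j x - r j y) <= L j * norm (x - y)"
  by metis
 define fl where "fl j phi h C \<longleftrightarrow> 0 < h & 0 <= C & (ALL u. phi 0 u = u) &
  (ALL u:cball U0 h. ALL s:{-h..h}. phi s u : cball U0 1 & ((%s. phi s u) has_vector_derivative r j (phi s u)) (at s within {-h..h})) &
  (ALL u:cball U0 h. ALL u':cball U0 h. ALL a:{-h..h}. ALL a':{-h..h}.
    norm (phi a' u' - phi a u - (u' - u) - (a' - a) *\<^sub>R r j U0) <= C * (abs a + abs a' + norm (u - U0) + norm (u' - U0)) * (abs(a' - a) + norm (u' - u)))"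
  for j and phi :: "real => real^'n => real^'n" and h C :: real
 have "ALL j:{1..?n}. EX phi h C. fl j phi h C"
 proof
  fix j assume j: "j : {1..?n}"
  show "EX phi h C. fl j phi h C" unfolding fl_def by (rule local_flow[OF zero_less_one L(1)[OF j] L(2)[OF j]])
 qed
 then obtain phi h C where fl: "!!j. j : {1..?n} ==> fl j (phi j) (h j) (C j)" by metis
 define H where "H = Min (h ` {1..?n})"
 define CC where "CC = (SUM j:{1..?n}. C j)"
 have ne: "{1..?n} ~= {}" using zero_less_card_finite by (simp add: Suc_le_eq)
 have H0: "0 < H" unfolding H_def using ne fl by (subst Min_gr_iff) (auto simp: fl_def)
 have Hle: "H <= h j" if "j : {1..?n}" for j unfolding H_def using that by (intro Min_le) auto
 have C0: "0 <= C j" if "j : {1..?n}" for j using fl[OF that] by (simp add: fl_def)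
 have CC0: "0 <= CC" unfolding CC_def using C0 by (rule sum_nonneg)
 have Cle: "C j <= CC" if "j : {1..?n}" for j unfolding CC_def using that C0 by (intro member_le_sum) auto
 have zero: "phi j 0 u = u" if "j : {1..?n}" for j u using fl[OF that] by (simp add: fl_def)
 have flow: "phi j a u : cball U0 1" "((%a. phi j a u) has_vector_derivative r j (phi j a u)) (at a within {-H..H})"
  if "j : {1..?n}" "u : cball U0 H" "a : {-H..H}" for j u a
 proof -
  have "u : cball U0 (h j)" "a : {-h j..h j}" "{-H..H} \<subseteq> {-h j..h j}" using that Hle[OF that(1)] by auto
  then show "phi j a u : cball U0 1" "((%a. phi j a u) has_vector_derivative r j (phi j a u)) (at a within {-H..H})"
   using fl[OF that(1)] has_vector_derivative_within_subset unfolding fl_def by blast+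
 qed
 have est: "norm (phi j a' u' - phi j a u - (u' - u) - (a' - a) *\<^sub>R r j U0) <= CC * (abs a + abs a' + norm (u - U0) + norm (u' - U0)) * (abs(a' - a) + norm (u' - u))"
  if j: "j : {1..?n}" and u: "u : cball U0 H" "u' : cball U0 H" "a : {-H..H}" "a' : {-H..H}" for j u u' a a'
 proof -
  have "u : cball U0 (h j)" "u' : cball U0 (h j)" "a : {-h j..h j}" "a' : {-h j..h j}" using u Hle[OF j] by auto
  then have "norm (phi j a' u' - phi j a u - (u' - u) - (a' - a) *\<^sub>R r j U0) <= C j * (abs a + abs a' + norm (u - U0) + norm (u' - U0)) * (abs(a' - a) + norm (u' - u))"
   using fl[OF j] unfolding fl_def by blast
  also have "... <= CC * (abs a + abs a' + norm (u - U0) + norm (u' - U0)) * (abs(a' - a) + norm (u' - u))"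
   using Cle[OF j] by (intro mult_right_mono) auto
  finally show ?thesis .
 qed
 define W where "W = compose_flows phi U0 ?n"
 obtain rho K where rho: "0 < rho" "0 <= K" "rho <= H" and Wes: "ALL s s'. (SUM j:{1..?n}. abs(s j)) <= rho --> (SUM j:{1..?n}. abs(s' j)) <= rho -->
   norm (W s' - W s - (SUM j:{1..?n}. (s' j - s j) *\<^sub>R r j U0))
    <= K * ((SUM j:{1..?n}. abs(s j)) + (SUM j:{1..?n}. abs(s' j))) * (SUM j:{1..?n}. abs(s' j - s j)) &
   (ALL i<?n. compose_flows phi U0 i s : cball U0 H)"
  using compose_flows_estimate[of H CC ?n ?n phi U0 "%j. r j U0", OF H0 CC0 order_refl zero est] unfolding W_def[symmetric] by blast
 have chain: "((%a. lam j (phi j a u)) has_vector_derivative frechet_derivative (lam j) (at (phi j a u)) (r j (phi j a u))) (at a within {-H..H})"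
  "((%a. F (phi j a u)) has_vector_derivative lam j (phi j a u) *\<^sub>R r j (phi j a u)) (at a within {-H..H})"
  if "j : {1..?n}" "u : cball U0 H" "a : {-H..H}" for j u a
 proof -
  show "((%a. lam j (phi j a u)) has_vector_derivative frechet_derivative (lam j) (at (phi j a u)) (r j (phi j a u))) (at a within {-H..H})"
   using vector_derivative_diff_chain_within[OF flow(2)[OF that] has_derivative_at_withinI[OF lam_has_derivative[OF that(1)]]] by (simp add: o_def)
  show "((%a. F (phi j a u)) has_vector_derivative lam j (phi j a u) *\<^sub>R r j (phi j a u)) (at a within {-H..H})"
   using vector_derivative_diff_chain_within[OF flow(2)[OF that] has_derivative_at_withinI[OF F_deriv]] A_r[OF that(1)] by (simp add: o_def)
 qed
 have LD: "F (W s) - mu *\<^sub>R W s = F U0 - mu *\<^sub>R U0"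
  if s: "(SUM j:{1..?n}. abs(s j)) <= rho" and sup: "ALL j:{1..?n}. s j ~= 0 --> linearly_degenerate (lam j) (r j) & lam j U0 = mu" for mu s
 proof -
  have sj: "abs(s j) <= H" if "j : {1..?n}" for j
   using order_trans[OF member_le_sum[OF that, of "%j. abs(s j)"] s] rho by simp
  have "F (compose_flows phi U0 i s) - mu *\<^sub>R compose_flows phi U0 i s = F U0 - mu *\<^sub>R U0 &
   (ALL j:{1..?n}. s j ~= 0 --> lam j (compose_flows phi U0 i s) = mu)" if "i <= ?n" for i
   using that
  proof (induction i)
   case 0
   then show ?case using sup by simp
  next
   case (Suc i)
   define u where "u = compose_flows phi U0 i s"
   define j where "j = Suc i"
   have j: "j : {1..?n}" using Suc.prems by (auto simp: j_def)
   have u: "u : cball U0 H" using Wes s Suc.prems unfolding u_def by (auto simp: Suc_le_eq)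
   have IH: "F u - mu *\<^sub>R u = F U0 - mu *\<^sub>R U0" "!!k. k : {1..?n} ==> s k ~= 0 ==> lam k u = mu"
    using Suc unfolding u_def by auto
   show ?case
   proof (cases "s j = 0")
    case True
    then have "compose_flows phi U0 (Suc i) s = u" using zero[OF j] by (simp add: u_def j_def)
    then show ?thesis using IH by simp
   next
    case False
    then have ld: "linearly_degenerate (lam j) (r j)" and lj: "lam j U0 = mu" using sup j by auto
    have mem: "0 : {-H..H}" "s j : {-H..H}" using sj[OF j] H0 by auto
    have lamc: "lam j (phi j a u) = mu" if a: "a : {-H..H}" for a
    proof -
     have "norm (lam j (phi j a u) - lam j (phi j 0 u)) <= 0 * abs(a - 0)"
     proof (rule vector_derivative_bound[where S="{-H..H}" and g'="%a. frechet_derivative (lam j) (at (phi j a u)) (r j (phi j a u))"])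
      show "norm (frechet_derivative (lam j) (at (phi j x u)) (r j (phi j x u))) <= 0" for x
       using ld by (simp add: linearly_degenerate_def)
     qed (use chain(1)[OF j u] a mem in auto)
     then show ?thesis using zero[OF j] IH(2)[OF j False] by simp
    qed
    define v where "v = phi j (s j) u"
    have "norm ((F (phi j (s j) u) - mu *\<^sub>R phi j (s j) u) - (F (phi j 0 u) - mu *\<^sub>R phi j 0 u)) <= 0 * abs(s j - 0)"
    proof (rule vector_derivative_bound[where S="{-H..H}" and g'="%a. 0"])
     fix a assume a: "a : {-H..H}"
     have "((%a. F (phi j a u) - mu *\<^sub>R phi j a u) has_vector_derivative lam j (phi j a u) *\<^sub>R r j (phi j a u) - mu *\<^sub>R r j (phi j a u)) (at a within {-H..H})"
      by (intro has_vector_derivative_diff chain(2)[OF j u a] bounded_linear.has_vector_derivative[OF bounded_linear_scaleR_right] flow(2)[OF j u a])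
     then show "((%a. F (phi j a u) - mu *\<^sub>R phi j a u) has_vector_derivative 0) (at a within {-H..H})" using lamc[OF a] by simp
    qed (use mem in auto)
    then have "F v - mu *\<^sub>R v = F U0 - mu *\<^sub>R U0" using zero[OF j] IH(1) by (simp add: v_def)
    moreover have "lam k v = mu" if "k : {1..?n}" "s k ~= 0" for k
     using lamc[OF mem(2)] lam_eq_everywhere[OF j that(1), of U0 v] sup that lj by (auto simp: v_def)
    moreover have "compose_flows phi U0 (Suc i) s = v" by (simp add: v_def u_def j_def)
    ultimately show ?thesis by simp
   qed
  qed
  then show ?thesis unfolding W_def by blast
 qed
 define M where "M j = L j * (norm (r j U0) + L j)" for j
 have M0: "0 <= M j" if "j : {1..?n}" for j using L(1)[OF that] by (simp add: M_def)
 have GNL: "norm (F (W s') - F (W s) - (lam j U0 + (s j + s' j) / 2) *\<^sub>R (W s' - W s)) <= M j * abs(s' j - s j) ^ 3"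
  if j: "j : {1..?n}" and gnl: "genuinely_nonlinear (lam j) (r j)" and z: "!!k. k ~= j ==> s k = 0 & s' k = 0"
   and small: "abs(s j) <= rho" "abs(s' j) <= rho" for j s s'
 proof -
  define gam where "gam a = phi j a U0" for a
  have U0: "U0 : cball U0 H" using H0 by simp
  have comp: "compose_flows phi U0 i t = (if i < j then U0 else gam (t j))" if "i <= ?n" "!!k. k ~= j ==> t k = 0" for i t
   using that(1)
  proof (induction i)
   case (Suc i)
   have "Suc i < j | Suc i = j | j <= i" by linarith
   then show ?case using Suc zero[of "Suc i"] that(2)[of "Suc i"] j by (auto simp: gam_def)
  qed (use j in auto)
  have Wg: "W s = gam (s j)" "W s' = gam (s' j)" unfolding W_def using comp[of ?n] z j by auto
  define a b where "a = s j" and "b = s' j"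
  have I: "a : {-H..H}" "b : {-H..H}" "0 : {-H..H}" using small rho H0 by (auto simp: a_def b_def)
  have gin: "gam x : cball U0 1" and gd: "(gam has_vector_derivative r j (gam x)) (at x within {-H..H})"
   and Fd: "((%x. F (gam x)) has_vector_derivative lam j (gam x) *\<^sub>R r j (gam x)) (at x within {-H..H})" if "x : {-H..H}" for x
   using flow[OF j U0 that] chain(2)[OF j U0 that] unfolding gam_def by auto
  have lamg: "lam j (gam x) = lam j U0 + x" if x: "x : {-H..H}" for x
  proof -
   have "norm ((lam j (gam x) - x) - (lam j (gam 0) - 0)) <= 0 * abs(x - 0)"
   proof (rule vector_derivative_bound[where S="{-H..H}" and g'="%x. 0"])
    fix y assume y: "y : {-H..H}"
    have "((%y. lam j (phi j y U0) - y) has_vector_derivative frechet_derivative (lam j) (at (phi j y U0)) (r j (phi j y U0)) - 1) (at y within {-H..H})"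
     by (intro has_vector_derivative_diff chain(1)[OF j U0 y] has_vector_derivative_id)
    then show "((%y. lam j (gam y) - y) has_vector_derivative 0) (at y within {-H..H})"
     using gnl by (simp add: gam_def genuinely_nonlinear_def)
   qed (use x I in auto)
   then show ?thesis using zero[OF j] by (simp add: gam_def)
  qed
  have bnd: "norm (r j (gam x)) <= norm (r j U0) + L j" if "x : {-H..H}" for x
  proof -
   have "norm (r j (gam x) - r j U0) <= L j * norm (gam x - U0)" using L(2)[OF j gin[OF that], of U0] by simp
   also have "... <= L j * 1" using gin[OF that] L(1)[OF j] by (intro mult_left_mono) (auto simp: dist_norm norm_minus_commute)
   finally show ?thesis using norm_triangle_ineq2[of "r j (gam x)" "r j U0"] by linarith
  qed
  have glip: "norm (gam x - gam y) <= (norm (r j U0) + L j) * abs(x - y)" if "x : {-H..H}" "y : {-H..H}" for x y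
   by (rule vector_derivative_bound[where S="{-H..H}", OF _ gd bnd]) (use that in auto)
  have rlip: "norm (r j (gam x) - r j (gam y)) <= M j * abs(x - y)" if "x : {-H..H}" "y : {-H..H}" for x y
   using order_trans[OF L(2)[OF j gin[OF that(1)] gin[OF that(2)]] mult_left_mono[OF glip[OF that] L(1)[OF j]]] by (simp add: M_def mult.assoc)
  define SS where "SS = closed_segment a b"
  have SSsub: "SS \<subseteq> {-H..H}" unfolding SS_def using I by (intro closed_segment_subset) auto
  have SSb: "abs(x - a) <= abs(b - a)" if "x : SS" for x using that unfolding SS_def closed_segment_eq_real_ivl by (auto split: if_splits)
  \<comment> \<open>The residual as a function of the end parameter. Its derivative
    \<open>E' x\<close> is half the error of the tangent approximation at \<open>x\<close>, hence
    quadratic in \<open>x - a\<close>.\<close>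
  define E where "E x = F (gam x) - F (gam a) - (lam j U0 + (a + x) / 2) *\<^sub>R (gam x - gam a)" for x
  define E' where "E' x = (1/2) *\<^sub>R ((x - a) *\<^sub>R r j (gam x) - (gam x - gam a))" for x
  have "norm (E b - E a) <= (M j * (abs(b - a))\<^sup>2) * abs(b - a)"
  proof (rule vector_derivative_bound[where S=SS and g'=E'])
   show "convex SS" unfolding SS_def by simp
   show "b : SS" "a : SS" unfolding SS_def by auto
   fix x assume x: "x : SS"
   then have xI: "x : {-H..H}" using SSsub by blast
   have gx: "(gam has_vector_derivative r j (gam x)) (at x within SS)" and Fx: "((%x. F (gam x)) has_vector_derivative lam j (gam x) *\<^sub>R r j (gam x)) (at x within SS)"
    using has_vector_derivative_within_subset[OF gd[OF xI] SSsub] has_vector_derivative_within_subset[OF Fd[OF xI] SSsub] by auto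
   have "(E has_vector_derivative (lam j (gam x) *\<^sub>R r j (gam x) - 0 - ((lam j U0 + (a + x) / 2) *\<^sub>R (r j (gam x) - 0) + (1/2) *\<^sub>R (gam x - gam a)))) (at x within SS)"
    unfolding E_def
    by (intro has_vector_derivative_diff Fx has_vector_derivative_const has_vector_derivative_scaleR gx) (auto intro!: derivative_eq_intros)
   moreover have "lam j (gam x) *\<^sub>R r j (gam x) - 0 - ((lam j U0 + (a + x) / 2) *\<^sub>R (r j (gam x) - 0) + (1/2) *\<^sub>R (gam x - gam a)) = E' x"
   proof -
    have "lam j (gam x) *\<^sub>R r j (gam x) - (lam j U0 + (a + x) / 2) *\<^sub>R r j (gam x) = ((1/2) * (x - a)) *\<^sub>R r j (gam x)"
     unfolding lamg[OF xI] scaleR_diff_left[symmetric] by (simp add: field_simps)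
    then show ?thesis unfolding E'_def by (simp add: scaleR_diff_right diff_diff_eq[symmetric])
   qed
   ultimately show "(E has_vector_derivative E' x) (at x within SS)" by simp
   have "norm ((gam x - x *\<^sub>R r j (gam x)) - (gam a - a *\<^sub>R r j (gam x))) <= (M j * abs(x - a)) * abs(x - a)"
   proof (rule vector_derivative_bound[where S="closed_segment a x" and g="%y. gam y - y *\<^sub>R r j (gam x)" and g'="%y. r j (gam y) - r j (gam x)"])
    fix y assume y: "y : closed_segment a x"
    have sub: "closed_segment a x \<subseteq> {-H..H}" using I xI by (intro closed_segment_subset) auto
    have yI: "y : {-H..H}" using y sub by blast
    have "((%y. gam y - y *\<^sub>R r j (gam x)) has_vector_derivative r j (gam y) - (1 *\<^sub>R r j (gam x))) (at y within closed_segment a x)"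
     by (intro has_vector_derivative_diff has_vector_derivative_within_subset[OF gd[OF yI] sub]
       bounded_linear.has_vector_derivative[OF bounded_linear_scaleR_left] has_vector_derivative_id)
    then show "((%y. gam y - y *\<^sub>R r j (gam x)) has_vector_derivative r j (gam y) - r j (gam x)) (at y within closed_segment a x)" by simp
    have "abs(y - x) <= abs(x - a)" using y unfolding closed_segment_eq_real_ivl by (auto split: if_splits)
    then show "norm (r j (gam y) - r j (gam x)) <= M j * abs(x - a)"
     using rlip[OF yI xI] M0[OF j] by (meson mult_left_mono order_trans)
   qed auto
   then have "norm ((x - a) *\<^sub>R r j (gam x) - (gam x - gam a)) <= M j * (abs(x - a))\<^sup>2"
    by (subst norm_minus_commute) (simp add: algebra_simps power2_eq_square)
   also have "... <= M j * (abs(b - a))\<^sup>2" using M0[OF j] SSb[OF x] by (intro mult_left_mono power_mono) auto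
   finally have 1: "norm ((x - a) *\<^sub>R r j (gam x) - (gam x - gam a)) <= M j * (abs(b - a))\<^sup>2" .
   have "norm (E' x) = norm ((x - a) *\<^sub>R r j (gam x) - (gam x - gam a)) / 2" unfolding E'_def by simp
   then show "norm (E' x) <= M j * (abs(b - a))\<^sup>2" using 1 norm_ge_zero[of "(x - a) *\<^sub>R r j (gam x) - (gam x - gam a)"] by linarith
  qed
  moreover have "E a = 0" by (simp add: E_def)
  ultimately show ?thesis unfolding Wg E_def a_def b_def by (simp add: power3_eq_cube power2_eq_square mult.assoc)
 qed
 define KK where "KK = K + (SUM j:{1..?n}. M j)"
 have KK: "K <= KK" "0 <= KK" "!!j. j : {1..?n} ==> M j <= KK"
 proof -
  have s0: "0 <= (SUM j:{1..?n}. M j)" using M0 by (rule sum_nonneg)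
  then show "K <= KK" "0 <= KK" using rho by (auto simp: KK_def)
  fix j assume "j : {1..?n}"
  then have "M j <= (SUM j:{1..?n}. M j)" using M0 by (intro member_le_sum) auto
  then show "M j <= KK" using rho by (simp add: KK_def)
 qed
 show ?thesis
 proof (rule exI[of _ W], rule exI[of _ rho], rule exI[of _ KK], intro conjI allI impI ballI)
  have "compose_flows phi U0 i (%_. 0) = U0" if "i <= ?n" for i using that by (induction i) (auto simp: zero)
  then show "W (%_. 0) = U0" unfolding W_def by simp
  fix s s' :: "nat => real" assume s: "(SUM j:{1..?n}. abs(s j)) <= rho" "(SUM j:{1..?n}. abs(s' j)) <= rho"
  have "norm (W s' - W s - (SUM j:{1..?n}. (s' j - s j) *\<^sub>R r j U0))
    <= K * ((SUM j:{1..?n}. abs(s j)) + (SUM j:{1..?n}. abs(s' j))) * (SUM j:{1..?n}. abs(s' j - s j))" using Wes s by blast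
  also have "... <= KK * ((SUM j:{1..?n}. abs(s j)) + (SUM j:{1..?n}. abs(s' j))) * (SUM j:{1..?n}. abs(s' j - s j))"
   using KK by (intro mult_right_mono add_nonneg_nonneg sum_nonneg) auto
  finally show "norm (W s' - W s - (SUM j:{1..?n}. (s' j - s j) *\<^sub>R r j U0))
    <= KK * ((SUM j:{1..?n}. abs(s j)) + (SUM j:{1..?n}. abs(s' j))) * (SUM j:{1..?n}. abs(s' j - s j))" .
 next
  fix j s s' assume j: "j : {1..?n}" and a: "genuinely_nonlinear (lam j) (r j)" "ALL k. k ~= j --> s k = 0 & s' k = 0" "abs(s j) <= rho" "abs(s' j) <= rho"
  have "norm (F (W s') - F (W s) - (lam j U0 + (s j + s' j) / 2) *\<^sub>R (W s' - W s)) <= M j * abs(s' j - s j) ^ 3"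
   using a by (intro GNL j) auto
  also have "... <= KK * abs(s' j - s j) ^ 3" using KK(3)[OF j] by (intro mult_right_mono) auto
  finally show "norm (F (W s') - F (W s) - (lam j U0 + (s j + s' j) / 2) *\<^sub>R (W s' - W s)) <= KK * abs(s' j - s j) ^ 3" .
 qed (use rho KK LD in blast)+
qed

end

text \<open>Induction on the set of positions, the largest one last: removing it leaves the values
  at all smaller positions unchanged.\<close>

lemma telescoping_steps:
 fixes g :: "real => real"
 assumes "finite I"
 shows "(SUM y:p ` I. g (stepv I d p y) - g (stepl I d p y)) = g (sum d I) - g 0"
proof -
 have "ALL I. finite I --> p ` I = Q --> (SUM y:Q. g (stepv I d p y) - g (stepl I d p y)) = g (sum d I) - g 0" if "finite Q" for Q
  using that
 proof (induction Q rule: finite_linorder_max_induct)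
  case empty
  then show ?case by auto
 next
  case (insert M Q)
  show ?case
  proof (intro allI impI)
   fix I assume I: "finite I" "p ` I = insert M Q"
   define J where "J = {i:I. p i < M}"
   have le: "p i <= M" if "i : I" for i
   proof -
    have "p i : insert M Q" using I(2) that by blast
    then show ?thesis using insert.hyps(2) less_imp_le by blast
   qed
   have J: "finite J" "p ` J = Q"
   proof -
    show "finite J" using I by (simp add: J_def)
    have "p ` J = p ` I \<inter> {..<M}" by (auto simp: J_def)
    then show "p ` J = Q" using I insert by auto
   qed
   have M: "stepv I d p M = sum d I" "stepl I d p M = sum d J"
   proof -
    have "{i:I. p i <= M} = I" using le by auto
    then show "stepv I d p M = sum d I" unfolding stepv_def by (simp only:)
    show "stepl I d p M = sum d J" unfolding stepl_def J_def ..
   qed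
   have eq: "stepv I d p y = stepv J d p y" "stepl I d p y = stepl J d p y" if "y : Q" for y
   proof -
    have y: "y < M" using insert that by auto
    then have "{i:I. p i <= y} = {i:J. p i <= y}" "{i:I. p i < y} = {i:J. p i < y}" by (auto simp: J_def)
    then show "stepv I d p y = stepv J d p y" "stepl I d p y = stepl J d p y" unfolding stepv_def stepl_def by (simp_all only:)
   qed
   have "(SUM y:insert M Q. g (stepv I d p y) - g (stepl I d p y)) = (g (sum d I) - g (sum d J)) + (SUM y:Q. g (stepv I d p y) - g (stepl I d p y))"
    using insert by (subst sum.insert) (auto simp: M)
   also have "(SUM y:Q. g (stepv I d p y) - g (stepl I d p y)) = (SUM y:Q. g (stepv J d p y) - g (stepl J d p y))"
    by (intro sum.cong refl) (simp only: eq)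
   also have "... = g (sum d J) - g 0" using insert.IH J by blast
   finally show "(SUM y:insert M Q. g (stepv I d p y) - g (stepl I d p y)) = g (sum d I) - g 0" by simp
  qed
 qed
 then show ?thesis using assms by blast
qed

section \<open>Energy of step functions\<close>

text \<open>For jumps of sum 0 this is the integral of the squared step function
  (\<open>energy_integral\<close>). In this form it is visibly affine in time while the particles
  move uniformly and keep their order.\<close>

definition energy :: "'i set => ('i => real) => ('i => real) => real" where
 "energy I d p = - (SUM i:I. SUM k:I. d i * d k * max (p i) (p k))"

lemma energy_integral:
 assumes I: "finite I" and d: "sum d I = 0"
 shows "has_bochner_integral lborel (%y. (stepv I d p y)\<^sup>2) (energy I d p)"
proof -
 \<comment> \<open>Products of half-line indicators are not integrable; cutting them off at a point
   \<open>M\<close> right of all jumps is harmless, because the step function vanishes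
   there.\<close>
 define M where "M = Max (insert 0 (p ` I))"
 have M: "p i <= M" if "i : I" for i unfolding M_def using I that by (intro Max_ge) auto
 have sq: "(stepv I d p y)\<^sup>2 = (SUM i:I. SUM k:I. d i * d k * indicator {max (p i) (p k)..<M} y)" for y
 proof (cases "y < M")
  case True
  have "(stepv I d p y)\<^sup>2 = (SUM i:I. SUM k:I. (d i * indicator {p i..} y) * (d k * indicator {p k..} y))"
   unfolding stepv_as_sum[OF I] power2_eq_square sum_product ..
  also have "... = (SUM i:I. SUM k:I. d i * d k * indicator {max (p i) (p k)..<M} y)"
   using True by (intro sum.cong refl) (auto simp: indicator_def)
  finally show ?thesis .
 next
  case False
  then have "{i:I. p i <= y} = I" using M by force
  then have "stepv I d p y = 0" unfolding stepv_def using d by (simp only:)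
  then show ?thesis using False by simp
 qed
 have "has_bochner_integral lborel (%y. (SUM i:I. SUM k:I. d i * d k * indicator {max (p i) (p k)..<M} y)) (SUM i:I. SUM k:I. d i * d k * (M - max (p i) (p k)))"
 proof (intro has_bochner_integral_sum has_bochner_integral_mult_right)
  fix i k assume "i : I" "k : I"
  then have "max (p i) (p k) <= M" using M by auto
  then show "has_bochner_integral lborel (indicator {max (p i) (p k)..<M} :: real => real) (M - max (p i) (p k))"
   using has_bochner_integral_real_indicator[of "{max (p i) (p k)..<M}" lborel] by (simp add: measure_def emeasure_lborel_Ico)
 qed
 moreover have "(SUM i:I. SUM k:I. d i * d k * (M - max (p i) (p k))) = energy I d p"
 proof -
  have "(SUM i:I. SUM k:I. d i * d k * M) = (SUM i:I. d i * sum d I * M)"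
   by (simp add: sum_distrib_left sum_distrib_right)
  then show ?thesis using d unfolding energy_def by (simp add: right_diff_distrib sum_subtractf)
 qed
 ultimately show ?thesis unfolding sq by simp
qed

lemma energy_le:
 assumes "!!i. i : I ==> abs(p i) <= B"
 shows "energy I d p <= B * (SUM i:I. abs(d i))\<^sup>2"
proof -
 have "energy I d p = (SUM i:I. SUM k:I. - (d i * d k * max (p i) (p k)))" by (simp add: energy_def sum_negf)
 also have "... <= (SUM i:I. SUM k:I. abs(d i) * abs(d k) * B)"
 proof (intro sum_mono)
  fix i k assume "i : I" "k : I"
  then have "abs(max (p i) (p k)) <= B" using assms[of i] assms[of k] by auto
  then have "abs(d i * d k * max (p i) (p k)) <= abs(d i) * abs(d k) * B" by (simp add: abs_mult mult_left_mono)
  then show "- (d i * d k * max (p i) (p k)) <= abs(d i) * abs(d k) * B" by linarith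
 qed
 also have "... = B * (SUM i:I. abs(d i))\<^sup>2" unfolding power2_eq_square sum_product by (simp add: sum_distrib_left mult_ac)
 finally show ?thesis .
qed

lemma energy_nonneg: "finite I ==> sum d I = 0 ==> 0 <= energy I d p"
 using energy_integral[of I d p] by (metis Bochner_Integration.integral_nonneg has_bochner_integral_integral_eq zero_le_power2)

text \<open>Differentiating \<open>max\<close> selects the speed of the particle further right, and
  the rate becomes minus the sum over the jumps [u] of \<open>2 * s^2\<close> times [u], where
  \<open>s\<close> is the mean of the two states. Each term is 2/3 of the jump of the cube
  \<open>u^3\<close> minus 1/6 of the cube of the jump; the jumps of \<open>u^3\<close> telescope to
  0.\<close>

lemma energy_dissipation:
 assumes I: "finite I" and d: "sum d I = 0" and P: "sticky I d kap P" and tau: "0 <= tau"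
 shows "EX h>0. ALL eta:{0..h}. energy I d (P (tau + eta)) = energy I d (P tau) + eta / 6 * (SUM y:P tau ` I. (jump I d (P tau) y) ^ 3)"
proof -
 define p where "p = P tau"
 define s where "s i = speed I d p (p i)" for i
 obtain h1 where h1: "h1 > 0" "ALL eta:{0..h1}. ALL i:I. P (tau + eta) i = p i + eta * s i"
  using P tau unfolding sticky_def p_def s_def by blast
 have pair: "\<forall>\<^sub>F eta in at_right 0. max (p i + eta * s i) (p k + eta * s k) = max (p i) (p k) + eta * (if p i < p k then s k else s i)" for i k
 proof -
  have lt: "\<forall>\<^sub>F eta in at_right 0. p i + eta * s i < p k + eta * s k" if "p i < p k" for i k
  proof -
   have "((%eta. (p k + eta * s k) - (p i + eta * s i)) \<longlongrightarrow> (p k + 0 * s k) - (p i + 0 * s i)) (at_right 0)"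
    by (intro tendsto_intros)
   then have "\<forall>\<^sub>F eta in at_right 0. 0 < (p k + eta * s k) - (p i + eta * s i)" using that by (intro order_tendstoD(1)) auto
   then show ?thesis by eventually_elim simp
  qed
  consider "p i < p k" | "p k < p i" | "p i = p k" by linarith
  then show ?thesis
  proof cases
   case 1
   show ?thesis using lt[OF 1] by eventually_elim (use 1 in auto)
  next
   case 2
   show ?thesis using lt[OF 2] by eventually_elim (use 2 in auto)
  next
   case 3
   then have "s i = s k" by (simp add: s_def)
   then show ?thesis using 3 by simp
  qed
 qed
 have "\<forall>\<^sub>F eta in at_right 0. ALL i:I. ALL k:I. max (p i + eta * s i) (p k + eta * s k) = max (p i) (p k) + eta * (if p i < p k then s k else s i)"
  using I pair by (intro eventually_ball_finite ballI) auto
 then obtain h2 where h2: "h2 > 0" "!!eta. 0 < eta ==> eta < h2 ==> ALL i:I. ALL k:I. max (p i + eta * s i) (p k + eta * s k) = max (p i) (p k) + eta * (if p i < p k then s k else s i)"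
  unfolding eventually_at_right_field by auto
 have cross: "(SUM i:I. SUM k:I. d i * d k * (if p i < p k then s k else s i)) = - (1/6) * (SUM y:p ` I. (jump I d p y) ^ 3)"
 proof -
  have "(SUM i:I. SUM k:I. d i * d k * (if p i < p k then s k else s i))
   = (SUM i:I. SUM k:I. (if p i < p k then d i * (d k * s k) else 0)) + (SUM i:I. SUM k:I. (if p k <= p i then d k * (d i * s i) else 0))"
   unfolding sum.distrib[symmetric] by (intro sum.cong refl) auto
  also have "(SUM i:I. SUM k:I. (if p i < p k then d i * (d k * s k) else 0)) = (SUM k:I. SUM i:I. (if p i < p k then d i * (d k * s k) else 0))"
   by (rule sum.swap)
  also have "... = (SUM k:I. stepl I d p (p k) * (d k * s k))"
   unfolding stepl_def sum_distrib_right by (rule sum.cong[OF refl]) (simp only: sum.inter_filter[OF I])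
  also have "(SUM i:I. SUM k:I. (if p k <= p i then d k * (d i * s i) else 0)) = (SUM i:I. stepv I d p (p i) * (d i * s i))"
   unfolding stepv_def sum_distrib_right by (rule sum.cong[OF refl]) (simp only: sum.inter_filter[OF I])
  also have "(SUM k:I. stepl I d p (p k) * (d k * s k)) + (SUM i:I. stepv I d p (p i) * (d i * s i)) = (SUM i:I. 2 * (speed I d p (p i))\<^sup>2 * d i)"
   unfolding sum.distrib[symmetric] by (intro sum.cong refl) (simp add: s_def speed_def power2_eq_square field_simps)
  also have "... = (SUM y:p ` I. SUM i:{i:I. p i = y}. 2 * (speed I d p (p i))\<^sup>2 * d i)" using I by (rule sum.image_gen)
  also have "... = (SUM y:p ` I. 2 * (speed I d p y)\<^sup>2 * jump I d p y)"
   unfolding jump_def sum_distrib_left by (intro sum.cong refl) auto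
  also have "... = (SUM y:p ` I. - (1/6) * (jump I d p y) ^ 3 + 2/3 * ((stepv I d p y)^3 - (stepl I d p y)^3))"
  proof (intro sum.cong refl)
   fix y
   have v: "stepv I d p y = stepl I d p y + jump I d p y" by (rule stepv_eq_stepl_jump[OF I])
   show "2 * (speed I d p y)\<^sup>2 * jump I d p y = - (1/6) * (jump I d p y) ^ 3 + 2/3 * ((stepv I d p y)^3 - (stepl I d p y)^3)"
    unfolding speed_def v by (simp add: power2_eq_square power3_eq_cube field_simps)
  qed
  also have "... = - (1/6) * (SUM y:p ` I. (jump I d p y) ^ 3) + 2/3 * (SUM y:p ` I. (stepv I d p y)^3 - (stepl I d p y)^3)"
   by (simp only: sum.distrib sum_distrib_left)
  also have "(SUM y:p ` I. (stepv I d p y)^3 - (stepl I d p y)^3) = 0"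
   using telescoping_steps[OF I, of "%u. u ^ 3" d p] d by simp
  finally show ?thesis by simp
 qed
 have "energy I d (P (tau + eta)) = energy I d p + eta / 6 * (SUM y:p ` I. (jump I d p y) ^ 3)" if eta: "eta : {0..min h1 (h2 / 2)}" for eta
 proof -
  have "energy I d (P (tau + eta)) = - (SUM i:I. SUM k:I. d i * d k * max (p i + eta * s i) (p k + eta * s k))"
   unfolding energy_def using h1(2) eta by (intro arg_cong[where f=uminus] sum.cong refl) auto
  also have "... = - (SUM i:I. SUM k:I. d i * d k * (max (p i) (p k) + eta * (if p i < p k then s k else s i)))"
  proof (cases "eta = 0")
   case False
   then have "0 < eta" "eta < h2" using eta h2(1) by auto
   then show ?thesis using h2(2)[of eta] by (intro arg_cong[where f=uminus] sum.cong refl) auto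
  qed simp
  also have "... = energy I d p - eta * (SUM i:I. SUM k:I. d i * d k * (if p i < p k then s k else s i))"
   unfolding energy_def distrib_left sum.distrib sum_distrib_left by (simp add: mult.left_commute)
  finally show ?thesis unfolding cross by simp
 qed
 then show ?thesis unfolding p_def[symmetric] using h1(1) h2(1) by (intro exI[of _ "min h1 (h2 / 2)"]) auto
qed

lemma cube_le:
 fixes x :: real assumes "x <= kap" "0 <= kap"
 shows "x ^ 3 <= kap\<^sup>2 * abs x"
proof (cases "0 <= x")
 case True
 then have "x\<^sup>2 * x <= kap\<^sup>2 * x" using assms by (intro mult_right_mono power_mono) auto
 then show ?thesis using True by (simp add: power3_eq_cube power2_eq_square)
next
 case False
 then have "x ^ 3 <= 0" by simp
 also have "0 <= kap\<^sup>2 * abs x" by simp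
 finally show ?thesis .
qed

lemma energy_continuous:
 assumes I: "finite I" and P: "sticky I d kap P"
 shows "continuous_on {0..} (%tau. energy I d (P tau))"
proof -
 have "continuous_on {0..} (%tau. P tau i)" if "i : I" for i
  by (rule lipschitz_on_continuous_on[of "SUM i:I. abs(d i)"], rule lipschitz_onI)
   (use P that in \<open>auto simp: sticky_def dist_real_def intro!: sum_nonneg\<close>)
 then show ?thesis unfolding energy_def by (intro continuous_intros)
qed

text \<open>Only upward jumps feed the energy, by \<open>cube_le\<close> at a rate of order
  \<open>kap^2\<close>.\<close>

lemma energy_growth:
 assumes I: "finite I" and d: "sum d I = 0" and P: "sticky I d kap P" and kap: "0 <= kap" and tau: "0 <= tau"
 shows "energy I d (P tau) <= energy I d (P 0) + kap\<^sup>2 * (SUM i:I. abs(d i)) / 6 * tau"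
proof -
 define c where "c = kap\<^sup>2 * (SUM i:I. abs(d i)) / 6"
 have "energy I d (P tau) <= energy I d (P 0) + c * (tau - 0)"
 proof (rule right_punctured_growth[OF tau])
  show "continuous_on {0..tau} (%tau. energy I d (P tau))" by (rule continuous_on_subset[OF energy_continuous[OF I P]]) auto
  fix t :: real assume t: "0 <= t" "t < tau"
  have "EX k>0. ALL eta:{0<..<k}. energy I d (P (s + eta)) <= energy I d (P s) + c * eta" if s: "0 <= s" for s
  proof -
   obtain h where h: "h > 0" "!!eta. eta : {0..h} ==> energy I d (P (s + eta)) = energy I d (P s) + eta / 6 * (SUM y:P s ` I. (jump I d (P s) y) ^ 3)"
    using energy_dissipation[OF I d P s] by blast
   have "(SUM y:P s ` I. (jump I d (P s) y) ^ 3) <= (SUM y:P s ` I. kap\<^sup>2 * abs(jump I d (P s) y))"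
    using P s kap by (intro sum_mono cube_le) (auto simp: sticky_def)
   also have "... = kap\<^sup>2 * (SUM y:P s ` I. abs(jump I d (P s) y))" by (simp add: sum_distrib_left)
   also have "... <= 6 * c" unfolding c_def using sum_abs_jump_le[OF I, of "P s ` I" d "P s"] I by (simp add: mult_left_mono)
   finally have le: "(SUM y:P s ` I. (jump I d (P s) y) ^ 3) <= 6 * c" .
   have "energy I d (P (s + eta)) <= energy I d (P s) + c * eta" if "eta : {0<..<h}" for eta
    using h(2)[of eta] that mult_left_mono[OF le, of "eta / 6"] by (simp add: mult_ac)
   then show ?thesis using h(1) by blast
  qed
  then show "EX h>0. ALL s:{t<..<t + h}. s < tau --> (EX k>0. ALL eta:{0<..<k}. energy I d (P (s + eta)) <= energy I d (P s) + c * eta)"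
   using t by (intro exI[of _ 1]) auto
 qed
 then show ?thesis by (simp add: c_def)
qed

section \<open>Step functions with moving jumps, compared with the semigroup\<close>

lemma step_measurable:
 fixes Psi :: "'k set => 'b::euclidean_space" and X :: "'k => real"
 assumes J: "finite J"
 shows "(%x. Psi {k:J. X k <= x}) : borel_measurable borel"
proof -
 have eq: "Psi {k:J. X k <= x} = (SUM K:Pow J. indicator {x. ALL k:J. X k <= x \<longleftrightarrow> k : K} x *\<^sub>R Psi K)" for x
 proof -
  have "(SUM K:Pow J. indicator {x. ALL k:J. X k <= x \<longleftrightarrow> k : K} x *\<^sub>R Psi K) = (SUM K:{{k:J. X k <= x}}. Psi K)"
   by (rule sum.mono_neutral_cong_right) (use J in \<open>auto simp: indicator_def\<close>)
  then show ?thesis by simp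
 qed
 have "{x. ALL k:J. X k <= x \<longleftrightarrow> k : K} : sets borel" for K
 proof -
  have "{x : space borel. ALL k:J. X k <= x \<longleftrightarrow> k : K} : sets borel"
   by (rule sets.sets_Collect_finite_All) (use J in auto)
  then show ?thesis by simp
 qed
 then show ?thesis unfolding eq by (intro borel_measurable_sum borel_measurable_scaleR borel_measurable_indicator) auto
qed

text \<open>For short times a front moves less than half its distance to any other position. Hence
  in the cell of \<open>X k0\<close> only fronts that start at \<open>X k0\<close> matter, and these
  move together by \<open>same\<close>.\<close>

lemma moving_cells:
 fixes X sp :: "'k => real"
 assumes J: "finite J" and same: "!!k k'. k : J ==> k' : J ==> X k = X k' ==> sp k = sp k'"
 shows "EX h>0. ALL eta:{0<..<h}. ALL k0:J. ALL x. (ALL q:X ` J. abs(x - X k0) <= abs(x - q)) -->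
  {k:J. X k + eta * sp k <= x} = (if (x - X k0) / eta < sp k0 then {k:J. X k < X k0} else {k:J. X k <= X k0})"
proof -
 have "\<forall>\<^sub>F eta in at_right 0. ALL k:J. ALL k0:J. X k ~= X k0 --> eta * abs(sp k) < abs(X k - X k0) / 2"
 proof (intro eventually_ball_finite J ballI)
  fix k k0
  have "((%eta. eta * abs(sp k)) \<longlongrightarrow> 0 * abs(sp k)) (at_right 0)" by (intro tendsto_intros)
  then have "X k ~= X k0 ==> \<forall>\<^sub>F eta in at_right 0. eta * abs(sp k) < abs(X k - X k0) / 2" by (rule order_tendstoD(2)) auto
  then show "\<forall>\<^sub>F eta in at_right 0. X k ~= X k0 --> eta * abs(sp k) < abs(X k - X k0) / 2" by (cases "X k = X k0") auto
 qed
 then obtain h where h: "h > 0" "!!eta. 0 < eta ==> eta < h ==> ALL k:J. ALL k0:J. X k ~= X k0 --> eta * abs(sp k) < abs(X k - X k0) / 2"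
  unfolding eventually_at_right_field by auto
 show ?thesis
 proof (rule exI[of _ h], intro conjI ballI allI impI)
  fix eta k0 x assume eta: "eta : {0<..<h}" and k0: "k0 : J" and cell: "ALL q:X ` J. abs(x - X k0) <= abs(x - q)"
  have small: "eta * abs(sp k) < abs(X k - X k0) / 2" if "k : J" "X k ~= X k0" for k using h(2)[of eta] eta that k0 by auto
  have abs: "abs(eta * sp k) = eta * abs(sp k)" for k using eta by (simp add: abs_mult)
  have left: "X k + eta * sp k <= x" if "k : J" "X k < X k0" for k
   using small[of k] abs[of k] cell that by (auto simp: abs_if split: if_splits)
  have right: "~ X k + eta * sp k <= x" if "k : J" "X k0 < X k" for k
   using small[of k] abs[of k] cell that by (auto simp: abs_if split: if_splits)
  have mid: "X k + eta * sp k <= x \<longleftrightarrow> ~ (x - X k0) / eta < sp k0" if "k : J" "X k = X k0" for k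
   using same[OF that(1) k0 that(2)] that eta by (auto simp: field_simps not_less)
  have "(X k + eta * sp k <= x) = (if (x - X k0) / eta < sp k0 then X k < X k0 else X k <= X k0)" if "k : J" for k
   using left[OF that] right[OF that] mid[OF that] by (cases "X k" "X k0" rule: linorder_cases) auto
  then show "{k:J. X k + eta * sp k <= x} = (if (x - X k0) / eta < sp k0 then {k:J. X k < X k0} else {k:J. X k <= X k0})"
   by (auto split: if_splits)
 qed (rule h)
qed

text \<open>For small \<open>h\<close>, coordinates that differ at \<open>t\<close> do not meet
  before \<open>t + h\<close> unless their slopes agree, and coordinates that agree at
  \<open>t\<close> can agree again only if their slopes do.\<close>

lemma collisions_isolated:
 fixes Y :: "real => 'k => real" and c :: "'k => real"
 assumes J: "finite J" and lin: "EX h>0. ALL eta:{0..h}. ALL k:J. Y (t + eta) k = Y t k + eta * c k"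
 shows "EX h>0. ALL s:{t<..<t + h}. ALL k:J. ALL k':J. Y s k = Y s k' --> c k = c k'"
proof -
 obtain h1 where h1: "h1 > 0" "!!eta k. eta : {0..h1} ==> k : J ==> Y (t + eta) k = Y t k + eta * c k" using lin by blast
 have "\<forall>\<^sub>F eta in at_right 0. ALL k:J. ALL k':J. Y t k + eta * c k = Y t k' + eta * c k' --> c k = c k'"
 proof (intro eventually_ball_finite J ballI)
  fix k k'
  show "\<forall>\<^sub>F eta in at_right 0. Y t k + eta * c k = Y t k' + eta * c k' --> c k = c k'"
  proof (cases "Y t k = Y t k'")
   case True
   show ?thesis unfolding eventually_at_right_field by (intro exI[of _ 1]) (auto simp: True)
  next
   case False
   have "((%eta. (Y t k - Y t k') + eta * (c k - c k')) \<longlongrightarrow> (Y t k - Y t k') + 0 * (c k - c k')) (at_right 0)" by (intro tendsto_intros)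
   then have "\<forall>\<^sub>F eta in at_right 0. (Y t k - Y t k') + eta * (c k - c k') ~= 0" by (rule tendsto_imp_eventually_ne) (use False in simp)
   then show ?thesis by eventually_elim (auto simp: algebra_simps)
  qed
 qed
 then obtain h2 where h2: "h2 > 0" "!!eta. 0 < eta ==> eta < h2 ==> ALL k:J. ALL k':J. Y t k + eta * c k = Y t k' + eta * c k' --> c k = c k'"
  unfolding eventually_at_right_field by auto
 show ?thesis
 proof (rule exI[of _ "min h1 h2"], intro conjI ballI impI)
  fix s k k' assume s: "s : {t<..<t + min h1 h2}" and k: "k : J" "k' : J" and eq: "Y s k = Y s k'"
  have "Y s k = Y t k + (s - t) * c k" "Y s k' = Y t k' + (s - t) * c k'" using h1(2)[of "s - t"] s k by auto
  then show "c k = c k'" using h2(2)[of "s - t"] s k eq by auto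
 qed (use h1 h2 in auto)
qed

context lipschitz_semigroup
begin

text \<open>In each cell both functions are self-similar about the jump, the semigroup by its
  Riemann clause and the moving step function by \<open>moving_cells\<close>; \<open>err\<close>
  compares the two profiles one jump at a time.\<close>

lemma moving_step_error:
 fixes X sp :: "'k => real" and Psi :: "'k set => real^'n" and e :: "real => real"
 assumes clause: "riemann_exact F lam r \<D> S R"
  and J: "finite J" "J ~= {}" and same: "!!k k'. k : J ==> k' : J ==> X k = X k' ==> sp k = sp k'"
  and v: "(%x. Psi {k:J. X k <= x}) : \<D>"
  and err: "!!k. k : J ==> lax_riemann_solution F lam r (Psi {k':J. X k' < X k}) (Psi {k':J. X k' <= X k}) (R (Psi {k':J. X k' < X k}) (Psi {k':J. X k' <= X k})) ==>
   profile_error (R (Psi {k':J. X k' < X k}) (Psi {k':J. X k' <= X k})) (Psi {k':J. X k' < X k}) (Psi {k':J. X k' <= X k}) (sp k) (e (X k))"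
 shows "EX h>0. ALL eta:{0<..<h}. L1_dist (S eta (%x. Psi {k:J. X k <= x})) (%x. Psi {k:J. X k + eta * sp k <= x}) <= eta * (SUM p:X ` J. e p)"
proof -
 define v where "v x = Psi {k:J. X k <= x}" for x
 define vl where "vl p = Psi {k:J. X k < p}" for p
 define P where "P = X ` J"
 have P: "finite P" "P ~= {}" using J by (auto simp: P_def)
 have vD: "v : \<D>" using v unfolding v_def[abs_def] .
 have step: "v x = v y" if "x <= y" "P \<inter> {x<..y} = {}" for x y
 proof -
  have "{k:J. X k <= x} = {k:J. X k <= y}" using that unfolding P_def by force
  then show ?thesis unfolding v_def by (simp only:)
 qed
 have left: "EX x<p. P \<inter> {x<..<p} = {} & v x = vl p" if "p : P" for p
 proof -
  define x where "x = Max (insert (p - 1) {q:P. q < p})"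
  have fin: "finite (insert (p - 1) {q:P. q < p})" using P by auto
  have "x : insert (p - 1) {q:P. q < p}" unfolding x_def using fin by (rule Max_in) auto
  then have xp: "x < p" by auto
  have ge: "q <= x" if "q : P" "q < p" for q unfolding x_def using fin that by (intro Max_ge) auto
  have "{k:J. X k <= x} = {k:J. X k < p}" using xp ge unfolding P_def by force
  then have "v x = vl p" unfolding v_def vl_def by (simp only:)
  moreover have "P \<inter> {x<..<p} = {}" using ge by force
  ultimately show ?thesis using xp by blast
 qed
 note rc = riemann_clause[OF clause vD P step left]
 define Q where "Q p s G Z \<longleftrightarrow> (EX k:J. X k = p & sp k = s) & integrable lborel G & (ALL xi. 0 <= G xi) & finite Z &
    (ALL xi. xi ~: Z --> norm (R (vl p) (v p) xi - (if xi < s then vl p else v p)) <= G xi) & (LINT xi|lborel. G xi) <= e p" for p s G Z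
 have "ALL p:P. EX s G Z. Q p s G Z"
 proof
  fix p assume p: "p : P"
  then obtain k where k: "k : J" "X k = p" unfolding P_def by blast
  have "lax_riemann_solution F lam r (vl p) (v p) (R (vl p) (v p))" using rc(1) p by blast
  then have "profile_error (R (vl p) (v p)) (vl p) (v p) (sp k) (e p)"
   using err[OF k(1)] unfolding k(2) v_def vl_def by blast
  then show "EX s G Z. Q p s G Z" unfolding Q_def using k by blast
 qed
 then obtain s G Z where "ALL p:P. Q p (s p) (G p) (Z p)" by metis
 note sGZ = this[unfolded Q_def]
 obtain h1 where h1: "h1 > 0" "ALL eta:{0<..<h1}. ALL k0:J. ALL x. (ALL q:X ` J. abs(x - X k0) <= abs(x - q)) -->
  {k:J. X k + eta * sp k <= x} = (if (x - X k0) / eta < sp k0 then {k:J. X k < X k0} else {k:J. X k <= X k0})"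
  using moving_cells[of J X sp, OF J(1) same] by blast
 obtain dl where dl: "dl > 0" "ALL t:{0<..dl}. AE x in lborel. ALL p:P. (ALL q:P. abs(x - p) <= abs(x - q)) --> S t v x = R (vl p) (v p) ((x - p) / t)"
  using rc(2) by blast
 have "L1_dist (S eta v) (%x. Psi {k:J. X k + eta * sp k <= x}) <= eta * (SUM p:P. e p)" if eta: "eta : {0<..<min h1 dl}" for eta
 proof -
  have "L1_dist (S eta v) (%x. Psi {k:J. X k + eta * sp k <= x}) <= eta * (SUM p:P. LINT xi|lborel. G p xi)"
  proof (rule L1_dist_le_cells[OF P])
   show "0 < eta" using eta by simp
   show "S eta v : borel_measurable lborel" using D_measurable[OF S_in[OF vD]] eta by simp
   show "(%x. Psi {k:J. X k + eta * sp k <= x}) : borel_measurable lborel" using step_measurable[OF J(1), of Psi "%k. X k + eta * sp k"] by simp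
   show "integrable lborel (G p)" "0 <= G p xi" if "p : P" for p xi using sGZ that by blast+
   have "finite (UN p:P. (%z. p + eta * z) ` Z p)" using P sGZ by blast
   then have "AE x in lborel. x ~: (UN p:P. (%z. p + eta * z) ` Z p)"
    by (intro AE_not_in finite_imp_null_set_lborel)
   moreover have "AE x in lborel. ALL p:P. (ALL q:P. abs(x - p) <= abs(x - q)) --> S eta v x = R (vl p) (v p) ((x - p) / eta)"
    using dl(2) eta by auto
   ultimately show "AE x in lborel. ALL p:P. (ALL q:P. abs(x - p) <= abs(x - q)) --> norm (S eta v x - Psi {k:J. X k + eta * sp k <= x}) <= G p ((x - p) / eta)"
   proof eventually_elim
    case (elim x)
    show ?case
    proof (intro ballI impI)
     fix p assume p: "p : P" and cell: "ALL q:P. abs(x - p) <= abs(x - q)"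
     have Sx: "S eta v x = R (vl p) (v p) ((x - p) / eta)" using elim(2) p cell by blast
     obtain k where k: "k : J" "X k = p" "sp k = s p" using sGZ p by blast
     have "x = p + eta * ((x - p) / eta)" using eta by simp
     then have nz: "(x - p) / eta ~: Z p" using elim(1) p by blast
     have "{k:J. X k + eta * sp k <= x} = (if (x - X k) / eta < sp k then {k':J. X k' < X k} else {k':J. X k' <= X k})"
      using h1(2) eta k(1) cell[unfolded k(2)[symmetric] P_def] by auto
     then have "Psi {k:J. X k + eta * sp k <= x} = (if (x - p) / eta < s p then vl p else v p)"
      unfolding k(2,3) v_def vl_def by (simp split: if_splits)
     then show "norm (S eta v x - Psi {k:J. X k + eta * sp k <= x}) <= G p ((x - p) / eta)"
      using sGZ p nz unfolding Sx by auto
    qed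
   qed
  qed
  also have "... <= eta * (SUM p:P. e p)" using eta sGZ by (intro mult_left_mono sum_mono) auto
  finally show ?thesis .
 qed
 then show ?thesis using h1(1) dl(1) unfolding v_def[abs_def] P_def by (intro exI[of _ "min h1 dl"]) auto
qed

end

section \<open>Tracking the fronts of all families\<close>

definition strength :: "nat => (nat => real) => real" where
 "strength n s = (SUM j:{1..n}. abs(s j))"

lemma strength_nonneg: "0 <= strength n s" unfolding strength_def by (intro sum_nonneg) auto

lemma stepv_shift: "stepv I d (%i. a + p i) x = stepv I d p (x - a)"
proof -
 have "{i:I. a + p i <= x} = {i:I. p i <= x - a}" by auto
 then show ?thesis unfolding stepv_def by (simp only:)
qed

lemma stepl_shift: "stepl I d (%i. a + p i) x = stepl I d p (x - a)"
proof -
 have "{i:I. a + p i < x} = {i:I. p i < x - a}" by auto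
 then show ?thesis unfolding stepl_def by (simp only:)
qed

lemma jump_shift: "jump I d (%i. a + p i) x = jump I d p (x - a)"
proof -
 have "{i:I. a + p i = x} = {i:I. p i = x - a}" by auto
 then show ?thesis unfolding jump_def by (simp only:)
qed

text \<open>All parameters but \<open>I\<close>, \<open>d\<close>, \<open>P\<close>,
  \<open>kap\<close> and \<open>eps\<close> are fixed once for the system and the datum. The
  smallness conditions keep the states where the estimates for \<open>W\<close>, \<open>F\<close>
  and the Riemann problem hold, and the front speeds within \<open>gam\<close> of the eigenvalues.
  \<open>small_l\<close> and \<open>kap0B\<close> ensure that a downward jump of a genuinely
  nonlinear family counts as decreasing in \<open>rarefaction_term\<close>.\<close>

locale front_tracking = hyperbolic_system F lam l r U0 + lipschitz_semigroup U0 \<D> S L1 L2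
 for F :: "real^'n => real^'n" and lam :: "nat => real^'n => real" and l r :: "nat => real^'n => real^'n" and U0 :: "real^'n"
  and \<D> :: "(real => real^'n) set" and S :: "real => (real => real^'n) => (real => real^'n)" and L1 L2 :: real +
 fixes R :: "real^'n => real^'n => real => real^'n" and W :: "(nat => real) => real^'n"
  and rho CW B kap0 dR CR CF gam dl0 V len :: real
  and I :: "nat set" and d :: "nat => nat => real" and P :: "nat => real => nat => real" and kap eps :: real
 assumes clause: "riemann_exact F lam r \<D> S R"
  and D_tv: "!!v. integrable lborel (%x. v x - U0) ==> total_variation v < ennreal dl0 ==> v : \<D>"
  and W_0: "W (%_. 0) = U0"
  and W_est: "!!s s'. strength CARD('n) s <= rho ==> strength CARD('n) s' <= rho ==>
   norm (W s' - W s - (SUM j:{1..CARD('n)}. (s' j - s j) *\<^sub>R r j U0)) <= CW * (strength CARD('n) s + strength CARD('n) s') * strength CARD('n) (%j. s' j - s j)"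
  and W_lip: "!!s s'. strength CARD('n) s <= rho ==> strength CARD('n) s' <= rho ==> norm (W s' - W s) <= B * strength CARD('n) (%j. s' j - s j)"
  and W_LD: "!!mu s. strength CARD('n) s <= rho ==> ALL j:{1..CARD('n)}. s j ~= 0 --> linearly_degenerate (lam j) (r j) & lam j U0 = mu ==>
   F (W s) - mu *\<^sub>R W s = F U0 - mu *\<^sub>R U0"
  and W_GNL: "!!j s s'. j : {1..CARD('n)} ==> genuinely_nonlinear (lam j) (r j) ==> ALL k. k ~= j --> s k = 0 & s' k = 0 ==> abs(s j) <= rho ==> abs(s' j) <= rho ==>
   norm (F (W s') - F (W s) - (lam j U0 + (s j + s' j) / 2) *\<^sub>R (W s' - W s)) <= CW * abs(s' j - s j) ^ 3"
  and F_quad: "!!u v. u : cball U0 1 ==> v : cball U0 1 ==> norm (F u - F v - A U0 (u - v)) <= CF * (norm (u - U0) + norm (v - U0)) * norm (u - v)"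
  and gap: "!!i j. i : {1..CARD('n)} ==> j : {1..CARD('n)} ==> lam i U0 ~= lam j U0 ==> 4 * gam <= abs(lam i U0 - lam j U0)"
  and riem: "!!ul ur j s. ul : ball U0 dR ==> ur : ball U0 dR ==> lax_riemann_solution F lam r ul ur (R ul ur) ==> j : {1..CARD('n)} ==> abs(s - lam j U0) < dR ==>
   (profile_error (R ul ur) ul ur s (CR * norm (F ur - F ul - s *\<^sub>R (ur - ul)) + rarefaction_term lam l r U0 kap0 CR j (ur - ul)))"
  and pos: "0 < rho" "0 <= CW" "0 <= B" "0 < kap0" "0 < dR" "0 <= CR" "0 <= CF" "0 < gam" "0 <= V" "0 <= len" "0 <= kap" "kap <= 1" "0 < eps" "eps <= 1"
  and I: "finite I" "I ~= {}"
  and d_sum: "!!j. j : {1..CARD('n)} ==> sum (d j) I = 0"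
  and d_V: "!!j. j : {1..CARD('n)} ==> (SUM i:I. abs(d j i)) <= V"
  and P_0: "!!j i. j : {1..CARD('n)} ==> i : I ==> abs(P j 0 i) <= len"
  and P_GNL: "!!j. j : {1..CARD('n)} ==> genuinely_nonlinear (lam j) (r j) ==> sticky I (d j) kap (P j)"
  and P_LD: "!!j tau. j : {1..CARD('n)} ==> linearly_degenerate (lam j) (r j) ==> 0 <= tau ==> P j tau = P j 0"
  and small_rho: "eps * (CARD('n) * V) <= rho" and small_gam: "eps * V <= gam" and small_dR: "eps * V < dR"
  and small_B: "B * (eps * (CARD('n) * V)) < dR" "B * (eps * (CARD('n) * V)) < dl0" "B * (eps * (CARD('n) * V)) <= 1"
  and small_l: "!!j. j : {1..CARD('n)} ==> norm (l j U0) * (2 * CW * (eps * V)) <= 1 / 2" and kap0B: "kap0 * B <= 1 / 2"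
begin

abbreviation gnl :: "nat => bool" where "gnl j \<equiv> genuinely_nonlinear (lam j) (r j)"

definition J :: "(nat \<times> nat) set" where "J = {1..CARD('n)} \<times> I"
definition dd :: "nat \<times> nat => real" where "dd k = d (fst k) (snd k)"
definition X :: "real => nat \<times> nat => real" where "X t k = lam (fst k) U0 * t + P (fst k) (eps * t) (snd k)"
definition sp :: "real => nat \<times> nat => real" where
 "sp t k = lam (fst k) U0 + (if gnl (fst k) then eps * speed I (d (fst k)) (P (fst k) (eps * t)) (P (fst k) (eps * t) (snd k)) else 0)"
text \<open>Zero off the range of the families, since \<open>W_GNL\<close> asks all other arguments
  to vanish.\<close>

definition coef :: "(nat \<times> nat) set => nat => real" where
 "coef K j = (if j : {1..CARD('n)} then eps * (SUM i:{i:I. (j, i) : K}. d j i) else 0)"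
text \<open>The state depends on the set of fronts passed, so fronts of several families at one
  point need no order among them.\<close>

definition Psi :: "(nat \<times> nat) set => real^'n" where "Psi K = W (coef K)"
definition w :: "real => real => real^'n" where "w t x = Psi {k:J. X t k <= x}"
text \<open>
  Front \<open>(j, i)\<close> is the \<open>i\<close>-th jump of \<open>v\<^sub>j\<close>, shifted by \<open>\<lambda>\<^sub>j t\<close>; at good times no two fronts of families
  with different speeds coincide.
\<close>

definition good :: "real => bool" where "good t \<longleftrightarrow> (ALL k:J. ALL k':J. X t k = X t k' --> lam (fst k) U0 = lam (fst k') U0)"

lemma J: "finite J" "J ~= {}"
proof -
 have "1 : {1..CARD('n)}" by (simp add: Suc_leI)
 then show "finite J" "J ~= {}" using I by (auto simp: J_def)
qed

lemma sum_J: "(SUM k:J. g k) = (SUM j:{1..CARD('n)}. SUM i:I. g (j, i))"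
 unfolding J_def by (simp add: sum.cartesian_product)

lemma sum_dd: "(SUM k:J. abs(dd k)) <= CARD('n) * V"
proof -
 have "(SUM k:J. abs(dd k)) <= (SUM j:{1..CARD('n)}. V)" unfolding sum_J dd_def by (intro sum_mono) (use d_V in auto)
 then show ?thesis by simp
qed

lemma coef_diff:
 assumes "K \<subseteq> K'" "K' \<subseteq> J"
 shows "strength CARD('n) (%j. coef K' j - coef K j) <= eps * (SUM k:K' - K. abs(dd k))"
proof -
 have "abs(coef K' j - coef K j) <= eps * (SUM i:I. if (j, i) : K' - K then abs(dd (j, i)) else 0)" if j: "j : {1..CARD('n)}" for j
 proof -
  have "coef K' j - coef K j = eps * ((SUM i:I. if (j, i) : K' then d j i else 0) - (SUM i:I. if (j, i) : K then d j i else 0))"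
   using j I unfolding coef_def by (simp add: sum.inter_filter right_diff_distrib)
  also have "(SUM i:I. if (j, i) : K' then d j i else 0) - (SUM i:I. if (j, i) : K then d j i else 0) = (SUM i:I. if (j, i) : K' - K then dd (j, i) else 0)"
   unfolding sum_subtractf[symmetric] using assms by (intro sum.cong refl) (auto simp: dd_def)
  also have "abs(eps * ...) <= eps * (SUM i:I. abs(if (j, i) : K' - K then dd (j, i) else 0))"
   using pos by (simp add: abs_mult mult_left_mono)
  also have "... = eps * (SUM i:I. if (j, i) : K' - K then abs(dd (j, i)) else 0)" by (intro arg_cong2[where f="(*)"] sum.cong refl) auto
  finally show ?thesis .
 qed
 then have "strength CARD('n) (%j. coef K' j - coef K j) <= (SUM j:{1..CARD('n)}. eps * (SUM i:I. if (j, i) : K' - K then abs(dd (j, i)) else 0))"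
  unfolding strength_def by (intro sum_mono)
 also have "... = eps * (SUM k:J. if k : K' - K then abs(dd k) else 0)" unfolding sum_J sum_distrib_left ..
 also have "(SUM k:J. if k : K' - K then abs(dd k) else 0) = (SUM k:J \<inter> (K' - K). abs(dd k))" using J(1) by (simp add: sum.inter_restrict)
 also have "J \<inter> (K' - K) = K' - K" using assms by auto
 finally show ?thesis .
qed

lemma coef_empty: "coef {} = (%_. 0)" unfolding coef_def by auto

lemma coef_strength: "K \<subseteq> J ==> strength CARD('n) (coef K) <= eps * (CARD('n) * V)"
proof -
 assume K: "K \<subseteq> J"
 have "strength CARD('n) (coef K) <= eps * (SUM k:K. abs(dd k))" using coef_diff[of "{}" K] K by (simp add: coef_empty)
 also have "... <= eps * (SUM k:J. abs(dd k))" using K J pos by (intro mult_left_mono sum_mono2) auto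
 also have "... <= eps * (CARD('n) * V)" using sum_dd pos by (intro mult_left_mono) auto
 finally show ?thesis .
qed

lemma coef_rho: "K \<subseteq> J ==> strength CARD('n) (coef K) <= rho" using order_trans[OF coef_strength small_rho] .

lemma coef_component: "K \<subseteq> J ==> abs(coef K j) <= eps * V"
proof -
 have "abs(SUM i:{i:I. (j, i) : K}. d j i) <= V" if "j : {1..CARD('n)}"
 proof -
  have "abs(SUM i:{i:I. (j, i) : K}. d j i) <= (SUM i:{i:I. (j, i) : K}. abs(d j i))" by (rule sum_abs)
  also have "... <= (SUM i:I. abs(d j i))" using I by (intro sum_mono2) auto
  finally show ?thesis using d_V[OF that] by simp
 qed
 then show ?thesis using pos unfolding coef_def by (auto simp: abs_mult)
qed

lemma Psi_diff: "K \<subseteq> K' ==> K' \<subseteq> J ==> norm (Psi K' - Psi K) <= B * (eps * (SUM k:K' - K. abs(dd k)))"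
proof -
 assume a: "K \<subseteq> K'" "K' \<subseteq> J"
 then have "norm (Psi K' - Psi K) <= B * strength CARD('n) (%j. coef K' j - coef K j)"
  unfolding Psi_def by (intro W_lip coef_rho) auto
 also have "... <= B * (eps * (SUM k:K' - K. abs(dd k)))" using coef_diff[OF a] pos by (intro mult_left_mono) auto
 finally show ?thesis .
qed

lemma Psi_U0: "K \<subseteq> J ==> norm (Psi K - U0) <= B * strength CARD('n) (coef K)"
 using W_lip[OF _ coef_rho, of "%_. 0" K] W_0 pos unfolding Psi_def by (simp add: strength_def)

lemma Psi_near: "K \<subseteq> J ==> norm (Psi K - U0) <= B * (eps * (CARD('n) * V))"
 using order_trans[OF Psi_U0 mult_left_mono[OF coef_strength]] pos by blast

lemma coef_step:
 "coef {k:J. X t k <= x} = (%j. if j : {1..CARD('n)} then eps * stepv I (d j) (%i. X t (j, i)) x else 0)"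
 "coef {k:J. X t k < x} = (%j. if j : {1..CARD('n)} then eps * stepl I (d j) (%i. X t (j, i)) x else 0)"
 unfolding coef_def stepv_def stepl_def J_def by (auto intro!: ext sum.cong)

lemma X_eq: "(%i. X t (j, i)) = (%i. lam j U0 * t + P j (eps * t) i)" by (simp add: X_def)

lemma w_eq: "w t x = W (%j. if j : {1..CARD('n)} then eps * stepv I (d j) (P j (eps * t)) (x - lam j U0 * t) else 0)"
 unfolding w_def Psi_def coef_step X_eq stepv_shift ..

lemma P_lip:
 assumes "j : {1..CARD('n)}" "i : I" "0 <= tau" "0 <= tau'"
 shows "abs(P j tau i - P j tau' i) <= V * abs(tau - tau')"
proof (cases "gnl j")
 case True
 have "abs(P j tau i - P j tau' i) <= (SUM i:I. abs(d j i)) * abs(tau - tau')" using P_GNL[OF assms(1) True] assms unfolding sticky_def by blast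
 also have "... <= V * abs(tau - tau')" using d_V[OF assms(1)] by (intro mult_right_mono) auto
 finally show ?thesis .
next
 case False
 then have "linearly_degenerate (lam j) (r j)" using fields[OF assms(1)] by blast
 then have "P j tau = P j 0" "P j tau' = P j 0" by (rule P_LD[OF assms(1) _ assms(3)], rule P_LD[OF assms(1) _ assms(4)])
 then show ?thesis using pos by simp
qed

lemma sp_lam: "k : J ==> abs(sp t k - lam (fst k) U0) <= eps * V"
proof -
 assume "k : J"
 then have "abs(speed I (d (fst k)) (P (fst k) (eps * t)) (P (fst k) (eps * t) (snd k))) <= V"
  using order_trans[OF abs_speed_le[OF I(1)] d_V] by (auto simp: J_def)
 then show ?thesis using pos by (auto simp: sp_def abs_mult)
qed

lemma X_lip: "k : J ==> 0 <= s ==> 0 <= t ==> abs(X s k - X t k) <= (abs(lam (fst k) U0) + eps * V) * abs(s - t)"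
proof -
 assume k: "k : J" and st: "0 <= s" "0 <= t"
 have "abs(P (fst k) (eps * s) (snd k) - P (fst k) (eps * t) (snd k)) <= V * abs(eps * s - eps * t)"
  using k st pos by (intro P_lip) (auto simp: J_def)
 also have "abs(eps * s - eps * t) = eps * abs(s - t)" using pos by (simp add: right_diff_distrib[symmetric] abs_mult)
 finally have 1: "abs(P (fst k) (eps * s) (snd k) - P (fst k) (eps * t) (snd k)) <= eps * V * abs(s - t)" by (simp add: mult_ac)
 have "abs(X s k - X t k) <= abs(lam (fst k) U0 * (s - t)) + abs(P (fst k) (eps * s) (snd k) - P (fst k) (eps * t) (snd k))"
  unfolding X_def by (simp add: right_diff_distrib)
 then show ?thesis using 1 by (simp add: abs_mult distrib_right)
qed

lemma X_linear: "0 <= t ==> EX h>0. ALL eta:{0..h}. ALL k:J. X (t + eta) k = X t k + eta * sp t k"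
proof -
 assume t: "0 <= t"
 have "ALL j:{1..CARD('n)}. EX h>0. ALL eta:{0..h}. ALL i:I. X (t + eta) (j, i) = X t (j, i) + eta * sp t (j, i)"
 proof
  fix j assume j: "j : {1..CARD('n)}"
  show "EX h>0. ALL eta:{0..h}. ALL i:I. X (t + eta) (j, i) = X t (j, i) + eta * sp t (j, i)"
  proof (cases "gnl j")
   case True
   have "0 <= eps * t" using t pos by simp
   then obtain h where h: "h > 0" "ALL eta:{0..h}. ALL i:I. P j (eps * t + eta) i = P j (eps * t) i + eta * speed I (d j) (P j (eps * t)) (P j (eps * t) i)"
    using P_GNL[OF j True] unfolding sticky_def by blast
   have "X (t + eta) (j, i) = X t (j, i) + eta * sp t (j, i)" if "eta : {0..h / eps}" "i : I" for eta i
   proof -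
    have "eps * eta : {0..h}" using that pos by (simp add: field_simps)
    then have "P j (eps * t + eps * eta) i = P j (eps * t) i + eps * eta * speed I (d j) (P j (eps * t)) (P j (eps * t) i)" using h(2) that by blast
    then show ?thesis using True by (simp add: X_def sp_def algebra_simps)
   qed
   then show ?thesis using h(1) pos by (intro exI[of _ "h / eps"]) auto
  next
   case False
   then have ld: "linearly_degenerate (lam j) (r j)" using fields[OF j] by blast
   have "X (t + eta) (j, i) = X t (j, i) + eta * sp t (j, i)" if "0 <= eta" for eta i
    using P_LD[OF j ld, of "eps * (t + eta)"] P_LD[OF j ld, of "eps * t"] False that t pos by (simp add: X_def sp_def algebra_simps)
   then show ?thesis by (intro exI[of _ 1]) auto
  qed
 qed
 then obtain h where h: "ALL j:{1..CARD('n)}. h j > 0 & (ALL eta:{0..h j}. ALL i:I. X (t + eta) (j, i) = X t (j, i) + eta * sp t (j, i))"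
  by (auto dest!: bchoice)
 have ne: "{1..CARD('n)} ~= {}" using zero_less_card_finite by (simp add: Suc_le_eq)
 show ?thesis
 proof (rule exI[of _ "Min (h ` {1..CARD('n)})"], rule conjI)
  show "0 < Min (h ` {1..CARD('n)})" using h ne by (subst Min_gr_iff) auto
  show "ALL eta:{0..Min (h ` {1..CARD('n)})}. ALL k:J. X (t + eta) k = X t k + eta * sp t k"
  proof (intro ballI)
   fix eta k assume eta: "eta : {0..Min (h ` {1..CARD('n)})}" and k: "k : J"
   obtain j i where ji: "k = (j, i)" "j : {1..CARD('n)}" "i : I" using k by (auto simp: J_def)
   have "Min (h ` {1..CARD('n)}) <= h j" using ji by (intro Min_le) auto
   then have "eta : {0..h j}" using eta by (meson atLeastAtMost_iff order_trans)
   then show "X (t + eta) k = X t k + eta * sp t k" using h ji by blast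
  qed
 qed
qed

text \<open>By \<open>collisions_isolated\<close>, fronts that coincide shortly after
  \<open>t\<close> have equal speeds. Speeds differ from the eigenvalues by at most
  \<open>gam\<close>, so the gap makes the eigenvalues equal.\<close>

lemma good_isolated: "0 <= t ==> EX h>0. ALL s:{t<..<t + h}. good s"
proof -
 assume t: "0 <= t"
 obtain h where h: "h > 0" "ALL s:{t<..<t + h}. ALL k:J. ALL k':J. X s k = X s k' --> sp t k = sp t k'"
  using collisions_isolated[OF J(1) X_linear[OF t]] by blast
 have "lam (fst k) U0 = lam (fst k') U0" if k: "k : J" "k' : J" and e: "sp t k = sp t k'" for k k'
 proof (rule ccontr)
  assume "lam (fst k) U0 ~= lam (fst k') U0"
  then have "4 * gam <= abs(lam (fst k) U0 - lam (fst k') U0)" using k by (intro gap) (auto simp: J_def)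
  then show False using sp_lam[OF k(1), of t] sp_lam[OF k(2), of t] e small_gam pos by linarith
 qed
 then show ?thesis using h unfolding good_def by blast
qed

text \<open>Equal eigenvalues mean one and the same family, whose speed is a function of the
  position, or two families that are not genuinely nonlinear by \<open>GNL_simple\<close>, whose
  fronts move with the eigenvalue.\<close>

lemma sp_same: "good t ==> k : J ==> k' : J ==> X t k = X t k' ==> sp t k = sp t k'"
proof -
 assume g: "good t" and k: "k : J" "k' : J" and x: "X t k = X t k'"
 have lam: "lam (fst k) U0 = lam (fst k') U0" using g k x unfolding good_def by blast
 have mem: "fst k : {1..CARD('n)}" "fst k' : {1..CARD('n)}" using k by (auto simp: J_def)
 show "sp t k = sp t k'"
 proof (cases "fst k = fst k'")
  case True
  then have "P (fst k) (eps * t) (snd k) = P (fst k') (eps * t) (snd k')" using x by (simp add: X_def)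
  then show ?thesis using True by (simp add: sp_def)
 next
  case False
  then have "~ gnl (fst k)" "~ gnl (fst k')" using GNL_simple[OF mem, of U0] GNL_simple[OF mem(2,1), of U0] lam by auto
  then show ?thesis using lam by (simp add: sp_def)
 qed
qed

lemma w_measurable: "w t : borel_measurable borel"
 using step_measurable[OF J(1), of Psi "X t"] unfolding w_def[abs_def] .

lemma w_in_D: "w t : \<D>"
proof (rule D_tv)
 show "integrable lborel (%x. w t x - U0)"
 proof (rule Bochner_Integration.integrable_bound)
  show "integrable lborel (%x. B * (SUM j:{1..CARD('n)}. eps * abs(stepv I (d j) (%i. X t (j, i)) x)))"
   by (intro Bochner_Integration.integrable_mult_right Bochner_Integration.integrable_sum integrable_abs stepv_integrable I(1) d_sum)
  show "(%x. w t x - U0) : borel_measurable lborel" using w_measurable by auto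
  show "AE x in lborel. norm (w t x - U0) <= norm (B * (SUM j:{1..CARD('n)}. eps * abs(stepv I (d j) (%i. X t (j, i)) x)))"
  proof (rule AE_I2)
   fix x
   have "norm (w t x - U0) <= B * strength CARD('n) (coef {k:J. X t k <= x})" unfolding w_def by (intro Psi_U0) auto
   also have "strength CARD('n) (coef {k:J. X t k <= x}) = (SUM j:{1..CARD('n)}. eps * abs(stepv I (d j) (%i. X t (j, i)) x))"
    unfolding strength_def coef_step using pos by (intro sum.cong) (auto simp: abs_mult)
   finally show "norm (w t x - U0) <= norm (B * (SUM j:{1..CARD('n)}. eps * abs(stepv I (d j) (%i. X t (j, i)) x)))" by simp
  qed
 qed
 have "total_variation (w t) <= ennreal (B * (eps * (CARD('n) * V)))"
 proof (rule total_variation_le[of "%x. B * (eps * (SUM k:{k:J. X t k <= x}. abs(dd k)))"])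
  fix x y :: real
  show "0 <= B * (eps * (SUM k:{k:J. X t k <= x}. abs(dd k)))" using pos by (intro mult_nonneg_nonneg sum_nonneg) auto
  have "(SUM k:{k:J. X t k <= x}. abs(dd k)) <= (SUM k:J. abs(dd k))" using J by (intro sum_mono2) auto
  then show "B * (eps * (SUM k:{k:J. X t k <= x}. abs(dd k))) <= B * (eps * (CARD('n) * V))"
   using sum_dd pos by (intro mult_left_mono) auto
  assume xy: "x <= y"
  have "norm (w t y - w t x) <= B * (eps * (SUM k:{k:J. X t k <= y} - {k:J. X t k <= x}. abs(dd k)))"
   unfolding w_def using xy by (intro Psi_diff) auto
  also have "(SUM k:{k:J. X t k <= y} - {k:J. X t k <= x}. abs(dd k)) = (SUM k:{k:J. X t k <= y}. abs(dd k)) - (SUM k:{k:J. X t k <= x}. abs(dd k))"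
   using xy J by (intro sum_diff) auto
  finally show "norm (w t y - w t x) <= B * (eps * (SUM k:{k:J. X t k <= y}. abs(dd k))) - B * (eps * (SUM k:{k:J. X t k <= x}. abs(dd k)))"
   by (simp add: right_diff_distrib)
 qed
 also have "... < ennreal dl0"
 proof (rule ennreal_lessI)
  have "0 <= B * (eps * (CARD('n) * V))" using pos by (intro mult_nonneg_nonneg) auto
  then show "0 < dl0" using small_B(2) by linarith
 qed (rule small_B(2))
 finally show "total_variation (w t) < ennreal dl0" .
qed

lemma w_lip: "EX Kw. ALL s>=0. ALL t>=0. L1_dist (w s) (w t) <= Kw * abs(s - t)"
proof (intro exI allI impI)
 fix s t :: real assume st: "0 <= s" "0 <= t"
 have int: "integrable lborel (%x. abs(stepv I (d j) (%i. X s (j, i)) x - stepv I (d j) (%i. X t (j, i)) x))" for j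
  by (rule stepv_diff(1)[OF I(1)])
 have "L1_dist (w s) (w t) <= (LINT x|lborel. B * (SUM j:{1..CARD('n)}. eps * abs(stepv I (d j) (%i. X s (j, i)) x - stepv I (d j) (%i. X t (j, i)) x)))"
  unfolding L1_dist_def
 proof (rule integral_mono)
  show "integrable lborel (%x. norm (w s x - w t x))" by (intro integrable_norm D_diff w_in_D)
  show "integrable lborel (%x. B * (SUM j:{1..CARD('n)}. eps * abs(stepv I (d j) (%i. X s (j, i)) x - stepv I (d j) (%i. X t (j, i)) x)))"
   by (intro Bochner_Integration.integrable_mult_right Bochner_Integration.integrable_sum int)
  fix x
  have "norm (w s x - w t x) <= B * strength CARD('n) (%j. coef {k:J. X s k <= x} j - coef {k:J. X t k <= x} j)"
   unfolding w_def Psi_def by (intro W_lip coef_rho) auto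
  also have "strength CARD('n) (%j. coef {k:J. X s k <= x} j - coef {k:J. X t k <= x} j) =
    (SUM j:{1..CARD('n)}. eps * abs(stepv I (d j) (%i. X s (j, i)) x - stepv I (d j) (%i. X t (j, i)) x))"
   unfolding strength_def coef_step using pos by (intro sum.cong) (auto simp: abs_mult right_diff_distrib[symmetric])
  finally show "norm (w s x - w t x) <= B * (SUM j:{1..CARD('n)}. eps * abs(stepv I (d j) (%i. X s (j, i)) x - stepv I (d j) (%i. X t (j, i)) x))" .
 qed
 also have "... = B * (SUM j:{1..CARD('n)}. eps * (LINT x|lborel. abs(stepv I (d j) (%i. X s (j, i)) x - stepv I (d j) (%i. X t (j, i)) x)))"
  using int by simp
 also have "... <= B * (SUM j:{1..CARD('n)}. eps * (SUM i:I. abs(dd (j, i)) * ((abs(lam j U0) + eps * V) * abs(s - t))))"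
 proof (intro mult_left_mono sum_mono)
  fix j assume j: "j : {1..CARD('n)}"
  have "(LINT x|lborel. abs(stepv I (d j) (%i. X s (j, i)) x - stepv I (d j) (%i. X t (j, i)) x)) <= (SUM i:I. abs(d j i) * abs(X s (j, i) - X t (j, i)))"
   by (rule stepv_diff(2)[OF I(1)])
  also have "... <= (SUM i:I. abs(dd (j, i)) * ((abs(lam j U0) + eps * V) * abs(s - t)))"
   using X_lip[OF _ st] j unfolding dd_def J_def by (intro sum_mono mult_mono) force+
  finally show "(LINT x|lborel. abs(stepv I (d j) (%i. X s (j, i)) x - stepv I (d j) (%i. X t (j, i)) x)) <= (SUM i:I. abs(dd (j, i)) * ((abs(lam j U0) + eps * V) * abs(s - t)))" .
 qed (use pos in auto)
 also have "... = (B * (SUM j:{1..CARD('n)}. eps * (SUM i:I. abs(dd (j, i)) * (abs(lam j U0) + eps * V)))) * abs(s - t)"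
  by (simp add: sum_distrib_right mult.assoc)
 finally show "L1_dist (w s) (w t) <= (B * (SUM j:{1..CARD('n)}. eps * (SUM i:I. abs(dd (j, i)) * (abs(lam j U0) + eps * V)))) * abs(s - t)" .
qed

section \<open>Local errors of the fronts at an arbitrary good time\<close>

definition lft :: "real => real => (nat \<times> nat) set" where "lft t p = {k:J. X t k < p}"
definition rgt :: "real => real => (nat \<times> nat) set" where "rgt t p = {k:J. X t k <= p}"
definition mass :: "real => real => real" where "mass t p = (SUM k:{k:J. X t k = p}. abs(dd k))"

text \<open>The Lax property is a premise because \<open>R\<close> is known to give Lax solutions
  only for jumps that occur in members of \<open>\<D>\<close>.\<close>

definition front_error :: "real => nat \<times> nat => real => bool" where
 "front_error t k e \<longleftrightarrow>
  (lax_riemann_solution F lam r (Psi (lft t (X t k))) (Psi (rgt t (X t k))) (R (Psi (lft t (X t k))) (Psi (rgt t (X t k)))) -->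
   (profile_error (R (Psi (lft t (X t k))) (Psi (rgt t (X t k)))) (Psi (lft t (X t k))) (Psi (rgt t (X t k))) (sp t k) e))"

lemma front_error_mono: "front_error t k e ==> e <= e' ==> front_error t k e'"
 unfolding front_error_def by (meson order_trans)

lemma sets: "lft t p \<subseteq> rgt t p" "lft t p \<subseteq> J" "rgt t p \<subseteq> J" "rgt t p - lft t p = {k:J. X t k = p}"
 unfolding lft_def rgt_def by auto

lemma front_error_riem:
 fixes t :: real
 assumes k: "k : J"
 defines "ul \<equiv> Psi (lft t (X t k))" and "ur \<equiv> Psi (rgt t (X t k))"
 shows "front_error t k (CR * norm (F ur - F ul - sp t k *\<^sub>R (ur - ul)) +
   (if linearly_degenerate (lam (fst k)) (r (fst k)) | l (fst k) U0 \<bullet> (ur - ul) <= - kap0 * norm (ur - ul) then 0 else CR * (norm (ur - ul))\<^sup>2))"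
 unfolding front_error_def
proof (intro impI, unfold ul_def[symmetric] ur_def[symmetric], rule riem)
 show "ul : ball U0 dR" "ur : ball U0 dR"
  using le_less_trans[OF Psi_near[OF sets(2)] small_B(1)] le_less_trans[OF Psi_near[OF sets(3)] small_B(1)]
  unfolding ul_def ur_def by (auto simp: dist_norm norm_minus_commute)
 show "fst k : {1..CARD('n)}" using k by (auto simp: J_def)
 show "abs(sp t k - lam (fst k) U0) < dR" using sp_lam[OF k, of t] small_dR by linarith
qed

lemma local_rate:
 assumes t: "0 <= t" and g: "good t" and e: "!!k. k : J ==> front_error t k (e (X t k))"
 shows "EX h>0. ALL eta:{0<..<h}. L1_dist (S eta (w t)) (w (t + eta)) <= eta * (SUM p:X t ` J. e p)"
proof -
 have D: "(%x. Psi {k:J. X t k <= x}) : \<D>" using w_in_D[of t] unfolding w_def[abs_def] .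
 obtain h1 where h1: "h1 > 0" "ALL eta:{0<..<h1}. L1_dist (S eta (%x. Psi {k:J. X t k <= x})) (%x. Psi {k:J. X t k + eta * sp t k <= x}) <= eta * (SUM p:X t ` J. e p)"
  using moving_step_error[OF clause J sp_same[OF g] D e[unfolded front_error_def lft_def rgt_def, rule_format]] by blast
 obtain h2 where h2: "h2 > 0" "ALL eta:{0..h2}. ALL k:J. X (t + eta) k = X t k + eta * sp t k" using X_linear[OF t] by blast
 have "w (t + eta) = (%x. Psi {k:J. X t k + eta * sp t k <= x})" if "eta : {0..h2}" for eta
 proof
  fix x
  have "{k:J. X (t + eta) k <= x} = {k:J. X t k + eta * sp t k <= x}" using h2(2) that by auto
  then show "w (t + eta) x = Psi {k:J. X t k + eta * sp t k <= x}" unfolding w_def by (simp only:)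
 qed
 then show ?thesis using h1 h2(1) unfolding w_def[of t, abs_def, symmetric] by (intro exI[of _ "min h1 h2"]) auto
qed

lemma coef_jump: "j : {1..CARD('n)} ==> coef (rgt t p) j - coef (lft t p) j = eps * jump I (d j) (%i. X t (j, i)) p"
 unfolding lft_def rgt_def coef_step using stepv_eq_stepl_jump[OF I(1), of "d j" "%i. X t (j, i)" p] by (simp add: algebra_simps)

lemma jump_zero: "(!!i. i : I ==> X t (j, i) ~= p) ==> jump I (d j) (%i. X t (j, i)) p = 0"
proof -
 assume "!!i. i : I ==> X t (j, i) ~= p"
 then have "{i:I. X t (j, i) = p} = {}" by auto
 then show ?thesis unfolding jump_def by (simp only: sum.empty)
qed

lemma Psi_jump:
 shows "strength CARD('n) (%j. coef (rgt t p) j - coef (lft t p) j) <= eps * mass t p"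
  "norm (Psi (rgt t p) - Psi (lft t p)) <= B * (eps * mass t p)"
  "norm (Psi (rgt t p) - Psi (lft t p) - (SUM j:{1..CARD('n)}. (coef (rgt t p) j - coef (lft t p) j) *\<^sub>R r j U0)) <= CW * (2 * (eps * (CARD('n) * V))) * (eps * mass t p)"
proof -
 show s: "strength CARD('n) (%j. coef (rgt t p) j - coef (lft t p) j) <= eps * mass t p"
  using coef_diff[OF sets(1,3)] unfolding sets(4) mass_def .
 show "norm (Psi (rgt t p) - Psi (lft t p)) <= B * (eps * mass t p)"
  using Psi_diff[OF sets(1,3)] unfolding sets(4) mass_def .
 have "norm (Psi (rgt t p) - Psi (lft t p) - (SUM j:{1..CARD('n)}. (coef (rgt t p) j - coef (lft t p) j) *\<^sub>R r j U0))
   <= CW * (strength CARD('n) (coef (lft t p)) + strength CARD('n) (coef (rgt t p))) * strength CARD('n) (%j. coef (rgt t p) j - coef (lft t p) j)"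
  unfolding Psi_def by (intro W_est coef_rho sets)
 also have "... <= CW * (2 * (eps * (CARD('n) * V))) * (eps * mass t p)"
  using coef_strength[OF sets(2), of t p] coef_strength[OF sets(3), of t p] s pos strength_nonneg[of "CARD('n)" "coef (lft t p)"] strength_nonneg[of "CARD('n)" "coef (rgt t p)"]
  by (intro mult_mono mult_left_mono mult_nonneg_nonneg strength_nonneg) auto
 finally show "norm (Psi (rgt t p) - Psi (lft t p) - (SUM j:{1..CARD('n)}. (coef (rgt t p) j - coef (lft t p) j) *\<^sub>R r j U0)) <= CW * (2 * (eps * (CARD('n) * V))) * (eps * mass t p)" .
qed

lemma mass_bounds: "0 <= mass t p" "mass t p <= CARD('n) * V" "(SUM p:X t ` J. mass t p) <= CARD('n) * V"
proof -
 show "0 <= mass t p" unfolding mass_def by (intro sum_nonneg) auto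
 have "mass t p <= (SUM k:J. abs(dd k))" unfolding mass_def using J by (intro sum_mono2) auto
 then show "mass t p <= CARD('n) * V" using sum_dd by simp
 show "(SUM p:X t ` J. mass t p) <= CARD('n) * V" unfolding mass_def sum.image_gen[OF J(1), symmetric] by (rule sum_dd)
qed

definition lin_norm :: real where "lin_norm = onorm (A U0) + (SUM j:{1..CARD('n)}. abs(lam j U0))"

text \<open>The summands stem, in order, from the quadratic remainder of \<open>F\<close>, the
  remainder of \<open>W\<close> in the linear part, the deviation of the front speed from the
  eigenvalue, and the rarefaction term.\<close>

definition C_any :: real where
 "C_any = CR * (2 * CF * (CARD('n) * V) * B * B + 2 * lin_norm * CW * (CARD('n) * V) + V * B) + CR * B * B * (CARD('n) * V)"

lemma bounded_linear_A: "bounded_linear (A U0)" using A_linear linear_conv_bounded_linear by blast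

text \<open>At a good time all families that jump at this point share the eigenvalue
  \<open>mu\<close>. The first-order part of the jump therefore lies in one eigenspace of
  \<open>A U0\<close> and drops out of the residual; what remains has two factors of order
  \<open>eps\<close>.\<close>

lemma front_error_any:
 assumes g: "good t" and k: "k : J"
 shows "front_error t k (C_any * eps^2 * mass t (X t k))"
proof -
 define p where "p = X t k"
 define ul ur where "ul = Psi (lft t p)" and "ur = Psi (rgt t p)"
 define c where "c j = coef (rgt t p) j - coef (lft t p) j" for j
 define e where "e = ur - ul - (SUM j:{1..CARD('n)}. c j *\<^sub>R r j U0)"
 define mu where "mu = lam (fst k) U0"
 define m where "m = mass t p"
 define nV where "nV = CARD('n) * V"
 have nV0: "0 <= nV" using pos by (simp add: nV_def)
 have m: "0 <= m" "m <= nV" unfolding m_def nV_def by (rule mass_bounds)+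
 have kj: "fst k : {1..CARD('n)}" using k by (auto simp: J_def)
 have du: "norm (ur - ul) <= B * (eps * m)" unfolding ur_def ul_def m_def by (rule Psi_jump)
 have en: "norm e <= CW * (2 * (eps * nV)) * (eps * m)" unfolding e_def ur_def ul_def m_def c_def nV_def by (rule Psi_jump)
 have eig: "c j *\<^sub>R A U0 (r j U0) = c j *\<^sub>R (mu *\<^sub>R r j U0)" if j: "j : {1..CARD('n)}" for j
 proof (cases "c j = 0")
  case False
  then have "~ (ALL i:I. X t (j, i) ~= p)" using coef_jump[OF j, of t p] jump_zero[of t j p] by (auto simp: c_def)
  then obtain i where "i : I" "X t (j, i) = X t k" by (auto simp: p_def)
  then have "lam j U0 = mu" using g k j unfolding good_def mu_def J_def by force
  then show ?thesis using A_r[OF j] by simp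
 qed simp
 interpret AL: bounded_linear "A U0" by (rule bounded_linear_A)
 have split: "A U0 (ur - ul) - mu *\<^sub>R (ur - ul) = A U0 e - mu *\<^sub>R e"
 proof -
  have "A U0 (SUM j:{1..CARD('n)}. c j *\<^sub>R r j U0) = mu *\<^sub>R (SUM j:{1..CARD('n)}. c j *\<^sub>R r j U0)"
   unfolding AL.sum AL.scaleR scaleR_sum_right by (intro sum.cong refl) (use eig in \<open>simp add: mult.commute\<close>)
  moreover have "ur - ul = e + (SUM j:{1..CARD('n)}. c j *\<^sub>R r j U0)" by (simp add: e_def)
  ultimately show ?thesis by (simp add: AL.add scaleR_add_right)
 qed
 have mu: "abs mu <= (SUM j:{1..CARD('n)}. abs(lam j U0))" unfolding mu_def using kj by (intro member_le_sum[of "fst k" _ "%j. abs(lam j U0)"]) auto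
 have lin: "norm (A U0 e - mu *\<^sub>R e) <= lin_norm * norm e"
 proof -
  have "norm (A U0 e) <= onorm (A U0) * norm e" by (rule onorm[OF bounded_linear_A])
  moreover have "norm (mu *\<^sub>R e) <= (SUM j:{1..CARD('n)}. abs(lam j U0)) * norm e" using mu by (simp add: mult_right_mono)
  ultimately show ?thesis unfolding lin_norm_def distrib_right using norm_triangle_ineq4[of "A U0 e" "mu *\<^sub>R e"] by linarith
 qed
 have ln0: "0 <= lin_norm" unfolding lin_norm_def using onorm_pos_le[OF bounded_linear_A] by (intro add_nonneg_nonneg sum_nonneg) auto
 have near: "norm (ul - U0) <= B * (eps * nV)" "norm (ur - U0) <= B * (eps * nV)"
  unfolding ul_def ur_def nV_def by (intro Psi_near sets)+
 have cb: "ul : cball U0 1" "ur : cball U0 1" using near small_B(3) unfolding nV_def by (auto simp: dist_norm norm_minus_commute)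
 have "norm (F ur - F ul - sp t k *\<^sub>R (ur - ul)) = norm ((F ur - F ul - A U0 (ur - ul)) + (A U0 e - mu *\<^sub>R e) + (mu - sp t k) *\<^sub>R (ur - ul))"
  unfolding split[symmetric] by (simp add: algebra_simps)
 also have "... <= norm (F ur - F ul - A U0 (ur - ul)) + norm (A U0 e - mu *\<^sub>R e) + norm ((mu - sp t k) *\<^sub>R (ur - ul))"
  by (intro order_trans[OF norm_triangle_ineq] add_mono norm_triangle_ineq order_refl)
 also have "norm (F ur - F ul - A U0 (ur - ul)) <= CF * (norm (ur - U0) + norm (ul - U0)) * norm (ur - ul)" by (rule F_quad[OF cb(2,1)])
 also have "... <= CF * (2 * (B * (eps * nV))) * (B * (eps * m))"
  using near du pos nV0 by (intro mult_mono mult_left_mono mult_nonneg_nonneg) auto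
 also have "norm (A U0 e - mu *\<^sub>R e) <= lin_norm * (CW * (2 * (eps * nV)) * (eps * m))" using order_trans[OF lin mult_left_mono[OF en ln0]] .
 also have "norm ((mu - sp t k) *\<^sub>R (ur - ul)) <= (eps * V) * (B * (eps * m))"
 proof -
  have "abs(mu - sp t k) <= eps * V" using sp_lam[OF k, of t] unfolding mu_def by linarith
  then show ?thesis using du pos unfolding norm_scaleR by (intro mult_mono) auto
 qed
 finally have res: "norm (F ur - F ul - sp t k *\<^sub>R (ur - ul)) <= (2 * CF * nV * B * B + 2 * lin_norm * CW * nV + V * B) * eps^2 * m"
  by (simp add: algebra_simps power2_eq_square)
 have sq: "(norm (ur - ul))\<^sup>2 <= B * B * nV * eps^2 * m"
 proof -
  have "(norm (ur - ul))\<^sup>2 <= (B * (eps * m))\<^sup>2" using du by (intro power_mono) auto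
  also have "... = (B * B * eps^2 * m) * m" by (simp add: power2_eq_square)
  also have "... <= (B * B * eps^2 * m) * nV" using m pos by (intro mult_left_mono mult_nonneg_nonneg) auto
  finally show ?thesis by (simp add: mult_ac)
 qed
 have "CR * norm (F ur - F ul - sp t k *\<^sub>R (ur - ul)) <= CR * ((2 * CF * nV * B * B + 2 * lin_norm * CW * nV + V * B) * eps^2 * m)"
  using res pos by (intro mult_left_mono) auto
 moreover have "CR * (norm (ur - ul))\<^sup>2 <= CR * (B * B * nV * eps^2 * m)" "0 <= CR * (B * B * nV * eps^2 * m)"
  using sq pos m nV0 by (auto intro!: mult_left_mono mult_nonneg_nonneg)
 moreover have "C_any * eps^2 * m = CR * ((2 * CF * nV * B * B + 2 * lin_norm * CW * nV + V * B) * eps^2 * m) + CR * (B * B * nV * eps^2 * m)"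
  unfolding C_any_def nV_def[symmetric] by (simp add: algebra_simps)
 ultimately have "CR * norm (F ur - F ul - sp t k *\<^sub>R (ur - ul)) +
   (if linearly_degenerate (lam (fst k)) (r (fst k)) | l (fst k) U0 \<bullet> (ur - ul) <= - kap0 * norm (ur - ul) then 0 else CR * (norm (ur - ul))\<^sup>2) <= C_any * eps^2 * m"
  by (simp split: if_splits)
 then show ?thesis using front_error_mono[OF front_error_riem[OF k]] unfolding ul_def ur_def p_def m_def by blast
qed

lemma C_any_nonneg: "0 <= C_any"
proof -
 have "0 <= lin_norm" unfolding lin_norm_def using onorm_pos_le[OF bounded_linear_A] by (intro add_nonneg_nonneg sum_nonneg) auto
 then show ?thesis unfolding C_any_def using pos by (intro add_nonneg_nonneg mult_nonneg_nonneg) auto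
qed

lemma rate_any:
 assumes "0 <= t" "good t"
 shows "EX h>0. ALL eta:{0<..<h}. L1_dist (S eta (w t)) (w (t + eta)) <= eta * (C_any * eps^2 * (CARD('n) * V))"
proof -
 have "(SUM p:X t ` J. C_any * eps^2 * mass t p) = C_any * eps^2 * (SUM p:X t ` J. mass t p)" by (simp add: sum_distrib_left)
 also have "... <= C_any * eps^2 * (CARD('n) * V)" using mass_bounds(3) C_any_nonneg by (intro mult_left_mono mult_nonneg_nonneg) auto
 finally have "eta * (SUM p:X t ` J. C_any * eps^2 * mass t p) <= eta * (C_any * eps^2 * (CARD('n) * V))" if "0 < eta" for eta
  using that by (intro mult_left_mono) auto
 then show ?thesis using local_rate[OF assms front_error_any[OF assms(2)]] by (meson greaterThanLessThan_iff order_trans)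
qed

section \<open>Local errors after the families have separated\<close>

definition T0 :: real where "T0 = (len + 1) / gam"

lemma T0_nonneg: "0 <= T0" using pos by (simp add: T0_def)

text \<open>Each family starts in \<open>{-len..len}\<close> and spreads by at most
  \<open>gam * t\<close> about its own characteristic, while different eigenvalues drift apart by at
  least \<open>4 * gam * t\<close>. From \<open>T0\<close> on this exceeds
  \<open>2 * (len + gam * t)\<close>.\<close>

lemma separated:
 assumes t: "T0 <= t" and k: "k : J" and j: "j : {1..CARD('n)}" "lam j U0 ~= lam (fst k) U0"
 shows "(ALL i:I. X t (j, i) < X t k) | (ALL i:I. X t k < X t (j, i))"
proof -
 have t0: "0 <= t" using t T0_nonneg by simp
 have kj: "fst k : {1..CARD('n)}" "snd k : I" using k by (auto simp: J_def)
 have Pb: "abs(P m (eps * t) i) <= len + gam * t" if "m : {1..CARD('n)}" "i : I" for m i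
 proof -
  have "abs(P m (eps * t) i - P m 0 i) <= V * abs(eps * t - 0)" using that t0 pos by (intro P_lip) auto
  also have "... = (eps * V) * t" using t0 pos by (simp add: abs_mult)
  also have "... <= gam * t" using small_gam t0 by (intro mult_right_mono)
  finally show ?thesis using P_0[OF that] by linarith
 qed
 have "len + 1 <= gam * t" using t pos by (simp add: T0_def field_simps)
 moreover have "2 * (len + y) < 4 * y" if "len + 1 <= y" for y :: real using that by argo
 ultimately have far: "2 * (len + gam * t) < 4 * gam * t" unfolding mult.assoc by blast
 have gp: "4 * gam * t <= abs(lam j U0 - lam (fst k) U0) * t" using gap[OF j(1) kj(1) j(2)] t0 by (intro mult_right_mono)
 consider "lam j U0 < lam (fst k) U0" | "lam (fst k) U0 < lam j U0" using j(2) by linarith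
 then show ?thesis
 proof cases
  case 1
  have "X t (j, i) < X t k" if "i : I" for i
   using Pb[OF j(1) that] Pb[OF kj] gp far 1 unfolding X_def by (simp add: algebra_simps)
  then show ?thesis by blast
 next
  case 2
  have "X t k < X t (j, i)" if "i : I" for i
   using Pb[OF j(1) that] Pb[OF kj] gp far 2 unfolding X_def by (simp add: algebra_simps)
  then show ?thesis by blast
 qed
qed

text \<open>A family that lies entirely on one side contributes none of its jumps or all of them,
  and all of them cancel.\<close>

lemma coef_separated:
 assumes t: "T0 <= t" and k: "k : J" and j: "j : {1..CARD('n)} ==> lam j U0 ~= lam (fst k) U0"
 shows "coef (lft t (X t k)) j = 0" "coef (rgt t (X t k)) j = 0"
proof -
 have "coef (lft t (X t k)) j = 0 & coef (rgt t (X t k)) j = 0"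
 proof (cases "j : {1..CARD('n)}")
  case True
  have eq: "{i:I. (j, i) : lft t (X t k)} = {i:I. X t (j, i) < X t k}" "{i:I. (j, i) : rgt t (X t k)} = {i:I. X t (j, i) <= X t k}"
   using True by (auto simp: lft_def rgt_def J_def)
  from separated[OF t k True j[OF True]] show ?thesis
  proof
   assume "ALL i:I. X t (j, i) < X t k"
   then have "{i:I. X t (j, i) < X t k} = I" "{i:I. X t (j, i) <= X t k} = I" by auto
   then show ?thesis unfolding coef_def eq using d_sum[OF True] by simp
  next
   assume "ALL i:I. X t k < X t (j, i)"
   then have "{i:I. X t (j, i) < X t k} = {}" "{i:I. X t (j, i) <= X t k} = {}" by auto
   then show ?thesis unfolding coef_def eq by (simp only: sum.empty) simp
  qed
 qed (auto simp: coef_def)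
 then show "coef (lft t (X t k)) j = 0" "coef (rgt t (X t k)) j = 0" by auto
qed

definition jmp :: "real => real => nat => real" where "jmp t p j = jump I (d j) (%i. X t (j, i)) p"

text \<open>\<open>CR * CW\<close> enters twice: for the cubic error of an upward jump, and to
  offset the negative cube that \<open>late_error\<close> assigns to it.\<close>

definition C_up :: real where "C_up = 2 * (CR * CW) + CR * B^2"

text \<open>The cube keeps its sign, so that the sum over the fronts is proportional to the rate of
  change of the energy.\<close>

definition late_error :: "real => real" where
 "late_error x = - (CR * CW * eps ^ 3) * x ^ 3 + C_up * eps^2 * kap * abs x"

lemma C_up_nonneg: "0 <= C_up" unfolding C_up_def using pos by (intro add_nonneg_nonneg mult_nonneg_nonneg) auto

text \<open>By \<open>W_LD\<close> both states share the value of
  \<open>F u - mu *\<^sub>R u\<close>, so the residual vanishes, and a degenerate field has no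
  rarefaction term.\<close>

lemma front_error_LD:
 assumes t: "T0 <= t" and k: "k : J" and ld: "~ gnl (fst k)"
 shows "front_error t k 0"
proof -
 define mu where "mu = lam (fst k) U0"
 have kj: "fst k : {1..CARD('n)}" using k by (auto simp: J_def)
 have LD: "linearly_degenerate (lam (fst k)) (r (fst k))" using fields[OF kj] ld by blast
 have grp: "linearly_degenerate (lam j) (r j)" if "j : {1..CARD('n)}" "lam j U0 = mu" for j
  using fields[OF that(1)] GNL_simple[OF that(1) kj, of U0] LD that(2) unfolding mu_def by metis
 have sup: "ALL j:{1..CARD('n)}. coef K j ~= 0 --> linearly_degenerate (lam j) (r j) & lam j U0 = mu"
  if "K = lft t (X t k) | K = rgt t (X t k)" for K
  using coef_separated[OF t k] grp that unfolding mu_def by blast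
 have "F (Psi (rgt t (X t k))) - mu *\<^sub>R Psi (rgt t (X t k)) = F U0 - mu *\<^sub>R U0" "F (Psi (lft t (X t k))) - mu *\<^sub>R Psi (lft t (X t k)) = F U0 - mu *\<^sub>R U0"
  unfolding Psi_def by (intro W_LD coef_rho sets sup; simp)+
 moreover have "sp t k = mu" using ld by (simp add: sp_def mu_def)
 moreover have "F ur - F ul - mu *\<^sub>R (ur - ul) = (F ur - mu *\<^sub>R ur) - (F ul - mu *\<^sub>R ul)" for ul ur by (simp add: algebra_simps)
 ultimately have "F (Psi (rgt t (X t k))) - F (Psi (lft t (X t k))) - sp t k *\<^sub>R (Psi (rgt t (X t k)) - Psi (lft t (X t k))) = 0"
  by (simp only:) simp
 then show ?thesis using front_error_riem[OF k, of t] LD by simp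
qed

text \<open>Only one family is present at this front, so its speed is the trapezoidal one of
  \<open>W_GNL\<close> and the residual is cubic. A downward jump lowers the projection by
  \<open>l j U0\<close> in proportion to its size, which switches off the rarefaction term. An
  upward jump is at most \<open>kap\<close>, so its square is at most \<open>kap\<close> times its
  size.\<close>

lemma front_error_GNL:
 assumes t: "T0 <= t" and k: "k : J" and gn: "gnl (fst k)"
 shows "front_error t k (late_error (jmp t (X t k) (fst k)))"
proof -
 define p j where "p = X t k" and "j = fst k"
 define s s' where "s = coef (lft t p)" and "s' = coef (rgt t p)"
 define ul ur where "ul = Psi (lft t p)" and "ur = Psi (rgt t p)"
 define D where "D = jmp t p j"
 have t0: "0 <= t" using t T0_nonneg by simp
 have kj: "j : {1..CARD('n)}" using k by (auto simp: J_def j_def)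
 have gj: "gnl j" using gn by (simp add: j_def)
 have other: "s m = 0" "s' m = 0" if "m ~= j" for m
  using coef_separated[OF t k, of m] GNL_simple[OF kj _ _ gj, of m U0] that unfolding s_def s'_def p_def j_def by metis+
 have sD: "s' j - s j = eps * D" unfolding s_def s'_def D_def jmp_def by (rule coef_jump[OF kj])
 have sb: "abs(s j) <= eps * V" "abs(s' j) <= eps * V" unfolding s_def s'_def by (intro coef_component sets)+
 have strj: "strength CARD('n) f = abs(f j)" if "!!m. m ~= j ==> f m = 0" for f
 proof -
  have "strength CARD('n) f = (SUM m:{j}. abs(f m))" unfolding strength_def using that kj by (intro sum.mono_neutral_right) auto
  then show ?thesis by simp
 qed
 have str: "strength CARD('n) s = abs(s j)" "strength CARD('n) s' = abs(s' j)" "strength CARD('n) (%m. s' m - s m) = eps * abs D"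
  using strj[of s] strj[of s'] strj[of "%m. s' m - s m"] other sD pos by (auto simp: abs_mult)
 have rho: "strength CARD('n) s <= rho" "strength CARD('n) s' <= rho" unfolding s_def s'_def by (intro coef_rho sets)+
 have spd: "sp t k = lam j U0 + (s j + s' j) / 2"
 proof -
  have pj: "P j (eps * t) (snd k) = p - lam j U0 * t" by (simp add: p_def X_def j_def)
  have "s j = eps * stepl I (d j) (P j (eps * t)) (p - lam j U0 * t)" "s' j = eps * stepv I (d j) (P j (eps * t)) (p - lam j U0 * t)"
   unfolding s_def s'_def lft_def rgt_def coef_step X_eq stepl_shift stepv_shift using kj by auto
  then show ?thesis using gj unfolding sp_def j_def[symmetric] pj speed_def by (simp add: algebra_simps add_divide_distrib)
 qed
 have res: "norm (F ur - F ul - sp t k *\<^sub>R (ur - ul)) <= CW * (eps * abs D) ^ 3"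
 proof -
  have "norm (F (W s') - F (W s) - (lam j U0 + (s j + s' j) / 2) *\<^sub>R (W s' - W s)) <= CW * abs(s' j - s j) ^ 3"
   using other rho str kj gj by (intro W_GNL) auto
  then show ?thesis unfolding spd sD using pos by (simp add: ul_def ur_def Psi_def s_def s'_def abs_mult)
 qed
 have du: "norm (ur - ul) <= B * (eps * abs D)"
  using W_lip[OF rho] unfolding str(3) by (simp add: ul_def ur_def Psi_def s_def s'_def)
 have Dkap: "D <= kap"
 proof -
  have "0 <= eps * t" using t0 pos by simp
  then show ?thesis using P_GNL[OF kj gj] unfolding D_def jmp_def X_eq jump_shift sticky_def by blast
 qed
 have cond: "l j U0 \<bullet> (ur - ul) <= - kap0 * norm (ur - ul)" if D0: "D <= 0"
 proof -
  define e where "e = ur - ul - (eps * D) *\<^sub>R r j U0"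
  have "(SUM m:{1..CARD('n)}. (s' m - s m) *\<^sub>R r m U0) = (SUM m:{j}. (s' m - s m) *\<^sub>R r m U0)"
   using kj other by (intro sum.mono_neutral_right) auto
  then have "(SUM m:{1..CARD('n)}. (s' m - s m) *\<^sub>R r m U0) = (eps * D) *\<^sub>R r j U0" using sD by simp
  then have "norm e <= CW * (abs(s j) + abs(s' j)) * (eps * abs D)"
   using W_est[OF rho] unfolding str by (simp add: e_def ul_def ur_def Psi_def s_def s'_def)
  also have "... <= CW * (2 * (eps * V)) * (eps * abs D)"
   using sb pos by (intro mult_right_mono mult_left_mono) auto
  finally have e: "norm e <= 2 * CW * (eps * V) * (eps * abs D)" by (simp add: mult_ac)
  have "l j U0 \<bullet> e <= norm (l j U0) * norm e" by (rule norm_cauchy_schwarz)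
  also have "... <= norm (l j U0) * (2 * CW * (eps * V) * (eps * abs D))" using e by (intro mult_left_mono) auto
  also have "... = (norm (l j U0) * (2 * CW * (eps * V))) * (eps * abs D)" by (simp add: mult_ac)
  also have "... <= 1 / 2 * (eps * abs D)" using small_l[OF kj] pos by (intro mult_right_mono) auto
  finally have le: "l j U0 \<bullet> e <= 1 / 2 * (eps * abs D)" .
  have "l j U0 \<bullet> (ur - ul) = eps * D + l j U0 \<bullet> e" unfolding e_def using l_r[OF kj kj, of U0] by (simp add: inner_diff_right)
  also have "eps * D = - (eps * abs D)" using D0 by simp
  finally have 1: "l j U0 \<bullet> (ur - ul) <= - (1 / 2 * (eps * abs D))" using le by linarith
  have "kap0 * norm (ur - ul) <= kap0 * (B * (eps * abs D))" using du pos by (intro mult_left_mono) auto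
  also have "... = (kap0 * B) * (eps * abs D)" by simp
  also have "... <= 1 / 2 * (eps * abs D)" using kap0B pos by (intro mult_right_mono) auto
  finally show ?thesis using 1 by linarith
 qed
 have "CR * norm (F ur - F ul - sp t k *\<^sub>R (ur - ul)) <= CR * (CW * (eps * abs D) ^ 3)" using res pos by (intro mult_left_mono)
 moreover have "CR * (norm (ur - ul))\<^sup>2 <= CR * (B * (eps * abs D))\<^sup>2" using du pos by (intro mult_left_mono power_mono) auto
 moreover have "CR * (CW * (eps * abs D) ^ 3) + (if D <= 0 then 0 else CR * (B * (eps * abs D))\<^sup>2) <= late_error D"
 proof (cases "D <= 0")
  case True
  then have "CR * (CW * (eps * abs D) ^ 3) = - (CR * CW * eps ^ 3) * D ^ 3" by (simp add: power_mult_distrib power3_eq_cube)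
  moreover have "0 <= C_up * eps^2 * kap * abs D" using C_up_nonneg pos by (intro mult_nonneg_nonneg) auto
  moreover have "(if D <= 0 then 0 else CR * (B * (eps * abs D))\<^sup>2) = 0" using True by simp
  ultimately show ?thesis unfolding late_error_def by linarith
 next
  case False
  have sq: "D\<^sup>2 <= kap * D" using False Dkap by (simp add: power2_eq_square mult_right_mono)
  have eps3: "eps ^ 3 * D ^ 3 <= eps\<^sup>2 * (kap * D)"
  proof -
   have "eps ^ 3 * D ^ 3 = (eps^2 * D^2) * (eps * D)" by (simp add: power2_eq_square power3_eq_cube)
   also have "... <= (eps^2 * D^2) * 1"
   proof (intro mult_left_mono)
    have "eps * D <= 1 * 1" using pos False Dkap by (intro mult_mono) auto
    then show "eps * D <= 1" by simp
   qed auto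
   also have "... <= eps\<^sup>2 * (kap * D)" using sq by (simp add: mult_left_mono)
   finally show ?thesis .
  qed
  have "CR * CW * (eps ^ 3 * D ^ 3) <= CR * CW * (eps^2 * (kap * D))" using eps3 pos by (intro mult_left_mono) auto
  moreover have "CR * B^2 * eps^2 * D^2 <= CR * B^2 * eps^2 * (kap * D)" using sq pos by (intro mult_left_mono) auto
  ultimately show ?thesis using False unfolding late_error_def C_up_def by (simp add: power_mult_distrib algebra_simps)
 qed
 moreover have "0 <= CR * (B * (eps * abs D))\<^sup>2" using pos by simp
 moreover have "(if linearly_degenerate (lam (fst k)) (r (fst k)) | l (fst k) U0 \<bullet> (ur - ul) <= - kap0 * norm (ur - ul) then 0 else x) <= (if D <= 0 then 0 else y)"
  if "x <= y" "0 <= y" for x y :: real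
  using cond[unfolded j_def] that by auto
 ultimately have "CR * norm (F ur - F ul - sp t k *\<^sub>R (ur - ul)) +
   (if linearly_degenerate (lam (fst k)) (r (fst k)) | l (fst k) U0 \<bullet> (ur - ul) <= - kap0 * norm (ur - ul) then 0 else CR * (norm (ur - ul))\<^sup>2) <= late_error D"
  by (meson add_mono order_trans)
 then show ?thesis using front_error_mono[OF front_error_riem[OF k, of t]] unfolding D_def ul_def ur_def p_def j_def by blast
qed

text \<open>Of these summands only that of the front's own family contributes; the sum over all
  families lets \<open>late_total\<close> interchange it with the sum over the fronts.\<close>

definition late_sum :: "real => real => real" where
 "late_sum t p = (SUM j:{1..CARD('n)}. if gnl j then late_error (jmp t p j) else 0)"

lemma front_error_late:
 assumes t: "T0 <= t" and k: "k : J"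
 shows "front_error t k (late_sum t (X t k))"
proof -
 have kj: "fst k : {1..CARD('n)}" using k by (auto simp: J_def)
 have zero: "late_error (jmp t (X t k) j) = 0" if "j : {1..CARD('n)}" "gnl j" "j ~= fst k" for j
 proof -
  have "lam j U0 ~= lam (fst k) U0" using GNL_simple[OF that(1) kj that(3,2)] .
  then have "ALL i:I. X t (j, i) ~= X t k" using separated[OF t k that(1)] by (metis less_irrefl)
  then have "jmp t (X t k) j = 0" unfolding jmp_def by (intro jump_zero) auto
  then show ?thesis by (simp add: late_error_def)
 qed
 have "late_sum t (X t k) = (SUM j:{fst k}. if gnl j then late_error (jmp t (X t k) j) else 0)"
  unfolding late_sum_def using kj zero by (intro sum.mono_neutral_right) auto
 then show ?thesis using front_error_GNL[OF t k] front_error_LD[OF t k] by auto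
qed

section \<open>Energy balance at late times\<close>

definition energy_GNL :: "real => real" where
 "energy_GNL t = (SUM j:{1..CARD('n)}. if gnl j then energy I (d j) (P j (eps * t)) else 0)"

definition cubes :: "real => real" where
 "cubes t = (SUM j:{1..CARD('n)}. if gnl j then (SUM y:P j (eps * t) ` I. (jump I (d j) (P j (eps * t)) y) ^ 3) else 0)"

lemma sum_jmp:
 fixes g :: "real => real"
 assumes "g 0 = 0" "j : {1..CARD('n)}"
 shows "(SUM p:X t ` J. g (jmp t p j)) = (SUM y:P j (eps * t) ` I. g (jump I (d j) (P j (eps * t)) y))"
proof -
 have "(SUM p:X t ` J. g (jmp t p j)) = (SUM p:(%i. X t (j, i)) ` I. g (jmp t p j))"
 proof (rule sum.mono_neutral_right)
  show "(%i. X t (j, i)) ` I \<subseteq> X t ` J" using assms by (auto simp: J_def)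
  show "ALL p:X t ` J - (%i. X t (j, i)) ` I. g (jmp t p j) = 0"
  proof
   fix p assume p: "p : X t ` J - (%i. X t (j, i)) ` I"
   have "X t (j, i) ~= p" if "i : I" for i using p imageI[OF that, of "%i. X t (j, i)"] by auto
   then have "jmp t p j = 0" unfolding jmp_def by (intro jump_zero)
   then show "g (jmp t p j) = 0" using assms by simp
  qed
 qed (use J in auto)
 also have "(%i. X t (j, i)) ` I = (%y. lam j U0 * t + y) ` (P j (eps * t) ` I)" unfolding X_eq image_image ..
 also have "(SUM p:(%y. lam j U0 * t + y) ` (P j (eps * t) ` I). g (jmp t p j)) = (SUM y:P j (eps * t) ` I. g (jump I (d j) (P j (eps * t)) y))"
  unfolding jmp_def X_eq jump_shift by (subst sum.reindex) (auto simp: inj_on_def)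
 finally show ?thesis .
qed

lemma late_total:
 "(SUM p:X t ` J. late_sum t p) <= - (CR * CW * eps ^ 3) * cubes t + C_up * eps^2 * kap * (CARD('n) * V)"
proof -
 have "(SUM p:X t ` J. late_sum t p) = (SUM j:{1..CARD('n)}. SUM p:X t ` J. if gnl j then late_error (jmp t p j) else 0)"
  unfolding late_sum_def by (rule sum.swap)
 also have "... <= (SUM j:{1..CARD('n)}. - (CR * CW * eps ^ 3) * (if gnl j then (SUM y:P j (eps * t) ` I. (jump I (d j) (P j (eps * t)) y) ^ 3) else 0) + C_up * eps^2 * kap * V)"
 proof (rule sum_mono)
  fix j assume j: "j : {1..CARD('n)}"
  have c0: "0 <= C_up * eps^2 * kap" using C_up_nonneg pos by (intro mult_nonneg_nonneg) auto
  show "(SUM p:X t ` J. if gnl j then late_error (jmp t p j) else 0) <= - (CR * CW * eps ^ 3) * (if gnl j then (SUM y:P j (eps * t) ` I. (jump I (d j) (P j (eps * t)) y) ^ 3) else 0) + C_up * eps^2 * kap * V"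
  proof (cases "gnl j")
   case True
   have "(SUM p:X t ` J. late_error (jmp t p j)) = (SUM y:P j (eps * t) ` I. late_error (jump I (d j) (P j (eps * t)) y))"
    by (rule sum_jmp[OF _ j]) (simp add: late_error_def)
   also have "... = - (CR * CW * eps ^ 3) * (SUM y:P j (eps * t) ` I. (jump I (d j) (P j (eps * t)) y) ^ 3) + C_up * eps^2 * kap * (SUM y:P j (eps * t) ` I. abs(jump I (d j) (P j (eps * t)) y))"
    unfolding late_error_def sum.distrib sum_distrib_left ..
   also have "C_up * eps^2 * kap * (SUM y:P j (eps * t) ` I. abs(jump I (d j) (P j (eps * t)) y)) <= C_up * eps^2 * kap * V"
    using order_trans[OF sum_abs_jump_le[OF I(1) finite_imageI[OF I(1)]] d_V[OF j]] c0 by (intro mult_left_mono)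
   finally show ?thesis using True by simp
  qed (use c0 pos in simp)
 qed
 also have "... = - (CR * CW * eps ^ 3) * cubes t + C_up * eps^2 * kap * (CARD('n) * V)"
  unfolding cubes_def sum.distrib sum_distrib_left by simp
 finally show ?thesis .
qed

lemma energy_GNL_rate: "0 <= t ==> EX h>0. ALL eta:{0..h}. energy_GNL (t + eta) = energy_GNL t + eta * eps / 6 * cubes t"
proof -
 assume t: "0 <= t"
 define q where "q j eta \<longleftrightarrow> gnl j --> energy I (d j) (P j (eps * (t + eta))) = energy I (d j) (P j (eps * t)) + eta * eps / 6 * (SUM y:P j (eps * t) ` I. (jump I (d j) (P j (eps * t)) y) ^ 3)" for j eta
 have "ALL j:{1..CARD('n)}. EX h>0. ALL eta:{0..h}. q j eta"
 proof
  fix j assume j: "j : {1..CARD('n)}"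
  show "EX h>0. ALL eta:{0..h}. q j eta"
  proof (cases "gnl j")
   case True
   have "0 <= eps * t" using t pos by simp
   then obtain h where h: "h > 0" "!!eta. eta : {0..h} ==> energy I (d j) (P j (eps * t + eta)) = energy I (d j) (P j (eps * t)) + eta / 6 * (SUM y:P j (eps * t) ` I. (jump I (d j) (P j (eps * t)) y) ^ 3)"
    using energy_dissipation[OF I(1) d_sum[OF j] P_GNL[OF j True]] by blast
   have "q j eta" if "eta : {0..h / eps}" for eta
   proof -
    have "eps * eta : {0..h}" using that pos by (simp add: field_simps)
    then show ?thesis using h(2)[of "eps * eta"] unfolding q_def by (simp add: distrib_left mult.commute)
   qed
   then show ?thesis using h(1) pos by (intro exI[of _ "h / eps"]) auto
  qed (auto simp: q_def intro: exI[of _ 1])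
 qed
 then obtain h where h: "ALL j:{1..CARD('n)}. h j > 0 & (ALL eta:{0..h j}. q j eta)" by (auto dest!: bchoice)
 have ne: "{1..CARD('n)} ~= {}" using zero_less_card_finite by (simp add: Suc_le_eq)
 show ?thesis
 proof (rule exI[of _ "Min (h ` {1..CARD('n)})"], rule conjI)
  show "0 < Min (h ` {1..CARD('n)})" using h ne by (subst Min_gr_iff) auto
  show "ALL eta:{0..Min (h ` {1..CARD('n)})}. energy_GNL (t + eta) = energy_GNL t + eta * eps / 6 * cubes t"
  proof
   fix eta assume eta: "eta : {0..Min (h ` {1..CARD('n)})}"
   have q: "q j eta" if j: "j : {1..CARD('n)}" for j
   proof -
    have "Min (h ` {1..CARD('n)}) <= h j" using j by (intro Min_le) auto
    then have "eta : {0..h j}" using eta by (meson atLeastAtMost_iff order_trans)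
    then show ?thesis using h j by blast
   qed
   define E Q where "E j = (if gnl j then energy I (d j) (P j (eps * t)) else 0)"
    and "Q j = (if gnl j then (SUM y:P j (eps * t) ` I. (jump I (d j) (P j (eps * t)) y) ^ 3) else 0)" for j
   have "energy_GNL (t + eta) = (SUM j:{1..CARD('n)}. E j + eta * eps / 6 * Q j)"
    unfolding energy_GNL_def E_def Q_def by (rule sum.cong[OF refl]) (use q in \<open>simp add: q_def\<close>)
   also have "... = energy_GNL t + eta * eps / 6 * cubes t"
    unfolding energy_GNL_def cubes_def E_def[symmetric] Q_def[symmetric] by (simp add: sum.distrib sum_distrib_left)
   finally show "energy_GNL (t + eta) = energy_GNL t + eta * eps / 6 * cubes t" .
  qed
 qed
qed

lemma energy_GNL_continuous: "continuous_on {0..} energy_GNL"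
proof -
 have "continuous_on {0..} (%t. if gnl j then energy I (d j) (P j (eps * t)) else 0)" if j: "j : {1..CARD('n)}" for j
 proof (cases "gnl j")
  case True
  have "continuous_on {0..} (%t. energy I (d j) (P j (eps * t)))"
   by (rule continuous_on_compose2[OF energy_continuous[OF I(1) P_GNL[OF j True]]]) (use pos in \<open>auto intro!: continuous_intros\<close>)
  then show ?thesis using True by simp
 qed simp
 then show ?thesis unfolding energy_GNL_def[abs_def] by (intro continuous_on_sum)
qed

text \<open>The energy changes at the rate \<open>eps / 6 * cubes t\<close>, so the cubic errors,
  \<open>- eps ^ 3 * cubes t\<close> up to the constant \<open>CR * CW\<close>, are
  \<open>6 * eps^2\<close> times the rate of energy loss.\<close>

lemma rate_late:
 assumes t: "T0 <= t" and g: "good t"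
 shows "EX h>0. ALL eta:{0<..<h}. L1_dist (S eta (w t)) (w (t + eta))
  <= (C_up * eps^2 * kap * (CARD('n) * V)) * eta - (6 * CR * CW * eps^2) * (energy_GNL (t + eta) - energy_GNL t)"
proof -
 have t0: "0 <= t" using t T0_nonneg by simp
 obtain h1 where h1: "h1 > 0" "ALL eta:{0<..<h1}. L1_dist (S eta (w t)) (w (t + eta)) <= eta * (SUM p:X t ` J. late_sum t p)"
  using local_rate[OF t0 g front_error_late[OF t]] by blast
 obtain h2 where h2: "h2 > 0" "ALL eta:{0..h2}. energy_GNL (t + eta) = energy_GNL t + eta * eps / 6 * cubes t"
  using energy_GNL_rate[OF t0] by blast
 have "L1_dist (S eta (w t)) (w (t + eta))
  <= (C_up * eps^2 * kap * (CARD('n) * V)) * eta - (6 * CR * CW * eps^2) * (energy_GNL (t + eta) - energy_GNL t)" if eta: "eta : {0<..<min h1 h2}" for eta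
 proof -
  have "L1_dist (S eta (w t)) (w (t + eta)) <= eta * (SUM p:X t ` J. late_sum t p)" using h1 eta by auto
  also have "... <= eta * (- (CR * CW * eps ^ 3) * cubes t + C_up * eps^2 * kap * (CARD('n) * V))" using late_total[of t] eta by (intro mult_left_mono) auto
  also have "... = (C_up * eps^2 * kap * (CARD('n) * V)) * eta - (6 * CR * CW * eps^2) * (eta * eps / 6 * cubes t)"
   by (simp add: algebra_simps power2_eq_square power3_eq_cube)
  also have "eta * eps / 6 * cubes t = energy_GNL (t + eta) - energy_GNL t" using h2 eta by simp
  finally show ?thesis .
 qed
 then show ?thesis using h1(1) h2(1) by (intro exI[of _ "min h1 h2"]) auto
qed

lemma energy_GNL_bounds:
 shows "0 <= energy_GNL t" "energy_GNL T0 <= CARD('n) * ((len + gam * T0) * V^2)"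
proof -
 show "0 <= energy_GNL t" unfolding energy_GNL_def using energy_nonneg[OF I(1) d_sum] by (intro sum_nonneg) simp
 have "energy_GNL T0 <= (SUM j:{1..CARD('n)}. (len + gam * T0) * V^2)"
  unfolding energy_GNL_def
 proof (rule sum_mono)
  fix j assume j: "j : {1..CARD('n)}"
  have b0: "0 <= len + gam * T0" using pos T0_nonneg by simp
  have "energy I (d j) (P j (eps * T0)) <= (len + gam * T0) * (SUM i:I. abs(d j i))\<^sup>2"
  proof (rule energy_le)
   fix i assume i: "i : I"
   have "abs(P j (eps * T0) i - P j 0 i) <= V * abs(eps * T0 - 0)" using i j T0_nonneg pos by (intro P_lip) auto
   also have "... = (eps * V) * T0" using T0_nonneg pos by (simp add: abs_mult)
   also have "... <= gam * T0" using small_gam T0_nonneg by (intro mult_right_mono)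
   finally show "abs(P j (eps * T0) i) <= len + gam * T0" using P_0[OF j i] by linarith
  qed
  also have "... <= (len + gam * T0) * V^2" using d_V[OF j] b0 by (intro mult_left_mono power_mono sum_nonneg) auto
  finally show "(if gnl j then energy I (d j) (P j (eps * T0)) else 0) <= (len + gam * T0) * V^2"
   using b0 by (auto split: if_splits)
 qed
 then show "energy_GNL T0 <= CARD('n) * ((len + gam * T0) * V^2)" by simp
qed

text \<open>Before time \<open>T0\<close> the waves of different families may interact, which costs \<open>O(eps^2)\<close> per unit
 time; afterwards the cubic shock errors are paid for by the dissipation of \<open>energy_GNL\<close>.\<close>

lemma semigroup_tracking_error:
 assumes T: "0 <= T"
 shows "L1_dist (S T (w 0)) (w T) <= L1 * (C_any * eps^2 * (CARD('n) * V) * T0 + C_up * eps^2 * kap * (CARD('n) * V) * T + 6 * CR * CW * eps^2 * (CARD('n) * ((len + gam * T0) * V^2)))"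
proof -
 obtain Kw where Kw: "!!s t. 0 <= s ==> 0 <= t ==> L1_dist (w s) (w t) <= Kw * abs(s - t)" using w_lip by blast
 define Z where "Z = S T (w 0)"
 have Z: "Z : \<D>" unfolding Z_def by (rule S_in[OF w_in_D T])
 \<comment> \<open>The early phase ends at the final time itself if that comes before
   \<open>T0\<close>.\<close>
 define b where "b = min T T0"
 have b: "0 <= b" "b <= T" "b <= T0" using T T0_nonneg by (auto simp: b_def)
 define c1 c2 M where "c1 = C_any * eps^2 * (CARD('n) * V)" and "c2 = C_up * eps^2 * kap * (CARD('n) * V)" and "M = 6 * CR * CW * eps^2"
 have c0: "0 <= c1" "0 <= c2" "0 <= M" unfolding c1_def c2_def M_def using pos C_any_nonneg C_up_nonneg by (auto intro!: mult_nonneg_nonneg)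
 have dist0: "L1_dist (S (T - 0) (w 0)) Z = 0" by (simp add: Z_def L1_dist_def)
 have "L1_dist (S (T - b) (w b)) Z <= L1_dist (S (T - 0) (w 0)) Z + L1 * (c1 * (b - 0) + 0 * ((%_. 0) (0::real) - (%_. 0) b))"
 proof (rule semigroup_error[OF order_refl b(1,2) w_in_D Z])
  show "L1_dist (w s) (w t) <= Kw * abs(s - t)" if "s : {0..b}" "t : {0..b}" for s t using that by (intro Kw) auto
  fix t assume t: "0 <= t" "t < b"
  obtain h where h: "h > 0" "ALL s:{t<..<t + h}. good s" using good_isolated[OF t(1)] by blast
  have "EX k>0. ALL eta:{0<..<k}. s + eta <= b --> L1_dist (S eta (w s)) (w (s + eta)) <= c1 * eta - 0 * (0 - 0)" if "s : {t<..<t + h}" for s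
   using rate_any[of s] h(2) that t unfolding c1_def by (auto simp: mult_ac)
  then show "EX h>0. ALL s:{t<..<t + h}. s < b --> (EX k>0. ALL eta:{0<..<k}. s + eta <= b --> L1_dist (S eta (w s)) (w (s + eta)) <= c1 * eta - 0 * ((%_. 0) (s + eta) - (%_. 0) s))"
   using h(1) by blast
 qed simp
 then have early: "L1_dist (S (T - b) (w b)) Z <= L1 * (c1 * b)" using dist0 by simp
 have "L1_dist (S (T - T) (w T)) Z <= L1 * (c1 * T0 + c2 * T + M * (CARD('n) * ((len + gam * T0) * V^2)))"
 proof (cases "T <= T0")
  case True
  then have "b = T" by (simp add: b_def)
  have "c1 * b <= c1 * T0" using b c0 by (intro mult_left_mono)
  moreover have "0 <= c2 * T" "0 <= M * (CARD('n) * ((len + gam * T0) * V^2))" using c0 T pos T0_nonneg by (auto intro!: mult_nonneg_nonneg)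
  ultimately have "L1 * (c1 * b) <= L1 * (c1 * T0 + c2 * T + M * (CARD('n) * ((len + gam * T0) * V^2)))" using L by (intro mult_left_mono) auto
  then show ?thesis using early \<open>b = T\<close> by simp
 next
  case False
  then have bT: "b = T0" "T0 <= T" by (auto simp: b_def)
  have "L1_dist (S (T - T) (w T)) Z <= L1_dist (S (T - T0) (w T0)) Z + L1 * (c2 * (T - T0) + M * (energy_GNL T0 - energy_GNL T))"
  proof (rule semigroup_error[OF T0_nonneg bT(2) order_refl w_in_D Z])
   show "L1_dist (w s) (w t) <= Kw * abs(s - t)" if "s : {T0..T}" "t : {T0..T}" for s t using that T0_nonneg by (intro Kw) auto
   show "continuous_on {T0..T} energy_GNL" using T0_nonneg by (intro continuous_on_subset[OF energy_GNL_continuous]) auto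
   fix t assume t: "T0 <= t" "t < T"
   have t0: "0 <= t" using t T0_nonneg by simp
   obtain h where h: "h > 0" "ALL s:{t<..<t + h}. good s" using good_isolated[OF t0] by blast
   have "EX k>0. ALL eta:{0<..<k}. s + eta <= T --> L1_dist (S eta (w s)) (w (s + eta)) <= c2 * eta - M * (energy_GNL (s + eta) - energy_GNL s)" if "s : {t<..<t + h}" for s
    using rate_late[of s] h(2) that t unfolding c2_def M_def by auto
   then show "EX h>0. ALL s:{t<..<t + h}. s < T --> (EX k>0. ALL eta:{0<..<k}. s + eta <= T --> L1_dist (S eta (w s)) (w (s + eta)) <= c2 * eta - M * (energy_GNL (s + eta) - energy_GNL s))"
    using h(1) by blast
  qed
  also have "L1_dist (S (T - T0) (w T0)) Z <= L1 * (c1 * T0)" using early bT by simp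
  also have "L1 * (c2 * (T - T0) + M * (energy_GNL T0 - energy_GNL T)) <= L1 * (c2 * T + M * (CARD('n) * ((len + gam * T0) * V^2)))"
  proof (intro mult_left_mono add_mono)
   show "energy_GNL T0 - energy_GNL T <= CARD('n) * ((len + gam * T0) * V^2)" using energy_GNL_bounds(2) energy_GNL_bounds(1)[of T] by linarith
  qed (use L c0 T0_nonneg in auto)
  finally show ?thesis by (simp add: algebra_simps)
 qed
 moreover have "L1_dist (S (T - T) (w T)) Z = L1_dist (w T) Z" using D_cong[OF S_in[OF w_in_D[of T] order_refl] w_in_D S_0[OF w_in_D] Z] by simp
 ultimately show ?thesis unfolding Z_def c1_def c2_def M_def by (simp add: L1_dist_commute)
qed

end

section \<open>Comparison with the linear superposition\<close>

lemma energy_shift: "sum d I = 0 ==> energy I d (%i. a + p i) = energy I d p"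
proof -
 assume d: "sum d I = 0"
 have "(SUM i:I. SUM k:I. d i * d k * max (a + p i) (a + p k)) = (SUM i:I. SUM k:I. d i * d k * a + d i * d k * max (p i) (p k))"
  by (intro sum.cong refl) (simp add: max_def algebra_simps)
 also have "... = (SUM i:I. SUM k:I. d i * d k) * a + (SUM i:I. SUM k:I. d i * d k * max (p i) (p k))"
  by (simp add: sum.distrib sum_distrib_right)
 also have "(SUM i:I. SUM k:I. d i * d k) = sum d I * sum d I" by (simp add: sum_product)
 finally show ?thesis using d by (simp add: energy_def)
qed

lemma L1_dist_combination:
 fixes rho :: "nat => 'a::euclidean_space" and g h :: "nat => real => real"
 assumes N: "finite N" and eps: "0 <= eps" and int: "!!j. j : N ==> integrable lborel (%x. g j x - h j x)"
  and e: "!!j. j : N ==> (LINT x|lborel. abs(g j x - h j x)) <= e"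
 shows "integrable lborel (%x. (c + eps *\<^sub>R (SUM j:N. g j x *\<^sub>R rho j)) - (c + eps *\<^sub>R (SUM j:N. h j x *\<^sub>R rho j)))"
  "L1_dist (%x. c + eps *\<^sub>R (SUM j:N. g j x *\<^sub>R rho j)) (%x. c + eps *\<^sub>R (SUM j:N. h j x *\<^sub>R rho j)) <= eps * ((SUM j:N. norm (rho j)) * e)"
proof -
 have eq: "(c + eps *\<^sub>R (SUM j:N. g j x *\<^sub>R rho j)) - (c + eps *\<^sub>R (SUM j:N. h j x *\<^sub>R rho j)) = eps *\<^sub>R (SUM j:N. (g j x - h j x) *\<^sub>R rho j)" for x
  by (simp add: scaleR_diff_left sum_subtractf scaleR_diff_right)
 show i: "integrable lborel (%x. (c + eps *\<^sub>R (SUM j:N. g j x *\<^sub>R rho j)) - (c + eps *\<^sub>R (SUM j:N. h j x *\<^sub>R rho j)))"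
  unfolding eq by (intro integrable_scaleR_right Bochner_Integration.integrable_sum integrable_scaleR_left int)
 have ia: "integrable lborel (%x. abs(g j x - h j x) * norm (rho j))" if "j : N" for j
  using int[OF that] by (intro integrable_mult_left integrable_abs)
 have "L1_dist (%x. c + eps *\<^sub>R (SUM j:N. g j x *\<^sub>R rho j)) (%x. c + eps *\<^sub>R (SUM j:N. h j x *\<^sub>R rho j))
   <= (LINT x|lborel. eps * (SUM j:N. abs(g j x - h j x) * norm (rho j)))"
  unfolding L1_dist_def
 proof (rule integral_mono)
  show "integrable lborel (%x. norm ((c + eps *\<^sub>R (SUM j:N. g j x *\<^sub>R rho j)) - (c + eps *\<^sub>R (SUM j:N. h j x *\<^sub>R rho j))))" using i by (rule integrable_norm)
  show "integrable lborel (%x. eps * (SUM j:N. abs(g j x - h j x) * norm (rho j)))"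
   by (intro Bochner_Integration.integrable_mult_right Bochner_Integration.integrable_sum ia)
  show "norm ((c + eps *\<^sub>R (SUM j:N. g j x *\<^sub>R rho j)) - (c + eps *\<^sub>R (SUM j:N. h j x *\<^sub>R rho j))) <= eps * (SUM j:N. abs(g j x - h j x) * norm (rho j))" for x
   unfolding eq using eps norm_sum[of "%j. (g j x - h j x) *\<^sub>R rho j" N] by (simp add: mult_left_mono)
 qed
 also have "... = eps * (SUM j:N. (LINT x|lborel. abs(g j x - h j x)) * norm (rho j))" using ia by simp
 also have "... <= eps * (SUM j:N. e * norm (rho j))" using e eps by (intro mult_left_mono sum_mono mult_right_mono) auto
 also have "... = eps * ((SUM j:N. norm (rho j)) * e)" by (simp add: sum_distrib_left mult.commute)
 finally show "L1_dist (%x. c + eps *\<^sub>R (SUM j:N. g j x *\<^sub>R rho j)) (%x. c + eps *\<^sub>R (SUM j:N. h j x *\<^sub>R rho j)) <= eps * ((SUM j:N. norm (rho j)) * e)" .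
qed

lemma integrable_shift:
 fixes f :: "real => real"
 assumes "integrable lborel f"
 shows "integrable lborel (%x. f (x - a))" "(LINT x|lborel. f (x - a)) = (LINT x|lborel. f x)"
 using lborel_integrable_real_affine[OF assms, of 1 "- a"] lborel_integral_real_affine[of 1 f "- a"] by (simp_all add: add.commute)

context front_tracking
begin

definition lin :: "real => real => real^'n" where
 "lin t x = U0 + eps *\<^sub>R (SUM j = 1..CARD('n). stepv I (d j) (P j (eps * t)) (x - lam j U0 * t) *\<^sub>R r j U0)"

lemma total_energy: "0 <= t ==> (SUM j:{1..CARD('n)}. energy I (d j) (P j (eps * t))) <= CARD('n) * (len * V^2 + kap\<^sup>2 * V / 6 * (eps * t))"
proof -
 assume t: "0 <= t"
 have "energy I (d j) (P j (eps * t)) <= len * V^2 + kap\<^sup>2 * V / 6 * (eps * t)" if j: "j : {1..CARD('n)}" for j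
 proof -
  have et: "0 <= eps * t" using t pos by simp
  have "energy I (d j) (P j 0) <= len * (SUM i:I. abs(d j i))\<^sup>2" using P_0[OF j] by (intro energy_le)
  also have "... <= len * V^2" using d_V[OF j] pos by (intro mult_left_mono power_mono sum_nonneg) auto
  finally have e0: "energy I (d j) (P j 0) <= len * V^2" .
  have c: "kap\<^sup>2 * (SUM i:I. abs(d j i)) / 6 * (eps * t) <= kap\<^sup>2 * V / 6 * (eps * t)"
   using d_V[OF j] et by (intro mult_right_mono divide_right_mono mult_left_mono) auto
  show ?thesis
  proof (cases "gnl j")
   case True
   show ?thesis using energy_growth[OF I(1) d_sum[OF j] P_GNL[OF j True] pos(11) et] e0 c by linarith
  next
   case False
   then have "linearly_degenerate (lam j) (r j)" using fields[OF j] by blast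
   then have "P j (eps * t) = P j 0" using P_LD[OF j] et by blast
   moreover have "0 <= kap\<^sup>2 * V / 6 * (eps * t)" using pos by (intro mult_nonneg_nonneg[OF _ et]) auto
   ultimately show ?thesis using e0 by simp
  qed
 qed
 then have "(SUM j:{1..CARD('n)}. energy I (d j) (P j (eps * t))) <= (SUM j:{1..CARD('n)}. len * V^2 + kap\<^sup>2 * V / 6 * (eps * t))" by (rule sum_mono)
 then show ?thesis by simp
qed

text \<open>At each point the quadratic remainder of \<open>W\<close> is bounded by the squares of
  the step functions \<open>v j\<close>. Their integrals are the energies, which grow through upward
  jumps only.\<close>

lemma w_linearization:
 assumes t: "0 <= t"
 shows "integrable lborel (%x. w t x - lin t x)"
  "L1_dist (w t) (lin t) <= CW * eps^2 * (CARD('n) * (CARD('n) * (len * V^2 + kap\<^sup>2 * V / 6 * (eps * t))))"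
proof -
 define v where "v j x = stepv I (d j) (%i. X t (j, i)) x" for j x
 have v: "v j x = stepv I (d j) (P j (eps * t)) (x - lam j U0 * t)" for j x unfolding v_def X_eq stepv_shift ..
 have sq: "has_bochner_integral lborel (%x. (v j x)\<^sup>2) (energy I (d j) (P j (eps * t)))" if j: "j : {1..CARD('n)}" for j
  using energy_integral[OF I(1) d_sum[OF j], of "%i. X t (j, i)"] unfolding v_def X_eq energy_shift[OF d_sum[OF j]] .
 have bound: "norm (w t x - lin t x) <= CW * eps^2 * (CARD('n) * (SUM j:{1..CARD('n)}. (v j x)\<^sup>2))" for x
 proof -
  define s where "s j = (if j : {1..CARD('n)} then eps * v j x else 0)" for j
  have "s = coef {k:J. X t k <= x}" unfolding coef_step s_def v_def by auto
  then have srho: "strength CARD('n) s <= rho" using coef_rho[of "{k:J. X t k <= x}"] by auto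
  have str: "strength CARD('n) s = eps * (SUM j:{1..CARD('n)}. abs(v j x))"
   unfolding strength_def s_def using pos by (simp add: sum_distrib_left abs_mult)
  have lin: "lin t x = U0 + (SUM j:{1..CARD('n)}. (s j - 0) *\<^sub>R r j U0)"
   unfolding lin_def v[symmetric] s_def scaleR_sum_right by simp
  have wt: "w t x = W s" unfolding w_eq s_def v ..
  have z: "strength CARD('n) (%_. 0) = 0" by (simp add: strength_def)
  have "norm (w t x - lin t x) = norm (W s - W (%_. 0) - (SUM j:{1..CARD('n)}. (s j - 0) *\<^sub>R r j U0))"
   unfolding wt lin W_0 by (simp add: diff_diff_eq)
  also have "... <= CW * (strength CARD('n) (%_. 0) + strength CARD('n) s) * strength CARD('n) (%j. s j - 0)"
   using srho pos z by (intro W_est) auto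
  also have "... = CW * eps^2 * (SUM j:{1..CARD('n)}. abs(v j x))\<^sup>2" unfolding z by (simp add: str power2_eq_square)
  also have "... <= CW * eps^2 * (CARD('n) * (SUM j:{1..CARD('n)}. (v j x)\<^sup>2))"
  proof (intro mult_left_mono)
   show "(SUM j:{1..CARD('n)}. abs(v j x))\<^sup>2 <= CARD('n) * (SUM j:{1..CARD('n)}. (v j x)\<^sup>2)"
    using sum_squared_le_sum_of_squares[of "%j. abs(v j x)" "{1..CARD('n)}"] by (simp add: mult.commute)
  qed (use pos in auto)
  finally show ?thesis .
 qed
 have H: "has_bochner_integral lborel (%x. CW * eps^2 * (CARD('n) * (SUM j:{1..CARD('n)}. (v j x)\<^sup>2)))
   (CW * eps^2 * (CARD('n) * (SUM j:{1..CARD('n)}. energy I (d j) (P j (eps * t)))))"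
  by (intro has_bochner_integral_mult_right has_bochner_integral_sum sq)
 have Hi: "integrable lborel (%x. CW * eps^2 * (CARD('n) * (SUM j:{1..CARD('n)}. (v j x)\<^sup>2)))" using H by (rule integrable.intros)
 show i: "integrable lborel (%x. w t x - lin t x)"
 proof (rule Bochner_Integration.integrable_bound[OF Hi])
  have "(%x. v j x) : borel_measurable borel" for j unfolding v_def by (rule stepv_measurable[OF I(1)])
  then have "lin t : borel_measurable borel" unfolding lin_def[abs_def] v[symmetric] by measurable
  then show "(%x. w t x - lin t x) : borel_measurable lborel" using w_measurable by auto
  show "AE x in lborel. norm (w t x - lin t x) <= norm (CW * eps^2 * (CARD('n) * (SUM j:{1..CARD('n)}. (v j x)\<^sup>2)))"
   unfolding real_norm_def using order_trans[OF bound abs_ge_self] by (intro AE_I2)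
 qed
 have "L1_dist (w t) (lin t) <= (LINT x|lborel. CW * eps^2 * (CARD('n) * (SUM j:{1..CARD('n)}. (v j x)\<^sup>2)))"
  unfolding L1_dist_def using i Hi bound by (intro integral_mono integrable_norm)
 also have "... = CW * eps^2 * (CARD('n) * (SUM j:{1..CARD('n)}. energy I (d j) (P j (eps * t))))" using H by (rule has_bochner_integral_integral_eq)
 also have "... <= CW * eps^2 * (CARD('n) * (CARD('n) * (len * V^2 + kap\<^sup>2 * V / 6 * (eps * t))))"
  using total_energy[OF t] pos by (intro mult_left_mono) auto
 finally show "L1_dist (w t) (lin t) <= CW * eps^2 * (CARD('n) * (CARD('n) * (len * V^2 + kap\<^sup>2 * V / 6 * (eps * t))))" .
qed

text \<open>A chain of comparisons: the datum with the initial step function, transported by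
  \<open>S\<close>; the semigroup with the moving fronts; these with the linear superposition; and
  that with the approximate solution. The terms free of \<open>kap\<close>, \<open>e\<close> and
  \<open>e'\<close> are of order \<open>eps^2\<close> uniformly in \<open>T\<close>.\<close>

lemma tracking_total:
 fixes U1 :: "real => real^'n" and \<sigma> :: "nat => real => real => real"
 assumes T: "0 <= T" and init_D: "(%y. U0 + eps *\<^sub>R U1 y) : \<D>"
  and init: "!!j. j : {1..CARD('n)} ==> integrable lborel (%y. l j U0 \<bullet> U1 y - stepv I (d j) (P j 0) y)"
   "!!j. j : {1..CARD('n)} ==> (LINT y|lborel. abs(l j U0 \<bullet> U1 y - stepv I (d j) (P j 0) y)) <= e"
  and fin: "!!j. j : {1..CARD('n)} ==> integrable lborel (%y. \<sigma> j (eps * T) y - stepv I (d j) (P j (eps * T)) y)"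
   "!!j. j : {1..CARD('n)} ==> (LINT y|lborel. abs(\<sigma> j (eps * T) y - stepv I (d j) (P j (eps * T)) y)) <= e'"
 shows "integrable lborel (%x. S T (%y. U0 + eps *\<^sub>R U1 y) x - approx_solution U0 lam r \<sigma> eps T x)"
  "L1_dist (S T (%y. U0 + eps *\<^sub>R U1 y)) (approx_solution U0 lam r \<sigma> eps T)
   <= L1 * (eps * ((SUM j = 1..CARD('n). norm (r j U0)) * e) + CW * eps^2 * (CARD('n) * (CARD('n) * (len * V^2))))
    + L1 * (C_any * eps^2 * (CARD('n) * V) * T0 + C_up * eps^2 * kap * (CARD('n) * V) * T + 6 * CR * CW * eps^2 * (CARD('n) * ((len + gam * T0) * V^2)))
    + CW * eps^2 * (CARD('n) * (CARD('n) * (len * V^2 + kap\<^sup>2 * V / 6 * (eps * T))))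
    + eps * ((SUM j = 1..CARD('n). norm (r j U0)) * e')"
proof -
 define Ub where "Ub y = U0 + eps *\<^sub>R U1 y" for y
 define ap where "ap = approx_solution U0 lam r \<sigma> eps T"
 have UbD: "Ub : \<D>" using init_D unfolding Ub_def[abs_def] .
 have Ub: "Ub = (%x. U0 + eps *\<^sub>R (SUM j:{1..CARD('n)}. (l j U0 \<bullet> U1 x) *\<^sub>R r j U0))"
  unfolding Ub_def[abs_def] using r_expansion[of _ U0] by metis
 have lin0: "lin 0 = (%x. U0 + eps *\<^sub>R (SUM j:{1..CARD('n)}. stepv I (d j) (P j 0) x *\<^sub>R r j U0))" by (auto simp: lin_def)
 have a0: "L1_dist Ub (lin 0) <= eps * ((SUM j = 1..CARD('n). norm (r j U0)) * e)" and a0i: "integrable lborel (%x. Ub x - lin 0 x)"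
  unfolding Ub lin0 using L1_dist_combination[OF _ _ init, of "{1..CARD('n)}" eps] pos by simp_all
 have sh: "integrable lborel (%x. \<sigma> j (eps * T) (x - lam j U0 * T) - stepv I (d j) (P j (eps * T)) (x - lam j U0 * T))"
  "(LINT x|lborel. abs(\<sigma> j (eps * T) (x - lam j U0 * T) - stepv I (d j) (P j (eps * T)) (x - lam j U0 * T))) <= e'" if j: "j : {1..CARD('n)}" for j
  using integrable_shift(1)[OF fin(1)[OF j], of "lam j U0 * T"] integrable_shift(2)[OF integrable_abs[OF fin(1)[OF j]], of "lam j U0 * T"] fin(2)[OF j] by auto
 have aT: "L1_dist (lin T) ap <= eps * ((SUM j = 1..CARD('n). norm (r j U0)) * e')" and aTi: "integrable lborel (%x. lin T x - ap x)"
 proof -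
  have ap: "ap = (%x. U0 + eps *\<^sub>R (SUM j:{1..CARD('n)}. \<sigma> j (eps * T) (x - lam j U0 * T) *\<^sub>R r j U0))" by (auto simp: ap_def approx_solution_def)
  have lT: "lin T = (%x. U0 + eps *\<^sub>R (SUM j:{1..CARD('n)}. stepv I (d j) (P j (eps * T)) (x - lam j U0 * T) *\<^sub>R r j U0))" by (auto simp: lin_def)
  have "L1_dist ap (lin T) <= eps * ((SUM j = 1..CARD('n). norm (r j U0)) * e')" "integrable lborel (%x. ap x - lin T x)"
   unfolding ap lT using L1_dist_combination[OF _ _ sh, of "{1..CARD('n)}" eps] pos by simp_all
  then show "L1_dist (lin T) ap <= eps * ((SUM j = 1..CARD('n). norm (r j U0)) * e')" "integrable lborel (%x. lin T x - ap x)"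
   using Bochner_Integration.integrable_minus[of lborel "%x. ap x - lin T x"] by (auto simp: L1_dist_commute)
 qed
 note w0 = w_linearization[OF order_refl] and wT = w_linearization[OF T]
 have i0: "integrable lborel (%x. lin 0 x - w 0 x)" using Bochner_Integration.integrable_minus[OF w0(1)] by simp
 have "L1_dist Ub (w 0) <= L1_dist Ub (lin 0) + L1_dist (lin 0) (w 0)" by (rule L1_dist_triangle(1)[OF a0i i0])
 also have "... <= eps * ((SUM j = 1..CARD('n). norm (r j U0)) * e) + CW * eps^2 * (CARD('n) * (CARD('n) * (len * V^2)))"
  using a0 w0(2) by (simp add: L1_dist_commute)
 finally have init_err: "L1_dist Ub (w 0) <= ..." .
 have "L1_dist (S T Ub) (S T (w 0)) <= L1 * L1_dist Ub (w 0)" using S_lip[OF UbD w_in_D T T] by simp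
 also have "... <= L1 * (eps * ((SUM j = 1..CARD('n). norm (r j U0)) * e) + CW * eps^2 * (CARD('n) * (CARD('n) * (len * V^2))))"
  using init_err L by (intro mult_left_mono)
 finally have s1: "L1_dist (S T Ub) (S T (w 0)) <= L1 * (eps * ((SUM j = 1..CARD('n). norm (r j U0)) * e) + CW * eps^2 * (CARD('n) * (CARD('n) * (len * V^2))))" .
 have d1: "S T Ub : \<D>" "S T (w 0) : \<D>" using S_in UbD w_in_D T by auto
 have i3: "integrable lborel (%x. w T x - ap x)" and s3: "L1_dist (w T) ap <= L1_dist (w T) (lin T) + L1_dist (lin T) ap"
  using L1_dist_triangle[OF wT(1) aTi] by auto
 have i4: "integrable lborel (%x. S T Ub x - ap x)" and s4: "L1_dist (S T Ub) ap <= L1_dist (S T Ub) (w T) + L1_dist (w T) ap"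
  using L1_dist_triangle[OF D_diff[OF d1(1) w_in_D] i3] by auto
 have s2: "L1_dist (S T Ub) (w T) <= L1_dist (S T Ub) (S T (w 0)) + L1_dist (S T (w 0)) (w T)" by (rule D_triangle[OF d1 w_in_D])
 show "integrable lborel (%x. S T (%y. U0 + eps *\<^sub>R U1 y) x - approx_solution U0 lam r \<sigma> eps T x)"
  using i4 unfolding ap_def Ub_def[abs_def] .
 have "L1_dist (S T Ub) ap <= L1 * (eps * ((SUM j = 1..CARD('n). norm (r j U0)) * e) + CW * eps^2 * (CARD('n) * (CARD('n) * (len * V^2))))
    + L1 * (C_any * eps^2 * (CARD('n) * V) * T0 + C_up * eps^2 * kap * (CARD('n) * V) * T + 6 * CR * CW * eps^2 * (CARD('n) * ((len + gam * T0) * V^2)))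
    + CW * eps^2 * (CARD('n) * (CARD('n) * (len * V^2 + kap\<^sup>2 * V / 6 * (eps * T))))
    + eps * ((SUM j = 1..CARD('n). norm (r j U0)) * e')"
  using s1 s2 s3 s4 semigroup_tracking_error[OF T] wT(2) aT by linarith
 then show "L1_dist (S T (%y. U0 + eps *\<^sub>R U1 y)) (approx_solution U0 lam r \<sigma> eps T)
   <= L1 * (eps * ((SUM j = 1..CARD('n). norm (r j U0)) * e) + CW * eps^2 * (CARD('n) * (CARD('n) * (len * V^2))))
    + L1 * (C_any * eps^2 * (CARD('n) * V) * T0 + C_up * eps^2 * kap * (CARD('n) * V) * T + 6 * CR * CW * eps^2 * (CARD('n) * ((len + gam * T0) * V^2)))
    + CW * eps^2 * (CARD('n) * (CARD('n) * (len * V^2 + kap\<^sup>2 * V / 6 * (eps * T))))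
    + eps * ((SUM j = 1..CARD('n). norm (r j U0)) * e')"
  unfolding ap_def Ub_def[abs_def] .
qed

end

text \<open>One grid serves all families. The number \<open>m\<close> of samples makes the jumps at
  most \<open>kap\<close>; the mesh \<open>h\<close> makes the L1 error at most \<open>kap\<close>
  and keeps the grid within distance 1 of the interval from \<open>- L\<close> to
  \<open>L\<close>.\<close>

lemma front_data:
 fixes f :: "'j => real => real" and G :: "real => real" and L V kap :: real
 assumes G: "mono G" "!!x. 0 <= G x" "!!x. G x <= V" and f: "!!j x y. j : N ==> x <= y ==> abs(f j y - f j x) <= G y - G x"
  and L: "!!j y. j : N ==> L <= abs y ==> f j y = 0" "0 <= L" and kap: "0 < kap"
 shows "EX (I :: nat set) d p. finite I & I ~= {} & (ALL i:I. abs(p i) <= L + 1) &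
  (ALL j:N. sum (d j) I = 0 & (SUM i:I. abs(d j i)) <= V & (ALL x. jump I (d j) p x <= kap) &
   integrable lborel (%y. f j y - stepv I (d j) p y) & (LINT y|lborel. abs(f j y - stepv I (d j) p y)) <= kap)"
proof -
 have V0: "0 <= V" using G(2,3)[of 0] by linarith
 define m where "m = nat \<lceil>V / kap\<rceil> + 1"
 have m: "0 < m" "V / real m <= kap"
 proof -
  show "0 < m" by (simp add: m_def)
  have "V / kap <= real m" unfolding m_def by linarith
  then show "V / real m <= kap" using kap \<open>0 < m\<close> by (simp add: field_simps)
 qed
 define h where "h = min (1 / real (m + 1)) (kap / (real m * (V + 1)))"
 have h0: "0 < h" using m kap V0 by (simp add: h_def)
 have h1: "real (m + 1) * h <= 1"
 proof -
  have "real (m + 1) * h <= real (m + 1) * (1 / real (m + 1))" unfolding h_def by (intro mult_left_mono) auto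
  then show ?thesis by simp
 qed
 have h2: "real m * h * V <= kap"
 proof -
  have "real m * h * V <= real m * h * (V + 1)" using h0 by (intro mult_left_mono) auto
  also have "... <= real m * (kap / (real m * (V + 1))) * (V + 1)" unfolding h_def using V0 by (intro mult_left_mono mult_right_mono) auto
  also have "... = kap"
  proof -
   have "V + 1 ~= 0" using V0 by linarith
   then show ?thesis using m(1) by simp
  qed
  finally show ?thesis .
 qed
 define K where "K = nat \<lceil>(2 * L + 1) / h\<rceil>"
 have Kr: "(2 * L + 1) / h <= real K" "real K <= (2 * L + 1) / h + 1" "0 < K"
 proof -
  have "0 < (2 * L + 1) / h" using L(2) h0 by simp
  then show "(2 * L + 1) / h <= real K" "real K <= (2 * L + 1) / h + 1" "0 < K" unfolding K_def by linarith+
 qed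
 have K: "2 * L + 1 <= real K * h" "real K * h <= 2 * L + 1 + h"
 proof -
  show "2 * L + 1 <= real K * h" using Kr(1) h0 by (simp add: pos_divide_le_eq)
  have "real K * h <= ((2 * L + 1) / h + 1) * h" using Kr(2) h0 by (intro mult_right_mono) auto
  also have "... = (2 * L + 1) / h * h + h" by (simp only: distrib_right mult_1)
  also have "(2 * L + 1) / h * h = 2 * L + 1" using h0 by simp
  finally show "real K * h <= 2 * L + 1 + h" .
 qed
 define p where "p k = - L - 1 + (real k + real m) * h" for k
 define d where "d j k = (f j (p k) - f j (p k - real m * h)) / real m" for j k
 have inj: "p i = p k \<longleftrightarrow> i = k" for i k using h0 by (auto simp: p_def)
 have pb: "abs(p k) <= L + 1" if "k < K" for k
 proof -
  have "0 <= (real k + real m) * h" using h0 by simp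
  moreover have "(real k + real m) * h <= (real K - 1 + real m) * h" using that h0 by (intro mult_right_mono) auto
  moreover have "(real K - 1 + real m) * h = real K * h + real (m + 1) * h - 2 * h" by (simp add: algebra_simps)
  ultimately show ?thesis using K(2) h1 h0 unfolding p_def by linarith
 qed
 have "sum (d j) {..<K} = 0 & (SUM i<K. abs(d j i)) <= V & (ALL x. jump {..<K} (d j) p x <= kap) &
   integrable lborel (%y. f j y - stepv {..<K} (d j) p y) & (LINT y|lborel. abs(f j y - stepv {..<K} (d j) p y)) <= kap" if j: "j : N" for j
 proof -
  note sa = step_approximation[of G V "f j" L m h K, OF G f[OF j] L(1)[OF j] m(1) h0 h1 L(2) K(1), folded p_def, folded d_def]
  have "jump {..<K} (d j) p x <= kap" for x
  proof (cases "EX k<K. p k = x")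
   case True
   then obtain k where "k < K" "p k = x" by blast
   then have "{i:{..<K}. p i = x} = {k}" using inj by auto
   then have "jump {..<K} (d j) p x = d j k" unfolding jump_def by (simp only: sum.insert finite.emptyI empty_iff sum.empty) simp
   also have "... <= kap" using sa(3)[of k] m(2) by linarith
   finally show ?thesis .
  next
   case False
   then have "{i:{..<K}. p i = x} = {}" by auto
   then have "jump {..<K} (d j) p x = 0" unfolding jump_def by (simp only: sum.empty)
   then show ?thesis using kap by simp
  qed
  then show ?thesis using sa h2 by auto
 qed
 then show ?thesis using pb Kr(3) by (intro exI[of _ "{..<K}"] exI[of _ d] exI[of _ p]) auto
qed

section \<open>Choice of the constants and the limit of vanishing \<open>kap\<close>\<close>

theorem theorem1p1:
  fixes F :: "real^'n \<Rightarrow> real^'n"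
    and U0 :: "real^'n"
    and U1 :: "real \<Rightarrow> real^'n"
    and lam :: "nat \<Rightarrow> real^'n \<Rightarrow> real"
    and l r :: "nat \<Rightarrow> real^'n \<Rightarrow> real^'n"
    and \<D> :: "(real \<Rightarrow> real^'n) set"
    and S :: "real \<Rightarrow> (real \<Rightarrow> real^'n) \<Rightarrow> (real \<Rightarrow> real^'n)"
    and \<sigma> :: "nat \<Rightarrow> real \<Rightarrow> real \<Rightarrow> real"
  assumes "smooth F"
    and "bounded_variation U1"
    and "compact (closure {x. U1 x \<noteq> 0})"
    and "\<And>U. real_diagonalizable (jacobian F (at U))"
    and "\<And>U. ordered_eigenvalues (jacobian F (at U)) (\<lambda>j. lam j U)"
    and "constant_multiplicity lam"
    and "smooth_eigenvectors F lam l r"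
    and "\<And>j. j \<in> {1..CARD('n)} \<Longrightarrow>
           genuinely_nonlinear (lam j) (r j) \<or> linearly_degenerate (lam j) (r j)"
    and "standard_riemann_semigroup F lam r U0 \<D> S"
    and "\<And>j. j \<in> {1..CARD('n)} \<Longrightarrow> genuinely_nonlinear (lam j) (r j) \<Longrightarrow>
           entropy_solution (\<lambda>s. s^2 / 2) (\<lambda>y. l j U0 \<bullet> U1 y) (\<sigma> j)"
    and "\<And>j. j \<in> {1..CARD('n)} \<Longrightarrow> linearly_degenerate (lam j) (r j) \<Longrightarrow>
           weak_solution (\<lambda>s. 0) (\<lambda>y. l j U0 \<bullet> U1 y) (\<sigma> j)"
  shows "\<exists>\<epsilon>\<^sub>0>0. \<exists>C>0. \<forall>t>0. \<forall>\<epsilon>\<in>{0<..\<epsilon>\<^sub>0}.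
           integrable lborel
             (\<lambda>x. S t (\<lambda>y. U0 + \<epsilon> *\<^sub>R U1 y) x - approx_solution U0 lam r \<sigma> \<epsilon> t x) \<and>
           L1_dist (S t (\<lambda>y. U0 + \<epsilon> *\<^sub>R U1 y)) (approx_solution U0 lam r \<sigma> \<epsilon> t) \<le> C * \<epsilon>^2"
proof -
 let ?N = "{1..CARD('n)}"
 define n where "n = real CARD('n)"
 interpret hyperbolic_system F lam l r U0
  by (unfold_locales; use assms in blast)
 have srs: "ALL v:\<D>. integrable lborel (%x. v x - U0)"
  "EX dl\<^sub>0>0. ALL v. integrable lborel (%x. v x - U0) & total_variation v < ennreal dl\<^sub>0 --> v : \<D>"
  "ALL v:\<D>. ALL t>=0. S t v : \<D>" "ALL v:\<D>. AE x in lborel. S 0 v x = v x"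
  "ALL v:\<D>. ALL s>=0. ALL t>=0. AE x in lborel. S t (S s v) x = S (t + s) v x"
  "EX L\<^sub>1 L\<^sub>2. ALL v:\<D>. ALL w:\<D>. ALL s>=0. ALL t>=0. L1_dist (S t v) (S s w) <= L\<^sub>1 * L1_dist v w + L\<^sub>2 * abs(t - s)"
  "EX R. small_jump_continuous R &
    (riemann_exact F lam r \<D> S R)"
  using assms(9) unfolding standard_riemann_semigroup_def by - (elim conjE, assumption)+
 obtain dl0 where dl0: "0 < dl0" "!!v. integrable lborel (%x. v x - U0) ==> total_variation v < ennreal dl0 ==> v : \<D>"
  using srs(2) by auto
 obtain L1' L2' where L': "ALL v:\<D>. ALL w:\<D>. ALL s>=0. ALL t>=0. L1_dist (S t v) (S s w) <= L1' * L1_dist v w + L2' * abs(t - s)"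
  using srs(6) by (elim exE)
 obtain R where R: "small_jump_continuous R" and clause: "riemann_exact F lam r \<D> S R"
  using srs(7) by (elim exE conjE)
 \<comment> \<open>The constants in the hypothesis may be negative; enlarging them to be nonnegative
   keeps the estimate.\<close>
 define L1 L2 where "L1 = max 0 L1'" and "L2 = max 0 L2'"
 interpret lipschitz_semigroup U0 \<D> S L1 L2
 proof
  show "0 <= L1" "0 <= L2" by (simp_all add: L1_def L2_def)
  fix v w s t assume "v : \<D>" "w : \<D>" "0 <= (s::real)" "0 <= (t::real)"
  then have "L1_dist (S t v) (S s w) <= L1' * L1_dist v w + L2' * abs(t - s)" using L' by blast
  also have "... <= L1 * L1_dist v w + L2 * abs(t - s)"
   unfolding L1_def L2_def using L1_dist_nonneg[of v w] by (intro add_mono mult_right_mono) auto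
  finally show "L1_dist (S t v) (S s w) <= L1 * L1_dist v w + L2 * abs(t - s)" .
 qed (use srs in blast)+
 obtain W rho CW where wm: "0 < rho" "0 <= CW" "W (%_. 0) = U0"
  "ALL s s'. strength CARD('n) s <= rho --> strength CARD('n) s' <= rho -->
   norm (W s' - W s - (SUM j:?N. (s' j - s j) *\<^sub>R r j U0)) <= CW * (strength CARD('n) s + strength CARD('n) s') * strength CARD('n) (%j. s' j - s j)"
  "ALL mu s. strength CARD('n) s <= rho --> (ALL j:?N. s j ~= 0 --> linearly_degenerate (lam j) (r j) & lam j U0 = mu) -->
   F (W s) - mu *\<^sub>R W s = F U0 - mu *\<^sub>R U0"
  "ALL j:?N. ALL s s'. genuinely_nonlinear (lam j) (r j) --> (ALL k. k ~= j --> s k = 0 & s' k = 0) --> abs(s j) <= rho --> abs(s' j) <= rho -->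
   norm (F (W s') - F (W s) - (lam j U0 + (s j + s' j) / 2) *\<^sub>R (W s' - W s)) <= CW * abs(s' j - s j) ^ 3"
  using wave_map[folded strength_def] by (elim exE conjE)
 define Rs where "Rs = (SUM j = 1..CARD('n). norm (r j U0))"
 have Rs0: "0 <= Rs" unfolding Rs_def by (intro sum_nonneg) auto
 define B where "B = Rs + 2 * CW * rho"
 have B0: "0 <= B" using Rs0 wm(1,2) by (simp add: B_def)
 have W_lip: "norm (W s' - W s) <= B * strength CARD('n) (%j. s' j - s j)"
  if s: "strength CARD('n) s <= rho" "strength CARD('n) s' <= rho" for s s'
 proof -
  define z where "z = (SUM j:?N. (s' j - s j) *\<^sub>R r j U0)"
  have "norm z <= (SUM j:?N. abs(s' j - s j) * Rs)"
   unfolding z_def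
  proof (intro order_trans[OF norm_sum] sum_mono)
   fix j assume "j : ?N"
   then have "norm (r j U0) <= Rs" unfolding Rs_def by (intro member_le_sum) auto
   then show "norm ((s' j - s j) *\<^sub>R r j U0) <= abs(s' j - s j) * Rs" by (simp add: mult_left_mono)
  qed
  then have z: "norm z <= Rs * strength CARD('n) (%j. s' j - s j)" by (simp add: strength_def sum_distrib_left mult.commute)
  have "norm (W s' - W s - z) <= CW * (strength CARD('n) s + strength CARD('n) s') * strength CARD('n) (%j. s' j - s j)"
   unfolding z_def using wm(4) s by blast
  also have "... <= CW * (rho + rho) * strength CARD('n) (%j. s' j - s j)"
   using s wm(2) by (intro mult_right_mono mult_left_mono add_mono strength_nonneg)
  finally show ?thesis using z norm_triangle_ineq[of "W s' - W s - z" z] by (simp add: B_def algebra_simps)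
 qed
 \<comment> \<open>In \<open>front_error_GNL\<close> at least half of a downward jump's parameter
   survives under \<open>l j U0\<close>, while \<open>B\<close> bounds the jump by its parameter;
   hence the requirement that \<open>kap0 * B\<close> be at most \<open>1 / 2\<close>.\<close>
 define kap0 where "kap0 = 1 / (2 * (B + 1))"
 have kap0: "0 < kap0" "kap0 * B <= 1 / 2" using B0 by (auto simp: kap0_def field_simps)
 obtain dR CR where dR: "0 < dR" "0 <= CR" and riem: "ALL ul:ball U0 dR. ALL ur:ball U0 dR. lax_riemann_solution F lam r ul ur (R ul ur) -->
  (ALL j:?N. ALL s. abs(s - lam j U0) < dR -->
   (profile_error (R ul ur) ul ur s (CR * norm (F ur - F ul - s *\<^sub>R (ur - ul)) + rarefaction_term lam l r U0 kap0 CR j (ur - ul))))"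
  using riemann_error[OF R kap0(1)] by (elim exE conjE bexE)
 obtain CF where CF: "0 <= CF" "ALL u:cball U0 1. ALL v:cball U0 1. norm (F u - F v - A U0 (u - v)) <= CF * (norm (u - U0) + norm (v - U0)) * norm (u - v)"
  using F_quadratic by blast
 obtain gam where gam: "0 < gam" "ALL i:?N. ALL j:?N. lam i U0 ~= lam j U0 --> 4 * gam <= abs(lam i U0 - lam j U0)"
  using lam_gap by blast
 obtain G VG where G: "mono G" "!!x. 0 <= G x" "!!x. G x <= VG" "!!x y. x <= y ==> norm (U1 y - U1 x) <= G y - G x"
  using bounded_variation_dominated[OF assms(2)] by blast
 have VG0: "0 <= VG" using G(2,3)[of 0] by linarith
 have "bounded {x. U1 x ~= 0}" using compact_imp_bounded[OF assms(3)] bounded_subset closure_subset by blast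
 then obtain b where b: "!!x. U1 x ~= 0 ==> abs x <= b" unfolding bounded_iff by auto
 define L where "L = abs b + 1"
 have Lz: "U1 y = 0" if "L <= abs y" for y using b[of y] that unfolding L_def by fastforce
 have L0: "0 <= L" by (simp add: L_def)
 define Lm where "Lm = (SUM j:?N. norm (l j U0))"
 have Lm0: "0 <= Lm" unfolding Lm_def by (intro sum_nonneg) auto
 have lLm: "norm (l j U0) <= Lm" if "j : ?N" for j unfolding Lm_def using that by (intro member_le_sum) auto
 define V where "V = Lm * VG"
 have V0: "0 <= V" using Lm0 VG0 by (simp add: V_def)
 define f where "f j y = l j U0 \<bullet> U1 y" for j y
 have fdom: "abs(f j y - f j x) <= Lm * G y - Lm * G x" if "j : ?N" "x <= y" for j x y
 proof -
  have "abs(f j y - f j x) <= norm (l j U0) * norm (U1 y - U1 x)" unfolding f_def inner_diff_right[symmetric] by (rule Cauchy_Schwarz_ineq2)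
  also have "... <= Lm * (G y - G x)" using lLm[OF that(1)] G(4)[OF that(2)] Lm0 by (intro mult_mono) auto
  finally show ?thesis by (simp add: right_diff_distrib)
 qed
 have LmG: "mono (%x. Lm * G x)" "!!x. 0 <= Lm * G x" "!!x. Lm * G x <= V"
  using G(1-3) Lm0 by (auto simp: mono_def V_def intro: mult_left_mono)
 have fz: "f j y = 0" if "L <= abs y" for j y using Lz[OF that] by (simp add: f_def)
 have fint: "integrable lborel (f j)" if j: "j : ?N" for j
  by (rule dominated_integrable(2)[OF LmG fdom[OF j] fz])
 have U1int: "integrable lborel U1"
 proof -
  have "U1 = (%y. SUM j:?N. f j y *\<^sub>R r j U0)" unfolding f_def using r_expansion[of _ U0] by blast
  moreover have "integrable lborel (%y. SUM j:?N. f j y *\<^sub>R r j U0)"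
   by (intro Bochner_Integration.integrable_sum integrable_scaleR_left fint)
  ultimately show ?thesis by simp
 qed
 define len where "len = L + 1"
 have len0: "0 <= len" using L0 by (simp add: len_def)
 have n0: "0 <= n" by (simp add: n_def)
 \<comment> \<open>Each smallness condition asks that \<open>eps\<close> times one of these summands
   stay below a threshold; bounding all of them by the sum \<open>Q\<close> yields every condition
   from \<open>small\<close>.\<close>
 define Q where "Q = 1 + n * V + V + B * (n * V) + VG + Lm * (2 * CW * V)"
 have Qs: "0 <= n * V" "0 <= B * (n * V)" "0 <= Lm * (2 * CW * V)" using n0 V0 B0 Lm0 wm(2) by auto
 have Q1: "1 <= Q" using Qs V0 VG0 by (simp add: Q_def)
 define c where "c = min (min 1 rho) (min gam (min (dR / 2) (min (dl0 / 2) (1 / 2))))"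
 have c: "0 < c" "c <= 1" "c <= rho" "c <= gam" "c <= dR / 2" "c <= dl0 / 2" "c <= 1 / 2"
  using wm(1) gam(1) dR(1) dl0(1) by (auto simp: c_def)
 define eps0 where "eps0 = c / Q"
 have eps0: "0 < eps0" using c(1) Q1 by (simp add: eps0_def)
 have small: "eps * x <= c" if "eps : {0<..eps0}" "x <= Q" for eps x
 proof -
  have "eps * x <= eps * Q" using that by (intro mult_left_mono) auto
  also have "... <= eps0 * Q" using that Q1 by (intro mult_right_mono) auto
  also have "... = c" using Q1 by (simp add: eps0_def)
  finally show ?thesis .
 qed
 \<comment> \<open>The constants of the locale are named before \<open>eps\<close>, \<open>t\<close>
   and \<open>kap\<close> are chosen, which shows that \<open>C\<close> does not depend on
   them.\<close>
 define Ca Tt where "Ca = front_tracking.C_any F lam U0 CW B CR CF V" and "Tt = front_tracking.T0 gam len"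
 define Cu where "Cu = front_tracking.C_up CW B CR"
 define K1 where "K1 = CW * (n * (n * (len * V\<^sup>2)))"
 define K2 where "K2 = Ca * (n * V) * Tt + 6 * CR * CW * (n * ((len + gam * Tt) * V\<^sup>2))"
 define C where "C = abs(L1 * K1 + L1 * K2 + K1) + 1"
 have main: "integrable lborel (%x. S t (%y. U0 + eps *\<^sub>R U1 y) x - approx_solution U0 lam r \<sigma> eps t x) &
   L1_dist (S t (%y. U0 + eps *\<^sub>R U1 y)) (approx_solution U0 lam r \<sigma> eps t) <= C * eps\<^sup>2"
  if t: "t > 0" and eps: "eps : {0<..eps0}" for t eps
 proof -
  have e0: "0 < eps" using eps by simp
  have e1: "eps <= 1" using small[OF eps Q1] c(2) by simp
  have s1: "eps * (CARD('n) * V) <= c" unfolding n_def[symmetric] using Qs V0 VG0 by (intro small eps) (simp add: Q_def)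
  have s2: "eps * V <= c" using Qs V0 VG0 by (intro small eps) (simp add: Q_def)
  have "eps * (B * (n * V)) <= c" using Qs V0 VG0 by (intro small eps) (simp add: Q_def)
  then have s3: "B * (eps * (CARD('n) * V)) <= c" unfolding n_def[symmetric] by (simp add: mult_ac)
  have s4: "eps * VG <= c" using Qs V0 VG0 by (intro small eps) (simp add: Q_def)
  have s5: "norm (l j U0) * (2 * CW * (eps * V)) <= 1 / 2" if "j : ?N" for j
  proof -
   have "norm (l j U0) * (2 * CW * (eps * V)) <= Lm * (2 * CW * (eps * V))"
    using lLm[OF that] wm(2) e0 V0 by (intro mult_right_mono) auto
   also have "... = eps * (Lm * (2 * CW * V))" by simp
   also have "... <= c" using Qs V0 VG0 by (intro small eps) (simp add: Q_def)
   finally show ?thesis using c(7) by simp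
  qed
  have UbD: "(%y. U0 + eps *\<^sub>R U1 y) : \<D>"
  proof (rule dl0(2))
   show "integrable lborel (%x. U0 + eps *\<^sub>R U1 x - U0)" using U1int by simp
   have "total_variation (%y. U0 + eps *\<^sub>R U1 y) <= ennreal (eps * VG)"
   proof (rule total_variation_le[of "%x. eps * G x"])
    fix x y :: real assume "x <= y"
    have "norm ((U0 + eps *\<^sub>R U1 y) - (U0 + eps *\<^sub>R U1 x)) = eps * norm (U1 y - U1 x)"
     using e0 by (simp add: scaleR_diff_right[symmetric])
    also have "... <= eps * (G y - G x)" using G(4)[OF \<open>x <= y\<close>] e0 by (intro mult_left_mono) auto
    finally show "norm ((U0 + eps *\<^sub>R U1 y) - (U0 + eps *\<^sub>R U1 x)) <= eps * G y - eps * G x" by (simp add: right_diff_distrib)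
   qed (use G e0 in auto)
   also have "... < ennreal dl0" using s4 c dl0(1) by (intro ennreal_lessI) auto
   finally show "total_variation (%y. U0 + eps *\<^sub>R U1 y) < ennreal dl0" .
  qed
  \<comment> \<open>This collects the terms that carry a factor \<open>kap\<close>. It may depend on
    \<open>eps\<close> and \<open>t\<close>, which are fixed while \<open>kap\<close> tends to
    0.\<close>
  define Y where "Y = L1 * (eps * Rs) + L1 * (Cu * eps\<^sup>2 * (n * V) * t) + CW * eps\<^sup>2 * (n * (n * (V / 6 * (eps * t)))) + eps * (Rs * (1 + V / 4 * (eps * t)))"
  define d1 where "d1 = L1_dist (S t (%y. U0 + eps *\<^sub>R U1 y)) (approx_solution U0 lam r \<sigma> eps t)"
  have step: "integrable lborel (%x. S t (%y. U0 + eps *\<^sub>R U1 y) x - approx_solution U0 lam r \<sigma> eps t x) & d1 <= C * eps\<^sup>2 + kap * Y"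
   if kap: "0 < kap" "kap <= 1" for kap
  proof -
   have et: "0 <= eps * t" using e0 t by simp
   have fd: "EX (I :: nat set) d p. finite I & I ~= {} & (ALL i:I. abs(p i) <= L + 1) &
    (ALL j:?N. sum (d j) I = 0 & (SUM i:I. abs(d j i)) <= V & (ALL x. jump I (d j) p x <= kap) &
    integrable lborel (%y. f j y - stepv I (d j) p y) & (LINT y|lborel. abs(f j y - stepv I (d j) p y)) <= kap)"
    by (rule front_data[of "%x. Lm * G x"]) (fact LmG L0 kap(1) | use fdom fz in blast)+
   obtain I :: "nat set" and d p where I: "finite I" "I ~= {}" and pb: "ALL i:I. abs(p i) <= L + 1" and data: "ALL j:?N. sum (d j) I = 0 & (SUM i:I. abs(d j i)) <= V & (ALL x. jump I (d j) p x <= kap) &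
    integrable lborel (%y. f j y - stepv I (d j) p y) & (LINT y|lborel. abs(f j y - stepv I (d j) p y)) <= kap"
    using fd by (elim exE conjE)
   define good where "good j P \<longleftrightarrow> P 0 = p & (if genuinely_nonlinear (lam j) (r j) then sticky I (d j) kap P else (ALL tau. P tau = p))" for j and P :: "real => nat => real"
   have "ALL j:?N. EX P. good j P"
   proof
    fix j assume j: "j : ?N"
    show "EX P. good j P"
    proof (cases "genuinely_nonlinear (lam j) (r j)")
     case True
     have "EX P. P 0 = p & sticky I (d j) kap P" using data j kap by (intro sticky_exists I(1)) auto
     then show ?thesis using True by (simp add: good_def)
    next
     case False
     then show ?thesis unfolding good_def by (intro exI[of _ "%_. p"]) simp
    qed
   qed
   then obtain P where P: "!!j. j : ?N ==> good j (P j)" by metis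
   have P0: "P j 0 = p" if "j : ?N" for j using P[OF that] by (simp add: good_def)
   have Pst: "sticky I (d j) kap (P j)" if "j : ?N" "genuinely_nonlinear (lam j) (r j)" for j using P[OF that(1)] that(2) by (simp add: good_def)
   have PLD: "P j tau = p" if "j : ?N" "linearly_degenerate (lam j) (r j)" for j tau
   proof -
    have "~ genuinely_nonlinear (lam j) (r j)" using not_GNL_LD that(2) by blast
    then show ?thesis using P[OF that(1)] by (simp add: good_def)
   qed
   have ft: "front_tracking F lam l r U0 \<D> S L1 L2 R W rho CW B kap0 dR CR CF gam dl0 V len I d P kap eps"
   proof (intro front_tracking.intro hyperbolic_system_axioms lipschitz_semigroup_axioms, rule front_tracking_axioms.intro)
    show "!!ul ur j s. ul : ball U0 dR ==> ur : ball U0 dR ==> lax_riemann_solution F lam r ul ur (R ul ur) ==> j : ?N ==> abs(s - lam j U0) < dR ==>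
     (profile_error (R ul ur) ul ur s (CR * norm (F ur - F ul - s *\<^sub>R (ur - ul)) + rarefaction_term lam l r U0 kap0 CR j (ur - ul)))"
     using riem by blast
    show "!!v. integrable lborel (%x. v x - U0) ==> total_variation v < ennreal dl0 ==> v : \<D>" by (rule dl0(2))
    show "!!j. j : ?N ==> norm (l j U0) * (2 * CW * (eps * V)) <= 1 / 2" by (rule s5)
    show "!!j i. j : ?N ==> i : I ==> abs(P j 0 i) <= len" using P0 pb by (simp add: len_def)
    show "!!j tau. j : ?N ==> linearly_degenerate (lam j) (r j) ==> 0 <= tau ==> P j tau = P j 0" using PLD P0 by simp
    show "eps * V < dR" "B * (eps * (CARD('n) * V)) < dR" "B * (eps * (CARD('n) * V)) < dl0" "B * (eps * (CARD('n) * V)) <= 1"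
     "eps * (CARD('n) * V) <= rho" "eps * V <= gam"
     using s1 s2 s3 c dR(1) dl0(1) by linarith+
    show "!!s s'. strength CARD('n) s <= rho ==> strength CARD('n) s' <= rho ==>
     norm (W s' - W s - (SUM j:?N. (s' j - s j) *\<^sub>R r j U0)) <= CW * (strength CARD('n) s + strength CARD('n) s') * strength CARD('n) (%j. s' j - s j)"
     by (rule wm(4)[THEN spec, THEN spec, THEN mp, THEN mp])
    show "!!mu s. strength CARD('n) s <= rho ==> ALL j:?N. s j ~= 0 --> linearly_degenerate (lam j) (r j) & lam j U0 = mu ==>
     F (W s) - mu *\<^sub>R W s = F U0 - mu *\<^sub>R U0"
     by (rule wm(5)[THEN spec, THEN spec, THEN mp, THEN mp])
    show "!!j s s'. j : ?N ==> genuinely_nonlinear (lam j) (r j) ==> ALL k. k ~= j --> s k = 0 & s' k = 0 ==> abs(s j) <= rho ==> abs(s' j) <= rho ==>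
     norm (F (W s') - F (W s) - (lam j U0 + (s j + s' j) / 2) *\<^sub>R (W s' - W s)) <= CW * abs(s' j - s j) ^ 3"
     by (rule wm(6)[THEN bspec, THEN spec, THEN spec, THEN mp, THEN mp, THEN mp, THEN mp])
    show "!!u v. u : cball U0 1 ==> v : cball U0 1 ==> norm (F u - F v - A U0 (u - v)) <= CF * (norm (u - U0) + norm (v - U0)) * norm (u - v)"
     by (rule CF(2)[THEN bspec, THEN bspec])
    show "!!i j. i : ?N ==> j : ?N ==> lam i U0 ~= lam j U0 ==> 4 * gam <= abs(lam i U0 - lam j U0)"
     by (rule gam(2)[THEN bspec, THEN bspec, THEN mp])
    show "!!j. j : ?N ==> sum (d j) I = 0" "!!j. j : ?N ==> (SUM i:I. abs(d j i)) <= V" using data by blast+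
    show "0 <= kap" using kap(1) by simp
   qed (fact clause wm(1-3) W_lip B0 kap0 dR CF(1) gam(1) V0 len0 I Pst e0 e1 kap(2))+
   have f0: "integrable lborel (%y. f j y - stepv I (d j) (P j 0) y)" "(LINT y|lborel. abs(f j y - stepv I (d j) (P j 0) y)) <= kap" if "j : ?N" for j
    using data that P0[OF that] by auto
   define e' where "e' = kap + kap * (V / 4 * (eps * t))"
   have fT: "integrable lborel (%y. \<sigma> j (eps * t) y - stepv I (d j) (P j (eps * t)) y) &
     (LINT y|lborel. abs(\<sigma> j (eps * t) y - stepv I (d j) (P j (eps * t)) y)) <= e'" if j: "j : ?N" for j
   proof (cases "genuinely_nonlinear (lam j) (r j)")
    case True
    note es = entropy_solution_tracking[OF assms(10)[OF j True] fint[OF j, unfolded f_def[abs_def]] I(1) Pst[OF j True] _ less_imp_le[OF kap(1)] et]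
    have sd: "sum (d j) I = 0" and dV: "(SUM i:I. abs(d j i)) <= V" using data j by auto
    have "kap * (SUM i:I. abs(d j i)) / 4 * (eps * t) <= kap * (V / 4 * (eps * t))"
     using mult_right_mono[OF mult_left_mono[OF dV, of "kap / 4"] et] kap(1) by (simp add: mult_ac)
    then show ?thesis using es[OF sd] f0(2)[OF j, unfolded f_def] unfolding e'_def by linarith
   next
    case False
    then have ld: "linearly_degenerate (lam j) (r j)" using fields[OF j] by blast
    have PP: "P j (eps * t) = P j 0" using PLD[OF j ld] by simp
    note ws = stationary_weak_solution[OF assms(11)[OF j ld] et]
    have ae: "AE y in lborel. \<sigma> j (eps * t) y - stepv I (d j) (P j 0) y = f j y - stepv I (d j) (P j 0) y"
     using ws(1) by eventually_elim (simp add: f_def)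
    have sm: "(%y. stepv I (d j) (P j 0) y) : borel_measurable lborel" using stepv_measurable[OF I(1)] by simp
    have m1: "(%y. \<sigma> j (eps * t) y - stepv I (d j) (P j 0) y) : borel_measurable lborel"
     using ws(2) sm by (intro borel_measurable_diff) auto
    have m2: "(%y. f j y - stepv I (d j) (P j 0) y) : borel_measurable lborel" using f0(1)[OF j] by auto
    have i: "integrable lborel (%y. \<sigma> j (eps * t) y - stepv I (d j) (P j 0) y)"
     using integrable_cong_AE[OF m1 m2 ae] f0(1)[OF j] by simp
    have "(LINT y|lborel. abs(\<sigma> j (eps * t) y - stepv I (d j) (P j 0) y)) = (LINT y|lborel. abs(f j y - stepv I (d j) (P j 0) y))"
     using m1 m2 ae by (intro integral_cong_AE) auto
    also have "... <= e'" using f0(2)[OF j] kap(1) V0 et unfolding e'_def by (simp add: add_increasing2)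
    finally show ?thesis unfolding PP using i by blast
   qed
   note tt = front_tracking.tracking_total[OF ft, where ?U1.0 = U1 and \<sigma> = \<sigma> and T = t, OF less_imp_le[OF t] UbD f0[unfolded f_def] fT[THEN conjunct1] fT[THEN conjunct2],
    folded d1_def Rs_def n_def Ca_def Tt_def Cu_def]
   \<comment> \<open>The one term quadratic in \<open>kap\<close>, from the growth of the energy, is
     replaced so that the remainder is linear in \<open>kap\<close>.\<close>
   have "kap\<^sup>2 <= kap" using kap by (simp add: power2_eq_square mult_left_le)
   then have "kap\<^sup>2 * (CW * eps\<^sup>2 * (n * (n * (V / 6 * (eps * t))))) <= kap * (CW * eps\<^sup>2 * (n * (n * (V / 6 * (eps * t)))))"
    using wm(2) n0 V0 e0 t by (intro mult_right_mono mult_nonneg_nonneg) auto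
   then have "d1 <= (L1 * K1 + L1 * K2 + K1) * eps\<^sup>2 + kap * Y"
    using tt(2) unfolding K1_def K2_def Y_def e'_def by (simp add: algebra_simps)
   also have "(L1 * K1 + L1 * K2 + K1) * eps\<^sup>2 <= C * eps\<^sup>2" unfolding C_def by (intro mult_right_mono) auto
   finally show ?thesis using tt(1) by simp
  qed
  have "d1 <= C * eps\<^sup>2"
  proof (rule field_le_epsilon)
   fix e :: real assume e: "0 < e"
   define kap where "kap = min 1 (e / (abs Y + 1))"
   have kap: "0 < kap" "kap <= 1" using e by (auto simp: kap_def)
   have "kap * Y <= kap * (abs Y + 1)" using kap by (intro mult_left_mono) auto
   also have "... <= e / (abs Y + 1) * (abs Y + 1)" unfolding kap_def by (intro mult_right_mono) auto
   also have "... = e"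
   proof -
    have "abs Y + 1 ~= 0" using abs_ge_zero[of Y] by linarith
    then show ?thesis by simp
   qed
   finally show "d1 <= C * eps\<^sup>2 + e" using step[OF kap] by linarith
  qed
  then show ?thesis using step[of 1] unfolding d1_def by simp
 qed
 have "0 < C" by (simp add: C_def)
 then show ?thesis using eps0 main by blast
qed

end
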